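(* Let $L|K$ and $L'|K$ be two extensions of $\sigma$-fields. Then $L|K$ and $L'|K$ are compatible if and only if $\pi_0^\sigma(L|K)|K$ and $\pi_0^\sigma(L'|K)|K$ are compatible.
   Context: All rings are commutative. A $\sigma$-field is a field $K$ together with a ring endomorphism $\sigma\colon K\to K$. An extension of $\sigma$-fields $L|K$ is a field extension of $\sigma$-fields such that $\sigma$ on $L$ restricts to $\sigma$ on $K$. Two extensions of $\sigma$-fields $L|K$ and $L'|K$ are compatible if there exists a $\sigma$-field extension of $K$ that contains isomorphic copies of $L|K$ and $L'|K$, i.e. a $\sigma$-field extension $M|K$ admitting $\sigma$-equivariant $K$-embeddings $L\to M$ and $L'\to M$. For a $\sigma$-field $K$, a $K$-$\sigma$-algebra is a commutative ring $R$ with an endomorphism $\sigma$ (not assumed injective) and a $\sigma$-equivariant ring morphism $K\to R$. $R$ is $\sigma$-separable over $K$ if $\sigma$ is injective on $R\otimes_K K'$ (with $\sigma(r\otimes a)=\sigma(r)\otimes\sigma(a)$) for every $\sigma$-field extension $K'|K$. $R$ is strongly $\sigma$-étale over $K$ if it is $\sigma$-separable over $K$ and étale as a $K$-algebra (i.e. $R\otimes_K\overline{K}$ is isomorphic to a finite product of copies of $\overline{K}$). The strong core $\pi_0^\sigma(L|K)$ is the union of all strongly $\sigma$-étale $K$-$\sigma$-subalgebras of $L$ (it is an intermediate $\sigma$-field of $L|K$). *)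

theory Defs
  imports "HOL-Algebra.Algebra"
begin

section \<open>Fields with an endomorphism\<close>

locale sigma_field = field K for K (structure) +
  fixes \<sigma>
  assumes endo: "\<sigma> \<in> ring_hom K K"

text \<open>
  An extension is given by its structure map \<open>\<phi>\<close>, which is injective because \<open>K\<close> is a field.
\<close>

locale sigma_extension = K: sigma_field K \<sigma> + L: sigma_field L \<tau>
  for K (structure) and \<sigma> and L (structure) and \<tau> +
  fixes \<phi>
  assumes structure_map: "\<phi> \<in> ring_hom K L"
    and equivariant: "a \<in> carrier K \<Longrightarrow> \<phi> (\<sigma> a) = \<tau> (\<phi> a)"

text \<open>
  \<open>\<epsilon>\<close> is a \<open>\<sigma>\<close>-equivariant \<open>K\<close>-embedding of \<open>(L, \<tau>, \<phi>)\<close> into \<open>(M, \<rho>, \<mu>)\<close>.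
\<close>

definition sigma_embedding ::
  "'k ring \<Rightarrow> 'l ring \<Rightarrow> ('l \<Rightarrow> 'l) \<Rightarrow> ('k \<Rightarrow> 'l) \<Rightarrow> 'm ring \<Rightarrow> ('m \<Rightarrow> 'm) \<Rightarrow> ('k \<Rightarrow> 'm) \<Rightarrow> ('l \<Rightarrow> 'm) \<Rightarrow> bool"
  where "sigma_embedding K L \<tau> \<phi> M \<rho> \<mu> \<epsilon> \<longleftrightarrow>
    \<epsilon> \<in> ring_hom L M \<and> inj_on \<epsilon> (carrier L) \<and>
    (\<forall>x \<in> carrier L. \<epsilon> (\<tau> x) = \<rho> (\<epsilon> x)) \<and>
    (\<forall>a \<in> carrier K. \<epsilon> (\<phi> a) = \<mu> a)"

text \<open>
  HOL cannot quantify over types inside a formula, so the overfield \<open>M\<close> is taken on the fixed type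
  of words over \<open>'l + 'l2\<close> and countably many further letters. This is no restriction: if some
  overfield on an arbitrary type exists, its \<open>\<sigma>\<close>-subfield generated by the two images also
  works, and each of its elements is the value of a word (see \<open>compatibleI\<close> below).
\<close>

definition compatible ::
  "'k ring \<Rightarrow> ('k \<Rightarrow> 'k) \<Rightarrow> 'l ring \<Rightarrow> ('l \<Rightarrow> 'l) \<Rightarrow> ('k \<Rightarrow> 'l) \<Rightarrow>
   'l2 ring \<Rightarrow> ('l2 \<Rightarrow> 'l2) \<Rightarrow> ('k \<Rightarrow> 'l2) \<Rightarrow> bool"
  where "compatible K \<sigma> L \<tau> \<phi> L' \<tau>' \<phi>' \<longleftrightarrow>
    (\<exists>(M :: (('l + 'l2) + nat) list ring) \<rho> \<mu> \<epsilon> \<epsilon>'.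
       sigma_extension K \<sigma> M \<rho> \<mu> \<and>
       sigma_embedding K L \<tau> \<phi> M \<rho> \<mu> \<epsilon> \<and>
       sigma_embedding K L' \<tau>' \<phi>' M \<rho> \<mu> \<epsilon>')"


section \<open>Tensor products of algebras\<close>

text \<open>
  The monoid ring of the multiplicative monoid of \<open>R \<times> S\<close> with integer coefficients: the free
  abelian group on \<open>carrier R \<times> carrier S\<close> with the bilinear extension of
  \<open>(r, s) (r', s') = (r r', s s')\<close>.
\<close>

definition pair_ring :: "'r ring \<Rightarrow> 's ring \<Rightarrow> ('r \<times> 's \<Rightarrow>\<^sub>0 int) ring"
  where "pair_ring R S =
    \<lparr>carrier = {f. Poly_Mapping.keys f \<subseteq> carrier R \<times> carrier S},
     monoid.mult = (\<lambda>f g. frag_extend (\<lambda>(r, s). frag_extend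
              (\<lambda>(r', s'). frag_of (r \<otimes>\<^bsub>R\<^esub> r', s \<otimes>\<^bsub>S\<^esub> s')) g) f),
     one = frag_of (\<one>\<^bsub>R\<^esub>, \<one>\<^bsub>S\<^esub>),
     ring.zero = 0,
     ring.add = (+)\<rparr>"

definition tensor_relations ::
  "'k ring \<Rightarrow> 'r ring \<Rightarrow> ('k \<Rightarrow> 'r) \<Rightarrow> 's ring \<Rightarrow> ('k \<Rightarrow> 's) \<Rightarrow> ('r \<times> 's \<Rightarrow>\<^sub>0 int) set"
  where "tensor_relations K R \<phi> S \<psi> =
    {frag_of (r \<oplus>\<^bsub>R\<^esub> r', s) - frag_of (r, s) - frag_of (r', s) | r r' s.
       r \<in> carrier R \<and> r' \<in> carrier R \<and> s \<in> carrier S} \<union>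
    {frag_of (r, s \<oplus>\<^bsub>S\<^esub> s') - frag_of (r, s) - frag_of (r, s') | r s s'.
       r \<in> carrier R \<and> s \<in> carrier S \<and> s' \<in> carrier S} \<union>
    {frag_of (\<phi> a \<otimes>\<^bsub>R\<^esub> r, s) - frag_of (r, \<psi> a \<otimes>\<^bsub>S\<^esub> s) | a r s.
       a \<in> carrier K \<and> r \<in> carrier R \<and> s \<in> carrier S}"

definition tensor_ideal ::
  "'k ring \<Rightarrow> 'r ring \<Rightarrow> ('k \<Rightarrow> 'r) \<Rightarrow> 's ring \<Rightarrow> ('k \<Rightarrow> 's) \<Rightarrow> ('r \<times> 's \<Rightarrow>\<^sub>0 int) set"
  where "tensor_ideal K R \<phi> S \<psi> = Idl\<^bsub>pair_ring R S\<^esub> (tensor_relations K R \<phi> S \<psi>)"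

definition tensor ::
  "'k ring \<Rightarrow> 'r ring \<Rightarrow> ('k \<Rightarrow> 'r) \<Rightarrow> 's ring \<Rightarrow> ('k \<Rightarrow> 's) \<Rightarrow> ('r \<times> 's \<Rightarrow>\<^sub>0 int) set ring"
  where "tensor K R \<phi> S \<psi> = pair_ring R S Quot tensor_ideal K R \<phi> S \<psi>"

definition pure_tensor ::
  "'k ring \<Rightarrow> 'r ring \<Rightarrow> ('k \<Rightarrow> 'r) \<Rightarrow> 's ring \<Rightarrow> ('k \<Rightarrow> 's) \<Rightarrow> 'r \<Rightarrow> 's \<Rightarrow> ('r \<times> 's \<Rightarrow>\<^sub>0 int) set"
  where "pure_tensor K R \<phi> S \<psi> r s = tensor_ideal K R \<phi> S \<psi> +>\<^bsub>pair_ring R S\<^esub> frag_of (r, s)"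

definition pair_map :: "('r \<Rightarrow> 'r2) \<Rightarrow> ('s \<Rightarrow> 's2) \<Rightarrow> ('r \<times> 's \<Rightarrow>\<^sub>0 int) \<Rightarrow> ('r2 \<times> 's2 \<Rightarrow>\<^sub>0 int)"
  where "pair_map \<alpha> \<beta> = frag_extend (\<lambda>(r, s). frag_of (\<alpha> r, \<beta> s))"

text \<open>
  The map \<open>\<tau> \<otimes> \<tau>'\<close> on \<open>R \<otimes>\<^sub>K S\<close>, sending the class of \<open>f\<close> to the class of \<open>pair_map \<tau> \<tau>' f\<close>.
  When \<open>\<tau>\<close> and \<open>\<tau>'\<close> extend the same endomorphism of \<open>K\<close>, all \<open>f\<close> in a coset give the same
  coset, which is then the union (see \<open>tensor_endo_coset\<close> below).
\<close>

definition tensor_endo ::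
  "'k ring \<Rightarrow> 'r ring \<Rightarrow> ('r \<Rightarrow> 'r) \<Rightarrow> ('k \<Rightarrow> 'r) \<Rightarrow> 's ring \<Rightarrow> ('s \<Rightarrow> 's) \<Rightarrow> ('k \<Rightarrow> 's) \<Rightarrow>
   ('r \<times> 's \<Rightarrow>\<^sub>0 int) set \<Rightarrow> ('r \<times> 's \<Rightarrow>\<^sub>0 int) set"
  where "tensor_endo K R \<tau> \<phi> S \<tau>' \<psi> A =
    (\<Union>f \<in> A. tensor_ideal K R \<phi> S \<psi> +>\<^bsub>pair_ring R S\<^esub> pair_map \<tau> \<tau>' f)"


section \<open>The strong core\<close>

locale sigma_algebra = K: sigma_field K \<sigma> + R: cring R
  for K (structure) and \<sigma> and R (structure) +
  fixes \<tau> \<phi>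
  assumes endo: "\<tau> \<in> ring_hom R R"
    and structure_map: "\<phi> \<in> ring_hom K R"
    and equivariant: "a \<in> carrier K \<Longrightarrow> \<phi> (\<sigma> a) = \<tau> (\<phi> a)"

text \<open>
  The \<open>\<sigma>\<close>-field extensions \<open>K'\<close> range over one type, which is again no restriction: a nonzero
  element of the kernel of \<open>\<sigma>\<close> on \<open>R \<otimes>\<^sub>K K'\<close>, together with a witness that its image vanishes,
  involves only finitely many elements of \<open>K'\<close>. So it occurs already over the \<open>\<sigma>\<close>-subfield
  generated by these over \<open>K\<close>, whose elements are values of words over \<open>'k\<close> and countably many
  further letters (see \<open>sigma_separableD\<close> below).
\<close>

definition sigma_separable ::
  "'k ring \<Rightarrow> ('k \<Rightarrow> 'k) \<Rightarrow> 'r ring \<Rightarrow> ('r \<Rightarrow> 'r) \<Rightarrow> ('k \<Rightarrow> 'r) \<Rightarrow> bool"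
  where "sigma_separable K \<sigma> R \<tau> \<phi> \<longleftrightarrow>
    (\<forall>(K' :: ('k + nat) list ring) \<sigma>' \<psi>. sigma_extension K \<sigma> K' \<sigma>' \<psi> \<longrightarrow>
       inj_on (tensor_endo K R \<tau> \<phi> K' \<sigma>' \<psi>) (carrier (tensor K R \<phi> K' \<psi>)))"

text \<open>
  The isomorphism \<open>R \<otimes>\<^sub>K Kbar \<cong> Kbar\<^sup>n\<close> is one of \<open>Kbar\<close>-algebras; \<open>indexed_const\<close> is the
  embedding of \<open>K\<close> into its algebraic closure.
\<close>

definition etale :: "'k ring \<Rightarrow> 'r ring \<Rightarrow> ('k \<Rightarrow> 'r) \<Rightarrow> bool"
  where "etale K R \<phi> \<longleftrightarrow>
    (let Kbar = field.alg_closure K; \<iota> = ring.indexed_const K in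
     \<exists>n. \<exists>h \<in> ring_iso (tensor K R \<phi> Kbar \<iota>) (RDirProd_list (replicate n Kbar)).
       \<forall>a \<in> carrier Kbar. h (pure_tensor K R \<phi> Kbar \<iota> \<one>\<^bsub>R\<^esub> a) = replicate n a)"

definition strongly_etale ::
  "'k ring \<Rightarrow> ('k \<Rightarrow> 'k) \<Rightarrow> 'r ring \<Rightarrow> ('r \<Rightarrow> 'r) \<Rightarrow> ('k \<Rightarrow> 'r) \<Rightarrow> bool"
  where "strongly_etale K \<sigma> R \<tau> \<phi> \<longleftrightarrow>
    sigma_algebra K \<sigma> R \<tau> \<phi> \<and> sigma_separable K \<sigma> R \<tau> \<phi> \<and> etale K R \<phi>"

definition sigma_subalgebra ::
  "'k ring \<Rightarrow> 'r set \<Rightarrow> 'r ring \<Rightarrow> ('r \<Rightarrow> 'r) \<Rightarrow> ('k \<Rightarrow> 'r) \<Rightarrow> bool"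
  where "sigma_subalgebra K S R \<tau> \<phi> \<longleftrightarrow>
    subcring S R \<and> \<phi> ` carrier K \<subseteq> S \<and> \<tau> ` S \<subseteq> S"

definition strong_core ::
  "'k ring \<Rightarrow> ('k \<Rightarrow> 'k) \<Rightarrow> 'l ring \<Rightarrow> ('l \<Rightarrow> 'l) \<Rightarrow> ('k \<Rightarrow> 'l) \<Rightarrow> 'l ring"
  where "strong_core K \<sigma> L \<tau> \<phi> =
    L\<lparr>carrier := \<Union>{S. sigma_subalgebra K S L \<tau> \<phi> \<and>
                     strongly_etale K \<sigma> (L\<lparr>carrier := S\<rparr>) \<tau> \<phi>}\<rparr>"

section \<open>Tensor products are well-defined\<close>

lemma pair_ring_carrier: "f \<in> carrier (pair_ring R S) \<longleftrightarrow> Poly_Mapping.keys f \<subseteq> carrier R \<times> carrier S"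
  and pair_ring_simps: "one (pair_ring R S) = frag_of (\<one>\<^bsub>R\<^esub>, \<one>\<^bsub>S\<^esub>)"
    "ring.zero (pair_ring R S) = 0" "ring.add (pair_ring R S) f g = f + g"
  by (simp_all add: pair_ring_def)

lemma frag_extend_diff_fun:
  "frag_extend (\<lambda>x. b x - c x) f = frag_extend b f - frag_extend c f"
proof -
  have "frag_cmul k (b x - c x) = frag_cmul k (b x) - frag_cmul k (c x)" for k x
    by (rule poly_mapping_eqI) (simp add: lookup_minus right_diff_distrib)
  then show ?thesis
    by (simp add: frag_extend_def sum_subtractf)
qed

lemma pair_mult_of: "frag_of (r, s) \<otimes>\<^bsub>pair_ring R S\<^esub> frag_of (r', s') = frag_of (r \<otimes>\<^bsub>R\<^esub> r', s \<otimes>\<^bsub>S\<^esub> s')"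
  by (simp add: pair_ring_def)

lemma pair_mult_0: "0 \<otimes>\<^bsub>pair_ring R S\<^esub> f = 0" "f \<otimes>\<^bsub>pair_ring R S\<^esub> 0 = 0"
  by (simp_all add: pair_ring_def) (simp add: frag_extend_def case_prod_unfold)

lemma pair_mult_diff:
  "(f - g) \<otimes>\<^bsub>pair_ring R S\<^esub> h = f \<otimes>\<^bsub>pair_ring R S\<^esub> h - g \<otimes>\<^bsub>pair_ring R S\<^esub> h"
  "h \<otimes>\<^bsub>pair_ring R S\<^esub> (f - g) = h \<otimes>\<^bsub>pair_ring R S\<^esub> f - h \<otimes>\<^bsub>pair_ring R S\<^esub> g"
  by (simp_all add: pair_ring_def frag_extend_diff frag_extend_diff_fun case_prod_unfold)

lemma pair_mult_add:
  "(f + g) \<otimes>\<^bsub>pair_ring R S\<^esub> h = f \<otimes>\<^bsub>pair_ring R S\<^esub> h + g \<otimes>\<^bsub>pair_ring R S\<^esub> h"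
  "h \<otimes>\<^bsub>pair_ring R S\<^esub> (f + g) = h \<otimes>\<^bsub>pair_ring R S\<^esub> f + h \<otimes>\<^bsub>pair_ring R S\<^esub> g"
  using pair_mult_diff(1)[where f = f and g = "0 - g" and R = R and S = S and h = h]
    pair_mult_diff(1)[where f = 0 and g = g and R = R and S = S and h = h]
    pair_mult_diff(2)[where f = f and g = "0 - g" and R = R and S = S and h = h]
    pair_mult_diff(2)[where f = 0 and g = g and R = R and S = S and h = h]
  by (simp_all add: pair_mult_0)

lemma pair_ring_cring:
  assumes "cring R" "cring S"
  shows "cring (pair_ring R S)"
proof -
  interpret R: cring R by fact
  interpret S: cring S by fact
  let ?P = "pair_ring R S"
  note [simp] = pair_mult_of pair_mult_0 pair_mult_diff pair_ring_carrier pair_ring_simps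
  have comm: "f \<otimes>\<^bsub>?P\<^esub> g = g \<otimes>\<^bsub>?P\<^esub> f" if "f \<in> carrier ?P" "g \<in> carrier ?P" for f g
    using that(1)[unfolded pair_ring_carrier]
  proof (induction f rule: frag_induction)
    case (one x)
    show ?case using that(2)[unfolded pair_ring_carrier]
      by (induction g rule: frag_induction) (use one in \<open>auto simp: R.m_comm S.m_comm\<close>)
  qed auto
  have closed: "f \<otimes>\<^bsub>?P\<^esub> g \<in> carrier ?P" if "f \<in> carrier ?P" "g \<in> carrier ?P" for f g
    using that(1)[unfolded pair_ring_carrier]
  proof (induction f rule: frag_induction)
    case (one x)
    show ?case using that(2)[unfolded pair_ring_carrier]
    proof (induction g rule: frag_induction)
      case (diff a b) then show ?case
        using keys_diff[of "frag_of x \<otimes>\<^bsub>?P\<^esub> a" "frag_of x \<otimes>\<^bsub>?P\<^esub> b"] by auto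
    qed (use one in auto)
  next
    case (diff a b) then show ?case
      using keys_diff[of "a \<otimes>\<^bsub>?P\<^esub> g" "b \<otimes>\<^bsub>?P\<^esub> g"] by auto
  qed auto
  have assoc: "(f \<otimes>\<^bsub>?P\<^esub> g) \<otimes>\<^bsub>?P\<^esub> h = f \<otimes>\<^bsub>?P\<^esub> (g \<otimes>\<^bsub>?P\<^esub> h)"
    if "f \<in> carrier ?P" "g \<in> carrier ?P" "h \<in> carrier ?P" for f g h
    using that(1)[unfolded pair_ring_carrier]
  proof (induction f rule: frag_induction)
    case (one x)
    show ?case using that(2)[unfolded pair_ring_carrier]
    proof (induction g rule: frag_induction)
      case (one y)
      show ?case using that(3)[unfolded pair_ring_carrier]
        by (induction h rule: frag_induction) (use one \<open>x \<in> _\<close> in \<open>auto simp: R.m_assoc S.m_assoc\<close>)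
    qed auto
  qed auto
  have one: "\<one>\<^bsub>?P\<^esub> \<otimes>\<^bsub>?P\<^esub> f = f" if "f \<in> carrier ?P" for f
    using that[unfolded pair_ring_carrier] by (induction f rule: frag_induction) auto
  show ?thesis
  proof (rule cringI)
    show "abelian_group ?P"
    proof (rule abelian_groupI)
      fix f assume "f \<in> carrier ?P"
      then show "\<exists>g\<in>carrier ?P. g \<oplus>\<^bsub>?P\<^esub> f = \<zero>\<^bsub>?P\<^esub>"
        by (intro bexI[of _ "- f"]) auto
    next
      fix f g assume "f \<in> carrier ?P" "g \<in> carrier ?P"
      then show "f \<oplus>\<^bsub>?P\<^esub> g \<in> carrier ?P"
        using keys_add[of f g] by auto
    qed (simp_all add: algebra_simps)
    show "Group.comm_monoid ?P"
    proof (rule comm_monoidI)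
      show "\<one>\<^bsub>?P\<^esub> \<in> carrier ?P" by simp
    qed (fact closed assoc one comm)+
    show "(f \<oplus>\<^bsub>?P\<^esub> g) \<otimes>\<^bsub>?P\<^esub> h = f \<otimes>\<^bsub>?P\<^esub> h \<oplus>\<^bsub>?P\<^esub> g \<otimes>\<^bsub>?P\<^esub> h" for f g h
      by (simp add: pair_mult_add)
  qed
qed

lemma keys_diff_subset:
  "Poly_Mapping.keys a \<subseteq> A \<Longrightarrow> Poly_Mapping.keys b \<subseteq> A \<Longrightarrow> Poly_Mapping.keys (a - b) \<subseteq> A"
  using keys_diff[of a b] by (meson Un_least order_trans)

lemma keys_frag_of_subset: "Poly_Mapping.keys (frag_of x) \<subseteq> A \<longleftrightarrow> x \<in> A"
  by simp

lemma tensor_relations_carrier: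
  assumes "cring R" "cring S" "\<phi> \<in> ring_hom K R" "\<psi> \<in> ring_hom K S"
  shows "tensor_relations K R \<phi> S \<psi> \<subseteq> carrier (pair_ring R S)"
proof
  interpret R: cring R by fact
  interpret S: cring S by fact
  note hom = ring_hom_closed[OF assms(3)] ring_hom_closed[OF assms(4)]
  fix f assume "f \<in> tensor_relations K R \<phi> S \<psi>"
  then consider
      r r' s where "f = frag_of (r \<oplus>\<^bsub>R\<^esub> r', s) - frag_of (r, s) - frag_of (r', s)"
        "r \<in> carrier R" "r' \<in> carrier R" "s \<in> carrier S" |
      r s s' where "f = frag_of (r, s \<oplus>\<^bsub>S\<^esub> s') - frag_of (r, s) - frag_of (r, s')"
        "r \<in> carrier R" "s \<in> carrier S" "s' \<in> carrier S" |
      a r s where "f = frag_of (\<phi> a \<otimes>\<^bsub>R\<^esub> r, s) - frag_of (r, \<psi> a \<otimes>\<^bsub>S\<^esub> s)"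
        "a \<in> carrier K" "r \<in> carrier R" "s \<in> carrier S"
      unfolding tensor_relations_def by blast
  then show "f \<in> carrier (pair_ring R S)"
    unfolding pair_ring_carrier
    by cases (simp_all add: hom keys_diff_subset del: keys_diff)
qed

lemma tensor_ideal:
  assumes "cring R" "cring S" "\<phi> \<in> ring_hom K R" "\<psi> \<in> ring_hom K S"
  shows "ideal (tensor_ideal K R \<phi> S \<psi>) (pair_ring R S)"
    and "tensor_relations K R \<phi> S \<psi> \<subseteq> tensor_ideal K R \<phi> S \<psi>"
  unfolding tensor_ideal_def
  by (rule ring.genideal_ideal ring.genideal_self; intro cring.axioms(1) pair_ring_cring tensor_relations_carrier assms)+

lemma tensor_cring:
  assumes "cring R" "cring S" "\<phi> \<in> ring_hom K R" "\<psi> \<in> ring_hom K S"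
  shows "cring (tensor K R \<phi> S \<psi>)"
  unfolding tensor_def
  using ideal.quotient_is_cring[OF tensor_ideal(1)[OF assms] pair_ring_cring[OF assms(1,2)]] .

lemma pair_map_simps [simp]:
  "pair_map \<alpha> \<beta> 0 = 0"
  "pair_map \<alpha> \<beta> (frag_of (r, s)) = frag_of (\<alpha> r, \<beta> s)"
  "pair_map \<alpha> \<beta> (f - g) = pair_map \<alpha> \<beta> f - pair_map \<alpha> \<beta> g"
  "pair_map \<alpha> \<beta> (f + g) = pair_map \<alpha> \<beta> f + pair_map \<alpha> \<beta> g"
  by (simp_all add: pair_map_def frag_extend_diff frag_extend_add)

lemma pair_map_hom:
  assumes "\<alpha> \<in> ring_hom R R'" "\<beta> \<in> ring_hom S S'"
  shows "pair_map \<alpha> \<beta> \<in> ring_hom (pair_ring R S) (pair_ring R' S')"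
proof (rule ring_hom_memI)
  note hom = ring_hom_memE[OF assms(1)] ring_hom_memE[OF assms(2)]
  show "pair_map \<alpha> \<beta> f \<in> carrier (pair_ring R' S')" if "f \<in> carrier (pair_ring R S)" for f
    using that unfolding pair_ring_carrier
  proof (induction f rule: frag_induction)
    case (diff a b)
    then show ?case by (simp add: keys_diff_subset)
  qed (simp_all add: hom split_paired_all)
  show "pair_map \<alpha> \<beta> (f \<otimes>\<^bsub>pair_ring R S\<^esub> g) = pair_map \<alpha> \<beta> f \<otimes>\<^bsub>pair_ring R' S'\<^esub> pair_map \<alpha> \<beta> g"
    if "f \<in> carrier (pair_ring R S)" "g \<in> carrier (pair_ring R S)" for f g
    using that(1) unfolding pair_ring_carrier
  proof (induction f rule: frag_induction)
    case (one x)
    obtain x1 x2 where x: "x = (x1, x2)" by (cases x)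
    show ?case using that(2) unfolding pair_ring_carrier
      by (induction g rule: frag_induction)
         (use one x in \<open>simp_all add: hom pair_mult_of pair_mult_0 pair_mult_diff split_paired_all\<close>)
  qed (simp_all add: pair_mult_0 pair_mult_diff)
qed (simp_all add: pair_ring_simps ring_hom_memE(4)[OF assms(1)] ring_hom_memE(4)[OF assms(2)])

lemma pair_map_ideal:
  assumes "cring R" "cring S" "\<phi> \<in> ring_hom K R" "\<psi> \<in> ring_hom K S"
    and "cring R'" "cring S'" "\<phi>' \<in> ring_hom K' R'" "\<psi>' \<in> ring_hom K' S'"
    and \<alpha>: "\<alpha> \<in> ring_hom R R'" and \<beta>: "\<beta> \<in> ring_hom S S'"
    and \<kappa>: "\<And>a. a \<in> carrier K \<Longrightarrow> \<kappa> a \<in> carrier K'"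
      "\<And>a. a \<in> carrier K \<Longrightarrow> \<alpha> (\<phi> a) = \<phi>' (\<kappa> a)"
      "\<And>a. a \<in> carrier K \<Longrightarrow> \<beta> (\<psi> a) = \<psi>' (\<kappa> a)"
    and f: "f \<in> tensor_ideal K R \<phi> S \<psi>"
  shows "pair_map \<alpha> \<beta> f \<in> tensor_ideal K' R' \<phi>' S' \<psi>'"
proof -
  let ?P = "pair_ring R S" and ?P' = "pair_ring R' S'" and ?I' = "tensor_ideal K' R' \<phi>' S' \<psi>'"
  interpret P: cring ?P by (rule pair_ring_cring[OF assms(1,2)])
  interpret P': cring ?P' by (rule pair_ring_cring[OF assms(5,6)])
  interpret h: ring_hom_ring ?P ?P' "pair_map \<alpha> \<beta>"
    by (intro ring_hom_ring.intro ring_hom_ring_axioms.intro P.ring_axioms P'.ring_axioms pair_map_hom \<alpha> \<beta>)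
  have I': "ideal ?I' ?P'" by (rule tensor_ideal(1)[OF assms(5-8)])
  let ?J = "{f \<in> carrier ?P. pair_map \<alpha> \<beta> f \<in> ?I'}"
  have J: "ideal ?J ?P"
    using h.ideal_vimage[OF I'] by simp
  note hom = ring_hom_memE[OF \<alpha>] ring_hom_memE[OF \<beta>] ring_hom_memE[OF assms(3)] ring_hom_memE[OF assms(4)]
  have "pair_map \<alpha> \<beta> g \<in> tensor_relations K' R' \<phi>' S' \<psi>'" if "g \<in> tensor_relations K R \<phi> S \<psi>" for g
  proof -
    from that consider
      (l) r r' s where "g = frag_of (r \<oplus>\<^bsub>R\<^esub> r', s) - frag_of (r, s) - frag_of (r', s)"
        "r \<in> carrier R" "r' \<in> carrier R" "s \<in> carrier S" |
      (r) r s s' where "g = frag_of (r, s \<oplus>\<^bsub>S\<^esub> s') - frag_of (r, s) - frag_of (r, s')"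
        "r \<in> carrier R" "s \<in> carrier S" "s' \<in> carrier S" |
      (m) a r s where "g = frag_of (\<phi> a \<otimes>\<^bsub>R\<^esub> r, s) - frag_of (r, \<psi> a \<otimes>\<^bsub>S\<^esub> s)"
        "a \<in> carrier K" "r \<in> carrier R" "s \<in> carrier S"
      unfolding tensor_relations_def by blast
    then show ?thesis
    proof cases
      case l
      then have "pair_map \<alpha> \<beta> g =
        frag_of (\<alpha> r \<oplus>\<^bsub>R'\<^esub> \<alpha> r', \<beta> s) - frag_of (\<alpha> r, \<beta> s) - frag_of (\<alpha> r', \<beta> s)"
        by (simp add: hom)
      then show ?thesis using l(2-) hom(1) hom(5) unfolding tensor_relations_def by blast
    next
      case r
      then have "pair_map \<alpha> \<beta> g =
        frag_of (\<alpha> r, \<beta> s \<oplus>\<^bsub>S'\<^esub> \<beta> s') - frag_of (\<alpha> r, \<beta> s) - frag_of (\<alpha> r, \<beta> s')"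
        by (simp add: hom)
      then show ?thesis using r(2-) hom(1) hom(5) unfolding tensor_relations_def by blast
    next
      case m
      then have "pair_map \<alpha> \<beta> g =
        frag_of (\<phi>' (\<kappa> a) \<otimes>\<^bsub>R'\<^esub> \<alpha> r, \<beta> s) - frag_of (\<alpha> r, \<psi>' (\<kappa> a) \<otimes>\<^bsub>S'\<^esub> \<beta> s)"
        by (simp add: hom \<kappa>)
      then show ?thesis using m(2-) hom(1) hom(5) \<kappa>(1) unfolding tensor_relations_def by blast
    qed
  qed
  then have "tensor_relations K R \<phi> S \<psi> \<subseteq> ?J"
    using tensor_relations_carrier[OF assms(1-4)] tensor_ideal(2)[OF assms(5-8)] by blast
  then show ?thesis
    using P.genideal_minimal[OF J] f unfolding tensor_ideal_def by blast
qed

lemma tensor_endo_coset: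
  assumes "sigma_algebra K \<sigma> R \<tau> \<phi>" "sigma_algebra K \<sigma> S \<tau>' \<psi>" "f \<in> carrier (pair_ring R S)"
  shows "tensor_endo K R \<tau> \<phi> S \<tau>' \<psi> (tensor_ideal K R \<phi> S \<psi> +>\<^bsub>pair_ring R S\<^esub> f) =
    tensor_ideal K R \<phi> S \<psi> +>\<^bsub>pair_ring R S\<^esub> pair_map \<tau> \<tau>' f"
proof -
  interpret R: sigma_algebra K \<sigma> R \<tau> \<phi> by fact
  interpret S: sigma_algebra K \<sigma> S \<tau>' \<psi> by fact
  let ?P = "pair_ring R S" and ?I = "tensor_ideal K R \<phi> S \<psi>"
  note cr = R.R.is_cring S.R.is_cring and sm = R.structure_map S.structure_map
  interpret P: cring ?P by (rule pair_ring_cring[OF cr])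
  interpret I: ideal ?I ?P by (rule tensor_ideal(1)[OF cr sm])
  have map: "pair_map \<tau> \<tau>' \<in> ring_hom ?P ?P"
    by (rule pair_map_hom[OF R.endo S.endo])
  have "?I +>\<^bsub>?P\<^esub> pair_map \<tau> \<tau>' g = ?I +>\<^bsub>?P\<^esub> pair_map \<tau> \<tau>' f" if gI: "g \<in> ?I +>\<^bsub>?P\<^esub> f" for g
  proof -
    obtain i where i: "i \<in> ?I" "g = i \<oplus>\<^bsub>?P\<^esub> f"
      using gI unfolding a_r_coset_def' by blast
    have "pair_map \<tau> \<tau>' i \<in> ?I"
    proof (rule pair_map_ideal[where \<kappa> = \<sigma>, OF cr sm cr sm R.endo S.endo _ _ _ i(1)])
      fix a assume a: "a \<in> carrier K"
      show "\<sigma> a \<in> carrier K" by (rule ring_hom_closed[OF R.K.endo a])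
      show "\<tau> (\<phi> a) = \<phi> (\<sigma> a)" by (rule R.equivariant[OF a, symmetric])
      show "\<tau>' (\<psi> a) = \<psi> (\<sigma> a)" by (rule S.equivariant[OF a, symmetric])
    qed
    then show ?thesis
      unfolding i(2) ring_hom_add[OF map I.Icarr[OF i(1)] assms(3)]
      using P.a_coset_add_assoc[OF I.a_subset I.Icarr ring_hom_closed[OF map assms(3)], of "pair_map \<tau> \<tau>' i"]
        I.a_rcos_const[of "pair_map \<tau> \<tau>' i"] by argo
  qed
  moreover have "f \<in> ?I +>\<^bsub>?P\<^esub> f"
    by (rule I.a_rcos_self[OF assms(3)])
  ultimately show ?thesis
    unfolding tensor_endo_def by blast
qed


section \<open>Independence of the choice of types\<close>

text \<open>
  Words as programs of a stack machine: they name the elements of the \<open>\<sigma>\<close>-subfield generated by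
  the values of \<open>g\<close>.
\<close>

definition word_step ::
  "'m ring \<Rightarrow> ('m \<Rightarrow> 'm) \<Rightarrow> ('x + nat \<Rightarrow> 'm) \<Rightarrow> 'x + nat \<Rightarrow> 'm list \<Rightarrow> 'm list"
  where "word_step M \<rho> g l st = (case l of
      Inl x \<Rightarrow> g (Inl x) # st
    | Inr n \<Rightarrow>
        if n = 0 then (\<ominus>\<^bsub>M\<^esub> hd st) # tl st
        else if n = 1 then (inv\<^bsub>M\<^esub> hd st) # tl st
        else if n = 2 then \<rho> (hd st) # tl st
        else if n = 3 then (hd (tl st) \<oplus>\<^bsub>M\<^esub> hd st) # tl (tl st)
        else if n = 4 then (hd (tl st) \<otimes>\<^bsub>M\<^esub> hd st) # tl (tl st)
        else if n = 5 then \<one>\<^bsub>M\<^esub> # st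
        else g (Inr (n - 6)) # st)"

lemma sigma_field_words:
  fixes M :: "'m ring" and g :: "'x + nat \<Rightarrow> 'm"
  assumes "sigma_field M \<rho>"
  obtains W :: "('x + nat) list ring" and \<omega> j
  where "sigma_field W \<omega>" "j \<in> ring_hom W M" "inj_on j (carrier W)"
    "\<And>w. w \<in> carrier W \<Longrightarrow> j (\<omega> w) = \<rho> (j w)"
    "\<And>y. g y \<in> carrier M \<Longrightarrow> g y \<in> j ` carrier W"
proof -
  interpret M: sigma_field M \<rho> by fact
  note \<rho> = ring_hom_memE[OF M.endo]
  define val where "val w m \<longleftrightarrow> (\<forall>st. fold (word_step M \<rho> g) w st = m # st)" for w m
  define F where "F = {m \<in> carrier M. \<exists>w. val w m}"
  define \<theta> where "\<theta> m = (SOME w. val w m)" for m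
  have val1: "val w m \<Longrightarrow> val (w @ [Inr 0]) (\<ominus>\<^bsub>M\<^esub> m)" "val w m \<Longrightarrow> val (w @ [Inr 1]) (inv\<^bsub>M\<^esub> m)"
    "val w m \<Longrightarrow> val (w @ [Inr 2]) (\<rho> m)" for w m
    by (simp_all add: val_def word_step_def)
  have val2: "val w m \<Longrightarrow> val w' m' \<Longrightarrow> val (w @ w' @ [Inr 3]) (m \<oplus>\<^bsub>M\<^esub> m')"
    "val w m \<Longrightarrow> val w' m' \<Longrightarrow> val (w @ w' @ [Inr 4]) (m \<otimes>\<^bsub>M\<^esub> m')" for w m w' m'
    by (simp_all add: val_def word_step_def)
  have val0: "val [Inr 5] \<one>\<^bsub>M\<^esub>"
    by (simp add: val_def word_step_def)
  have valg: "\<exists>w. val w (g y)" for y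
  proof (cases y)
    case (Inl x)
    then have "val [Inl x] (g y)" by (simp add: val_def word_step_def)
    then show ?thesis ..
  next
    case (Inr n)
    then have "val [Inr (n + 6)] (g y)" by (simp add: val_def word_step_def)
    then show ?thesis ..
  qed
  have F: "subfield F M"
  proof (rule M.subfieldI'[OF M.subringI])
    show "F \<subseteq> carrier M" "\<one>\<^bsub>M\<^esub> \<in> F" using val0 by (auto simp: F_def)
    show "\<ominus>\<^bsub>M\<^esub> m \<in> F" if "m \<in> F" for m using that val1(1) by (auto simp: F_def)
    show "m \<otimes>\<^bsub>M\<^esub> m' \<in> F" if "m \<in> F" "m' \<in> F" for m m' using that val2(2) by (simp add: F_def) blast
    show "m \<oplus>\<^bsub>M\<^esub> m' \<in> F" if "m \<in> F" "m' \<in> F" for m m' using that val2(1) by (simp add: F_def) blast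
    show "inv\<^bsub>M\<^esub> m \<in> F" if "m \<in> F - {\<zero>\<^bsub>M\<^esub>}" for m
      using that val1(2) M.field_Units M.Units_inv_closed by (simp add: F_def) blast
  qed
  have \<rho>F: "\<rho> m \<in> F" if "m \<in> F" for m
    using that val1(3) \<rho>(1) by (simp add: F_def) blast
  have \<theta>: "val (\<theta> m) m" if "m \<in> F" for m
    using that someI_ex[of "\<lambda>w. val w m"] by (simp add: F_def \<theta>_def)
  have inj: "inj_on \<theta> F"
  proof (rule inj_onI)
    fix m m' assume "m \<in> F" "m' \<in> F" "\<theta> m = \<theta> m'"
    then have "val (\<theta> m) m" "val (\<theta> m) m'" using \<theta>[of m] \<theta>[of m'] by simp_all
    then show "m = m'" unfolding val_def by simp
  qed
  let ?F = "M\<lparr>carrier := F\<rparr>"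
  define W where "W = image_ring \<theta> ?F"
  define j where "j = inv_into F \<theta>"
  define \<omega> where "\<omega> w = \<theta> (\<rho> (j w))" for w
  have fF: "field ?F" by (rule M.subfield_iff(2)[OF F])
  have j\<theta>: "j (\<theta> m) = m" if "m \<in> F" for m
    unfolding j_def by (rule inv_into_f_f[OF inj that])
  have cW: "carrier W = \<theta> ` F" by (simp add: W_def image_ring_carrier)
  have iso: "\<theta> \<in> ring_iso ?F W"
    unfolding W_def by (rule inj_imp_image_ring_iso) (simp add: inj)
  note th = ring_iso_memE[OF iso, simplified]
  have FM: "F \<subseteq> carrier M" by (auto simp: F_def)
  have jhom: "j \<in> ring_hom W M"
  proof (rule ring_hom_memI)
    show "j x \<in> carrier M" if "x \<in> carrier W" for x
      using that FM by (auto simp: cW j\<theta>)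
    note sub = subringE[OF subfieldE(1)[OF F]]
    show "j (x \<otimes>\<^bsub>W\<^esub> y) = j x \<otimes>\<^bsub>M\<^esub> j y" if "x \<in> carrier W" "y \<in> carrier W" for x y
      using that by (auto simp: cW j\<theta> sub th(2)[symmetric])
    show "j (x \<oplus>\<^bsub>W\<^esub> y) = j x \<oplus>\<^bsub>M\<^esub> j y" if "x \<in> carrier W" "y \<in> carrier W" for x y
      using that by (auto simp: cW j\<theta> sub th(3)[symmetric])
    show "j \<one>\<^bsub>W\<^esub> = \<one>\<^bsub>M\<^esub>"
      using th(4) j\<theta>[OF sub(3)] by simp
  qed
  have eq: "j (\<omega> w) = \<rho> (j w)" if "w \<in> carrier W" for w
    using that by (auto simp: cW \<omega>_def j\<theta> \<rho>F)
  have "sigma_field W \<omega>"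
  proof (intro sigma_field.intro sigma_field_axioms.intro)
    show "field W" unfolding W_def
      by (rule field.inj_imp_image_ring_is_field[OF fF]) (simp add: inj)
    note sub = subringE[OF subfieldE(1)[OF F]]
    show "\<omega> \<in> ring_hom W W"
    proof (rule ring_hom_memI)
      show "\<omega> x \<in> carrier W" if "x \<in> carrier W" for x
        using that by (auto simp: cW \<omega>_def j\<theta> \<rho>F)
      show "\<omega> (x \<otimes>\<^bsub>W\<^esub> y) = \<omega> x \<otimes>\<^bsub>W\<^esub> \<omega> y" if "x \<in> carrier W" "y \<in> carrier W" for x y
        using that FM by (auto simp: cW \<omega>_def j\<theta> sub th(2)[symmetric] \<rho>F \<rho> subset_iff)
      show "\<omega> (x \<oplus>\<^bsub>W\<^esub> y) = \<omega> x \<oplus>\<^bsub>W\<^esub> \<omega> y" if "x \<in> carrier W" "y \<in> carrier W" for x y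
        using that FM by (auto simp: cW \<omega>_def j\<theta> sub th(3)[symmetric] \<rho>F \<rho> subset_iff)
      show "\<omega> \<one>\<^bsub>W\<^esub> = \<one>\<^bsub>W\<^esub>"
        using th(4) j\<theta>[OF sub(3)] by (simp add: \<omega>_def \<rho>(4))
    qed
  qed
  moreover have "inj_on j (carrier W)"
    unfolding cW by (rule inj_onI) (auto simp: j\<theta>)
  moreover have "g y \<in> j ` carrier W" if "g y \<in> carrier M" for y
  proof -
    have "g y \<in> F" using that valg by (simp add: F_def)
    then show ?thesis using j\<theta> by (force simp: cW)
  qed
  ultimately show thesis using that jhom eq by blast
qed

lemma inj_hom_inv:
  assumes "ring W" "j \<in> ring_hom W M" "inj_on j (carrier W)"
    and "\<mu> \<in> ring_hom K M" "\<mu> ` carrier K \<subseteq> j ` carrier W" "ring K"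
  shows "inv_into (carrier W) j \<circ> \<mu> \<in> ring_hom K W"
    and "a \<in> carrier K \<Longrightarrow> j ((inv_into (carrier W) j \<circ> \<mu>) a) = \<mu> a"
proof -
  interpret W: ring W by fact
  interpret K: ring K by fact
  let ?i = "inv_into (carrier W) j"
  note hj = ring_hom_memE[OF assms(2)] and hm = ring_hom_memE[OF assms(4)]
  have ji: "j (?i (\<mu> a)) = \<mu> a" "?i (\<mu> a) \<in> carrier W" if "a \<in> carrier K" for a
    using assms(5) that by (auto intro!: f_inv_into_f inv_into_into)
  show "a \<in> carrier K \<Longrightarrow> j ((?i \<circ> \<mu>) a) = \<mu> a" by (simp add: ji)
  have eqI: "x = y" if "x \<in> carrier W" "y \<in> carrier W" "j x = j y" for x y
    using assms(3) that by (auto dest: inj_onD)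
  show "?i \<circ> \<mu> \<in> ring_hom K W"
    by (rule ring_hom_memI; (rule eqI)?) (simp_all add: ji hj hm(2-4)[symmetric])
qed

lemma sigma_extension_words:
  assumes "sigma_extension K \<sigma> M \<rho> \<mu>" "sigma_field W \<omega>" "j \<in> ring_hom W M" "inj_on j (carrier W)"
    and "\<And>w. w \<in> carrier W \<Longrightarrow> j (\<omega> w) = \<rho> (j w)" "\<mu> ` carrier K \<subseteq> j ` carrier W"
  shows "sigma_extension K \<sigma> W \<omega> (inv_into (carrier W) j \<circ> \<mu>)"
proof -
  interpret E: sigma_extension K \<sigma> M \<rho> \<mu> by fact
  interpret W: sigma_field W \<omega> by fact
  note i = inj_hom_inv[OF W.ring_axioms assms(3,4) E.structure_map assms(6) E.K.ring_axioms]
  note ic = ring_hom_closed[OF i(1)] and \<sigma>c = ring_hom_closed[OF E.K.endo]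
    and \<omega>c = ring_hom_closed[OF W.endo]
  show ?thesis
  proof (intro sigma_extension.intro sigma_extension_axioms.intro)
    fix a assume a: "a \<in> carrier K"
    show "(inv_into (carrier W) j \<circ> \<mu>) (\<sigma> a) = \<omega> ((inv_into (carrier W) j \<circ> \<mu>) a)"
    proof (rule inj_onD[OF assms(4)])
      show "j ((inv_into (carrier W) j \<circ> \<mu>) (\<sigma> a)) = j (\<omega> ((inv_into (carrier W) j \<circ> \<mu>) a))"
        using i(2)[OF a] i(2)[OF \<sigma>c[OF a]] assms(5)[OF ic[OF a]] E.equivariant[OF a] by simp
    qed (use ic[OF \<sigma>c[OF a]] \<omega>c[OF ic[OF a]] in simp_all)
  qed (fact i(1) E.K.sigma_field_axioms assms(2))+
qed

lemma sigma_embedding_words: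
  assumes "sigma_embedding K L \<tau> \<phi> M \<rho> \<mu> \<epsilon>" "ring L" "\<tau> \<in> ring_hom L L" "\<phi> \<in> ring_hom K L"
    and "sigma_field W \<omega>" "j \<in> ring_hom W M" "inj_on j (carrier W)"
    and "\<And>w. w \<in> carrier W \<Longrightarrow> j (\<omega> w) = \<rho> (j w)" "\<epsilon> ` carrier L \<subseteq> j ` carrier W"
  shows "sigma_embedding K L \<tau> \<phi> W \<omega> (inv_into (carrier W) j \<circ> \<mu>) (inv_into (carrier W) j \<circ> \<epsilon>)"
proof -
  interpret W: sigma_field W \<omega> by fact
  let ?i = "inv_into (carrier W) j"
  have \<epsilon>: "\<epsilon> \<in> ring_hom L M" "inj_on \<epsilon> (carrier L)"
    "\<And>x. x \<in> carrier L \<Longrightarrow> \<epsilon> (\<tau> x) = \<rho> (\<epsilon> x)" "\<And>a. a \<in> carrier K \<Longrightarrow> \<epsilon> (\<phi> a) = \<mu> a"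
    using assms(1) by (simp_all add: sigma_embedding_def)
  note i = inj_hom_inv[OF W.ring_axioms assms(6,7) \<epsilon>(1) assms(9,2)]
  note ic = ring_hom_closed[OF i(1)] and \<tau>c = ring_hom_closed[OF assms(3)]
    and \<omega>c = ring_hom_closed[OF W.endo]
  have "inj_on (?i \<circ> \<epsilon>) (carrier L)"
  proof (rule inj_onI)
    fix x y assume "x \<in> carrier L" "y \<in> carrier L" "(?i \<circ> \<epsilon>) x = (?i \<circ> \<epsilon>) y"
    then show "x = y" using i(2)[of x] i(2)[of y] inj_onD[OF \<epsilon>(2)] by metis
  qed
  moreover have "(?i \<circ> \<epsilon>) (\<tau> x) = \<omega> ((?i \<circ> \<epsilon>) x)" if x: "x \<in> carrier L" for x
  proof (rule inj_onD[OF assms(7)])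
    show "j ((?i \<circ> \<epsilon>) (\<tau> x)) = j (\<omega> ((?i \<circ> \<epsilon>) x))"
      using i(2)[OF x] i(2)[OF \<tau>c[OF x]] assms(8)[OF ic[OF x]] \<epsilon>(3)[OF x] by simp
  qed (use ic[OF \<tau>c[OF x]] \<omega>c[OF ic[OF x]] in simp_all)
  ultimately show ?thesis
    unfolding sigma_embedding_def using i(1) \<epsilon>(4) by simp
qed

text \<open>The overfield in \<open>compatible\<close> may be taken on any type.\<close>

theorem compatibleI:
  fixes M :: "'m ring" and L :: "'l ring" and L' :: "'l2 ring"
  assumes "sigma_extension K \<sigma> L \<tau> \<phi>" "sigma_extension K \<sigma> L' \<tau>' \<phi>'"
    and "sigma_extension K \<sigma> M \<rho> \<mu>"
    and "sigma_embedding K L \<tau> \<phi> M \<rho> \<mu> \<epsilon>" "sigma_embedding K L' \<tau>' \<phi>' M \<rho> \<mu> \<epsilon>'"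
  shows "compatible K \<sigma> L \<tau> \<phi> L' \<tau>' \<phi>'"
proof -
  interpret E: sigma_extension K \<sigma> L \<tau> \<phi> by fact
  interpret E': sigma_extension K \<sigma> L' \<tau>' \<phi>' by fact
  interpret M: sigma_extension K \<sigma> M \<rho> \<mu> by fact
  define g :: "('l + 'l2) + nat \<Rightarrow> 'm" where "g y = (case y of Inl (Inl x) \<Rightarrow> \<epsilon> x | Inl (Inr x) \<Rightarrow> \<epsilon>' x | Inr n \<Rightarrow> \<zero>\<^bsub>M\<^esub>)" for y
  obtain W :: "(('l + 'l2) + nat) list ring" and \<omega> j where W: "sigma_field W \<omega>" "j \<in> ring_hom W M" "inj_on j (carrier W)"
    "\<And>w. w \<in> carrier W \<Longrightarrow> j (\<omega> w) = \<rho> (j w)"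
    "\<And>y. g y \<in> carrier M \<Longrightarrow> g y \<in> j ` carrier W"
    by (rule sigma_field_words[OF M.L.sigma_field_axioms, of g]; rule that)
  have \<epsilon>: "\<epsilon> \<in> ring_hom L M" "\<epsilon>' \<in> ring_hom L' M"
    "\<And>a. a \<in> carrier K \<Longrightarrow> \<epsilon> (\<phi> a) = \<mu> a"
    using assms(4,5) by (simp_all add: sigma_embedding_def)
  have im: "\<epsilon> ` carrier L \<subseteq> j ` carrier W" "\<epsilon>' ` carrier L' \<subseteq> j ` carrier W"
    using W(5)[of "Inl (Inl _)"] W(5)[of "Inl (Inr _)"] ring_hom_closed[OF \<epsilon>(1)] ring_hom_closed[OF \<epsilon>(2)]
    by (auto simp: g_def)
  have "\<mu> ` carrier K \<subseteq> j ` carrier W"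
    using im(1) \<epsilon>(3)[symmetric] ring_hom_closed[OF E.structure_map] by (auto simp: subset_iff)
  then show ?thesis
    unfolding compatible_def
    using sigma_extension_words[OF assms(3) W(1-4)]
      sigma_embedding_words[OF assms(4) E.L.ring_axioms E.L.endo E.structure_map W(1-4) im(1)]
      sigma_embedding_words[OF assms(5) E'.L.ring_axioms E'.L.endo E'.structure_map W(1-4) im(2)]
    by blast
qed

lemma snd_keys: 
  assumes "f \<in> carrier (pair_ring R S)"
  shows "snd ` Poly_Mapping.keys f \<subseteq> carrier S"
proof
  fix s assume "s \<in> snd ` Poly_Mapping.keys f"
  then obtain x where "x \<in> Poly_Mapping.keys f" "s = snd x" by (rule imageE)
  then show "s \<in> carrier S"
    using subsetD[OF assms[unfolded pair_ring_carrier], of x] by (simp add: mem_Times_iff)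
qed

lemma pair_map_cong:
  assumes "f \<in> carrier (pair_ring R S)"
    and "\<And>r. r \<in> carrier R \<Longrightarrow> \<alpha> r = \<alpha>' r" "\<And>s. s \<in> carrier S \<Longrightarrow> \<beta> s = \<beta>' s"
  shows "pair_map \<alpha> \<beta> f = pair_map \<alpha>' \<beta>' f"
  unfolding pair_map_def
proof (rule frag_extend_eq)
  fix x assume "x \<in> Poly_Mapping.keys f"
  from subsetD[OF assms(1)[unfolded pair_ring_carrier] this]
  show "(case x of (r, s) \<Rightarrow> frag_of (\<alpha> r, \<beta> s)) = (case x of (r, s) \<Rightarrow> frag_of (\<alpha>' r, \<beta>' s))"
    by (cases x) (simp add: assms(2,3))
qed

lemma pair_map_comp:
  "pair_map \<alpha> \<beta> (pair_map \<alpha>' \<beta>' f) = pair_map (\<alpha> \<circ> \<alpha>') (\<beta> \<circ> \<beta>') f"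
  using subset_UNIV[of "Poly_Mapping.keys f"]
  by (induction f rule: frag_induction) (simp_all add: split_paired_all)

lemma pair_map_id: "pair_map id id f = f"
  using subset_UNIV[of "Poly_Mapping.keys f"]
  by (induction f rule: frag_induction) (simp_all add: split_paired_all)

lemma pair_map_id_inj:
  assumes "inj_on j (carrier W)" "f \<in> carrier (pair_ring R W)" "f' \<in> carrier (pair_ring R W)"
    and "pair_map id j f = pair_map id j f'"
  shows "f = f'"
proof -
  have *: "pair_map id (inv_into (carrier W) j) (pair_map id j h) = h" if "h \<in> carrier (pair_ring R W)" for h
  proof -
    have "pair_map (id \<circ> id) (inv_into (carrier W) j \<circ> j) h = pair_map id id h"
      by (rule pair_map_cong[OF that]) (simp_all add: inv_into_f_f[OF assms(1)])
    then show ?thesis by (simp only: pair_map_comp pair_map_id)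
  qed
  show ?thesis
    using arg_cong[OF assms(4), of "pair_map id (inv_into (carrier W) j)"]
    unfolding *[OF assms(2)] *[OF assms(3)] .
qed

lemma pair_map_id_lift:
  assumes "f \<in> carrier (pair_ring R K')" "snd ` Poly_Mapping.keys f \<subseteq> j ` carrier W"
  shows "\<exists>f' \<in> carrier (pair_ring R W). pair_map id j f' = f"
proof -
  have "Poly_Mapping.keys f \<subseteq> carrier R \<times> (j ` carrier W)"
    using assms unfolding pair_ring_carrier by force
  then have "\<exists>f'. f' \<in> carrier (pair_ring R W) \<and> pair_map id j f' = f"
  proof (induction f rule: frag_induction)
    case zero
    show ?case by (rule exI[of _ 0]) (simp add: pair_ring_carrier)
  next
    case (one x)
    then obtain r w where "x = (r, j w)" "r \<in> carrier R" "w \<in> carrier W" by blast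
    then show ?case by (intro exI[of _ "frag_of (r, w)"]) (simp add: pair_ring_carrier)
  next
    case (diff a b)
    then obtain a' b' where "a' \<in> carrier (pair_ring R W)" "pair_map id j a' = a"
      "b' \<in> carrier (pair_ring R W)" "pair_map id j b' = b" by blast
    then show ?case
      by (intro exI[of _ "a' - b'"] conjI)
         (simp add: pair_ring_carrier keys_diff_subset, simp only: pair_map_simps)
  qed
  then show ?thesis by blast
qed

lemma tensor_ideal_local:
  fixes K :: "'k ring" and W0 :: "'w ring"
  assumes "cring R" "cring K'" "\<phi> \<in> ring_hom K R" "\<psi> \<in> ring_hom K K'"
    and f: "f \<in> tensor_ideal K R \<phi> K' \<psi>"
  shows "\<exists>C. finite C \<and> C \<subseteq> carrier K' \<and> (\<forall>(W :: 'w ring) j \<psi>'.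
      cring W \<and> j \<in> ring_hom W K' \<and> \<psi>' \<in> ring_hom K W \<and>
      (\<forall>a \<in> carrier K. j (\<psi>' a) = \<psi> a) \<longrightarrow> C \<subseteq> j ` carrier W \<longrightarrow>
      (\<exists>f' \<in> tensor_ideal K R \<phi> W \<psi>'. pair_map id j f' = f))"
proof -
  let ?P = "pair_ring R K'"
  interpret R: cring R by fact
  interpret P: cring ?P by (rule pair_ring_cring[OF assms(1,2)])
  define Q where "Q W j \<psi>' \<longleftrightarrow> cring W \<and> j \<in> ring_hom W K' \<and> \<psi>' \<in> ring_hom K W \<and>
      (\<forall>a \<in> carrier K. j (\<psi>' a) = \<psi> a)" for W :: "'w ring" and j \<psi>'
  define J where "J = {f \<in> carrier ?P. \<exists>C. finite C \<and> C \<subseteq> carrier K' \<and> (\<forall>(W :: 'w ring) j \<psi>'.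
      Q W j \<psi>' \<longrightarrow> C \<subseteq> j ` carrier W \<longrightarrow> (\<exists>f' \<in> tensor_ideal K R \<phi> W \<psi>'. pair_map id j f' = f))}"
  have JI: "f \<in> J" if "f \<in> carrier ?P" "finite C" "C \<subseteq> carrier K'"
    "\<And>(W :: 'w ring) j \<psi>'. Q W j \<psi>' \<Longrightarrow> C \<subseteq> j ` carrier W \<Longrightarrow>
       \<exists>f' \<in> tensor_ideal K R \<phi> W \<psi>'. pair_map id j f' = f" for f C
    unfolding J_def using that by blast
  have JE: "\<exists>C. finite C \<and> C \<subseteq> carrier K' \<and> (\<forall>(W :: 'w ring) j \<psi>'.
      Q W j \<psi>' \<longrightarrow> C \<subseteq> j ` carrier W \<longrightarrow> (\<exists>f' \<in> tensor_ideal K R \<phi> W \<psi>'. pair_map id j f' = f))"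
    "f \<in> carrier ?P" if "f \<in> J" for f
    using that unfolding J_def by auto
  have idl: "ideal (tensor_ideal K R \<phi> W \<psi>') (pair_ring R W)"
    "tensor_relations K R \<phi> W \<psi>' \<subseteq> tensor_ideal K R \<phi> W \<psi>'" "ring (pair_ring R W)" if "Q W j \<psi>'" for W j \<psi>'
    using tensor_ideal[OF assms(1) _ assms(3), of W \<psi>'] cring.axioms(1)[OF pair_ring_cring[OF assms(1), of W]] that
    by (simp_all add: Q_def)
  have hom: "pair_map id j \<in> ring_hom (pair_ring R W) ?P" if "Q W j \<psi>'" for W j \<psi>'
    by (rule pair_map_hom) (use that in \<open>simp_all add: Q_def ring_hom_def\<close>)
  have Pneg: "\<ominus>\<^bsub>?P\<^esub> x = - x" if "x \<in> carrier ?P" for x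
    by (rule P.minus_equality) (use that in \<open>simp_all add: pair_ring_simps pair_ring_carrier\<close>)
  have mult_closed: "h \<otimes>\<^bsub>?P\<^esub> f \<in> J" if fJ: "f \<in> J" and hc: "h \<in> carrier ?P" for f h
  proof -
    obtain C where C: "finite C" "C \<subseteq> carrier K'" "\<forall>(W :: 'w ring) j \<psi>'.
        Q W j \<psi>' \<longrightarrow> C \<subseteq> j ` carrier W \<longrightarrow> (\<exists>f' \<in> tensor_ideal K R \<phi> W \<psi>'. pair_map id j f' = f)"
      using JE(1)[OF fJ] by blast
    show ?thesis
    proof (rule JI)
      show "h \<otimes>\<^bsub>?P\<^esub> f \<in> carrier ?P" by (rule P.m_closed[OF hc JE(2)[OF fJ]])
      show "finite (C \<union> snd ` Poly_Mapping.keys h)" by (intro finite_UnI finite_imageI finite_keys C(1))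
      show "C \<union> snd ` Poly_Mapping.keys h \<subseteq> carrier K'"
        by (rule Un_least[OF C(2) snd_keys[OF hc]])
      fix W :: "'w ring" and j \<psi>'
      assume Q: "Q W j \<psi>'" and sub: "C \<union> snd ` Poly_Mapping.keys h \<subseteq> j ` carrier W"
      obtain f' where f': "f' \<in> tensor_ideal K R \<phi> W \<psi>'" "pair_map id j f' = f"
        using C(3)[rule_format, OF Q] sub by (meson Un_subset_iff)
      obtain h' where h': "h' \<in> carrier (pair_ring R W)" "pair_map id j h' = h"
        using pair_map_id_lift[OF hc, of j W] sub by (meson Un_subset_iff)
      have "h' \<otimes>\<^bsub>pair_ring R W\<^esub> f' \<in> tensor_ideal K R \<phi> W \<psi>'"
        using ideal.I_l_closed[OF idl(1)[OF Q]] f' h' by blast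
      moreover have "pair_map id j (h' \<otimes>\<^bsub>pair_ring R W\<^esub> f') = h \<otimes>\<^bsub>?P\<^esub> f"
        using ring_hom_mult[OF hom[OF Q] h'(1) ideal.Icarr[OF idl(1)[OF Q] f'(1)]] f' h' by simp
      ultimately show "\<exists>f' \<in> tensor_ideal K R \<phi> W \<psi>'. pair_map id j f' = h \<otimes>\<^bsub>?P\<^esub> f" by blast
    qed
  qed
  have J: "ideal J ?P"
  proof (rule idealI[OF P.ring_axioms])
    show "subgroup J (add_monoid ?P)"
    proof (rule group.subgroupI[OF P.add.is_group])
      show "J \<subseteq> carrier (add_monoid ?P)" using JE(2) by auto
      have "0 \<in> J"
      proof (rule JI[of _ "{}"])
        fix W :: "'w ring" and j \<psi>' assume "Q W j \<psi>'"
        from additive_subgroup.zero_closed[OF ideal.axioms(1)[OF idl(1)[OF this]]]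
        show "\<exists>f' \<in> tensor_ideal K R \<phi> W \<psi>'. pair_map id j f' = 0"
          by (intro bexI[of _ 0]) (simp_all add: pair_ring_simps)
      qed (simp_all add: pair_ring_carrier)
      then show "J \<noteq> {}" by blast
      fix f assume f: "f \<in> J"
      have "\<ominus>\<^bsub>?P\<^esub> \<one>\<^bsub>?P\<^esub> \<otimes>\<^bsub>?P\<^esub> f \<in> J" by (rule mult_closed[OF f]) simp
      then have "\<ominus>\<^bsub>?P\<^esub> f \<in> J" using JE(2)[OF f] by (simp add: P.l_minus)
      then show "inv\<^bsub>add_monoid ?P\<^esub> f \<in> J" by (simp add: a_inv_def)
      fix g assume g: "g \<in> J"
      obtain C where C: "finite C" "C \<subseteq> carrier K'" "\<forall>(W :: 'w ring) j \<psi>'.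
          Q W j \<psi>' \<longrightarrow> C \<subseteq> j ` carrier W \<longrightarrow> (\<exists>f' \<in> tensor_ideal K R \<phi> W \<psi>'. pair_map id j f' = f)"
        using JE(1)[OF f] by blast
      obtain D where D: "finite D" "D \<subseteq> carrier K'" "\<forall>(W :: 'w ring) j \<psi>'.
          Q W j \<psi>' \<longrightarrow> D \<subseteq> j ` carrier W \<longrightarrow> (\<exists>f' \<in> tensor_ideal K R \<phi> W \<psi>'. pair_map id j f' = g)"
        using JE(1)[OF g] by blast
      have "f + g \<in> J"
      proof (rule JI)
        show "f + g \<in> carrier ?P"
          using P.add.m_closed[OF JE(2)[OF f] JE(2)[OF g]] by (simp add: pair_ring_simps)
        show "finite (C \<union> D)" "C \<union> D \<subseteq> carrier K'" using C(1,2) D(1,2) by simp_all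
        fix W :: "'w ring" and j \<psi>'
        assume Q: "Q W j \<psi>'" and sub: "C \<union> D \<subseteq> j ` carrier W"
        obtain f' where f': "f' \<in> tensor_ideal K R \<phi> W \<psi>'" "pair_map id j f' = f"
          using C(3)[rule_format, OF Q] sub by (meson Un_subset_iff)
        obtain g' where g': "g' \<in> tensor_ideal K R \<phi> W \<psi>'" "pair_map id j g' = g"
          using D(3)[rule_format, OF Q] sub by (meson Un_subset_iff)
        have "f' \<oplus>\<^bsub>pair_ring R W\<^esub> g' \<in> tensor_ideal K R \<phi> W \<psi>'"
          using additive_subgroup.a_closed[OF ideal.axioms(1)[OF idl(1)[OF Q]] f'(1) g'(1)] .
        then show "\<exists>f' \<in> tensor_ideal K R \<phi> W \<psi>'. pair_map id j f' = f + g"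
          using f' g' by (intro bexI[of _ "f' + g'"]) (simp_all add: pair_ring_simps)
      qed
      then show "f \<otimes>\<^bsub>add_monoid ?P\<^esub> g \<in> J" by (simp add: pair_ring_simps)
    qed
    show "h \<otimes>\<^bsub>?P\<^esub> f \<in> J" if "f \<in> J" "h \<in> carrier ?P" for f h
      using mult_closed[OF that] .
    then show "f \<otimes>\<^bsub>?P\<^esub> h \<in> J" if "f \<in> J" "h \<in> carrier ?P" for f h
      using that P.m_comm[OF JE(2)[OF that(1)] that(2)] by simp
  qed
  have rel: "f \<in> J" if "f \<in> tensor_relations K R \<phi> K' \<psi>" for f
  proof -
    have fc: "f \<in> carrier ?P" using tensor_relations_carrier[OF assms(1-4)] that by blast
    from that consider
      (l) r r' s where "f = frag_of (r \<oplus>\<^bsub>R\<^esub> r', s) - frag_of (r, s) - frag_of (r', s)"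
        "r \<in> carrier R" "r' \<in> carrier R" "s \<in> carrier K'" |
      (r) r s s' where "f = frag_of (r, s \<oplus>\<^bsub>K'\<^esub> s') - frag_of (r, s) - frag_of (r, s')"
        "r \<in> carrier R" "s \<in> carrier K'" "s' \<in> carrier K'" |
      (m) a r s where "f = frag_of (\<phi> a \<otimes>\<^bsub>R\<^esub> r, s) - frag_of (r, \<psi> a \<otimes>\<^bsub>K'\<^esub> s)"
        "a \<in> carrier K" "r \<in> carrier R" "s \<in> carrier K'"
      unfolding tensor_relations_def by blast
    then show ?thesis
    proof cases
      case l
      show ?thesis
      proof (rule JI[OF fc, of "{s}"])
        fix W :: "'w ring" and j \<psi>'
        assume Q: "Q W j \<psi>'" and sub: "{s} \<subseteq> j ` carrier W"
        then obtain w where w: "s = j w" "w \<in> carrier W" by blast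
        have "frag_of (r \<oplus>\<^bsub>R\<^esub> r', w) - frag_of (r, w) - frag_of (r', w) \<in> tensor_relations K R \<phi> W \<psi>'"
          unfolding tensor_relations_def using l(2-) w(2) by blast
        then show "\<exists>f' \<in> tensor_ideal K R \<phi> W \<psi>'. pair_map id j f' = f"
          using idl(2)[OF Q] l(1) w(1) by (intro bexI) auto
      qed (use l in auto)
    next
      case r
      show ?thesis
      proof (rule JI[OF fc, of "{s, s'}"])
        fix W :: "'w ring" and j \<psi>'
        assume Q: "Q W j \<psi>'" and sub: "{s, s'} \<subseteq> j ` carrier W"
        then obtain w w' where w: "s = j w" "w \<in> carrier W" "s' = j w'" "w' \<in> carrier W" by blast
        have "frag_of (r, w \<oplus>\<^bsub>W\<^esub> w') - frag_of (r, w) - frag_of (r, w') \<in> tensor_relations K R \<phi> W \<psi>'"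
          unfolding tensor_relations_def using r(2) w(2,4) by blast
        moreover have "pair_map id j (frag_of (r, w \<oplus>\<^bsub>W\<^esub> w') - frag_of (r, w) - frag_of (r, w')) = f"
          using ring_hom_add[of j W K' w w'] Q w r(1) by (simp add: Q_def)
        ultimately show "\<exists>f' \<in> tensor_ideal K R \<phi> W \<psi>'. pair_map id j f' = f"
          using idl(2)[OF Q] by blast
      qed (use r in auto)
    next
      case m
      show ?thesis
      proof (rule JI[OF fc, of "{s}"])
        fix W :: "'w ring" and j \<psi>'
        assume Q: "Q W j \<psi>'" and sub: "{s} \<subseteq> j ` carrier W"
        then obtain w where w: "s = j w" "w \<in> carrier W" by blast
        have "frag_of (\<phi> a \<otimes>\<^bsub>R\<^esub> r, w) - frag_of (r, \<psi>' a \<otimes>\<^bsub>W\<^esub> w) \<in> tensor_relations K R \<phi> W \<psi>'"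
          unfolding tensor_relations_def using m(2,3) w(2) by blast
        moreover have "pair_map id j (frag_of (\<phi> a \<otimes>\<^bsub>R\<^esub> r, w) - frag_of (r, \<psi>' a \<otimes>\<^bsub>W\<^esub> w)) = f"
          using ring_hom_mult[of j W K' "\<psi>' a" w] ring_hom_closed[of \<psi>' K W a] Q w m(1,2) by (simp add: Q_def)
        ultimately show "\<exists>f' \<in> tensor_ideal K R \<phi> W \<psi>'. pair_map id j f' = f"
          using idl(2)[OF Q] by blast
      qed (use m in auto)
    qed
  qed
  have "f \<in> J"
    using P.genideal_minimal[OF J, of "tensor_relations K R \<phi> K' \<psi>"] f rel unfolding tensor_ideal_def by blast
  then show ?thesis using JE(1) unfolding Q_def by blast
qed

lemma inj_on_tensor_endo_iff:
  assumes "sigma_algebra K \<sigma> R \<tau> \<phi>" "sigma_algebra K \<sigma> S \<tau>' \<psi>"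
  shows "inj_on (tensor_endo K R \<tau> \<phi> S \<tau>' \<psi>) (carrier (tensor K R \<phi> S \<psi>)) \<longleftrightarrow>
    (\<forall>f \<in> carrier (pair_ring R S). pair_map \<tau> \<tau>' f \<in> tensor_ideal K R \<phi> S \<psi> \<longrightarrow> f \<in> tensor_ideal K R \<phi> S \<psi>)"
    (is "?inj \<longleftrightarrow> ?ker")
proof -
  interpret R: sigma_algebra K \<sigma> R \<tau> \<phi> by fact
  interpret S: sigma_algebra K \<sigma> S \<tau>' \<psi> by fact
  let ?P = "pair_ring R S" and ?I = "tensor_ideal K R \<phi> S \<psi>" and ?t = "tensor_endo K R \<tau> \<phi> S \<tau>' \<psi>"
  note cr = R.R.is_cring S.R.is_cring and sm = R.structure_map S.structure_map
  interpret P: cring ?P by (rule pair_ring_cring[OF cr])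
  interpret I: ideal ?I ?P by (rule tensor_ideal(1)[OF cr sm])
  have map: "pair_map \<tau> \<tau>' \<in> ring_hom ?P ?P"
    by (rule pair_map_hom[OF R.endo S.endo])
  note t = tensor_endo_coset[OF assms]
  have car: "carrier (tensor K R \<phi> S \<psi>) = (\<lambda>f. ?I +>\<^bsub>?P\<^esub> f) ` carrier ?P"
    unfolding tensor_def FactRing_def A_RCOSETS_def' by auto
  have Pminus: "f \<ominus>\<^bsub>?P\<^esub> g = f - g" if "f \<in> carrier ?P" "g \<in> carrier ?P" for f g
  proof -
    have "\<ominus>\<^bsub>?P\<^esub> g = - g"
      by (rule P.minus_equality) (use that in \<open>simp_all add: pair_ring_simps pair_ring_carrier\<close>)
    then show ?thesis by (simp add: a_minus_def pair_ring_simps)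
  qed
  have eq: "?I +>\<^bsub>?P\<^esub> f = ?I +>\<^bsub>?P\<^esub> g \<longleftrightarrow> f - g \<in> ?I" if "f \<in> carrier ?P" "g \<in> carrier ?P" for f g
    using P.quotient_eq_iff_same_a_r_cos[OF I.ideal_axioms that] Pminus[OF that] by simp
  have sub: "f - g \<in> carrier ?P" if "f \<in> carrier ?P" "g \<in> carrier ?P" for f g
    using that by (simp add: pair_ring_carrier keys_diff_subset)
  have z: "0 \<in> carrier ?P" by (simp add: pair_ring_carrier)
  note mc = ring_hom_closed[OF map]
  show ?thesis
  proof
    assume inj: ?inj
    show ?ker
    proof (intro ballI impI)
      fix f assume f: "f \<in> carrier ?P" "pair_map \<tau> \<tau>' f \<in> ?I"
      then have "?t (?I +>\<^bsub>?P\<^esub> f) = ?t (?I +>\<^bsub>?P\<^esub> 0)"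
        using t[OF f(1)] t[OF z] eq[OF mc[OF f(1)] mc[OF z]] by simp
      then have "?I +>\<^bsub>?P\<^esub> f = ?I +>\<^bsub>?P\<^esub> 0"
        using inj_onD[OF inj] f(1) z unfolding car by blast
      then show "f \<in> ?I" using eq[OF f(1) z] by simp
    qed
  next
    assume ker: ?ker
    show ?inj unfolding car
    proof (rule inj_onI, elim imageE, hypsubst)
      fix f g assume "?t (?I +>\<^bsub>?P\<^esub> f) = ?t (?I +>\<^bsub>?P\<^esub> g)" and fg: "f \<in> carrier ?P" "g \<in> carrier ?P"
      then have "pair_map \<tau> \<tau>' (f - g) \<in> ?I"
        using t[OF fg(1)] t[OF fg(2)] eq[OF mc[OF fg(1)] mc[OF fg(2)]] by simp
      then show "?I +>\<^bsub>?P\<^esub> f = ?I +>\<^bsub>?P\<^esub> g"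
        using ker sub[OF fg] eq[OF fg] by blast
    qed
  qed
qed

lemma sigma_extension_imp_algebra:
  "sigma_extension K \<sigma> L \<tau> \<phi> \<Longrightarrow> sigma_algebra K \<sigma> L \<tau> \<phi>"
proof -
  assume "sigma_extension K \<sigma> L \<tau> \<phi>"
  then interpret sigma_extension K \<sigma> L \<tau> \<phi> .
  show ?thesis
    by (intro sigma_algebra.intro sigma_algebra_axioms.intro)
       (fact K.sigma_field_axioms L.is_cring L.endo structure_map equivariant)+
qed

text \<open>The \<open>\<sigma>\<close>-field extensions in \<open>sigma_separable\<close> may be taken on any type.\<close>

theorem sigma_separableD:
  fixes K :: "'k ring" and K' :: "'m ring"
  assumes "sigma_algebra K \<sigma> R \<tau> \<phi>" "sigma_separable K \<sigma> R \<tau> \<phi>"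
    and "sigma_extension K \<sigma> K' \<sigma>' \<psi>"
  shows "inj_on (tensor_endo K R \<tau> \<phi> K' \<sigma>' \<psi>) (carrier (tensor K R \<phi> K' \<psi>))"
proof -
  interpret R: sigma_algebra K \<sigma> R \<tau> \<phi> by fact
  interpret E: sigma_extension K \<sigma> K' \<sigma>' \<psi> by fact
  have "f \<in> tensor_ideal K R \<phi> K' \<psi>"
    if f: "f \<in> carrier (pair_ring R K')" and h: "pair_map \<tau> \<sigma>' f \<in> tensor_ideal K R \<phi> K' \<psi>" for f
  proof -
    obtain C where C: "finite C" "C \<subseteq> carrier K'" "\<forall>(W :: ('k + nat) list ring) j \<psi>'.
        cring W \<and> j \<in> ring_hom W K' \<and> \<psi>' \<in> ring_hom K W \<and>
        (\<forall>a \<in> carrier K. j (\<psi>' a) = \<psi> a) \<longrightarrow> C \<subseteq> j ` carrier W \<longrightarrow>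
        (\<exists>f' \<in> tensor_ideal K R \<phi> W \<psi>'. pair_map id j f' = pair_map \<tau> \<sigma>' f)"
      using tensor_ideal_local[OF R.R.is_cring E.L.is_cring R.structure_map E.structure_map h] by blast
    let ?D = "C \<union> snd ` Poly_Mapping.keys f"
    have D: "finite ?D" "?D \<subseteq> carrier K'"
      by (intro finite_UnI finite_imageI finite_keys C(1), rule Un_least[OF C(2) snd_keys[OF f]])
    from finite_list[OF D(1)] obtain xs where xs: "set xs = ?D" ..
    define g :: "'k + nat \<Rightarrow> 'm" where "g y = (case y of Inl a \<Rightarrow> \<psi> a | Inr n \<Rightarrow> xs ! n)" for y
    obtain W :: "('k + nat) list ring" and \<omega> j where W: "sigma_field W \<omega>" "j \<in> ring_hom W K'" "inj_on j (carrier W)"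
      "\<And>w. w \<in> carrier W \<Longrightarrow> j (\<omega> w) = \<sigma>' (j w)"
      "\<And>y. g y \<in> carrier K' \<Longrightarrow> g y \<in> j ` carrier W"
      by (rule sigma_field_words[OF E.L.sigma_field_axioms, of g]; rule that)
    interpret W: sigma_field W \<omega> by fact
    have im: "\<psi> ` carrier K \<subseteq> j ` carrier W"
      using W(5)[of "Inl _"] ring_hom_closed[OF E.structure_map] by (auto simp: g_def)
    have imD: "?D \<subseteq> j ` carrier W"
    proof
      fix x assume x: "x \<in> ?D"
      then obtain n where "xs ! n = x" unfolding xs[symmetric] in_set_conv_nth by blast
      then have "x = g (Inr n)" by (simp add: g_def)
      then show "x \<in> j ` carrier W" using W(5)[of "Inr n"] subsetD[OF D(2) x] by simp
    qed
    let ?\<psi> = "inv_into (carrier W) j \<circ> \<psi>"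
    note EW = sigma_extension_words[OF assms(3) W(1-4) im]
    note i = inj_hom_inv[OF W.ring_axioms W(2,3) E.structure_map im R.K.ring_axioms]
    obtain f' where f': "f' \<in> carrier (pair_ring R W)" "pair_map id j f' = f"
      using pair_map_id_lift[OF f, of j W] imD by (meson Un_subset_iff)
    obtain h' where h': "h' \<in> tensor_ideal K R \<phi> W ?\<psi>" "pair_map id j h' = pair_map \<tau> \<sigma>' f"
      using C(3)[THEN spec, THEN spec, THEN spec, of W j ?\<psi>] W.is_cring W(2) i imD
      by (meson Un_subset_iff)
    have AW: "sigma_algebra K \<sigma> W \<omega> ?\<psi>" by (rule sigma_extension_imp_algebra[OF EW])
    have h'c: "h' \<in> carrier (pair_ring R W)"
      using ideal.Icarr[OF tensor_ideal(1)[OF R.R.is_cring W.is_cring R.structure_map i(1)] h'(1)] .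
    have mc: "pair_map \<tau> \<omega> f' \<in> carrier (pair_ring R W)"
      using ring_hom_closed[OF pair_map_hom[OF R.endo W.endo] f'(1)] .
    have "pair_map id j (pair_map \<tau> \<omega> f') = pair_map \<tau> \<sigma>' (pair_map id j f')"
      unfolding pair_map_comp by (rule pair_map_cong[OF f'(1)]) (simp_all add: W(4))
    then have "pair_map \<tau> \<omega> f' = h'"
      using pair_map_id_inj[OF W(3) mc h'c] f'(2) h'(2) by simp
    then have "f' \<in> tensor_ideal K R \<phi> W ?\<psi>"
      using inj_on_tensor_endo_iff[OF assms(1) AW] assms(2) EW f'(1) h'(1)
      unfolding sigma_separable_def by blast
    moreover have "id \<in> ring_hom R R" by (simp add: ring_hom_def)
    ultimately have "pair_map id j f' \<in> tensor_ideal K R \<phi> K' \<psi>"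
      by (intro pair_map_ideal[where \<kappa> = "\<lambda>a. a", OF R.R.is_cring W.is_cring R.structure_map i(1)
            R.R.is_cring E.L.is_cring R.structure_map E.structure_map _ W(2)] i(2)) simp_all
    then show ?thesis using f'(2) by simp
  qed
  then show ?thesis
    using inj_on_tensor_endo_iff[OF assms(1) sigma_extension_imp_algebra[OF assms(3)]] by blast
qed

end

theory Submission
  imports Defs
begin

text \<open>
  Call an algebraic element \<open>x\<close> of \<open>L\<close> good if \<open>K(x) = K(\<tau> x)\<close> and \<open>K(x) = K(x\<^sup>q)\<close> for all powers \<open>q\<close>
  of the characteristic exponent. Then \<open>K(x)\<close> is strongly \<open>\<sigma>\<close>-etale, so a compatibility of the
  strong cores provides equivariant embeddings of all these \<open>K(x)\<close> into a \<open>\<sigma>\<close>-field \<open>N\<close>. It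
  suffices to amalgamate \<open>L\<close> with any such \<open>N\<close>; doing this for \<open>L\<close> and then for \<open>L'\<close> gives the claim.

  Extend the endomorphism of \<open>N\<close> to \<open>\<rho>\<close> on an algebraic closure \<open>\<Omega>\<close>. For algebraic \<open>b\<close> in \<open>L\<close>, the
  fields generated by \<open>\<tau>\<^sup>n b, \<tau>\<^sup>n\<^sup>+\<^sup>1 b, \<dots>\<close> decrease to a finite extension of \<open>K\<close>, which some power of
  \<open>\<tau>\<close> maps, up to \<open>q\<close>-th powers, into a \<open>K(x)\<close> with good \<open>x\<close>. This yields a homomorphism to \<open>\<Omega>\<close>
  that is equivariant on the limit field, and a Galois correction followed by a compactness argument
  makes it equivariant on all algebraic elements of \<open>L\<close>.

  Let \<open>E\<close> be the algebraic closure of \<open>K\<close> in an algebraic closure \<open>\<Lambda>\<close> of \<open>L\<close>. The endomorphisms of \<open>L\<close>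
  and of \<open>E\<close> (transported from \<open>\<Omega>\<close>) have a common extension \<open>w\<close> to \<open>\<Lambda>\<close>. Since \<open>E\<close> is
  algebraically closed, \<open>\<Omega>\<close> has a place over \<open>E\<close> with values in \<open>E\<close>, and reducing suitably scaled
  tensors by it shows that \<open>\<Lambda> \<otimes>\<^sub>E \<Omega>\<close> is a domain. The union of the kernels of all powers of
  \<open>w \<otimes> \<rho>\<close> is then a prime ideal, and the fraction field of the quotient is the amalgam.
\<close>

section \<open>Graphs of homomorphisms\<close>

text \<open>An algebraic element \<open>x\<close> of \<open>L\<close> may be inseparable over
  \<open>K\<close>, and \<open>\<tau> x\<close> may have smaller degree than \<open>x\<close>; such
  elements need not lie in the strong core. This is why the core is reached only after a power of
  \<tau> and a \<open>q\<close>-th power. Both are undone in \<Omega>: \<open>q\<close>-th powers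
  are injective on a field, and \<rho>, though perhaps not surjective, can be inverted at all values
  that occur, because the polynomials satisfied by them split over its image.

  Algebraic closures enter because a tensor product of fields over \<open>K\<close> may have zero
  divisors. The kernels of the powers of \<open>w \<otimes> \<rho>\<close> enter because
  \<open>w\<close> may carry elements transcendental over \<open>E\<close> into \<open>E\<close>, so
  that \<open>w \<otimes> \<rho>\<close> need not be injective.

  Places take over the role of automorphism groups. A homomorphism from a subring to an
  algebraically closed field extends to a valuation ring, which contains every element algebraic
  over a subfield of that subring; conjugates are then values of places. Homomorphisms are handled
  as graphs, so that extending one means adjoining a pair to a subring of a product.\<close>

lemma (in cring) simple_extension_subring:
  assumes "subring K R" "x \<in> carrier R"
  shows "subring (simple_extension K x) R"
proof (rule subringI)
  note K = subringE[OF assms(1)]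
  let ?E = "simple_extension K x"
  show EC: "?E \<subseteq> carrier R" by (rule simple_extension_in_carrier[OF K(1) assms(2)])
  have KE: "K \<subseteq> ?E" by (rule simple_extension_incl[OF K(1) assms(2)])
  then show "\<one> \<in> ?E" using K(3) by blast
  show add: "a \<oplus> b \<in> ?E" if "a \<in> ?E" "b \<in> ?E" for a b
    using that
  proof (induction arbitrary: b rule: simple_extension.induct)
    case zero then show ?case using EC by (simp add: subset_iff)
  next
    case (lin k1 k2)
    note c = subsetD[OF EC] subsetD[OF K(1)]
    from lin.prems show ?case
    proof (cases rule: simple_extension.cases)
      case zero
      then show ?thesis using lin simple_extension.lin[OF lin(1,2)] c assms(2) by simp
    next
      case (lin l1 l2)
      have "k1 \<otimes> x \<oplus> k2 \<oplus> b = (k1 \<oplus> l1) \<otimes> x \<oplus> (k2 \<oplus> l2)"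
        using lin \<open>k1 \<in> ?E\<close> \<open>k2 \<in> K\<close> c assms(2) by (simp add: l_distr a_ac)
      then show ?thesis
        using simple_extension.lin[of "k1 \<oplus> l1" K x "k2 \<oplus> l2"] lin.IH[OF lin(2)] K(7) lin(3) \<open>k2 \<in> K\<close>
        by simp
    qed
  qed
  have mx: "a \<otimes> x \<in> ?E" if "a \<in> ?E" for a
    using simple_extension.lin[OF that K(2)] EC that assms(2) by (simp add: subset_iff)
  have mk: "k \<otimes> a \<in> ?E" if "a \<in> ?E" "k \<in> K" for a k
    using that
  proof (induction rule: simple_extension.induct)
    case zero then show ?case using K(1) by (simp add: subset_iff)
  next
    case (lin k1 k2)
    have "k \<otimes> (k1 \<otimes> x \<oplus> k2) = (k \<otimes> k1) \<otimes> x \<oplus> k \<otimes> k2"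
      using lin subsetD[OF EC] subsetD[OF K(1)] assms(2) by (simp add: r_distr m_ac)
    then show ?case using lin simple_extension.lin[of "k \<otimes> k1" K x "k \<otimes> k2"] K(6) by simp
  qed
  \<comment> \<open>Products are reduced to multiplication by \<open>x\<close> and by elements of
    \<open>K\<close>, without division: the lemma is applied to subrings of the product ring of
    \<open>ring_pair\<close>, which has zero divisors.\<close>
  show mult: "a \<otimes> b \<in> ?E" if "a \<in> ?E" "b \<in> ?E" for a b
    using that
  proof (induction rule: simple_extension.induct)
    case zero then show ?case using EC by (simp add: subset_iff)
  next
    case (lin k1 k2)
    have "(k1 \<otimes> x \<oplus> k2) \<otimes> b = (k1 \<otimes> b) \<otimes> x \<oplus> k2 \<otimes> b"
    proof -
      have "k1 \<in> carrier R" "k2 \<in> carrier R" "b \<in> carrier R"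
        using lin EC K(1) by blast+
      then show ?thesis using assms(2) by algebra
    qed
    then show ?case using add[OF mx[of "k1 \<otimes> b"] mk[of b k2]] lin by simp
  qed
  show "\<ominus> a \<in> ?E" if "a \<in> ?E" for a
  proof -
    have "\<ominus> \<one> \<otimes> a \<in> ?E" using mk[OF that] K(3,5) by blast
    then show ?thesis using that EC by (simp add: l_minus subset_iff)
  qed
qed

lemma (in ring) mem_simple_extension_iff:
  assumes "K \<subseteq> carrier R" "x \<in> carrier R"
  shows "z \<in> simple_extension K x \<longleftrightarrow> (\<exists>p. set p \<subseteq> K \<and> z = eval p x)"
proof
  assume "z \<in> simple_extension K x"
  then obtain p where "p \<in> carrier (K[X])" "z = eval p x"
    unfolding simple_extension_as_eval_img[OF assms] by (elim imageE)
  then show "\<exists>p. set p \<subseteq> K \<and> z = eval p x"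
    using polynomial_incl[of K p] univ_poly_carrier[of R K p] by (intro exI[of _ p]) simp
next
  assume "\<exists>p. set p \<subseteq> K \<and> z = eval p x"
  then obtain p where p: "set p \<subseteq> K" "z = eval p x" by (elim exE conjE)
  then have "z = eval (normalize p) x" using eval_normalize[of p x] assms by simp
  moreover have "normalize p \<in> carrier (K[X])"
    using normalize_gives_polynomial[OF p(1)] univ_poly_carrier[of R K] by simp
  ultimately show "z \<in> simple_extension K x"
    unfolding simple_extension_as_eval_img[OF assms] by (rule image_eqI)
qed

lemma RDirProd_sel:
  "carrier (RDirProd R S) = carrier R \<times> carrier S"
  "x \<otimes>\<^bsub>RDirProd R S\<^esub> y = (fst x \<otimes>\<^bsub>R\<^esub> fst y, snd x \<otimes>\<^bsub>S\<^esub> snd y)"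
  "x \<oplus>\<^bsub>RDirProd R S\<^esub> y = (fst x \<oplus>\<^bsub>R\<^esub> fst y, snd x \<oplus>\<^bsub>S\<^esub> snd y)"
  "\<one>\<^bsub>RDirProd R S\<^esub> = (\<one>\<^bsub>R\<^esub>, \<one>\<^bsub>S\<^esub>)" "\<zero>\<^bsub>RDirProd R S\<^esub> = (\<zero>\<^bsub>R\<^esub>, \<zero>\<^bsub>S\<^esub>)"
  by (simp_all add: RDirProd_def DirProd_def monoid.defs case_prod_unfold)

lemma RDirProd_cring:
  assumes "cring R" "cring S" shows "cring (RDirProd R S)"
proof -
  interpret R: cring R by fact
  interpret S: cring S by fact
  interpret P: ring "RDirProd R S" by (rule RDirProd_ring[OF R.ring_axioms S.ring_axioms])
  show ?thesis by unfold_locales (auto simp: RDirProd_sel R.m_comm S.m_comm)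
qed

text \<open>
  A ring homomorphism from a subring of \<open>F\<close> to \<open>S\<close> is encoded by its graph, a subring of \<open>F \<times> S\<close>.
\<close>

definition hom_graph :: "'f ring \<Rightarrow> 's ring \<Rightarrow> ('f \<times> 's) set \<Rightarrow> bool"
  where "hom_graph F S G \<longleftrightarrow>
    subring G (RDirProd F S) \<and> (\<forall>b. (\<zero>\<^bsub>F\<^esub>, b) \<in> G \<longrightarrow> b = \<zero>\<^bsub>S\<^esub>)"

locale ring_pair = F: cring F + S: cring S for F :: "'f ring" and S :: "'s ring"
begin

abbreviation prd where "prd \<equiv> RDirProd F S"

sublocale P: cring prd
  by (rule RDirProd_cring[OF F.is_cring S.is_cring])

lemma fst_hom: "ring_hom_ring prd F fst" and snd_hom: "ring_hom_ring prd S snd"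
  by (intro ring_hom_ringI P.ring_axioms F.ring_axioms S.ring_axioms; auto simp: RDirProd_sel)+

sublocale f: ring_hom_ring prd F fst by (rule fst_hom)
sublocale s: ring_hom_ring prd S snd by (rule snd_hom)

lemma hom_graph_minus:
  assumes "(a, b) \<in> carrier prd" shows "\<ominus>\<^bsub>prd\<^esub> (a, b) = (\<ominus>\<^bsub>F\<^esub> a, \<ominus>\<^bsub>S\<^esub> b)"
  using f.hom_a_inv[OF assms] s.hom_a_inv[OF assms] by (intro prod_eqI) simp_all

lemma hom_graphD:
  assumes "hom_graph F S G"
  shows "subring G prd" "(\<zero>\<^bsub>F\<^esub>, b) \<in> G \<Longrightarrow> b = \<zero>\<^bsub>S\<^esub>" "G \<subseteq> carrier F \<times> carrier S"
  using assms subringE(1)[of G prd] by (auto simp: hom_graph_def RDirProd_sel)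

lemma hom_graph_unique:
  assumes "hom_graph F S G" "(a, b) \<in> G" "(a, c) \<in> G"
  shows "b = c"
proof -
  note G = hom_graphD[OF assms(1)]
  have c: "a \<in> carrier F" "b \<in> carrier S" "c \<in> carrier S" using G(3) assms(2,3) by auto
  have "(a, b) \<oplus>\<^bsub>prd\<^esub> (\<ominus>\<^bsub>prd\<^esub> (a, c)) \<in> G" using subringE(5,7)[OF G(1)] assms by blast
  then have "(\<zero>\<^bsub>F\<^esub>, b \<oplus>\<^bsub>S\<^esub> \<ominus>\<^bsub>S\<^esub> c) \<in> G"
    using c hom_graph_minus[of a c] by (simp add: RDirProd_sel F.r_neg)
  from G(2)[OF this] show ?thesis using c S.r_right_minus_eq[of b c] by (simp add: a_minus_def)
qed

lemma hom_graph_hom: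
  assumes "hom_graph F S G"
  shows "\<exists>R \<phi>. R = fst ` G \<and> subring R F \<and> \<phi> \<in> ring_hom (F\<lparr>carrier := R\<rparr>) S \<and> (\<forall>a b. (a, b) \<in> G \<longleftrightarrow> a \<in> R \<and> \<phi> a = b)"
proof -
  note G = hom_graphD[OF assms] and u = hom_graph_unique[OF assms]
  define \<phi> where "\<phi> a = (THE b. (a, b) \<in> G)" for a
  have \<phi>: "\<phi> a = b" if "(a, b) \<in> G" for a b
    unfolding \<phi>_def using that u by blast
  have \<phi>': "(a, \<phi> a) \<in> G" if "a \<in> fst ` G" for a
    using that \<phi> by force
  have iff: "(a, b) \<in> G \<longleftrightarrow> a \<in> fst ` G \<and> \<phi> a = b" for a b
    using \<phi> \<phi>' by force
  have "subring (fst ` G) F" by (rule f.img_is_subring[OF G(1)])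
  moreover have "\<phi> \<in> ring_hom (F\<lparr>carrier := fst ` G\<rparr>) S"
  proof (rule ring_hom_memI)
    fix x y assume x: "x \<in> carrier (F\<lparr>carrier := fst ` G\<rparr>)" and y: "y \<in> carrier (F\<lparr>carrier := fst ` G\<rparr>)"
    have xy: "(x, \<phi> x) \<in> G" "(y, \<phi> y) \<in> G" using \<phi>' x y by auto
    show "\<phi> x \<in> carrier S" using xy G(3) by auto
    show "\<phi> (x \<otimes>\<^bsub>F\<lparr>carrier := fst ` G\<rparr>\<^esub> y) = \<phi> x \<otimes>\<^bsub>S\<^esub> \<phi> y"
      using subringE(6)[OF G(1) xy] by (intro \<phi>) (simp add: RDirProd_sel)
    show "\<phi> (x \<oplus>\<^bsub>F\<lparr>carrier := fst ` G\<rparr>\<^esub> y) = \<phi> x \<oplus>\<^bsub>S\<^esub> \<phi> y"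
      using subringE(7)[OF G(1) xy] by (intro \<phi>) (simp add: RDirProd_sel)
  next
    show "\<phi> \<one>\<^bsub>F\<lparr>carrier := fst ` G\<rparr>\<^esub> = \<one>\<^bsub>S\<^esub>"
      using subringE(3)[OF G(1)] by (intro \<phi>) (simp add: RDirProd_sel)
  qed
  ultimately show ?thesis using iff by blast
qed

lemma graph_of_hom:
  assumes k: "subring k F" and h: "h \<in> ring_hom (F\<lparr>carrier := k\<rparr>) S"
  shows "hom_graph F S ((\<lambda>a. (a, h a)) ` k)"
proof -
  note K = subringE[OF k]
  note hm = ring_hom_memE[OF h, simplified]
  interpret k: ring "F\<lparr>carrier := k\<rparr>" by (rule F.subring_is_ring[OF k])
  interpret h: ring_hom_ring "F\<lparr>carrier := k\<rparr>" S h
    by (rule ring_hom_ringI2[OF k.ring_axioms S.ring_axioms h])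
  have z: "h \<zero>\<^bsub>F\<^esub> = \<zero>\<^bsub>S\<^esub>" using h.hom_zero by simp
  have neg: "h (\<ominus>\<^bsub>F\<^esub> a) = \<ominus>\<^bsub>S\<^esub> h a" if "a \<in> k" for a
  proof -
    have "h (\<ominus>\<^bsub>F\<^esub> a) \<oplus>\<^bsub>S\<^esub> h a = \<zero>\<^bsub>S\<^esub>"
      using hm(3)[OF K(5)[OF that] that] that K(1) z by (simp add: F.l_neg subset_iff)
    then show ?thesis using hm(1) that K(5) S.minus_equality by metis
  qed
  have "subring ((\<lambda>a. (a, h a)) ` k) prd"
    
  proof (rule P.subringI)
    fix x y assume "x \<in> (\<lambda>a. (a, h a)) ` k" "y \<in> (\<lambda>a. (a, h a)) ` k"
    then show "x \<otimes>\<^bsub>prd\<^esub> y \<in> (\<lambda>a. (a, h a)) ` k" "x \<oplus>\<^bsub>prd\<^esub> y \<in> (\<lambda>a. (a, h a)) ` k"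
      using K(6,7) hm(2,3)[symmetric] by (auto simp: RDirProd_sel)
  next
    fix x assume "x \<in> (\<lambda>a. (a, h a)) ` k"
    then obtain a where a: "a \<in> k" "x = (a, h a)" by blast
    then have "\<ominus>\<^bsub>prd\<^esub> x = (\<ominus>\<^bsub>F\<^esub> a, h (\<ominus>\<^bsub>F\<^esub> a))"
      using hom_graph_minus[of a "h a"] neg K(1) hm(1) by (auto simp: RDirProd_sel)
    then show "\<ominus>\<^bsub>prd\<^esub> x \<in> (\<lambda>a. (a, h a)) ` k" using K(5) a(1) by simp
  next
    show "(\<lambda>a. (a, h a)) ` k \<subseteq> carrier prd" using K(1) hm(1) by (auto simp: RDirProd_sel)
    show "\<one>\<^bsub>prd\<^esub> \<in> (\<lambda>a. (a, h a)) ` k" using K(3) hm(4) by (auto simp: RDirProd_sel)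
  qed
  then show ?thesis unfolding hom_graph_def using z by auto
qed

text \<open>Any two elements of the union of a chain lie in one member, so the union of a chain of
  graphs is a graph and Zorn's lemma applies.\<close>

lemma hom_graph_maximal:
  assumes "hom_graph F S G0"
  obtains G where "hom_graph F S G" "G0 \<subseteq> G" "\<And>H. hom_graph F S H \<Longrightarrow> G \<subseteq> H \<Longrightarrow> H = G"
proof -
  let ?A = "{G. hom_graph F S G \<and> G0 \<subseteq> G}"
  have "\<exists>M \<in> ?A. \<forall>Z \<in> ?A. M \<subseteq> Z \<longrightarrow> Z = M"
  proof (rule subset_Zorn_nonempty)
    show "?A \<noteq> {}" using assms by blast
    fix C assume C: "C \<noteq> {}" "subset.chain ?A C"
    have CA: "C \<subseteq> ?A" and tot: "\<And>Z Y. Z \<in> C \<Longrightarrow> Y \<in> C \<Longrightarrow> Z \<subseteq> Y \<or> Y \<subseteq> Z"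
      using C(2) by (auto simp: subset_chain_def)
    have sr: "subring Z prd" if "Z \<in> C" for Z using that CA hom_graphD(1) by blast
    obtain Z0 where Z0: "Z0 \<in> C" using C(1) by blast
    have two: "\<exists>Z \<in> C. x \<in> Z \<and> y \<in> Z" if "x \<in> \<Union>C" "y \<in> \<Union>C" for x y
    proof -
      obtain Z Y where "Z \<in> C" "x \<in> Z" "Y \<in> C" "y \<in> Y" using \<open>x \<in> \<Union>C\<close> \<open>y \<in> \<Union>C\<close> by blast
      then show ?thesis using tot[of Z Y] by blast
    qed
    have "subring (\<Union>C) prd"
    proof (rule P.subringI)
      show "\<Union>C \<subseteq> carrier prd" using subringE(1)[OF sr] by blast
      show "\<one>\<^bsub>prd\<^esub> \<in> \<Union>C" using subringE(3)[OF sr[OF Z0]] Z0 by blast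
      show "\<ominus>\<^bsub>prd\<^esub> h \<in> \<Union>C" if "h \<in> \<Union>C" for h using that subringE(5)[OF sr] by blast
      show "h1 \<otimes>\<^bsub>prd\<^esub> h2 \<in> \<Union>C" if "h1 \<in> \<Union>C" "h2 \<in> \<Union>C" for h1 h2
        using two[OF that] subringE(6)[OF sr] by blast
      show "h1 \<oplus>\<^bsub>prd\<^esub> h2 \<in> \<Union>C" if "h1 \<in> \<Union>C" "h2 \<in> \<Union>C" for h1 h2
        using two[OF that] subringE(7)[OF sr] by blast
    qed
    moreover have "b = \<zero>\<^bsub>S\<^esub>" if "(\<zero>\<^bsub>F\<^esub>, b) \<in> \<Union>C" for b
      using that CA hom_graphD(2) by blast
    ultimately show "\<Union>C \<in> ?A" using Z0 CA unfolding hom_graph_def by blast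
  qed
  then obtain M where M: "hom_graph F S M" "G0 \<subseteq> M" "\<forall>Z \<in> ?A. M \<subseteq> Z \<longrightarrow> Z = M" by blast
  from M(1,2) show ?thesis by (rule that) (use M in blast)
qed

text \<open>An element of the extended ring is the value at \<open>(x, \<xi>)\<close> of a
  coefficient list over \<open>G\<close>, and both projections commute with evaluation. So
  \<open>rel\<close> is exactly the requirement that the extended relation remain
  single-valued.\<close>

lemma hom_graph_adjoin:
  assumes G: "hom_graph F S G" and x: "x \<in> carrier F" "\<xi> \<in> carrier S"
    and rel: "\<And>p. set p \<subseteq> G \<Longrightarrow> F.eval (map fst p) x = \<zero>\<^bsub>F\<^esub> \<Longrightarrow> S.eval (map snd p) \<xi> = \<zero>\<^bsub>S\<^esub>"
  shows "hom_graph F S (P.simple_extension G (x, \<xi>))" "G \<subseteq> P.simple_extension G (x, \<xi>)"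
    "(x, \<xi>) \<in> P.simple_extension G (x, \<xi>)"
proof -
  have c: "(x, \<xi>) \<in> carrier prd" using x by (simp add: RDirProd_sel)
  note sr = hom_graphD(1)[OF G] and GC = subringE(1)[OF hom_graphD(1)[OF G]]
  show "G \<subseteq> P.simple_extension G (x, \<xi>)" by (rule P.simple_extension_incl[OF GC c])
  show "(x, \<xi>) \<in> P.simple_extension G (x, \<xi>)" by (rule P.simple_extension_mem[OF sr c])
  have "b = \<zero>\<^bsub>S\<^esub>" if b: "(\<zero>\<^bsub>F\<^esub>, b) \<in> P.simple_extension G (x, \<xi>)" for b
  proof -
    from b obtain p where p: "set p \<subseteq> G" "(\<zero>\<^bsub>F\<^esub>, b) = P.eval p (x, \<xi>)"
      unfolding P.mem_simple_extension_iff[OF GC c] by (elim exE conjE)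
    have pc: "set p \<subseteq> carrier prd" using p(1) GC by blast
    have "F.eval (map fst p) x = \<zero>\<^bsub>F\<^esub>" using f.eval_hom'[OF c pc] p(2)[symmetric] by simp
    from rel[OF p(1) this] show ?thesis using s.eval_hom'[OF c pc] p(2)[symmetric] by simp
  qed
  then show "hom_graph F S (P.simple_extension G (x, \<xi>))"
    unfolding hom_graph_def using P.simple_extension_subring[OF sr c] by blast
qed

end

section \<open>Chevalley extension of homomorphisms to algebraically closed fields\<close>

lemma (in cring) eval_map2_minus:
  assumes "length p = length q" "set p \<subseteq> carrier R" "set q \<subseteq> carrier R" "h \<in> carrier R" "y \<in> carrier R"
  shows "eval (map2 (\<lambda>a b. a \<ominus> h \<otimes> b) p q) y = eval p y \<ominus> h \<otimes> eval q y"
  using assms(1-3)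
proof (induction p q rule: list_induct2)
  case Nil then show ?case using assms by (simp add: a_minus_def)
next
  case (Cons a p b q)
  have c: "a \<in> carrier R" "b \<in> carrier R" "eval p y \<in> carrier R" "eval q y \<in> carrier R"
    "y [^] length q \<in> carrier R"
    using Cons.prems assms(5) eval_in_carrier by auto
  have "eval (map2 (\<lambda>a b. a \<ominus> h \<otimes> b) (a # p) (b # q)) y =
      (a \<ominus> h \<otimes> b) \<otimes> y [^] length q \<oplus> (eval p y \<ominus> h \<otimes> eval q y)"
    using Cons by simp
  also have "\<dots> = (a \<otimes> y [^] length q \<oplus> eval p y) \<ominus> h \<otimes> (b \<otimes> y [^] length q \<oplus> eval q y)"
    using c assms(4) by algebra
  finally show ?case using Cons.hyps by simp
qed

lemma (in ring) eval_replicate_zero: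
  "y \<in> carrier R \<Longrightarrow> eval (replicate k \<zero>) y = \<zero>"
  by (induction k) simp_all

text \<open>One step of division by the monic polynomial \<open>\<one> # m\<close>, on lists of
  fixed length: subtracting \<open>h\<close> times its shift by \<open>k\<close> cancels the leading
  entry \<open>h\<close>, which is dropped, while other entries are allowed to become zero.\<close>

lemma (in cring) eval_reduce:
  assumes "length m + k = length d" "set d \<subseteq> carrier R" "set m \<subseteq> carrier R" "h \<in> carrier R" "y \<in> carrier R"
  shows "eval (map2 (\<lambda>a b. a \<ominus> h \<otimes> b) d (m @ replicate k \<zero>)) y =
    eval (h # d) y \<ominus> h \<otimes> (y [^] k \<otimes> eval (\<one> # m) y)"
proof -
  have c: "eval m y \<in> carrier R" "eval d y \<in> carrier R" using assms eval_in_carrier by auto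
  have "eval (m @ replicate k \<zero>) y = eval m y \<otimes> y [^] k"
    using eval_append[of m "replicate k \<zero>" y] assms eval_replicate_zero c by (simp add: set_replicate_conv_if)
  moreover have "set (m @ replicate k \<zero>) \<subseteq> carrier R" using assms(3) by (auto simp: set_replicate_conv_if)
  ultimately have "eval (map2 (\<lambda>a b. a \<ominus> h \<otimes> b) d (m @ replicate k \<zero>)) y =
      eval d y \<ominus> h \<otimes> (eval m y \<otimes> y [^] k)"
    using eval_map2_minus[of d "m @ replicate k \<zero>" h y] assms by simp
  also have "\<dots> = (h \<otimes> (y [^] k \<otimes> y [^] length m) \<oplus> eval d y) \<ominus> h \<otimes> (y [^] k \<otimes> (\<one> \<otimes> y [^] length m \<oplus> eval m y))"
  proof -
    have "y [^] k \<in> carrier R" "y [^] length m \<in> carrier R" using assms(5) by auto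
    then show ?thesis using c assms(4) by algebra
  qed
  also have "y [^] k \<otimes> y [^] length m = y [^] length d"
    using assms(1,5) by (simp add: nat_pow_mult add.commute)
  finally show ?thesis by simp
qed

text \<open>The reciprocal polynomial: a relation for \<open>y = 1/x\<close> becomes one for
  \<open>x\<close> with the coefficients in reverse order. The exponent is the length and not the
  degree, whence the extra factor \<open>x\<close>.\<close>

lemma (in cring) eval_rev:
  assumes "set p \<subseteq> carrier R" "x \<in> carrier R" "y \<in> carrier R" "x \<otimes> y = \<one>"
  shows "eval p y \<otimes> x [^] length p = x \<otimes> eval (rev p) x"
  using assms(1)
proof (induction p)
  case Nil then show ?case using assms by simp
next
  case (Cons c p)
  have cc: "c \<in> carrier R" "eval p y \<in> carrier R" "eval (rev p) x \<in> carrier R"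
    "x [^] length p \<in> carrier R" "y [^] length p \<in> carrier R"
    using Cons.prems assms eval_in_carrier by auto
  have xy: "y [^] length p \<otimes> x [^] length p = \<one>"
    using assms nat_pow_distrib[of y x "length p"] by (simp add: m_comm)
  have "eval (c # p) y \<otimes> x [^] length (c # p) =
      c \<otimes> (y [^] length p \<otimes> x [^] length p) \<otimes> x \<oplus> (eval p y \<otimes> x [^] length p) \<otimes> x"
    using cc assms(2) by (simp, algebra)
  also have "\<dots> = x \<otimes> (eval (rev p) x \<otimes> x \<oplus> c)"
    unfolding xy using Cons cc assms(2) by (simp, algebra)
  also have "\<dots> = x \<otimes> eval (rev (c # p)) x"
    using eval_append_aux[of "rev p" c x] Cons.prems assms(2) by simp
  finally show ?case .
qed

lemma (in cring) eval_scale: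
  assumes "set p \<subseteq> carrier R" "c \<in> carrier R" "y \<in> carrier R"
  shows "eval (map (\<lambda>a. c \<otimes> a) p) y = c \<otimes> eval p y"
  using assms
proof (induction p)
  case (Cons a p)
  have "a \<in> carrier R" "eval p y \<in> carrier R" "y [^] length p \<in> carrier R"
    using Cons.prems eval_in_carrier by auto
  then show ?case using Cons by (simp, algebra)
qed simp

context algebraically_closed
begin

lemma root_exists:
  assumes "q \<in> carrier (poly_ring L)" "length q > 1"
  obtains \<xi> where "\<xi> \<in> carrier L" "eval q \<xi> = \<zero>"
proof -
  have "size (roots q) > 0" using roots_over_carrier[OF assms(1)] assms(2) unfolding splitted_def by simp
  then obtain a where "a \<in># roots q" using size_eq_0_iff_empty multiset_nonemptyE by (metis less_irrefl)
  then show ?thesis using that roots_mem_iff_is_root[OF assms(1)] is_root_def by blast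
qed

end

section \<open>The valuation ring of a maximal graph\<close>

locale field_pair = F: field F + S: algebraically_closed S for F :: "'f ring" and S :: "'s ring"
begin

sublocale ring_pair F S by unfold_locales

context
  fixes G
  assumes G: "hom_graph F S G" and max: "\<And>H. hom_graph F S H \<Longrightarrow> G \<subseteq> H \<Longrightarrow> H = G"
begin

lemma max_adjoin:
  assumes x: "x \<in> carrier F" "\<xi> \<in> carrier S"
    and rel: "\<And>p. set p \<subseteq> G \<Longrightarrow> F.eval (map fst p) x = \<zero>\<^bsub>F\<^esub> \<Longrightarrow> S.eval (map snd p) \<xi> = \<zero>\<^bsub>S\<^esub>"
  shows "(x, \<xi>) \<in> G"
  using hom_graph_adjoin[OF G x rel] max by blast

text \<open>The pair of inverses can be adjoined to \<open>G\<close>: a power of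
  \<open>(a, b)\<close> clears the denominators of any relation and leads back to \<open>G\<close>,
  where first coordinate \<open>\<zero>\<close> forces second coordinate \<open>\<zero>\<close>, and
  the power of \<open>b\<close> cancels in the field \<open>S\<close>. By maximality the pair
  already lies in \<open>G\<close>, so elements of nonzero residue are units.\<close>

lemma max_inv:
  assumes ab: "(a, b) \<in> G" "b \<noteq> \<zero>\<^bsub>S\<^esub>"
  shows "a \<noteq> \<zero>\<^bsub>F\<^esub>" "(inv\<^bsub>F\<^esub> a, inv\<^bsub>S\<^esub> b) \<in> G"
proof -
  note sr = hom_graphD(1)[OF G] note GC = subringE(1)[OF sr]
  show a: "a \<noteq> \<zero>\<^bsub>F\<^esub>" using hom_graphD(2)[OF G] ab by blast
  have abc: "a \<in> carrier F" "b \<in> carrier S" "(a, b) \<in> carrier prd" using GC ab(1) by (auto simp: RDirProd_sel)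
  have i: "inv\<^bsub>F\<^esub> a \<in> carrier F" "inv\<^bsub>S\<^esub> b \<in> carrier S" "inv\<^bsub>F\<^esub> a \<otimes>\<^bsub>F\<^esub> a = \<one>\<^bsub>F\<^esub>" "inv\<^bsub>S\<^esub> b \<otimes>\<^bsub>S\<^esub> b = \<one>\<^bsub>S\<^esub>"
    using a ab(2) abc F.field_Units S.field_Units by auto
  let ?x = "(inv\<^bsub>F\<^esub> a, inv\<^bsub>S\<^esub> b)"
  have xc: "?x \<in> carrier prd" using i by (simp add: RDirProd_sel)
  have xa: "?x \<otimes>\<^bsub>prd\<^esub> (a, b) = \<one>\<^bsub>prd\<^esub>" using i by (simp add: RDirProd_sel)
  have pw: "(a, b) [^]\<^bsub>prd\<^esub> n \<in> G" for n :: nat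
    by (induction n) (use subringE(3,6)[OF sr] ab(1) in auto)
  have cl: "\<exists>n::nat. z \<otimes>\<^bsub>prd\<^esub> (a, b) [^]\<^bsub>prd\<^esub> n \<in> G" if "z \<in> P.simple_extension G ?x" for z
    using that
  proof (induction rule: P.simple_extension.induct)
    case zero then show ?case using abc subringE(2)[OF sr] by (auto intro!: exI[of _ "0::nat"])
  next
    case (lin k1 k2)
    then obtain n :: nat where n: "k1 \<otimes>\<^bsub>prd\<^esub> (a, b) [^]\<^bsub>prd\<^esub> n \<in> G" by (elim exE)
    have k: "k1 \<in> carrier prd" "k2 \<in> carrier prd" "(a, b) [^]\<^bsub>prd\<^esub> n \<in> carrier prd"
      using lin(1,2) P.simple_extension_in_carrier[OF GC xc] GC abc(3) P.nat_pow_closed by (blast, blast, blast)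
    have "(k1 \<otimes>\<^bsub>prd\<^esub> ?x \<oplus>\<^bsub>prd\<^esub> k2) \<otimes>\<^bsub>prd\<^esub> ((a, b) [^]\<^bsub>prd\<^esub> n \<otimes>\<^bsub>prd\<^esub> (a, b)) =
      k1 \<otimes>\<^bsub>prd\<^esub> (a, b) [^]\<^bsub>prd\<^esub> n \<otimes>\<^bsub>prd\<^esub> (?x \<otimes>\<^bsub>prd\<^esub> (a, b)) \<oplus>\<^bsub>prd\<^esub> k2 \<otimes>\<^bsub>prd\<^esub> ((a, b) [^]\<^bsub>prd\<^esub> n \<otimes>\<^bsub>prd\<^esub> (a, b))"
      using k xc abc(3) by algebra
    also have "\<dots> \<in> G"
      unfolding xa using n pw[of "Suc n"] subringE(6,7)[OF sr] lin(2) k P.r_one[of "k1 \<otimes>\<^bsub>prd\<^esub> (a, b) [^]\<^bsub>prd\<^esub> n"] by auto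
    finally show ?case by (intro exI[of _ "Suc n"]) simp
  qed
  show "?x \<in> G"
  proof (rule max_adjoin[OF i(1,2)])
    fix p assume p: "set p \<subseteq> G" "F.eval (map fst p) (inv\<^bsub>F\<^esub> a) = \<zero>\<^bsub>F\<^esub>"
    have pc: "set p \<subseteq> carrier prd" using p(1) GC by blast
    let ?z = "P.eval p ?x"
    have "?z \<in> P.simple_extension G ?x"
      unfolding P.mem_simple_extension_iff[OF GC xc] using p(1) by blast
    then obtain n :: nat where n: "?z \<otimes>\<^bsub>prd\<^esub> (a, b) [^]\<^bsub>prd\<^esub> n \<in> G" using cl by blast
    have zf: "fst ?z = \<zero>\<^bsub>F\<^esub>" and zs: "snd ?z = S.eval (map snd p) (inv\<^bsub>S\<^esub> b)"
      using f.eval_hom'[OF xc pc] s.eval_hom'[OF xc pc] p(2) by simp_all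
    have zc: "snd ?z \<in> carrier S" using P.eval_in_carrier[OF pc xc] by (auto simp: RDirProd_sel)
    have "?z \<otimes>\<^bsub>prd\<^esub> (a, b) [^]\<^bsub>prd\<^esub> n = (\<zero>\<^bsub>F\<^esub>, snd ?z \<otimes>\<^bsub>S\<^esub> b [^]\<^bsub>S\<^esub> n)"
      using zf f.hom_nat_pow[OF abc(3)] s.hom_nat_pow[OF abc(3)] abc by (simp add: RDirProd_sel)
    then have "snd ?z \<otimes>\<^bsub>S\<^esub> b [^]\<^bsub>S\<^esub> n = \<zero>\<^bsub>S\<^esub>" using n hom_graphD(2)[OF G] by simp
    moreover have "b [^]\<^bsub>S\<^esub> n \<noteq> \<zero>\<^bsub>S\<^esub>" 
      by (induction n) (use ab(2) abc(2) S.integral_iff in auto)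
    ultimately show "S.eval (map snd p) (inv\<^bsub>S\<^esub> b) = \<zero>\<^bsub>S\<^esub>"
      using S.integral[of "snd ?z"] zc zs abc(2) by auto
  qed
qed

text \<open>Provides division with remainder over the residue field in
  \<open>relation_A\<close>.\<close>

lemma image_subfield: "subfield (snd ` G) S"
proof (rule S.subfieldI')
  show "subring (snd ` G) S" by (rule s.img_is_subring[OF hom_graphD(1)[OF G]])
  show "inv\<^bsub>S\<^esub> k \<in> snd ` G" if "k \<in> snd ` G - {\<zero>\<^bsub>S\<^esub>}" for k
    using that max_inv(2) by force
qed

text \<open>Since no pair \<open>(x, \<xi>)\<close> can be adjoined, the residues of the relations
  for \<open>x\<close> have no common root in \<open>S\<close>. A nonzero residue of least length
  divides all the others, because quotients over the residue field lift to \<open>G\<close> and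
  remainders are again residues of relations. As \<open>S\<close> is algebraically closed, this
  common divisor must be a constant.\<close>

lemma relation_A:
  assumes x: "x \<in> carrier F" "x \<notin> fst ` G"
  shows "\<exists>p n c. set p \<subseteq> G \<and> F.eval (map fst p) x = \<zero>\<^bsub>F\<^esub> \<and> map snd p = replicate n \<zero>\<^bsub>S\<^esub> @ [c] \<and> c \<noteq> \<zero>\<^bsub>S\<^esub>"
proof -
  note sr = hom_graphD(1)[OF G] note GC = subringE(1)[OF sr]
  let ?K = "snd ` G"
  note KF = image_subfield note KR = subfieldE(1)[OF KF]
  interpret KX: cring "?K[X]\<^bsub>S\<^esub>" by (rule S.univ_poly_is_cring[OF KR])
  define rel where "rel p \<longleftrightarrow> set p \<subseteq> G \<and> F.eval (map fst p) x = \<zero>\<^bsub>F\<^esub>" for p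
  define q where "q p = S.normalize (map snd p)" for p :: "('f \<times> 's) list"
  have qK: "q p \<in> carrier (?K[X]\<^bsub>S\<^esub>)" if "rel p" for p
    using that S.normalize_gives_polynomial[of "map snd p" ?K] unfolding rel_def q_def by (auto simp: univ_poly_carrier[symmetric])
  have SC: "set (map snd p) \<subseteq> carrier S" if "set p \<subseteq> G" for p
    using that GC by (auto simp: RDirProd_sel)
  have evq: "S.eval (map snd p) \<xi> = S.eval (q p) \<xi>" if "set p \<subseteq> G" "\<xi> \<in> carrier S" for p \<xi>
    unfolding q_def using S.eval_normalize[OF SC[OF that(1)] that(2)] by simp
  have notin: "\<not> (\<forall>p. rel p \<longrightarrow> S.eval (q p) \<xi> = \<zero>\<^bsub>S\<^esub>)" if \<xi>: "\<xi> \<in> carrier S" for \<xi>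
  proof
    assume *: "\<forall>p. rel p \<longrightarrow> S.eval (q p) \<xi> = \<zero>\<^bsub>S\<^esub>"
    have "(x, \<xi>) \<in> G"
      by (rule max_adjoin[OF x(1) \<xi>]) (use * evq[OF _ \<xi>] in \<open>auto simp: rel_def\<close>)
    then show False using x(2) by force
  qed
  \<comment> \<open>The failure of the candidate root \<open>\<zero>\<close> already exhibits a
    relation with nonzero residue.\<close>
  have "\<exists>p. rel p \<and> q p \<noteq> []"
    using notin[OF S.zero_closed] by (metis S.eval.simps(1))
  then obtain p where p: "rel p" "q p \<noteq> []" and least: "\<And>p'. rel p' \<Longrightarrow> q p' \<noteq> [] \<Longrightarrow> length (q p) \<le> length (q p')"
    using ex_has_least_nat[of "\<lambda>p. rel p \<and> q p \<noteq> []" _ "\<lambda>p. length (q p)"] by blast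
  have len: "length (q p) = 1"
  proof (rule ccontr)
    assume "length (q p) \<noteq> 1"
    then have "length (q p) > 1" using p(2) by (cases "q p") auto
    then obtain \<xi> where \<xi>: "\<xi> \<in> carrier S" "S.eval (q p) \<xi> = \<zero>\<^bsub>S\<^esub>"
      using S.root_exists[OF S.carrier_polynomial_shell[OF KR qK[OF p(1)]]] by blast
    have "S.eval (q p') \<xi> = \<zero>\<^bsub>S\<^esub>" if p': "rel p'" for p'
    proof -
      obtain b r where br: "b \<in> carrier (?K[X]\<^bsub>S\<^esub>)" "r \<in> carrier (?K[X]\<^bsub>S\<^esub>)"
        "q p' = q p \<otimes>\<^bsub>?K[X]\<^bsub>S\<^esub>\<^esub> b \<oplus>\<^bsub>?K[X]\<^bsub>S\<^esub>\<^esub> r" "r = [] \<or> length r - 1 < length (q p) - 1"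
        using S.field_long_division_theorem_shell[OF KF qK[OF p'] qK[OF p(1)]] p(2)
        by (auto simp: univ_poly_zero)
      \<comment> \<open>The negated quotient, so that the remainder is a sum and lifts to the
        relation \<open>p' + p c\<close>.\<close>
      define b' where "b' = \<ominus>\<^bsub>?K[X]\<^bsub>S\<^esub>\<^esub> b"
      have b': "b' \<in> carrier (?K[X]\<^bsub>S\<^esub>)" using br(1) by (simp add: b'_def)
      have r: "r = q p' \<oplus>\<^bsub>?K[X]\<^bsub>S\<^esub>\<^esub> q p \<otimes>\<^bsub>?K[X]\<^bsub>S\<^esub>\<^esub> b'"
        unfolding br(3) b'_def using br(1,2) qK[OF p(1)] by algebra
      have "set b' \<subseteq> ?K" using b' S.polynomial_incl by (simp add: univ_poly_carrier[symmetric])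
      then have "b' \<in> lists (snd ` G)" by (auto simp: in_lists_conv_set)
      then obtain c where c: "set c \<subseteq> G" "map snd c = b'" unfolding lists_image by (auto simp: in_lists_conv_set)
      have GL: "set p \<subseteq> G" "set p' \<subseteq> G" using p(1) p' by (simp_all add: rel_def)
      let ?m = "P.poly_mult p c"
      let ?s = "P.poly_add p' ?m"
      have mG: "set ?m \<subseteq> G"
        using P.poly_mult_is_polynomial[OF sr GL(1) c(1)] P.polynomial_incl by blast
      have sG: "set ?s \<subseteq> G"
        using P.poly_add_is_polynomial[OF sr GL(2) mG] P.polynomial_incl by blast
      have C: "set p \<subseteq> carrier prd" "set p' \<subseteq> carrier prd" "set c \<subseteq> carrier prd" "set ?m \<subseteq> carrier prd" "set ?s \<subseteq> carrier prd"
        using GL c(1) mG sG GC by blast+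
      have xc: "(x, \<zero>\<^bsub>S\<^esub>) \<in> carrier prd" using x(1) by (simp add: RDirProd_sel)
      have ev: "F.eval (map fst l) x = fst (P.eval l (x, \<zero>\<^bsub>S\<^esub>))" if "set l \<subseteq> carrier prd" for l
        using f.eval_hom'[OF xc that] by simp
      have "fst (P.eval ?s (x, \<zero>\<^bsub>S\<^esub>)) = \<zero>\<^bsub>F\<^esub>"
        using p(1) p' ev[OF C(1)] ev[OF C(2)] P.eval_in_carrier[OF C(3) xc]
        unfolding P.eval_poly_add[OF C(2,4) xc] P.eval_poly_mult[OF C(1,3) xc]
        by (auto simp: rel_def RDirProd_sel)
      then have "rel ?s" unfolding rel_def using sG ev[OF C(5)] by simp
      moreover have "q ?s = r"
      proof -
        have "q ?s = S.poly_add (map snd p') (map snd ?m)"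
          unfolding q_def by (rule s.poly_add_hom'[OF C(2,4)])
        also have "\<dots> = S.poly_add (q p') (S.normalize (map snd ?m))"
          unfolding q_def by (rule S.poly_add_normalize(3)[OF SC[OF GL(2)] SC[OF mG]])
        also have "S.normalize (map snd ?m) = S.poly_mult (map snd p) b'"
          using s.poly_mult_hom'[OF C(1,3)] c(2) by simp
        also have "\<dots> = S.poly_mult (q p) b'"
          unfolding q_def by (rule S.poly_mult_normalize[OF SC[OF GL(1)]]) (use SC[OF c(1)] c(2) in simp)
        finally show ?thesis unfolding r by (simp add: univ_poly_add univ_poly_mult)
      qed
      ultimately have "r = []" using least[of ?s] br(4) p(2) by (cases "r = []") (auto simp: Suc_le_eq)
      then have "q p' = S.poly_mult (q p) b"
        using br(3) KX.r_zero[OF KX.m_closed[OF qK[OF p(1)] br(1)]] by (simp add: univ_poly_zero univ_poly_mult)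
      moreover have "set (q p) \<subseteq> carrier S" "set b \<subseteq> carrier S"
        using S.carrier_polynomial_shell[OF KR qK[OF p(1)]] S.carrier_polynomial_shell[OF KR br(1)] S.polynomial_incl
        by (simp_all add: univ_poly_carrier[symmetric])
      ultimately show ?thesis using S.eval_poly_mult[of "q p" b \<xi>] \<xi> S.eval_in_carrier[of b \<xi>] by simp
    qed
    then show False using notin[OF \<xi>(1)] by blast
  qed
  then obtain c where c: "q p = [c]" by (cases "q p") auto
  have "map snd p = replicate (length (map snd p) - length (q p)) \<zero>\<^bsub>S\<^esub> @ q p"
    unfolding q_def by (rule S.normalize_trick)
  moreover have "c \<noteq> \<zero>\<^bsub>S\<^esub>" using qK[OF p(1)] c by (simp add: univ_poly_carrier[symmetric] polynomial_def)
  ultimately show ?thesis using p(1) c unfolding rel_def by metis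
qed

text \<open>The obstruction to adjoining \<open>(y, \<zero>)\<close>. Lists carry the constant term
  last, and evaluation at \<open>\<zero>\<close> reads it off.\<close>

lemma relation_B:
  assumes y: "y \<in> carrier F" "(y, \<zero>\<^bsub>S\<^esub>) \<notin> G"
  shows "\<exists>p. set p \<subseteq> G \<and> F.eval (map fst p) y = \<zero>\<^bsub>F\<^esub> \<and> p \<noteq> [] \<and> snd (last p) \<noteq> \<zero>\<^bsub>S\<^esub>"
proof -
  obtain p where p: "set p \<subseteq> G" "F.eval (map fst p) y = \<zero>\<^bsub>F\<^esub>" "S.eval (map snd p) \<zero>\<^bsub>S\<^esub> \<noteq> \<zero>\<^bsub>S\<^esub>"
    using max_adjoin[OF y(1) S.zero_closed] y(2) by blast
  from p(3) have ne: "p \<noteq> []" by auto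
  then obtain r v where r: "p = r @ [v]" by (metis append_butlast_last_id)
  have c: "set (map snd r) \<subseteq> carrier S" "snd v \<in> carrier S"
    using p(1) subringE(1)[OF hom_graphD(1)[OF G]] by (auto simp: r RDirProd_sel)
  have "S.eval (map snd p) \<zero>\<^bsub>S\<^esub> = snd v"
    using S.eval_append_aux[OF c S.zero_closed] S.eval_in_carrier[OF c(1) S.zero_closed] c(2) by (simp add: r)
  then show ?thesis using p ne r by (intro exI[of _ p]) auto
qed

text \<open>Chevalley's elimination between a relation for \<open>x\<close> and one for
  \<open>y = 1/x\<close>. The shorter relation, read backwards, has a leading coefficient of nonzero
  residue; made monic, it removes the leading term of the longer one. The residues of the remaining
  coefficients do not change, so the hypotheses survive while the total length drops. For
  \<open>n = 0\<close> the relation for \<open>x\<close> is a zero element with nonzero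
  residue.\<close>

lemma relations_contradict:
  assumes xy: "x \<in> carrier F" "y \<in> carrier F" "x \<otimes>\<^bsub>F\<^esub> y = \<one>\<^bsub>F\<^esub>"
  shows "\<lbrakk>set p \<subseteq> G; F.eval (map fst p) x = \<zero>\<^bsub>F\<^esub>; map snd p = replicate n \<zero>\<^bsub>S\<^esub> @ [c]; c \<noteq> \<zero>\<^bsub>S\<^esub>;
     set q \<subseteq> G; F.eval (map fst q) y = \<zero>\<^bsub>F\<^esub>; q \<noteq> []; snd (last q) \<noteq> \<zero>\<^bsub>S\<^esub>\<rbrakk> \<Longrightarrow> False"
proof (induction "length p + length q" arbitrary: p q n c rule: less_induct)
  case less
  note sr = hom_graphD(1)[OF G] note GC = subringE(1)[OF sr]
  let ?x = "(x, \<one>\<^bsub>S\<^esub>)" and ?y = "(y, \<one>\<^bsub>S\<^esub>)"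
  have zc: "?x \<in> carrier prd" "?y \<in> carrier prd" "?x \<otimes>\<^bsub>prd\<^esub> ?y = \<one>\<^bsub>prd\<^esub>" "?y \<otimes>\<^bsub>prd\<^esub> ?x = \<one>\<^bsub>prd\<^esub>"
    using xy F.m_comm by (simp_all add: RDirProd_sel)
  have evf: "fst (P.eval l z) = F.eval (map fst l) (fst z)" if "set l \<subseteq> G" "z \<in> carrier prd" for l z
    using f.eval_hom'[OF that(2), of l] that(1) GC by auto
  \<comment> \<open>The condition \<open>zz\<close> gives every subtracted product residue zero. In
    one use the leading coefficient \<open>h\<close> of the relation for \<open>x\<close> has
    residue zero; in the other the relation for \<open>x\<close> is the reversed one, whose residues
    vanish after the leading entry.\<close>
  have reduce: "\<exists>d'. set d' \<subseteq> G \<and> F.eval (map fst d') (fst z) = \<zero>\<^bsub>F\<^esub> \<and> map snd d' = map snd d"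
    if z: "z \<in> carrier prd" "w \<in> carrier prd" "z \<otimes>\<^bsub>prd\<^esub> w = \<one>\<^bsub>prd\<^esub>"
      and hd: "set (h # d) \<subseteq> G" "F.eval (map fst (h # d)) (fst z) = \<zero>\<^bsub>F\<^esub>"
      and l: "set l \<subseteq> G" "F.eval (map fst l) (fst w) = \<zero>\<^bsub>F\<^esub>" "rev l = v # r" "snd v \<noteq> \<zero>\<^bsub>S\<^esub>" "length r \<le> length d"
      and zz: "snd h = \<zero>\<^bsub>S\<^esub> \<or> (\<forall>b \<in> set r. snd b = \<zero>\<^bsub>S\<^esub>)" for z w h d l v r
  proof -
    have vG: "v \<in> G" "set r \<subseteq> G" using l(1,3) by (metis set_rev list.set_intros(1) subsetD, metis set_rev set_subset_Cons subset_trans)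
    obtain v1 v2 where v12: "v = (v1, v2)" by fastforce
    define v' where "v' = (inv\<^bsub>F\<^esub> v1, inv\<^bsub>S\<^esub> v2)"
    have v': "v' \<in> G" "v1 \<noteq> \<zero>\<^bsub>F\<^esub>" using max_inv[of v1 v2] vG(1) l(4) by (simp_all add: v12 v'_def)
    have v'v: "v' \<otimes>\<^bsub>prd\<^esub> v = \<one>\<^bsub>prd\<^esub>"
      using vG(1) GC v'(2) l(4) F.field_Units S.field_Units by (auto simp: v12 v'_def RDirProd_sel)
    define m where "m = map (\<lambda>a. v' \<otimes>\<^bsub>prd\<^esub> a) r"
    have mG: "set m \<subseteq> G" unfolding m_def set_map using vG(2) v'(1) subringE(6)[OF sr] by blast
    define k where "k = length d - length r"
    have mk: "length m + k = length d" using l(5) by (simp add: m_def k_def)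
    let ?d' = "map2 (\<lambda>a b. a \<ominus>\<^bsub>prd\<^esub> h \<otimes>\<^bsub>prd\<^esub> b) d (m @ replicate k \<zero>\<^bsub>prd\<^esub>)"
    have mkG: "set (m @ replicate k \<zero>\<^bsub>prd\<^esub>) \<subseteq> G" using mG subringE(2)[OF sr] by (auto simp: set_replicate_conv_if)
    have hG: "h \<in> G" "set d \<subseteq> G" using hd(1) by auto
    have "a \<ominus>\<^bsub>prd\<^esub> h \<otimes>\<^bsub>prd\<^esub> b \<in> G" if "a \<in> G" "b \<in> G" for a b
      using that hG(1) subringE(5,6,7)[OF sr] by (simp add: a_minus_def)
    moreover have "a \<in> G" "b \<in> G" if "(a, b) \<in> set (zip d (m @ replicate k \<zero>\<^bsub>prd\<^esub>))" for a b
      using set_zip_leftD[OF that] set_zip_rightD[OF that] hG(2) mkG by blast+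
    ultimately have d'G: "set ?d' \<subseteq> G" unfolding set_map by (intro image_subsetI) (simp only: split_paired_all prod.case)
    have C: "set d \<subseteq> carrier prd" "set m \<subseteq> carrier prd" "h \<in> carrier prd" "set l \<subseteq> carrier prd" "v' \<in> carrier prd" "set r \<subseteq> carrier prd" "set (v # r) \<subseteq> carrier prd"
      using hG mG l(1) v'(1) vG GC by auto
    have rl: "fst (P.eval (v # r) z) = \<zero>\<^bsub>F\<^esub>"
    proof -
      have "P.eval l w \<otimes>\<^bsub>prd\<^esub> z [^]\<^bsub>prd\<^esub> length l = z \<otimes>\<^bsub>prd\<^esub> P.eval (rev l) z"
        by (rule P.eval_rev[OF C(4) z])
      then have "fst (P.eval l w) \<otimes>\<^bsub>F\<^esub> fst (z [^]\<^bsub>prd\<^esub> length l) = fst z \<otimes>\<^bsub>F\<^esub> fst (P.eval (v # r) z)"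
        unfolding l(3) by (metis fst_conv RDirProd_sel(2))
      moreover have "fst (z [^]\<^bsub>prd\<^esub> length l) \<in> carrier F" using P.nat_pow_closed[OF z(1), of "length l"] by (auto simp: RDirProd_sel)
      ultimately have "fst z \<otimes>\<^bsub>F\<^esub> fst (P.eval (v # r) z) = \<zero>\<^bsub>F\<^esub>"
        using evf[OF l(1) z(2)] l(2) by simp
      moreover have "fst z \<noteq> \<zero>\<^bsub>F\<^esub>" using z by (auto simp: RDirProd_sel)
      ultimately show ?thesis
        using F.integral[of "fst z" "fst (P.eval (v # r) z)"] z(1) P.eval_in_carrier[OF C(7) z(1)] by (auto simp: RDirProd_sel)
    qed
    have "map (\<lambda>a. v' \<otimes>\<^bsub>prd\<^esub> a) (v # r) = \<one>\<^bsub>prd\<^esub> # m" using v'v by (simp add: m_def)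
    then have m1: "P.eval (\<one>\<^bsub>prd\<^esub> # m) z = v' \<otimes>\<^bsub>prd\<^esub> P.eval (v # r) z"
      using P.eval_scale[OF C(7,5) z(1)] by simp
    have e: "P.eval ?d' z = P.eval (h # d) z \<ominus>\<^bsub>prd\<^esub> h \<otimes>\<^bsub>prd\<^esub> (z [^]\<^bsub>prd\<^esub> k \<otimes>\<^bsub>prd\<^esub> P.eval (\<one>\<^bsub>prd\<^esub> # m) z)"
      by (rule P.eval_reduce[OF mk C(1,2,3) z(1)])
    have ec: "P.eval (h # d) z \<in> carrier prd" "P.eval (v # r) z \<in> carrier prd" "z [^]\<^bsub>prd\<^esub> k \<in> carrier prd"
      using P.eval_in_carrier[of _ z] C z(1) P.nat_pow_closed[OF z(1)] by (simp, blast, blast)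
    have "fst (P.eval ?d' z) = \<zero>\<^bsub>F\<^esub>"
      unfolding e m1 using rl evf[OF hd(1) z(1)] hd(2) ec C(3,5) 
      by (simp add: a_minus_def f.hom_a_inv)
    then have 1: "F.eval (map fst ?d') (fst z) = \<zero>\<^bsub>F\<^esub>" using evf[OF d'G z(1)] by simp
    have "map snd ?d' = map snd d"
    proof (rule nth_equalityI)
      fix i assume "i < length (map snd ?d')"
      then have i: "i < length d" "i < length (m @ replicate k \<zero>\<^bsub>prd\<^esub>)" using mk by simp_all
      let ?b = "(m @ replicate k \<zero>\<^bsub>prd\<^esub>) ! i"
      have bc: "?b \<in> carrier prd" "d ! i \<in> carrier prd" using nth_mem[OF i(2)] nth_mem[OF i(1)] mkG hG(2) GC by blast+
      have "snd h = \<zero>\<^bsub>S\<^esub> \<or> snd ?b = \<zero>\<^bsub>S\<^esub>"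
      proof (cases "i < length m")
        case True
        then have "?b = v' \<otimes>\<^bsub>prd\<^esub> (r ! i)" "r ! i \<in> set r" by (simp_all add: nth_append m_def)
        then show ?thesis using zz C(5) by (auto simp: RDirProd_sel)
      next
        case False
        then show ?thesis using i(2) by (simp add: nth_append RDirProd_sel)
      qed
      then have "snd h \<otimes>\<^bsub>S\<^esub> snd ?b = \<zero>\<^bsub>S\<^esub>" using bc C(3) by (auto simp: RDirProd_sel)
      then have "snd (d ! i \<ominus>\<^bsub>prd\<^esub> h \<otimes>\<^bsub>prd\<^esub> ?b) = snd (d ! i)"
        using bc C(3) by (simp add: a_minus_def s.hom_a_inv)
      then show "map snd ?d' ! i = map snd d ! i" using i mk by simp
    qed (use mk in simp)
    then show ?thesis using d'G 1 by blast
  qed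
  obtain h d where hd: "p = h # d" using less.prems(3) by (cases p) auto
  obtain h' d' where hd': "q = h' # d'" using less.prems(7) by (cases q) auto
  obtain v r where vr: "rev q = v # r" using less.prems(7) by (cases "rev q") auto
  obtain u t where ut: "rev p = u # t" using hd by (cases "rev p") auto
  have v: "snd v \<noteq> \<zero>\<^bsub>S\<^esub>" using less.prems(7,8) vr by (metis hd_rev list.sel(1))
  have "rev (map snd p) = c # replicate n \<zero>\<^bsub>S\<^esub>" using less.prems(3) by simp
  then have u: "snd u = c" "map snd t = replicate n \<zero>\<^bsub>S\<^esub>" using ut by (simp_all add: rev_map)
  have len: "length p = Suc n" "length q = Suc (length r)" using less.prems(3) vr
    by (metis length_append_singleton length_map length_replicate, metis length_Cons length_rev)
  have tn: "length t = n" using u(2) by (metis length_map length_replicate)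
  show False
  proof (cases n)
    case 0
    then have "p = [u]" using len ut by (cases p) auto
    moreover have "u \<in> carrier prd" using \<open>p = [u]\<close> less.prems(1) GC by auto
    ultimately have "fst u = \<zero>\<^bsub>F\<^esub>" using less.prems(2) xy by (simp add: RDirProd_sel)
    moreover have "u \<in> G" using \<open>p = [u]\<close> less.prems(1) by simp
    ultimately have "snd u = \<zero>\<^bsub>S\<^esub>" using hom_graphD(2)[OF G, of "snd u"] by (metis prod.collapse)
    then show False using u less.prems(4) by simp
  next
    case (Suc n')
    show False
    proof (cases "length q \<le> length p")
      case True
      have h0: "snd h = \<zero>\<^bsub>S\<^esub>" "map snd d = replicate n' \<zero>\<^bsub>S\<^esub> @ [c]" using less.prems(3) hd Suc by simp_all
      have "\<exists>d2. set d2 \<subseteq> G \<and> F.eval (map fst d2) (fst ?x) = \<zero>\<^bsub>F\<^esub> \<and> map snd d2 = map snd d"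
        by (rule reduce[OF zc(1,2,3), of h d q v r]) (use less.prems hd vr v h0 len True in auto)
      then obtain d2 where d2: "set d2 \<subseteq> G" "F.eval (map fst d2) x = \<zero>\<^bsub>F\<^esub>" "map snd d2 = map snd d" by auto
      have "length d2 = length d" using d2(3) by (metis length_map)
      then show False
        using less.hyps[of d2 q n' c] d2 h0(2) less.prems hd by simp
    next
      case False
      have "\<exists>d2. set d2 \<subseteq> G \<and> F.eval (map fst d2) (fst ?y) = \<zero>\<^bsub>F\<^esub> \<and> map snd d2 = map snd d'"
      proof (rule reduce[OF zc(2,1,4), of h' d' p u t])
        have "set (map snd t) \<subseteq> {\<zero>\<^bsub>S\<^esub>}" unfolding u(2) by auto
        then show "snd h' = \<zero>\<^bsub>S\<^esub> \<or> (\<forall>b \<in> set t. snd b = \<zero>\<^bsub>S\<^esub>)" by auto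
      qed (use less.prems hd' ut u len tn False in auto)
      then obtain d2 where d2: "set d2 \<subseteq> G" "F.eval (map fst d2) y = \<zero>\<^bsub>F\<^esub>" "map snd d2 = map snd d'" by auto
      have l2: "length d2 = length d'" using d2(3) by (metis length_map)
      have d'ne: "d' \<noteq> []" using False len hd' by auto
      then have d2ne: "d2 \<noteq> []" using l2 by auto
      have "snd (last d2) = snd (last q)"
        using d2(3) d'ne d2ne hd' by (metis last_map last_ConsR)
      then show False
        using less.hyps[of p d2 n c] d2(1,2) d2ne l2 less.prems hd' by simp
    qed
  qed
qed

lemma max_valuation:
  assumes "x \<in> carrier F"
  shows "x \<in> fst ` G \<or> (x \<noteq> \<zero>\<^bsub>F\<^esub> \<and> (inv\<^bsub>F\<^esub> x, \<zero>\<^bsub>S\<^esub>) \<in> G)"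
proof (rule ccontr)
  assume *: "\<not> ?thesis"
  have "\<zero>\<^bsub>F\<^esub> \<in> fst ` G" using subringE(2)[OF f.img_is_subring[OF hom_graphD(1)[OF G]]] .
  then have x0: "x \<noteq> \<zero>\<^bsub>F\<^esub>" using * by blast
  then have i: "inv\<^bsub>F\<^esub> x \<in> carrier F" "x \<otimes>\<^bsub>F\<^esub> inv\<^bsub>F\<^esub> x = \<one>\<^bsub>F\<^esub>" using assms F.field_Units by auto
  obtain p n c where "set p \<subseteq> G" "F.eval (map fst p) x = \<zero>\<^bsub>F\<^esub>" "map snd p = replicate n \<zero>\<^bsub>S\<^esub> @ [c]" "c \<noteq> \<zero>\<^bsub>S\<^esub>"
    using relation_A[OF assms] * by blast
  moreover obtain q where "set q \<subseteq> G" "F.eval (map fst q) (inv\<^bsub>F\<^esub> x) = \<zero>\<^bsub>F\<^esub>" "q \<noteq> []" "snd (last q) \<noteq> \<zero>\<^bsub>S\<^esub>"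
    using relation_B[OF i(1)] * x0 by blast
  ultimately show False by (rule relations_contradict[OF assms i])
qed

end

end

section \<open>Homomorphisms on simple extensions\<close>

lemma (in ring) subring_hom_ring:
  assumes "subring k R" "ring S" "h \<in> ring_hom (R\<lparr>carrier := k\<rparr>) S"
  shows "ring_hom_ring (R\<lparr>carrier := k\<rparr>) S h"
  by (rule ring_hom_ringI2[OF subring_is_ring[OF assms(1)] assms(2,3)])

lemma (in ring) subring_hom_eval:
  assumes "subring k R" "ring S" "h \<in> ring_hom (R\<lparr>carrier := k\<rparr>) S" "set p \<subseteq> k" "x \<in> k"
  shows "h (eval p x) = ring.eval S (map h p) (h x)"
proof -
  interpret h: ring_hom_ring "R\<lparr>carrier := k\<rparr>" S h by (rule subring_hom_ring[OF assms(1-3)])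
  show ?thesis using h.eval_hom'[of x p] assms(4,5) eval_consistent[OF assms(1)] by simp
qed

lemma (in ring) subring_hom_zero:
  assumes "subring k R" "ring S" "h \<in> ring_hom (R\<lparr>carrier := k\<rparr>) S"
  shows "h \<zero> = \<zero>\<^bsub>S\<^esub>"
proof -
  interpret h: ring_hom_ring "R\<lparr>carrier := k\<rparr>" S h by (rule subring_hom_ring[OF assms])
  show ?thesis using h.hom_zero by simp
qed

lemma ring_hom_subring_mono:
  "h \<in> ring_hom (R\<lparr>carrier := k\<rparr>) S \<Longrightarrow> k' \<subseteq> k \<Longrightarrow> h \<in> ring_hom (R\<lparr>carrier := k'\<rparr>) S"
  by (auto simp: ring_hom_def subset_iff)

lemma (in ring) subfield_hom_inj:
  assumes "subfield k R" "field S" "h \<in> ring_hom (R\<lparr>carrier := k\<rparr>) S"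
  shows "inj_on h k"
  using non_trivial_field_hom_is_inj[OF assms(3) subfield_iff(2)[OF assms(1)] assms(2)] by simp

text \<open>After removal of leading zeros, a relation \<open>p\<close> for \<open>x\<close> is a
  multiple of the minimal polynomial. The target is only a commutative ring, because
  \<open>separable_roots\<close> needs the dual numbers.\<close>

lemma (in domain) root_transfer:
  assumes k: "subfield k R" and x: "x \<in> carrier R" "(algebraic over k) x"
    and S: "cring S" and h: "h \<in> ring_hom (R\<lparr>carrier := k\<rparr>) S"
    and z: "z \<in> carrier S" "ring.eval S (map h (Irr k x)) z = \<zero>\<^bsub>S\<^esub>"
    and p: "set p \<subseteq> k" "eval p x = \<zero>"
  shows "ring.eval S (map h p) z = \<zero>\<^bsub>S\<^esub>"
proof -
  interpret S: cring S by fact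
  note kr = subfieldE(1)[OF k]
  interpret k: ring "R\<lparr>carrier := k\<rparr>" by (rule subring_is_ring[OF kr])
  interpret h: ring_hom_ring "R\<lparr>carrier := k\<rparr>" S h by (rule subring_hom_ring[OF kr S.ring_axioms h])
  have kC: "k \<subseteq> carrier R" by (rule subfieldE(3)[OF k])
  have hC: "set (map h q) \<subseteq> carrier S" if "set q \<subseteq> k" for q using that h.hom_closed by auto
  let ?q = "normalize p"
  have qk: "?q \<in> carrier (k[X])" using normalize_gives_polynomial[OF p(1)] by (simp add: univ_poly_carrier[symmetric])
  have "eval ?q x = \<zero>" using p eval_normalize[of p x] kC x(1) by simp
  then have "Irr k x pdivides ?q" by (rule Irr_minimal[OF k x qk])
  then have "Irr k x divides\<^bsub>k[X]\<^esub> ?q" using pdivides_iff_shell[OF k IrrE(1)[OF k x] qk] by simp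
  then obtain b where b: "b \<in> carrier (k[X])" "?q = poly_mult (Irr k x) b"
    unfolding factor_def by (auto simp: univ_poly_mult)
  have sb: "set b \<subseteq> k" "set (Irr k x) \<subseteq> k" "set ?q \<subseteq> k"
    using b(1) IrrE(1)[OF k x] qk polynomial_incl by (simp_all add: univ_poly_carrier[symmetric])
  have "S.eval (map h ?q) z = S.eval (S.normalize (map h ?q)) z"
    using S.eval_normalize[OF hC[OF sb(3)] z(1)] by simp
  also have "S.normalize (map h ?q) = S.poly_mult (map h (Irr k x)) (map h b)"
    using h.poly_mult_hom'[of "Irr k x" b] sb b(2) poly_mult_consistent[OF kr] by simp
  also have "S.eval \<dots> z = \<zero>\<^bsub>S\<^esub>"
    using S.eval_poly_mult[OF hC[OF sb(2)] hC[OF sb(1)] z(1)] z(2) S.eval_in_carrier[OF hC[OF sb(1)] z(1)] by simp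
  finally have "S.eval (map h ?q) z = \<zero>\<^bsub>S\<^esub>" .
  moreover have "map h p = replicate (length p - length ?q) \<zero>\<^bsub>S\<^esub> @ map h ?q"
    using arg_cong[OF normalize_trick[of p], of "map h"] h.hom_zero by simp
  ultimately show ?thesis using S.eval_replicate[OF hC[OF sb(3)] z(1)] by simp
qed

text \<open>The pair \<open>(x, z)\<close> is adjoined to the graph of \<open>h\<close>;
  \<open>root_transfer\<close> checks the relations.\<close>

lemma simple_extension_hom:
  fixes R :: "'r ring" (structure) and S :: "'s ring"
  assumes "domain R" and k: "subfield k R" and x: "x \<in> carrier R" "(ring.algebraic R over k) x"
    and S: "cring S" and h: "h \<in> ring_hom (R\<lparr>carrier := k\<rparr>) S"
    and z: "z \<in> carrier S" "ring.eval S (map h (ring.Irr R k x)) z = \<zero>\<^bsub>S\<^esub>"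
  obtains g where "g \<in> ring_hom (R\<lparr>carrier := ring.simple_extension R k x\<rparr>) S" "\<And>a. a \<in> k \<Longrightarrow> g a = h a" "g x = z"
proof -
  interpret R: domain R by fact
  interpret S: cring S by fact
  interpret ring_pair R S by unfold_locales
  note kr = subfieldE(1)[OF k]
  have kC: "k \<subseteq> carrier R" by (rule subfieldE(3)[OF k])
  let ?G = "(\<lambda>a. (a, h a)) ` k"
  have G: "hom_graph R S ?G" by (rule graph_of_hom[OF kr h])
  have rel: "S.eval (map snd p) z = \<zero>\<^bsub>S\<^esub>" if "set p \<subseteq> ?G" "R.eval (map fst p) x = \<zero>" for p
  proof -
    have e: "map snd p = map h (map fst p)" "set (map fst p) \<subseteq> k" using that(1) by auto
    show ?thesis unfolding e(1) by (rule R.root_transfer[OF k x S h z e(2) that(2)])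
  qed
  let ?H = "P.simple_extension ?G (x, z)"
  have H: "hom_graph R S ?H" "?G \<subseteq> ?H" "(x, z) \<in> ?H" by (rule hom_graph_adjoin[OF G x(1) z(1) rel]; assumption)+
  obtain Q g where g: "Q = fst ` ?H" "subring Q R" "g \<in> ring_hom (R\<lparr>carrier := Q\<rparr>) S" "\<And>a b. (a, b) \<in> ?H \<longleftrightarrow> a \<in> Q \<and> g a = b"
    using hom_graph_hom[OF H(1)] by auto
  have "k \<subseteq> Q" "x \<in> Q" using H(2,3) g(4) by auto
  then have "R.simple_extension k x \<subseteq> Q" by (rule R.simple_extension_subring_incl[OF g(2)])
  from ring_hom_subring_mono[OF g(3) this] show ?thesis
    by (rule that) (use H(2,3) g(4) in auto)
qed

text \<open>A valuation ring \<open>V\<close> with its residue map, followed by an embedding of the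
  residue field into \<open>S\<close>; the elements outside \<open>V\<close> are those of value
  infinity.\<close>

definition place :: "'f ring \<Rightarrow> 's ring \<Rightarrow> 'f set \<Rightarrow> ('f \<Rightarrow> 's) \<Rightarrow> bool"
  where "place F S V \<phi> \<longleftrightarrow> subring V F \<and> \<phi> \<in> ring_hom (F\<lparr>carrier := V\<rparr>) S \<and>
    (\<forall>x \<in> carrier F. x \<in> V \<or> (x \<noteq> \<zero>\<^bsub>F\<^esub> \<and> inv\<^bsub>F\<^esub> x \<in> V \<and> \<phi> (inv\<^bsub>F\<^esub> x) = \<zero>\<^bsub>S\<^esub>))"

lemma placeD:
  assumes "place F S V \<phi>"
  shows "subring V F" "\<phi> \<in> ring_hom (F\<lparr>carrier := V\<rparr>) S"
    "x \<in> carrier F \<Longrightarrow> x \<notin> V \<Longrightarrow> x \<noteq> \<zero>\<^bsub>F\<^esub> \<and> inv\<^bsub>F\<^esub> x \<in> V \<and> \<phi> (inv\<^bsub>F\<^esub> x) = \<zero>\<^bsub>S\<^esub>"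
  using assms unfolding place_def by blast+

context field_pair
begin

text \<open>Zorn's lemma gives a maximal graph above that of \<open>h\<close>, and
  \<open>max_valuation\<close> turns it into a place.\<close>

theorem place_extends:
  assumes k: "subring k F" and h: "h \<in> ring_hom (F\<lparr>carrier := k\<rparr>) S"
  obtains V \<phi> where "place F S V \<phi>" "k \<subseteq> V" "\<And>a. a \<in> k \<Longrightarrow> \<phi> a = h a"
proof -
  have "hom_graph F S ((\<lambda>a. (a, h a)) ` k)" by (rule graph_of_hom[OF k h])
  from hom_graph_maximal[OF this] obtain G where G: "hom_graph F S G" "(\<lambda>a. (a, h a)) ` k \<subseteq> G"
    "\<And>H. hom_graph F S H \<Longrightarrow> G \<subseteq> H \<Longrightarrow> H = G" by blast
  obtain V \<phi> where \<phi>: "V = fst ` G" "subring V F" "\<phi> \<in> ring_hom (F\<lparr>carrier := V\<rparr>) S" "\<And>a b. (a, b) \<in> G \<longleftrightarrow> a \<in> V \<and> \<phi> a = b"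
    using hom_graph_hom[OF G(1)] by auto
  have "place F S V \<phi>"
    unfolding place_def using \<phi>(2,3) max_valuation[OF G(1,3)] \<phi>(1,4) by blast
  then show ?thesis by (rule that) (use G(2) \<phi>(4) in auto)
qed

text \<open>Valuation rings are integrally closed. If \<open>x\<close> had value infinity,
  \<open>y = 1/x\<close> would have value \<open>\<zero>\<close>. Applied to the reversed polynomial
  at \<open>y\<close>, the place would leave only the image of the leading coefficient
  \<open>c\<close>, which is invertible in \<open>k\<close> and cannot map to
  \<open>\<zero>\<close>.\<close>

lemma algebraic_in_place:
  assumes \<phi>: "place F S V \<phi>" and k: "subfield k F" "k \<subseteq> V" and x: "x \<in> carrier F" "(F.algebraic over k) x"
  shows "x \<in> V"
proof (rule ccontr)
  assume "x \<notin> V"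
  then have x0: "x \<noteq> \<zero>\<^bsub>F\<^esub>" "inv\<^bsub>F\<^esub> x \<in> V" "\<phi> (inv\<^bsub>F\<^esub> x) = \<zero>\<^bsub>S\<^esub>" using placeD(3)[OF \<phi> x(1)] by blast+
  let ?y = "inv\<^bsub>F\<^esub> x"
  have y: "?y \<in> carrier F" "?y \<otimes>\<^bsub>F\<^esub> x = \<one>\<^bsub>F\<^esub>" using x0(1) x(1) F.field_Units by auto
  obtain p where p: "p \<in> carrier (k[X]\<^bsub>F\<^esub>)" "p \<noteq> []" "F.eval p x = \<zero>\<^bsub>F\<^esub>"
    using F.algebraicE[OF subfieldE(1)[OF k(1)] x] by blast
  obtain c r where cr: "p = c # r" using p(2) by (cases p) auto
  have pk: "set p \<subseteq> k" "c \<noteq> \<zero>\<^bsub>F\<^esub>" "c \<in> k" using p(1) unfolding cr univ_poly_carrier[symmetric] polynomial_def by auto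
  have kC: "k \<subseteq> carrier F" by (rule subfieldE(3)[OF k(1)])
  have pC: "set p \<subseteq> carrier F" using pk(1) kC by blast
  have "F.eval p x \<otimes>\<^bsub>F\<^esub> ?y [^]\<^bsub>F\<^esub> length p = ?y \<otimes>\<^bsub>F\<^esub> F.eval (rev p) ?y"
    by (rule F.eval_rev[OF pC y(1) x(1) y(2)])
  then have "?y \<otimes>\<^bsub>F\<^esub> F.eval (rev p) ?y = \<zero>\<^bsub>F\<^esub>" using p(3) y(1) by simp
  moreover have "?y \<noteq> \<zero>\<^bsub>F\<^esub>" using y(2) x(1) by auto
  ultimately have e: "F.eval (rev p) ?y = \<zero>\<^bsub>F\<^esub>"
    using F.integral[of ?y "F.eval (rev p) ?y"] y(1) F.eval_in_carrier[of "rev p" ?y] pC by auto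
  note V = placeD(1,2)[OF \<phi>]
  note hm = ring_hom_memE[OF V(2), simplified]
  have z: "\<phi> \<zero>\<^bsub>F\<^esub> = \<zero>\<^bsub>S\<^esub>" by (rule F.subring_hom_zero[OF V(1) S.ring_axioms V(2)])
  have "\<zero>\<^bsub>S\<^esub> = \<phi> (F.eval (rev p) ?y)" using e z by simp
  also have "\<dots> = S.eval (map \<phi> (rev p)) \<zero>\<^bsub>S\<^esub>"
    using F.subring_hom_eval[OF V(1) S.ring_axioms V(2), of "rev p" ?y] pk(1) k(2) x0 by auto
  also have "\<dots> = \<phi> c"
  proof -
    have rC: "set (map \<phi> (rev r)) \<subseteq> carrier S" "\<phi> c \<in> carrier S" using pk k(2) hm(1) unfolding cr by auto
    have "S.eval (map \<phi> (rev r) @ [\<phi> c]) \<zero>\<^bsub>S\<^esub> = S.eval (map \<phi> (rev r)) \<zero>\<^bsub>S\<^esub> \<otimes>\<^bsub>S\<^esub> \<zero>\<^bsub>S\<^esub> \<oplus>\<^bsub>S\<^esub> \<phi> c"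
      by (rule S.eval_append_aux[OF rC S.zero_closed])
    then show ?thesis using S.eval_in_carrier[OF rC(1) S.zero_closed] rC(2) by (simp add: cr)
  qed
  finally have "\<phi> c = \<zero>\<^bsub>S\<^esub>" ..
  moreover have "\<phi> c \<otimes>\<^bsub>S\<^esub> \<phi> (inv\<^bsub>F\<^esub> c) = \<one>\<^bsub>S\<^esub>"
    using hm(2)[of c "inv\<^bsub>F\<^esub> c"] F.subfield_m_inv[OF k(1), of c] pk(2,3) k(2) hm(4) by (simp add: subset_iff)
  moreover have "\<phi> (inv\<^bsub>F\<^esub> c) \<in> carrier S" using hm(1) F.subfield_m_inv(1)[OF k(1), of c] pk(2,3) k(2) by auto
  ultimately show False by simp
qed

text \<open>With \<open>place_root\<close> this identifies the values at \<open>x\<close> of the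
  places that extend \<open>h\<close>: they are the roots of the image of the minimal polynomial.
  Conjugates are produced and compared in this way.\<close>

lemma root_place:
  assumes k: "subfield k F" and h: "h \<in> ring_hom (F\<lparr>carrier := k\<rparr>) S"
    and x: "x \<in> carrier F" "(F.algebraic over k) x" and z: "z \<in> carrier S" "S.eval (map h (F.Irr k x)) z = \<zero>\<^bsub>S\<^esub>"
  obtains V \<phi> where "place F S V \<phi>" "k \<subseteq> V" "\<And>a. a \<in> k \<Longrightarrow> \<phi> a = h a" "x \<in> V" "\<phi> x = z"
proof -
  note kr = subfieldE(1)[OF k]
  obtain g where g: "g \<in> ring_hom (F\<lparr>carrier := F.simple_extension k x\<rparr>) S" "\<And>a. a \<in> k \<Longrightarrow> g a = h a" "g x = z"
    by (rule simple_extension_hom[OF F.domain_axioms k x S.is_cring h z]; rule that)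
  obtain V \<phi> where \<phi>: "place F S V \<phi>" "F.simple_extension k x \<subseteq> V" "\<And>a. a \<in> F.simple_extension k x \<Longrightarrow> \<phi> a = g a"
    by (rule place_extends[OF F.simple_extension_subring[OF kr x(1)] g(1)]; rule that)
  have "k \<subseteq> F.simple_extension k x" "x \<in> F.simple_extension k x"
    using F.simple_extension_incl[OF subringE(1)[OF kr] x(1)] F.simple_extension_mem[OF kr x(1)] by auto
  with \<phi> g(2,3) show ?thesis by (intro that[of V \<phi>]) auto
qed

lemma place_root:
  assumes \<phi>: "place F S V \<phi>" "k \<subseteq> V" "\<And>a. a \<in> k \<Longrightarrow> \<phi> a = h a" and k: "subfield k F" and x: "x \<in> carrier F" "(F.algebraic over k) x"
  shows "\<phi> x \<in> carrier S" "S.eval (map h (F.Irr k x)) (\<phi> x) = \<zero>\<^bsub>S\<^esub>"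
proof -
  have xV: "x \<in> V" by (rule algebraic_in_place[OF \<phi>(1) k \<phi>(2) x])
  note V = placeD(1,2)[OF \<phi>(1)]
  show "\<phi> x \<in> carrier S" using ring_hom_memE(1)[OF V(2)] xV by simp
  have I: "set (F.Irr k x) \<subseteq> k" using F.IrrE(1)[OF k x] F.polynomial_incl by (simp add: univ_poly_carrier[symmetric])
  have e: "map h (F.Irr k x) = map \<phi> (F.Irr k x)" using I \<phi>(3) by auto
  then show "S.eval (map h (F.Irr k x)) (\<phi> x) = \<zero>\<^bsub>S\<^esub>"
    unfolding e using F.subring_hom_eval[OF V(1) S.ring_axioms V(2) order_trans[OF I \<phi>(2)] xV] F.IrrE(4)[OF k x]
      F.subring_hom_zero[OF V(1) S.ring_axioms V(2)] by simp
qed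

end

section \<open>Separability and primitive elements\<close>

text \<open>
  The powers of the characteristic exponent: \<open>n = 1\<close> in characteristic \<open>0\<close>, a power of \<open>p\<close> otherwise.
\<close>

definition frob_exp :: "('a, 'b) ring_scheme \<Rightarrow> nat \<Rightarrow> bool"
  where "frob_exp R n \<longleftrightarrow> n > 0 \<and> (\<forall>p. Factorial_Ring.prime p \<longrightarrow> p dvd n \<longrightarrow> [p] \<cdot>\<^bsub>R\<^esub> \<one>\<^bsub>R\<^esub> = \<zero>\<^bsub>R\<^esub>)"

lemma frob_exp_1: "frob_exp R 1"
  by (simp add: frob_exp_def)

lemma frob_exp_mult: "frob_exp R m \<Longrightarrow> frob_exp R n \<Longrightarrow> frob_exp R (m * n)"
  by (auto simp: frob_exp_def prime_dvd_mult_iff)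

lemma (in cring) binomial:
  assumes "x \<in> carrier R" "y \<in> carrier R"
  shows "(x \<oplus> y) [^] (n::nat) = (\<Oplus>k\<in>{..n}. [(n choose k)] \<cdot>\<^bsub>R\<^esub> (x [^] k \<otimes> y [^] (n - k)))"
proof (induction n)
  case 0 then show ?case using assms by simp
next
  case (Suc n)
  note c = nat_pow_closed[OF assms(1)] nat_pow_closed[OF assms(2)] add.nat_pow_closed
  let ?S = "\<Oplus>k\<in>{..n}. [(n choose k)] \<cdot>\<^bsub>R\<^esub> (x [^] k \<otimes> y [^] (n - k))"
  let ?a = "\<lambda>k. [(n choose k)] \<cdot>\<^bsub>R\<^esub> (x [^] Suc k \<otimes> y [^] (n - k))"
  let ?b = "\<lambda>k. [(n choose Suc k)] \<cdot>\<^bsub>R\<^esub> (x [^] Suc k \<otimes> y [^] (n - k))"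
  have S: "?S \<in> carrier R" by (rule finsum_closed) (simp add: c)
  have "?S \<otimes> x = (\<Oplus>k\<in>{..n}. ?a k)"
    using c assms by (subst finsum_ldistr) (auto intro!: finsum_cong' simp: add_pow_ldistr add_pow_rdistr m_ac Pi_def)
  moreover have "?S \<otimes> y = y [^] Suc n \<oplus> (\<Oplus>k\<in>{..n}. ?b k)"
  proof -
    have "?S \<otimes> y = (\<Oplus>k\<in>{..n}. [(n choose k)] \<cdot>\<^bsub>R\<^esub> (x [^] k \<otimes> y [^] (Suc n - k)))"
      using c assms by (subst finsum_ldistr) (auto intro!: finsum_cong' simp: add_pow_ldistr add_pow_rdistr m_ac Pi_def Suc_diff_le)
    also have "\<dots> = (\<Oplus>k\<in>{..Suc n}. [(n choose k)] \<cdot>\<^bsub>R\<^esub> (x [^] k \<otimes> y [^] (Suc n - k)))"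
      by (subst finsum_Suc[of "\<lambda>k. [(n choose k)] \<cdot>\<^bsub>R\<^esub> (x [^] k \<otimes> y [^] (Suc n - k))" n])
        (use c assms in \<open>auto simp: Pi_def binomial_eq_0 intro!: l_zero[symmetric] finsum_closed\<close>)
    also have "\<dots> = (\<Oplus>k\<in>{..n}. ?b k) \<oplus> [(n choose 0)] \<cdot>\<^bsub>R\<^esub> (x [^] (0::nat) \<otimes> y [^] (Suc n - 0))"
      using c assms by (subst finsum_Suc2) (auto simp: Pi_def)
    finally show ?thesis using c assms by (simp add: a_comm)
  qed
  ultimately have "(x \<oplus> y) [^] Suc n = (\<Oplus>k\<in>{..n}. ?a k) \<oplus> (y [^] Suc n \<oplus> (\<Oplus>k\<in>{..n}. ?b k))"
    using Suc S assms by (simp add: r_distr)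
  also have "\<dots> = ((\<Oplus>k\<in>{..n}. ?a k) \<oplus> (\<Oplus>k\<in>{..n}. ?b k)) \<oplus> y [^] Suc n"
    using c assms by (simp add: a_ac Pi_def)
  also have "(\<Oplus>k\<in>{..n}. ?a k) \<oplus> (\<Oplus>k\<in>{..n}. ?b k) = (\<Oplus>k\<in>{..n}. [(Suc n choose Suc k)] \<cdot>\<^bsub>R\<^esub> (x [^] Suc k \<otimes> y [^] (Suc n - Suc k)))"
    using c assms by (subst finsum_addf[symmetric]) (auto intro!: finsum_cong' simp: Pi_def add.nat_pow_mult)
  also have "\<dots> \<oplus> y [^] Suc n = (\<Oplus>k\<in>{..Suc n}. [(Suc n choose k)] \<cdot>\<^bsub>R\<^esub> (x [^] k \<otimes> y [^] (Suc n - k)))"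
    by (subst finsum_Suc2[of "\<lambda>k. [(Suc n choose k)] \<cdot>\<^bsub>R\<^esub> (x [^] k \<otimes> y [^] (Suc n - k))" n])
      (use c assms in \<open>auto simp: Pi_def\<close>)
  finally show ?case .
qed

lemma (in cring) char_add_pow:
  assumes "[p] \<cdot>\<^bsub>R\<^esub> \<one> = \<zero>" "p dvd (n::nat)" "x \<in> carrier R" shows "[n] \<cdot>\<^bsub>R\<^esub> x = \<zero>"
proof -
  obtain m where m: "n = m * p" using assms(2) by (metis dvd_div_mult_self)
  have "[p] \<cdot>\<^bsub>R\<^esub> x = \<zero>" using add_pow_ldistr[of \<one> x p] assms by simp
  then show ?thesis using add.nat_pow_pow[OF assms(3), of m p] by (simp add: m mult.commute)
qed

text \<open>All prime factors of \<open>n\<close> vanish in the ring, so they can be split off one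
  at a time; for a prime exponent the middle binomial coefficients vanish.\<close>

lemma (in cring) frob_add:
  assumes "frob_exp R n" "x \<in> carrier R" "y \<in> carrier R"
  shows "(x \<oplus> y) [^] n = x [^] n \<oplus> y [^] n"
  using assms
proof (induction n arbitrary: x y rule: less_induct)
  case (less n)
  note c = nat_pow_closed[OF less.prems(2)] nat_pow_closed[OF less.prems(3)]
  have n0: "n > 0" using less.prems(1) by (simp add: frob_exp_def)
  show ?case
  proof (cases "n = 1")
    case True then show ?thesis using less.prems by simp
  next
    case False
    then obtain p where p: "Factorial_Ring.prime p" "p dvd n" using prime_factor_nat by blast
    then obtain m where m: "n = p * m" by blast
    have p0: "[p] \<cdot>\<^bsub>R\<^esub> \<one> = \<zero>" using less.prems(1) p by (simp add: frob_exp_def)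
    have fm: "frob_exp R m" using less.prems(1) m by (simp add: frob_exp_def)
    have lt: "m < n" using m n0 prime_gt_1_nat[OF p(1)] by simp
    have "(x \<oplus> y) [^] p = (\<Oplus>k\<in>{..p}. if k = 0 then y [^] p else if k = p then x [^] p else \<zero>)"
      unfolding binomial[OF less.prems(2,3)]
    proof (rule finsum_cong')
      fix k assume k: "k \<in> {..p}"
      show "[(p choose k)] \<cdot>\<^bsub>R\<^esub> (x [^] k \<otimes> y [^] (p - k)) = (if k = 0 then y [^] p else if k = p then x [^] p else \<zero>)"
      proof (cases "k = 0 \<or> k = p")
        case True then show ?thesis using c by auto
      next
        case False
        then have "p dvd (p choose k)" using k p(1) by (intro dvd_choose_prime) auto
        then show ?thesis using char_add_pow[OF p0] False c by auto
      qed
    qed (use c in auto)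
    also have "\<dots> = x [^] p \<oplus> y [^] p"
    proof -
      obtain q where q: "p = Suc q" using prime_gt_0_nat[OF p(1)] gr0_implies_Suc by blast
      have "(\<Oplus>k\<in>{..p}. if k = 0 then y [^] p else if k = p then x [^] p else \<zero>) =
        x [^] p \<oplus> (\<Oplus>k\<in>{..q}. if k = 0 then y [^] p else if k = p then x [^] p else \<zero>)"
        unfolding q by (subst finsum_Suc) (use c less.prems(2,3) in auto)
      also have "(\<Oplus>k\<in>{..q}. if k = 0 then y [^] p else if k = p then x [^] p else \<zero>) = (\<Oplus>k\<in>{..q}. if 0 = k then y [^] p else \<zero>)"
        by (rule finsum_cong') (use c q less.prems(2,3) in auto)
      also have "\<dots> = y [^] p" by (rule finsum_singleton[of 0 "{..q}" "\<lambda>_. y [^] p"]) (use c in auto)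
      finally show ?thesis .
    qed
    finally have "(x \<oplus> y) [^] p = x [^] p \<oplus> y [^] p" .
    then have "(x \<oplus> y) [^] n = (x [^] p \<oplus> y [^] p) [^] m"
      using less.prems nat_pow_pow[of "x \<oplus> y" p m] by (simp add: m)
    also have "\<dots> = (x [^] p) [^] m \<oplus> (y [^] p) [^] m"
      by (rule less.IH[OF lt fm c(1) c(2)])
    finally show ?thesis using less.prems by (simp add: nat_pow_pow m)
  qed
qed

lemma (in cring) frob_hom: "frob_exp R n \<Longrightarrow> (\<lambda>x. x [^] n) \<in> ring_hom R R"
  by (rule ring_hom_memI) (simp_all add: frob_add nat_pow_distrib)

lemma (in field) frob_inj:
  assumes "frob_exp R n" "x \<in> carrier R" "y \<in> carrier R" "x [^] n = y [^] n" shows "x = y"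
  using non_trivial_field_hom_is_inj[OF frob_hom[OF assms(1)] field_axioms field_axioms] assms by (auto dest: inj_onD)

lemma (in ring) hom_add_pow:
  assumes "ring S" "h \<in> ring_hom R S" "x \<in> carrier R"
  shows "h ([(n::nat)] \<cdot>\<^bsub>R\<^esub> x) = [n] \<cdot>\<^bsub>S\<^esub> h x"
proof -
  interpret ring_hom_ring R S h by (rule ring_hom_ringI2[OF ring_axioms assms(1,2)])
  show ?thesis by (induction n) (use assms(3) in \<open>simp_all\<close>)
qed

lemma frob_exp_subring: "frob_exp (R\<lparr>carrier := k\<rparr>) n = frob_exp R n"
  by (simp add: frob_exp_def add_pow_def nat_pow_def)

lemma (in field) frob_exp_hom:
  assumes "field S" "h \<in> ring_hom R S"
  shows "frob_exp S n \<longleftrightarrow> frob_exp R n"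
proof -
  interpret S: field S by fact
  interpret ring_hom_ring R S h by (rule ring_hom_ringI2[OF ring_axioms S.ring_axioms assms(2)])
  have "[p] \<cdot>\<^bsub>S\<^esub> \<one>\<^bsub>S\<^esub> = h ([p] \<cdot>\<^bsub>R\<^esub> \<one>)" for p :: nat
    using hom_add_pow[OF S.ring_axioms assms(2) one_closed] by simp
  moreover have "h x = \<zero>\<^bsub>S\<^esub> \<longleftrightarrow> x = \<zero>" if "x \<in> carrier R" for x
    using inj_onD[OF non_trivial_field_hom_is_inj[OF assms(2) field_axioms assms(1)], of x \<zero>] that by auto
  ultimately show ?thesis by (simp add: frob_exp_def)
qed

text \<open>If a product of integers vanishes in a field, one of the factors does; descending along
  the prime factors of \<open>n\<close> reaches a prime.\<close>

lemma (in field) char_prime: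
  assumes "[n] \<cdot>\<^bsub>R\<^esub> \<one> = \<zero>" "(n::nat) > 0"
  obtains p where "Factorial_Ring.prime p" "frob_exp R p"
proof -
  have "\<exists>p::nat. Factorial_Ring.prime p \<and> [p] \<cdot>\<^bsub>R\<^esub> \<one> = \<zero>"
    using assms
  proof (induction n rule: less_induct)
    case (less n)
    have "n \<noteq> 1" using less.prems by auto
    then obtain p where p: "Factorial_Ring.prime p" "p dvd n" using prime_factor_nat by blast
    then obtain m where m: "n = p * m" by blast
    have "[p] \<cdot>\<^bsub>R\<^esub> \<one> \<otimes> [m] \<cdot>\<^bsub>R\<^esub> \<one> = \<zero>"
      using less.prems(1) add_pow_ldistr[of \<one> "[m] \<cdot>\<^bsub>R\<^esub> \<one>" p] add.nat_pow_pow[of \<one> p m] by (simp add: m mult.commute)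
    then have "[p] \<cdot>\<^bsub>R\<^esub> \<one> = \<zero> \<or> [m] \<cdot>\<^bsub>R\<^esub> \<one> = \<zero>" using integral by simp
    moreover have "m < n" "m > 0" using m less.prems(2) prime_gt_1_nat[OF p(1)] by auto
    ultimately show ?case
    proof (elim disjE)
      assume "[p] \<cdot>\<^bsub>R\<^esub> \<one> = \<zero>"
      with p(1) show ?case by (intro exI[of _ p] conjI)
    next
      assume "[m] \<cdot>\<^bsub>R\<^esub> \<one> = \<zero>" "m < n" "m > 0"
      then show ?case using less.IH[of m] by simp
    qed
  qed
  then obtain p :: nat where p: "Factorial_Ring.prime p" "[p] \<cdot>\<^bsub>R\<^esub> \<one> = \<zero>" by blast
  have "frob_exp R p" unfolding frob_exp_def
    using p(2) prime_gt_0_nat[OF p(1)] primes_dvd_imp_eq[OF _ p(1)] by auto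
  with p(1) show ?thesis by (rule that)
qed

text \<open>
  A double root of a polynomial \<open>q\<close> lifts to the root \<open>z + \<epsilon>\<close> over the dual numbers. So if the minimal
  polynomial of \<open>x\<close> acquires a double root, \<open>x\<close> is not determined by \<open>x\<^sup>p\<close>.
\<close>

definition dual_numbers :: "('s, 'b) ring_scheme \<Rightarrow> ('s \<times> 's) ring"
  where "dual_numbers S = \<lparr>carrier = carrier S \<times> carrier S,
    monoid.mult = (\<lambda>x y. (fst x \<otimes>\<^bsub>S\<^esub> fst y, fst x \<otimes>\<^bsub>S\<^esub> snd y \<oplus>\<^bsub>S\<^esub> snd x \<otimes>\<^bsub>S\<^esub> fst y)),
    one = (\<one>\<^bsub>S\<^esub>, \<zero>\<^bsub>S\<^esub>), ring.zero = (\<zero>\<^bsub>S\<^esub>, \<zero>\<^bsub>S\<^esub>),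
    ring.add = (\<lambda>x y. (fst x \<oplus>\<^bsub>S\<^esub> fst y, snd x \<oplus>\<^bsub>S\<^esub> snd y))\<rparr>"

lemma dual_sel:
  "carrier (dual_numbers S) = carrier S \<times> carrier S"
  "x \<otimes>\<^bsub>dual_numbers S\<^esub> y = (fst x \<otimes>\<^bsub>S\<^esub> fst y, fst x \<otimes>\<^bsub>S\<^esub> snd y \<oplus>\<^bsub>S\<^esub> snd x \<otimes>\<^bsub>S\<^esub> fst y)"
  "\<one>\<^bsub>dual_numbers S\<^esub> = (\<one>\<^bsub>S\<^esub>, \<zero>\<^bsub>S\<^esub>)" "\<zero>\<^bsub>dual_numbers S\<^esub> = (\<zero>\<^bsub>S\<^esub>, \<zero>\<^bsub>S\<^esub>)"
  "x \<oplus>\<^bsub>dual_numbers S\<^esub> y = (fst x \<oplus>\<^bsub>S\<^esub> fst y, snd x \<oplus>\<^bsub>S\<^esub> snd y)"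
  by (simp_all add: dual_numbers_def)

text \<open>The formal derivative. Vanishing leading coefficients are kept, so that the length drops
  by exactly one and mapping a homomorphism over the list commutes with it.\<close>

fun (in ring) pder :: "'a list \<Rightarrow> 'a list"
  where "pder [] = []"
  | "pder (c # p) = (if p = [] then [] else ([length p] \<cdot>\<^bsub>R\<^esub> c) # pder p)"

context cring
begin

lemma dual_cring: "cring (dual_numbers R)"
proof (rule cringI)
  show "abelian_group (dual_numbers R)"
  proof (rule abelian_groupI)
    fix x assume "x \<in> carrier (dual_numbers R)"
    then show "\<exists>y\<in>carrier (dual_numbers R). y \<oplus>\<^bsub>dual_numbers R\<^esub> x = \<zero>\<^bsub>dual_numbers R\<^esub>"
      by (intro bexI[of _ "(\<ominus> fst x, \<ominus> snd x)"]) (auto simp: dual_sel l_neg)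
  qed (auto simp: dual_sel a_ac)
  show "Group.comm_monoid (dual_numbers R)"
  proof (rule comm_monoidI)
    fix x y z assume "x \<in> carrier (dual_numbers R)" "y \<in> carrier (dual_numbers R)" "z \<in> carrier (dual_numbers R)"
    then have c: "fst x \<in> carrier R" "snd x \<in> carrier R" "fst y \<in> carrier R" "snd y \<in> carrier R"
      "fst z \<in> carrier R" "snd z \<in> carrier R" by (auto simp: dual_sel)
    have "fst x \<otimes> fst y \<otimes> snd z \<oplus> (fst x \<otimes> snd y \<oplus> snd x \<otimes> fst y) \<otimes> fst z =
      fst x \<otimes> (fst y \<otimes> snd z \<oplus> snd y \<otimes> fst z) \<oplus> snd x \<otimes> (fst y \<otimes> fst z)"
      using c by algebra
    then show "x \<otimes>\<^bsub>dual_numbers R\<^esub> y \<otimes>\<^bsub>dual_numbers R\<^esub> z = x \<otimes>\<^bsub>dual_numbers R\<^esub> (y \<otimes>\<^bsub>dual_numbers R\<^esub> z)"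
      using c by (simp add: dual_sel m_assoc)
  next
    fix x y assume "x \<in> carrier (dual_numbers R)" "y \<in> carrier (dual_numbers R)"
    then show "x \<otimes>\<^bsub>dual_numbers R\<^esub> y = y \<otimes>\<^bsub>dual_numbers R\<^esub> x"
      by (auto simp: dual_sel m_comm a_comm)
  qed (auto simp: dual_sel)
next
  fix x y z assume "x \<in> carrier (dual_numbers R)" "y \<in> carrier (dual_numbers R)" "z \<in> carrier (dual_numbers R)"
  then have c: "fst x \<in> carrier R" "snd x \<in> carrier R" "fst y \<in> carrier R" "snd y \<in> carrier R"
    "fst z \<in> carrier R" "snd z \<in> carrier R" by (auto simp: dual_sel)
  have "(fst x \<oplus> fst y) \<otimes> snd z \<oplus> (snd x \<oplus> snd y) \<otimes> fst z =
    (fst x \<otimes> snd z \<oplus> snd x \<otimes> fst z) \<oplus> (fst y \<otimes> snd z \<oplus> snd y \<otimes> fst z)"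
    using c by algebra
  then show "(x \<oplus>\<^bsub>dual_numbers R\<^esub> y) \<otimes>\<^bsub>dual_numbers R\<^esub> z =
    x \<otimes>\<^bsub>dual_numbers R\<^esub> z \<oplus>\<^bsub>dual_numbers R\<^esub> y \<otimes>\<^bsub>dual_numbers R\<^esub> z"
    using c by (simp add: dual_sel l_distr)
qed

abbreviation (input) dual_const where "dual_const \<equiv> \<lambda>a. (a, \<zero>)"

lemma dual_const_hom: "dual_const \<in> ring_hom R (dual_numbers R)"
  by (rule ring_hom_memI) (auto simp: dual_sel)

lemma dual_pow:
  assumes "z \<in> carrier R"
  shows "(z, \<one>) [^]\<^bsub>dual_numbers R\<^esub> (n::nat) = (z [^] n, [n] \<cdot>\<^bsub>R\<^esub> (z [^] (n - 1)))"
proof (induction n)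
  case 0 then show ?case by (simp add: dual_sel)
next
  case (Suc n)
  have "z [^] n \<otimes> \<one> \<oplus> [n] \<cdot>\<^bsub>R\<^esub> (z [^] (n - 1)) \<otimes> z = [Suc n] \<cdot>\<^bsub>R\<^esub> (z [^] n)"
    using assms by (cases n) (simp_all add: add_pow_ldistr l_distr a_comm)
  then show ?case using Suc by (simp add: dual_sel)
qed

lemma length_pder: "length (pder p) = length p - 1"
  by (induction p rule: pder.induct) auto

text \<open>The Taylor expansion \<open>p(z + \<epsilon>) = p(z) + \<epsilon> p'(z)\<close> with
  \<open>\<epsilon>\<^sup>2 = 0\<close>.\<close>

lemma eval_dual:
  assumes "set p \<subseteq> carrier R" "z \<in> carrier R"
  shows "ring.eval (dual_numbers R) (map dual_const p) (z, \<one>) = (eval p z, eval (pder p) z)"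
proof -
  interpret D: cring "dual_numbers R" by (rule dual_cring)
  show ?thesis
    using assms(1)
  proof (induction p)
    case Nil then show ?case by (simp add: dual_sel)
  next
    case (Cons c p)
    have c: "c \<in> carrier R" using Cons.prems by simp
    show ?case
    proof (cases "p = []")
      case True then show ?thesis using c assms(2) by (simp add: dual_sel)
    next
      case False
      then show ?thesis using Cons c assms(2)
        by (simp add: dual_sel dual_pow length_pder add_pow_ldistr add_pow_rdistr)
    qed
  qed
qed

end

context field_pair
begin

text \<open>The square of \<open>X - z\<close> divides \<open>q\<close>, and \<open>X - z\<close>
  takes the value \<epsilon>, of square zero, at \<open>z + \<epsilon>\<close>.\<close>

lemma double_root:
  assumes q: "q \<in> carrier (poly_ring S)" and z: "z \<in> carrier S" "S.alg_mult q z \<ge> 2"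
  shows "S.eval (S.pder q) z = \<zero>\<^bsub>S\<^esub>" "ring.eval (dual_numbers S) (map (\<lambda>a. (a, \<zero>\<^bsub>S\<^esub>)) q) (z, \<one>\<^bsub>S\<^esub>) = \<zero>\<^bsub>dual_numbers S\<^esub>"
proof -
  interpret D: cring "dual_numbers S" by (rule S.dual_cring)
  let ?c = "\<lambda>a. (a, \<zero>\<^bsub>S\<^esub>)" and ?X = "[\<one>\<^bsub>S\<^esub>, \<ominus>\<^bsub>S\<^esub> z]"
  have cr: "ring_hom_ring S (dual_numbers S) ?c"
    by (rule ring_hom_ringI2[OF S.ring_axioms D.ring_axioms S.dual_const_hom])
  have Xc: "?X \<in> carrier (poly_ring S)" unfolding univ_poly_carrier[symmetric] polynomial_def using z(1) by simp
  have "?X [^]\<^bsub>poly_ring S\<^esub> (2::nat) pdivides\<^bsub>S\<^esub> q" by (rule S.le_alg_mult_imp_pdivides[OF z(1) q z(2)])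
  then obtain b where b: "b \<in> carrier (poly_ring S)" "q = (?X [^]\<^bsub>poly_ring S\<^esub> (2::nat)) \<otimes>\<^bsub>poly_ring S\<^esub> b"
    unfolding pdivides_def factor_def by blast
  interpret PX: cring "poly_ring S" by (rule S.univ_poly_is_cring[OF S.carrier_is_subring])
  have "q = S.poly_mult ?X (S.poly_mult ?X b)"
    using b Xc by (simp add: numeral_2_eq_2 PX.m_assoc) (simp add: univ_poly_mult)
  moreover define r where "r = S.poly_mult ?X b"
  ultimately have q': "q = S.poly_mult ?X r" by simp
  have pc: "set l \<subseteq> carrier S" if "l \<in> carrier (poly_ring S)" for l
    by (rule S.polynomial_incl) (use that in \<open>simp only: univ_poly_carrier\<close>)
  have C: "set ?X \<subseteq> carrier S" "set b \<subseteq> carrier S" "set q \<subseteq> carrier S"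
    using pc[OF Xc] pc[OF b(1)] pc[OF q] by blast+
  have rC: "set r \<subseteq> carrier S" unfolding r_def by (rule S.poly_mult_in_carrier[OF C(1,2)])
  have cC: "set (map ?c l) \<subseteq> carrier (dual_numbers S)" if "set l \<subseteq> carrier S" for l using that by (auto simp: dual_sel)
  have zc: "(z, \<one>\<^bsub>S\<^esub>) \<in> carrier (dual_numbers S)" using z(1) by (simp add: dual_sel)
  have mult: "D.eval (map ?c (S.poly_mult l l')) (z, \<one>\<^bsub>S\<^esub>) = D.eval (map ?c l) (z, \<one>\<^bsub>S\<^esub>) \<otimes>\<^bsub>dual_numbers S\<^esub> D.eval (map ?c l') (z, \<one>\<^bsub>S\<^esub>)"
    if "set l \<subseteq> carrier S" "set l' \<subseteq> carrier S" for l l'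
    using D.eval_normalize[OF cC[OF S.poly_mult_in_carrier[OF that]] zc] ring_hom_ring.poly_mult_hom'[OF cr that]
      D.eval_poly_mult[OF cC[OF that(1)] cC[OF that(2)] zc] by simp
  have X: "D.eval (map ?c ?X) (z, \<one>\<^bsub>S\<^esub>) = (\<zero>\<^bsub>S\<^esub>, \<one>\<^bsub>S\<^esub>)"
    unfolding S.eval_dual[OF C(1) z(1)] using z(1) by (simp add: S.r_neg)
  define u where "u = D.eval (map ?c b) (z, \<one>\<^bsub>S\<^esub>)"
  have u: "fst u \<in> carrier S" "snd u \<in> carrier S"
    using D.eval_in_carrier[OF cC[OF C(2)] zc] unfolding u_def[symmetric] by (auto simp: dual_sel(1))
  have "D.eval (map ?c q) (z, \<one>\<^bsub>S\<^esub>) = (\<zero>\<^bsub>S\<^esub>, \<one>\<^bsub>S\<^esub>) \<otimes>\<^bsub>dual_numbers S\<^esub> D.eval (map ?c r) (z, \<one>\<^bsub>S\<^esub>)"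
    by (subst q', subst mult[OF C(1) rC], subst X) (rule refl)
  also have "D.eval (map ?c r) (z, \<one>\<^bsub>S\<^esub>) = (\<zero>\<^bsub>S\<^esub>, \<one>\<^bsub>S\<^esub>) \<otimes>\<^bsub>dual_numbers S\<^esub> u"
    unfolding u_def by (subst r_def, subst mult[OF C(1,2)], subst X) (rule refl)
  also have "(\<zero>\<^bsub>S\<^esub>, \<one>\<^bsub>S\<^esub>) \<otimes>\<^bsub>dual_numbers S\<^esub> ((\<zero>\<^bsub>S\<^esub>, \<one>\<^bsub>S\<^esub>) \<otimes>\<^bsub>dual_numbers S\<^esub> u) = \<zero>\<^bsub>dual_numbers S\<^esub>"
    using u by (simp add: dual_sel)
  finally show e: "D.eval (map ?c q) (z, \<one>\<^bsub>S\<^esub>) = \<zero>\<^bsub>dual_numbers S\<^esub>" .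
  show "S.eval (S.pder q) z = \<zero>\<^bsub>S\<^esub>" 
    using trans[OF S.eval_dual[OF C(3) z(1), symmetric] e] by (simp add: dual_sel(4))
qed

lemma map_pder:
  assumes "subring k F" "h \<in> ring_hom (F\<lparr>carrier := k\<rparr>) S" "set p \<subseteq> k"
  shows "map h (F.pder p) = S.pder (map h p)"
proof -
  interpret k: ring "F\<lparr>carrier := k\<rparr>" by (rule F.subring_is_ring[OF assms(1)])
  have "h ([n] \<cdot>\<^bsub>F\<^esub> c) = [n] \<cdot>\<^bsub>S\<^esub> h c" if "c \<in> k" for n :: nat and c
    using k.hom_add_pow[OF S.ring_axioms assms(2)] that by (simp add: add_pow_def nat_pow_def)
  then show ?thesis using assms(3) by (induction p rule: F.pder.induct) auto
qed

text \<open>At a double root \<open>z\<close> the derivative of the minimal polynomial vanishes at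
  \<open>x\<close>, hence identically because of its degree. So the degree is zero in the field and
  the characteristic is a prime \<open>p\<close>. The homomorphism with
  \<open>x \<mapsto> z + \<epsilon>\<close> sends \<open>x\<^sup>p\<close> to an element without
  \<epsilon>-part, and therefore also \<open>x\<close>, which is a polynomial in
  \<open>x\<^sup>p\<close> by \<open>sep\<close>; this is absurd.\<close>

theorem separable_roots:
  assumes k: "subfield k F" and h: "h \<in> ring_hom (F\<lparr>carrier := k\<rparr>) S"
    and x: "x \<in> carrier F" "(F.algebraic over k) x"
    and sep: "\<And>n. frob_exp F n \<Longrightarrow> x \<in> F.simple_extension k (x [^]\<^bsub>F\<^esub> n)"
  shows "card {z \<in> carrier S. S.eval (map h (F.Irr k x)) z = \<zero>\<^bsub>S\<^esub>} = length (F.Irr k x) - 1"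
proof -
  note kr = subfieldE(1)[OF k] and kC = subfieldE(3)[OF k]
  note hm = ring_hom_memE[OF h, simplified]
  note I = F.IrrE[OF k x]
  let ?I = "F.Irr k x" and ?m = "map h (F.Irr k x)"
  interpret D: cring "dual_numbers S" by (rule S.dual_cring)
  let ?c = "\<lambda>a. (a, \<zero>\<^bsub>S\<^esub>)"
  have Ik: "set ?I \<subseteq> k" using I(1) F.polynomial_incl by (simp add: univ_poly_carrier[symmetric])
  have Ine: "length ?I \<ge> 2" using F.pirreducible_degree[OF k I(1,2)] by simp
  have m: "?m \<in> carrier (poly_ring S)" unfolding univ_poly_carrier[symmetric] polynomial_def
    using Ik Ine I(3) hm(1,4) by (cases ?I) auto
  have dm: "length ?m = length ?I" by simp
  have count: "count (S.roots ?m) z = 1" if "z \<in># S.roots ?m" for z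
  proof (rule ccontr)
    assume "count (S.roots ?m) z \<noteq> 1"
    then have "S.alg_mult ?m z \<ge> 2" using that S.alg_mult_eq_count_roots[OF m]
      by (simp add: not_less_eq_eq numeral_2_eq_2 Suc_le_eq flip: count_greater_zero_iff)
    moreover have z: "z \<in> carrier S" "S.eval ?m z = \<zero>\<^bsub>S\<^esub>"
      using that S.roots_mem_iff_is_root[OF m] by (auto simp: S.is_root_def)
    ultimately have dr: "S.eval (S.pder ?m) z = \<zero>\<^bsub>S\<^esub>" "D.eval (map ?c ?m) (z, \<one>\<^bsub>S\<^esub>) = \<zero>\<^bsub>dual_numbers S\<^esub>"
      using double_root[OF m] by blast+
    note E = F.simple_extension_subring[OF kr x(1)]
    let ?E = "F.simple_extension k x"
    have kE: "k \<subseteq> ?E" "x \<in> ?E" using F.simple_extension_incl[OF kC x(1)] F.simple_extension_mem[OF kr x(1)] by auto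
    have Ef: "subfield ?E F" using F.simple_extension_is_subfield[OF k x(1)] x(2) by simp
    obtain g where g: "g \<in> ring_hom (F\<lparr>carrier := ?E\<rparr>) S" "\<And>a. a \<in> k \<Longrightarrow> g a = h a" "g x = z"
      by (rule simple_extension_hom[OF F.domain_axioms k x S.is_cring h z]; rule that)
    let ?d = "F.pder ?I"
    have dk: "set ?d \<subseteq> k"
    proof -
      have "[n] \<cdot>\<^bsub>F\<^esub> c \<in> k" if "c \<in> k" for n :: nat and c
        by (induction n) (use that subringE(2,7)[OF kr] in auto)
      then have "set p \<subseteq> k \<Longrightarrow> set (F.pder p) \<subseteq> k" for p by (induction p rule: F.pder.induct) auto
      then show ?thesis using Ik by blast
    qed
    have "map g ?d = S.pder ?m" using map_pder[OF kr h Ik] dk g(2) by (simp add: subset_iff flip: map_pder[OF kr h Ik])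
    then have "g (F.eval ?d x) = \<zero>\<^bsub>S\<^esub>"
      using F.subring_hom_eval[OF E S.ring_axioms g(1) order_trans[OF dk kE(1)] kE(2)] g(3) dr(1) by simp
    moreover have "F.eval ?d x \<in> ?E" using F.mem_simple_extension_iff[OF kC x(1)] dk by blast
    moreover have "g \<zero>\<^bsub>F\<^esub> = \<zero>\<^bsub>S\<^esub>" "\<zero>\<^bsub>F\<^esub> \<in> ?E"
      using F.subring_hom_zero[OF E S.ring_axioms g(1)] subringE(2)[OF E] by auto
    ultimately have d0: "F.eval ?d x = \<zero>\<^bsub>F\<^esub>"
      using inj_onD[OF F.subfield_hom_inj[OF Ef S.field_axioms g(1)]] by metis
    have nd: "F.normalize ?d = []"
    proof (rule ccontr)
      assume ne: "F.normalize ?d \<noteq> []"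
      have nk: "F.normalize ?d \<in> carrier (k[X]\<^bsub>F\<^esub>)" using F.normalize_gives_polynomial[OF dk] by (simp add: univ_poly_carrier[symmetric])
      have "F.eval (F.normalize ?d) x = \<zero>\<^bsub>F\<^esub>" using d0 F.eval_normalize[of ?d x] dk kC x(1) by auto
      then have "length ?I - 1 \<le> length (F.normalize ?d) - 1"
        using F.pdivides_imp_degree_le[OF kr I(1) nk ne] F.Irr_minimal[OF k x nk] by blast
      moreover have "length (F.normalize ?d) \<le> length ?I - 1"
        using F.normalize_length_le[of ?d] by (simp add: F.length_pder)
      moreover have "length (F.normalize ?d) > 0" using ne by simp
      ultimately show False using Ine by linarith
    qed
    obtain a r where ar: "?I = a # r" "r \<noteq> []" using Ine by (cases ?I) (auto simp: Suc_le_eq)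
    have "a = \<one>\<^bsub>F\<^esub>" using I(3) ar(1) by simp
    then have "?d = ([length r] \<cdot>\<^bsub>F\<^esub> \<one>\<^bsub>F\<^esub>) # F.pder r" using ar by simp
    then have "[length r] \<cdot>\<^bsub>F\<^esub> \<one>\<^bsub>F\<^esub> = \<zero>\<^bsub>F\<^esub>" using nd by (metis F.normalize.simps(2) list.sel(1) list.distinct(1))
    then obtain p where p: "Factorial_Ring.prime p" "frob_exp F p" using F.char_prime[of "length r"] ar(2) by blast
    note c = S.dual_const_hom
    have ch: "?c \<circ> h \<in> ring_hom (F\<lparr>carrier := k\<rparr>) (dual_numbers S)" by (rule ring_hom_trans[OF h c])
    have zc: "(z, \<one>\<^bsub>S\<^esub>) \<in> carrier (dual_numbers S)" using z(1) by (simp add: dual_sel)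
    have zr: "D.eval (map (?c \<circ> h) ?I) (z, \<one>\<^bsub>S\<^esub>) = \<zero>\<^bsub>dual_numbers S\<^esub>" using dr(2) by (simp add: comp_def)
    obtain f where f: "f \<in> ring_hom (F\<lparr>carrier := ?E\<rparr>) (dual_numbers S)" "\<And>a. a \<in> k \<Longrightarrow> f a = (?c \<circ> h) a" "f x = (z, \<one>\<^bsub>S\<^esub>)"
      by (rule simple_extension_hom[OF F.domain_axioms k x D.is_cring ch zc zr]; rule that)
    have xp: "x [^]\<^bsub>F\<^esub> p \<in> carrier F" using x(1) by simp
    obtain q where q: "set q \<subseteq> k" "x = F.eval q (x [^]\<^bsub>F\<^esub> p)"
      using sep[OF p(2)] F.mem_simple_extension_iff[OF kC xp] by auto
    interpret fh: ring_hom_ring "F\<lparr>carrier := ?E\<rparr>" "dual_numbers S" f by (rule F.subring_hom_ring[OF E D.ring_axioms f(1)])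
    have xpE: "x [^]\<^bsub>F\<^esub> p \<in> ?E" by (induction p) (use subringE(3,6)[OF E] kE(2) in auto)
    have pw: "x [^]\<^bsub>F\<lparr>carrier := ?E\<rparr>\<^esub> p = x [^]\<^bsub>F\<^esub> p" by (simp add: nat_pow_def)
    have p0: "[p] \<cdot>\<^bsub>S\<^esub> \<one>\<^bsub>S\<^esub> = \<zero>\<^bsub>S\<^esub>"
    proof -
      have "[p] \<cdot>\<^bsub>F\<^esub> \<one>\<^bsub>F\<^esub> = \<zero>\<^bsub>F\<^esub>" using p by (simp add: frob_exp_def)
      then show ?thesis using ring.hom_add_pow[OF fh.R.ring_axioms S.ring_axioms g(1) fh.R.one_closed, of p] ring_hom_memE(4)[OF g(1)]
        F.subring_hom_zero[OF E S.ring_axioms g(1)] by (simp add: add_pow_def nat_pow_def)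
    qed
    have "f (x [^]\<^bsub>F\<^esub> p) = (z, \<one>\<^bsub>S\<^esub>) [^]\<^bsub>dual_numbers S\<^esub> p"
      using fh.hom_nat_pow[of x p] kE(2) f(3) pw by simp
    also have "\<dots> = ?c (z [^]\<^bsub>S\<^esub> p)" using S.dual_pow[OF z(1)] S.char_add_pow[OF p0, of p] z(1) by simp
    finally have fp: "f (x [^]\<^bsub>F\<^esub> p) = ?c (z [^]\<^bsub>S\<^esub> p)" .
    have fq: "map f q = map ?c (map h q)" using q(1) f(2) by auto
    have hq: "set (map h q) \<subseteq> carrier S" using q(1) hm(1) by auto
    have cr: "ring_hom_ring S (dual_numbers S) ?c" by (rule ring_hom_ringI2[OF S.ring_axioms D.ring_axioms c])
    have "(z, \<one>\<^bsub>S\<^esub>) = f (F.eval q (x [^]\<^bsub>F\<^esub> p))" using f(3) q(2) by simp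
    also have "\<dots> = D.eval (map f q) (f (x [^]\<^bsub>F\<^esub> p))"
      by (rule F.subring_hom_eval[OF E D.ring_axioms f(1) order_trans[OF q(1) kE(1)] xpE])
    also have "\<dots> = ?c (S.eval (map h q) (z [^]\<^bsub>S\<^esub> p))"
      unfolding fp fq by (rule ring_hom_ring.eval_hom'[OF cr _ hq, symmetric]) (use z(1) in simp)
    finally show False by simp
  qed
  have "{z \<in> carrier S. S.eval ?m z = \<zero>\<^bsub>S\<^esub>} = set_mset (S.roots ?m)"
    using S.roots_mem_iff_is_root[OF m] m Ine by (auto simp: S.is_root_def)
  moreover have "size (S.roots ?m) = card (set_mset (S.roots ?m))"
    unfolding size_multiset_overloaded_eq using count by simp
  ultimately show ?thesis using S.roots_over_carrier[OF m] by (simp add: S.splitted_def)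
qed

end

section \<open>Degrees and primitive elements\<close>

context field
begin

abbreviation deg_over :: "'a set \<Rightarrow> 'a \<Rightarrow> nat"
  where "deg_over k x \<equiv> length (Irr k x) - 1"

lemma algebraic_simple_extension:
  assumes "subfield k R" "y \<in> carrier R" "(algebraic over k) y" "x \<in> simple_extension k y"
  shows "x \<in> carrier R" "(algebraic over k) x"
  using simple_extesion_mem_imp_algebraic[OF assms] simple_extension_in_carrier[OF subfieldE(3)[OF assms(1)] assms(2)] assms(4)
  by blast+

lemma algebraic_pow:
  assumes "subfield k R" "x \<in> carrier R" "(algebraic over k) x"
  shows "x [^] (n::nat) \<in> simple_extension k x" "x [^] n \<in> carrier R" "(algebraic over k) (x [^] n)"
proof -
  note E = simple_extension_subring[OF subfieldE(1)[OF assms(1)] assms(2)]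
  show 1: "x [^] n \<in> simple_extension k x"
    by (induction n) (use subringE(3,6)[OF E] simple_extension_mem[OF subfieldE(1)[OF assms(1)] assms(2)] in auto)
  show "x [^] n \<in> carrier R" "(algebraic over k) (x [^] n)"
    using algebraic_simple_extension[OF assms 1] by blast+
qed

lemma simple_extension_trans:
  assumes "subfield k R" "y \<in> carrier R" "x \<in> simple_extension k y"
  shows "simple_extension k x \<subseteq> simple_extension k y"
  using simple_extension_subring_incl[OF simple_extension_subring[OF subfieldE(1)[OF assms(1)] assms(2)]
      simple_extension_incl[OF subfieldE(3)[OF assms(1)] assms(2)] assms(3)] .

lemma deg_over_le:
  assumes k: "subfield k R" and y: "y \<in> carrier R" "(algebraic over k) y" and xy: "x \<in> simple_extension k y"
  shows "deg_over k x \<le> deg_over k y" "deg_over k y \<le> deg_over k x \<Longrightarrow> y \<in> simple_extension k x"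
proof -
  note x = algebraic_simple_extension[OF k y xy]
  have incl: "simple_extension k x \<subseteq> simple_extension k y" by (rule simple_extension_trans[OF k y(1) xy])
  note dx = dimension_simple_extension[OF k x] and dy = dimension_simple_extension[OF k y]
  obtain Us where Us: "set Us \<subseteq> carrier R" "independent k Us" "length Us = deg_over k x" "Span k Us = simple_extension k x"
    using exists_base[OF k dx] by blast
  have UE: "set Us \<subseteq> simple_extension k y" using Span_base_incl[OF k Us(1)] Us(4) incl by blast
  show le: "deg_over k x \<le> deg_over k y" using independent_length_le_dimension[OF k dy Us(2) UE] Us(3) by simp
  assume "deg_over k y \<le> deg_over k x"
  then have "Span k Us = simple_extension k y"
    using independent_length_eq_dimension[OF k dy Us(2) UE] le Us(3) by simp
  then show "y \<in> simple_extension k x"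
    using Us(4) simple_extension_mem[OF subfieldE(1)[OF k] y(1)] by simp
qed

text \<open>The exponent is chosen such that \<open>x\<^sup>n\<close> has least degree; a further
  power generates a subfield of the same degree, hence the same field. This stands in for the
  separable part of an extension.\<close>

lemma separable_power:
  assumes k: "subfield k R" and x: "x \<in> carrier R" "(algebraic over k) x"
  obtains n where "frob_exp R n" "\<And>m. frob_exp R m \<Longrightarrow> x [^] n \<in> simple_extension k ((x [^] n) [^] m)"
proof -
  obtain n where n: "frob_exp R n" "\<And>m. frob_exp R m \<Longrightarrow> deg_over k (x [^] n) \<le> deg_over k (x [^] m)"
    using ex_has_least_nat[of "frob_exp R" 1 "\<lambda>n. deg_over k (x [^] n)"] frob_exp_1 by blast
  from n(1) show ?thesis
  proof (rule that)
    fix m assume m: "frob_exp R m"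
    note xn = algebraic_pow(2,3)[OF k x, of n]
    have "(x [^] n) [^] m = x [^] (n * m)" using x(1) by (simp add: nat_pow_pow)
    then have "deg_over k (x [^] n) \<le> deg_over k ((x [^] n) [^] m)" using n(2)[OF frob_exp_mult[OF n(1) m]] by simp
    then show "x [^] n \<in> simple_extension k ((x [^] n) [^] m)"
      by (rule deg_over_le(2)[OF k xn algebraic_pow(1)[OF k xn]])
  qed
qed

text \<open>A finite extension of a finite field is finite, and its multiplicative group is
  cyclic.\<close>

lemma finite_primitive:
  assumes k: "subfield k R" "finite k" and xs: "set xs \<subseteq> carrier R" "\<And>x. x \<in> set xs \<Longrightarrow> (algebraic over k) x"
  obtains y where "y \<in> finite_extension k xs" "set xs \<subseteq> simple_extension k y"
proof -
  let ?E = "finite_extension k xs"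
  have Ef: "subfield ?E R" by (rule finite_extension_is_subfield[OF k(1) xs(1)]) (rule xs(2))
  have "finite_dimension k ?E" by (rule finite_extension_finite_dimension(1)[OF k(1) xs(1)]) (rule xs(2))
  then obtain n where "dimension n k ?E" by blast
  then obtain Us where Us: "set Us \<subseteq> carrier R" "Span k Us = ?E" using exists_base[OF k(1)] by blast
  have "?E = (\<lambda>Ks. combine Ks Us) ` {Ks. set Ks \<subseteq> k \<and> length Ks = length Us}"
    unfolding Us(2)[symmetric] Span_eq_combine_set_length_version[OF k(1) Us(1)] by auto
  then have fin: "finite ?E" using finite_lists_length_eq[OF k(2)] by (metis finite_imageI)
  interpret E: field "R\<lparr>carrier := ?E\<rparr>" by (rule subfield_iff(2)[OF Ef])
  obtain a where a: "a \<in> carrier (mult_of (R\<lparr>carrier := ?E\<rparr>))"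
    "carrier (mult_of (R\<lparr>carrier := ?E\<rparr>)) = {a [^]\<^bsub>R\<lparr>carrier := ?E\<rparr>\<^esub> i | i::nat. i \<in> UNIV}"
    using E.finite_field_mult_group_has_gen fin by auto
  have aE: "a \<in> ?E" "a \<in> carrier R" using a(1) subfieldE(3)[OF Ef] by auto
  note A = simple_extension_subring[OF subfieldE(1)[OF k(1)] aE(2)]
  have pw: "a [^]\<^bsub>R\<lparr>carrier := ?E\<rparr>\<^esub> i = a [^] i" for i :: nat by (simp add: nat_pow_def)
  have "x \<in> simple_extension k a" if "x \<in> ?E" for x
  proof (cases "x = \<zero>")
    case True then show ?thesis by simp
  next
    case False
    then have "x \<in> carrier (mult_of (R\<lparr>carrier := ?E\<rparr>))" using that by simp
    then obtain i :: nat where "x = a [^] i" unfolding a(2) pw by blast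
    moreover have "a [^] i \<in> simple_extension k a"
      by (induction i) (use subringE(3,6)[OF A] simple_extension_mem[OF subfieldE(1)[OF k(1)] aE(2)] in auto)
    ultimately show ?thesis by simp
  qed
  with aE(1) show ?thesis
    by (intro that[of a]) (use finite_extension_mem[OF subfieldE(1)[OF k(1)] xs(1)] in auto)
qed

end

context field_pair
begin

text \<open>The classical generator \<open>a + c \<beta>\<close>, where only
  \<open>\<beta> = b\<^sup>n\<close> is made separable. A place that agrees with
  \<open>\<phi>0\<close> on \<open>k(y)\<close> but not at \<beta> would determine
  \<open>h c\<close> as a quotient of differences of conjugates, and these values are avoided. So
  \<beta> has a single conjugate over \<open>k(y)\<close>, and by \<open>separable_roots\<close> it
  has degree one there.\<close>

lemma primitive_pair:
  assumes k: "subfield k F" and h: "h \<in> ring_hom (F\<lparr>carrier := k\<rparr>) S"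
    and a: "a \<in> carrier F" "(F.algebraic over k) a" and b: "b \<in> carrier F" "(F.algebraic over k) b"
  shows "\<exists>y n. y \<in> F.finite_extension k [a, b] \<and> frob_exp F n \<and> a \<in> F.simple_extension k y \<and>
    b [^]\<^bsub>F\<^esub> n \<in> F.simple_extension k y"
proof (cases "finite k")
  case True
  obtain y where "y \<in> F.finite_extension k [a, b]" "set [a, b] \<subseteq> F.simple_extension k y"
    using F.finite_primitive[OF k True, of "[a, b]"] a b by auto
  then show ?thesis using frob_exp_1[of F] b(1) by (intro exI[of _ y] exI[of _ 1]) simp
next
  case False
  note kr = subfieldE(1)[OF k] and kC = subfieldE(3)[OF k]
  obtain n where n: "frob_exp F n"
    and sep: "\<And>m. frob_exp F m \<Longrightarrow> b [^]\<^bsub>F\<^esub> n \<in> F.simple_extension k ((b [^]\<^bsub>F\<^esub> n) [^]\<^bsub>F\<^esub> m)"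
    using F.separable_power[OF k b] by blast
  define \<beta> where "\<beta> = b [^]\<^bsub>F\<^esub> n"
  have \<beta>: "\<beta> \<in> carrier F" "(F.algebraic over k) \<beta>" unfolding \<beta>_def by (rule F.algebraic_pow(2,3)[OF k b])+
  obtain V0 \<phi>0 where \<phi>0: "place F S V0 \<phi>0" "k \<subseteq> V0" "\<And>a. a \<in> k \<Longrightarrow> \<phi>0 a = h a"
    by (rule place_extends[OF kr h]; rule that)
  note V0 = placeD(1,2)[OF \<phi>0(1)]
  note in0 = algebraic_in_place[OF \<phi>0(1) k \<phi>0(2)]
  define A where "A = {z \<in> carrier S. S.eval (map h (F.Irr k a)) z = \<zero>\<^bsub>S\<^esub>}"
  define B where "B = {z \<in> carrier S. S.eval (map h (F.Irr k \<beta>)) z = \<zero>\<^bsub>S\<^esub>}"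
  note hm = ring_hom_memE[OF h, simplified]
  have fin: "finite {z \<in> carrier S. S.eval (map h (F.Irr k x)) z = \<zero>\<^bsub>S\<^esub>}" if x: "x \<in> carrier F" "(F.algebraic over k) x" for x
  proof -
    note I = F.IrrE[OF k x]
    have Ik: "set (F.Irr k x) \<subseteq> k" using I(1) F.polynomial_incl by (simp add: univ_poly_carrier[symmetric])
    have m: "map h (F.Irr k x) \<in> carrier (poly_ring S)" unfolding univ_poly_carrier[symmetric] polynomial_def
      using Ik I(3) hm(1,4) by (cases "F.Irr k x") auto
    have "F.Irr k x \<noteq> []" using F.pirreducible_degree[OF k I(1,2)] by auto
    then show ?thesis using S.finite_number_of_roots[OF m] by (simp add: S.is_root_def)
  qed
  have "finite A" "finite B" unfolding A_def B_def by (rule fin[OF a], rule fin[OF \<beta>])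
  moreover have "infinite (h ` k)"
    using False finite_imageD[OF _ F.subfield_hom_inj[OF k S.field_axioms h]] by blast
  \<comment> \<open>Finitely many values are excluded; a pair with zero denominator merely
    contributes one more of them.\<close>
  ultimately obtain c where c: "c \<in> k"
    "h c \<notin> (\<lambda>(u, v). (u \<ominus>\<^bsub>S\<^esub> \<phi>0 a) \<otimes>\<^bsub>S\<^esub> inv\<^bsub>S\<^esub> (\<phi>0 \<beta> \<ominus>\<^bsub>S\<^esub> v)) ` (A \<times> B)"
    by (metis (no_types, lifting) finite_SigmaI finite_imageI finite_subset image_subsetI)
  define y where "y = a \<oplus>\<^bsub>F\<^esub> c \<otimes>\<^bsub>F\<^esub> \<beta>"
  have cC: "c \<in> carrier F" using c(1) kC by blast
  have yE: "y \<in> F.finite_extension k [a, b]"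
  proof -
    have E: "subring (F.finite_extension k [a, b]) F" by (rule F.finite_extension_is_subring[OF kr]) (use a b in auto)
    have m: "a \<in> F.finite_extension k [a, b]" "b \<in> F.finite_extension k [a, b]"
      using F.finite_extension_mem[OF kr, of "[a, b]"] a b by auto
    have "c \<in> F.finite_extension k [a, b]" using F.finite_extension_incl[OF kC, of "[a, b]"] a(1) b(1) c(1) by auto
    moreover have "\<beta> \<in> F.finite_extension k [a, b]"
      unfolding \<beta>_def by (induction n) (use m(2) subringE(3,6)[OF E] in auto)
    ultimately show ?thesis unfolding y_def using m(1) subringE(6,7)[OF E] by blast
  qed
  have y: "y \<in> carrier F" "(F.algebraic over k) y"
    using F.finite_extension_in_carrier[OF kC, of "[a, b]"] F.finite_extesion_mem_imp_algebraic[OF k, of "[a, b]" y] yE a b by auto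
  let ?k = "F.simple_extension k y"
  have kf: "subfield ?k F" using F.simple_extension_is_subfield[OF k y(1)] y(2) by simp
  note k'r = subfieldE(1)[OF kf]
  have kk: "k \<subseteq> ?k" "y \<in> ?k" using F.simple_extension_incl[OF kC y(1)] F.simple_extension_mem[OF kr y(1)] by auto
  have kV: "?k \<subseteq> V0" by (rule F.simple_extension_subring_incl[OF V0(1) \<phi>0(2) in0[OF y]])
  have h0: "\<phi>0 \<in> ring_hom (F\<lparr>carrier := ?k\<rparr>) S" by (rule ring_hom_subring_mono[OF V0(2) kV])
  have \<beta>k: "(F.algebraic over ?k) \<beta>" using F.algebraic_mono[OF kk(1)] \<beta>(2) by simp
  have val: "\<phi> y = \<phi> a \<oplus>\<^bsub>S\<^esub> h c \<otimes>\<^bsub>S\<^esub> \<phi> \<beta>" "\<phi> a \<in> A" "\<phi> \<beta> \<in> B"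
    if \<phi>: "place F S V \<phi>" "k \<subseteq> V" "\<And>a. a \<in> k \<Longrightarrow> \<phi> a = h a" for V \<phi>
  proof -
    note V = placeD(1,2)[OF \<phi>(1)] note in1 = algebraic_in_place[OF \<phi>(1) k \<phi>(2)]
    have "c \<otimes>\<^bsub>F\<^esub> \<beta> \<in> V" using subringE(6)[OF V(1)] in1[OF \<beta>] c(1) \<phi>(2) by blast
    then show "\<phi> y = \<phi> a \<oplus>\<^bsub>S\<^esub> h c \<otimes>\<^bsub>S\<^esub> \<phi> \<beta>"
      unfolding y_def using ring_hom_memE(2,3)[OF V(2), simplified] in1[OF a] in1[OF \<beta>] \<phi>(2,3) c(1) by (simp add: subset_iff)
    show "\<phi> a \<in> A" "\<phi> \<beta> \<in> B" unfolding A_def B_def using place_root[OF \<phi> k] a \<beta> by blast+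
  qed
  have sepk: "\<beta> \<in> F.simple_extension ?k (\<beta> [^]\<^bsub>F\<^esub> m)" if "frob_exp F m" for m
    using sep[OF that] F.mono_simple_extension[OF kk(1)] unfolding \<beta>_def by blast
  have "{z \<in> carrier S. S.eval (map \<phi>0 (F.Irr ?k \<beta>)) z = \<zero>\<^bsub>S\<^esub>} \<subseteq> {\<phi>0 \<beta>}"
  proof (rule subsetI)
    fix z assume "z \<in> {z \<in> carrier S. S.eval (map \<phi>0 (F.Irr ?k \<beta>)) z = \<zero>\<^bsub>S\<^esub>}"
    then have z: "z \<in> carrier S" "S.eval (map \<phi>0 (F.Irr ?k \<beta>)) z = \<zero>\<^bsub>S\<^esub>" by auto
    obtain V \<phi> where \<phi>: "place F S V \<phi>" "?k \<subseteq> V" "\<And>a. a \<in> ?k \<Longrightarrow> \<phi> a = \<phi>0 a" "\<beta> \<in> V" "\<phi> \<beta> = z"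
      by (rule root_place[OF kf h0 \<beta>(1) \<beta>k z]; rule that)
    have "k \<subseteq> V" "\<And>a. a \<in> k \<Longrightarrow> \<phi> a = h a" using \<phi>(2,3) kk(1) \<phi>0(3) by auto
    note v = val[OF \<phi>(1) this] and v0 = val[OF \<phi>0]
    have C: "\<phi> a \<in> carrier S" "\<phi>0 a \<in> carrier S" "\<phi>0 \<beta> \<in> carrier S" "h c \<in> carrier S"
      using v(2) v0(2,3) c(1) hm(1) unfolding A_def B_def by auto
    have e: "\<phi> a \<oplus>\<^bsub>S\<^esub> h c \<otimes>\<^bsub>S\<^esub> z = \<phi>0 a \<oplus>\<^bsub>S\<^esub> h c \<otimes>\<^bsub>S\<^esub> \<phi>0 \<beta>"
      using v(1) v0(1) \<phi>(3)[OF kk(2)] \<phi>(5) by simp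
    have "\<phi>0 \<beta> = z"
    proof (rule ccontr)
      assume ne: "\<phi>0 \<beta> \<noteq> z"
      let ?d = "\<phi>0 \<beta> \<ominus>\<^bsub>S\<^esub> z"
      have d: "?d \<in> carrier S" "?d \<noteq> \<zero>\<^bsub>S\<^esub>" using ne C z(1) by (auto simp: S.r_right_minus_eq)
      have i: "inv\<^bsub>S\<^esub> ?d \<in> carrier S" "?d \<otimes>\<^bsub>S\<^esub> inv\<^bsub>S\<^esub> ?d = \<one>\<^bsub>S\<^esub>" using d S.field_Units by auto
      have "\<phi> a \<ominus>\<^bsub>S\<^esub> \<phi>0 a = h c \<otimes>\<^bsub>S\<^esub> ?d"
      proof -
        have "\<phi> a \<ominus>\<^bsub>S\<^esub> \<phi>0 a = (\<phi> a \<oplus>\<^bsub>S\<^esub> h c \<otimes>\<^bsub>S\<^esub> z) \<ominus>\<^bsub>S\<^esub> \<phi>0 a \<ominus>\<^bsub>S\<^esub> h c \<otimes>\<^bsub>S\<^esub> z" using C z(1) by algebra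
        also have "\<dots> = h c \<otimes>\<^bsub>S\<^esub> ?d" unfolding e using C z(1) by algebra
        finally show ?thesis .
      qed
      then have "(\<phi> a \<ominus>\<^bsub>S\<^esub> \<phi>0 a) \<otimes>\<^bsub>S\<^esub> inv\<^bsub>S\<^esub> ?d = h c" using i d C by (simp add: S.m_assoc)
      then show False using c(2) v(2) v(3) \<phi>(5) by force
    qed
    then show "z \<in> {\<phi>0 \<beta>}" by simp
  qed
  then have "card {z \<in> carrier S. S.eval (map \<phi>0 (F.Irr ?k \<beta>)) z = \<zero>\<^bsub>S\<^esub>} \<le> 1"
    by (metis card.empty card_insert_disjoint card_mono finite.emptyI finite.insertI insert_absorb empty_iff One_nat_def)
  then have "length (F.Irr ?k \<beta>) - 1 \<le> 1" using separable_roots[OF kf h0 \<beta>(1) \<beta>k sepk] by simp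
  moreover note I = F.IrrE[OF kf \<beta>(1) \<beta>k]
  moreover have "length (F.Irr ?k \<beta>) - 1 \<ge> 1" using F.pirreducible_degree[OF kf I(1,2)] .
  ultimately have "length (F.Irr ?k \<beta>) = 2" by simp
  then obtain u v where uv: "F.Irr ?k \<beta> = [u, v]" by (auto simp: numeral_2_eq_2 length_Suc_conv)
  have "set (F.Irr ?k \<beta>) \<subseteq> ?k" using I(1) F.polynomial_incl by (simp add: univ_poly_carrier[symmetric])
  then have vk: "v \<in> ?k" "v \<in> carrier F" using uv subringE(1)[OF k'r] by auto
  have "\<beta> \<oplus>\<^bsub>F\<^esub> v = \<zero>\<^bsub>F\<^esub>" using I(3,4) uv \<beta>(1) vk by simp
  then have "\<beta> = \<ominus>\<^bsub>F\<^esub> v" using F.minus_equality[of \<beta> v] \<beta>(1) vk(2) by simp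
  then have \<beta>in: "\<beta> \<in> ?k" using subringE(5)[OF k'r vk(1)] by simp
  have "a = y \<ominus>\<^bsub>F\<^esub> c \<otimes>\<^bsub>F\<^esub> \<beta>" unfolding y_def using a(1) cC \<beta>(1) by algebra
  also have "\<dots> \<in> ?k" unfolding a_minus_def
    by (intro subringE(5,6,7)[OF k'r] kk(2) \<beta>in subsetD[OF kk(1) c(1)])
  finally have "a \<in> ?k" .
  with yE n \<beta>in show ?thesis unfolding \<beta>_def by (intro exI conjI)
qed

text \<open>Powers of the elements of \<open>xs\<close> are placed in \<open>k(y)\<close>, and not
  the elements themselves, since an inseparable finite extension may have no generator. The map
  \<open>h\<close> supplies an algebraically closed field in which conjugates are counted.\<close>

theorem primitive_element:
  assumes k: "subfield k F" and h: "h \<in> ring_hom (F\<lparr>carrier := k\<rparr>) S"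
    and xs: "set xs \<subseteq> carrier F" "\<And>x. x \<in> set xs \<Longrightarrow> (F.algebraic over k) x"
  obtains y n where "y \<in> F.finite_extension k xs" "y \<in> carrier F" "(F.algebraic over k) y" "frob_exp F n"
    "\<And>x. x \<in> set xs \<Longrightarrow> x [^]\<^bsub>F\<^esub> n \<in> F.simple_extension k y"
proof -
  have "\<exists>y n. y \<in> F.finite_extension k xs \<and> frob_exp F n \<and> (\<forall>x \<in> set xs. x [^]\<^bsub>F\<^esub> n \<in> F.simple_extension k y)"
    using xs
  proof (induction xs)
    case Nil
    then show ?case using subringE(2)[OF subfieldE(1)[OF k]] frob_exp_1[of F] by (intro exI[of _ "\<zero>\<^bsub>F\<^esub>"] exI[of _ 1]) simp
  next
    case (Cons x xs)
    then obtain y n where y: "y \<in> F.finite_extension k xs" "frob_exp F n" "\<forall>x \<in> set xs. x [^]\<^bsub>F\<^esub> n \<in> F.simple_extension k y"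
      by auto
    have C: "set xs \<subseteq> carrier F" "x \<in> carrier F" "(F.algebraic over k) x" using Cons.prems by auto
    have yc: "y \<in> carrier F" "(F.algebraic over k) y"
      using F.finite_extension_in_carrier[OF subfieldE(3)[OF k] C(1)] y(1)
        F.finite_extesion_mem_imp_algebraic[OF k C(1)] Cons.prems(2) by auto
    obtain z m where z: "z \<in> F.finite_extension k [y, x]" "frob_exp F m" "y \<in> F.simple_extension k z" "x [^]\<^bsub>F\<^esub> m \<in> F.simple_extension k z"
      using primitive_pair[OF k h yc C(2,3)] by blast
    have sub: "subring (F.finite_extension k (x # xs)) F" by (rule F.finite_extension_is_subring[OF subfieldE(1)[OF k] Cons.prems(1)])
    have "F.finite_extension k [y, x] \<subseteq> F.finite_extension k (x # xs)"
    proof (rule F.finite_extension_subring_incl[OF sub])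
      show "k \<subseteq> F.finite_extension k (x # xs)" by (rule F.finite_extension_incl[OF subfieldE(3)[OF k] Cons.prems(1)])
      show "set [y, x] \<subseteq> F.finite_extension k (x # xs)"
        using F.finite_extension_mem[OF subfieldE(1)[OF k] Cons.prems(1)] y(1)
          F.finite_extension_incl_aux[OF subfieldE(3)[OF k] C(2,1)] by auto
    qed
    then have zE: "z \<in> F.finite_extension k (x # xs)" using z(1) by blast
    have zc: "z \<in> carrier F" using zE subringE(1)[OF sub] by blast
    have Z: "subring (F.simple_extension k z) F" by (rule F.simple_extension_subring[OF subfieldE(1)[OF k] zc])
    have pw: "a [^]\<^bsub>F\<^esub> (i::nat) \<in> F.simple_extension k z" if "a \<in> F.simple_extension k z" for a i
      by (induction i) (use that subringE(3,6)[OF Z] in auto)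
    have "w [^]\<^bsub>F\<^esub> (n * m) \<in> F.simple_extension k z" if w: "w \<in> set (x # xs)" for w
    proof (cases "w = x")
      case True
      then show ?thesis using pw[OF z(4), of n] C(2) by (simp add: F.nat_pow_pow mult.commute)
    next
      case False
      then have "w [^]\<^bsub>F\<^esub> n \<in> F.simple_extension k z" "w \<in> carrier F"
        using w y(3) F.simple_extension_trans[OF k zc z(3)] C(1) by auto
      then show ?thesis using pw[of "w [^]\<^bsub>F\<^esub> n" m] by (simp add: F.nat_pow_pow)
    qed
    then show ?case using zE frob_exp_mult[OF y(2) z(2)] by blast
  qed
  then obtain y n where y: "y \<in> F.finite_extension k xs" "frob_exp F n" "\<forall>x \<in> set xs. x [^]\<^bsub>F\<^esub> n \<in> F.simple_extension k y" by blast
  have "y \<in> carrier F" "(F.algebraic over k) y"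
    using F.finite_extension_in_carrier[OF subfieldE(3)[OF k] xs(1)] y(1)
      F.finite_extesion_mem_imp_algebraic[OF k xs(1)] xs(2) by auto
  with y show ?thesis by (intro that[of y n]) auto
qed

end

section \<open>Compactness for homomorphisms on algebraic elements\<close>

text \<open>A family of sets that is maximal with the finite intersection property on
  \<open>A\<close> must contain, for each \<open>a\<close>, one of the finitely many sets
  \<open>{x. x a = v}\<close>; \<open>y\<close> collects these values. The function \<open>y\<close>
  itself need not belong to \<open>A\<close>, it is only matched on finite sets.\<close>

lemma function_compactness:
  fixes A :: "('a \<Rightarrow> 'b) set" and C :: "('a \<Rightarrow> 'b) set set"
  assumes fin: "\<And>a. a \<in> I \<Longrightarrow> finite ((\<lambda>x. x a) ` A)"
    and fip: "\<And>J. finite J \<Longrightarrow> J \<subseteq> C \<Longrightarrow> A \<inter> \<Inter>J \<noteq> {}"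
  obtains y where "\<And>E J. finite E \<Longrightarrow> E \<subseteq> I \<Longrightarrow> finite J \<Longrightarrow> J \<subseteq> C \<Longrightarrow> \<exists>x \<in> A \<inter> \<Inter>J. \<forall>a \<in> E. x a = y a"
proof -
  define P where "P U \<longleftrightarrow> C \<subseteq> U \<and> (\<forall>J. finite J \<longrightarrow> J \<subseteq> U \<longrightarrow> A \<inter> \<Inter>J \<noteq> {})" for U
  have "\<exists>M \<in> Collect P. \<forall>Z \<in> Collect P. M \<subseteq> Z \<longrightarrow> Z = M"
  proof (rule subset_Zorn_nonempty)
    show "Collect P \<noteq> {}" using fip unfolding P_def by blast
    fix K assume K: "K \<noteq> {}" "subset.chain (Collect P) K"
    have "A \<inter> \<Inter>J \<noteq> {}" if J: "finite J" "J \<subseteq> \<Union>K" for J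
    proof -
      obtain Z where "Z \<in> K" "J \<subseteq> Z" using finite_subset_Union_chain[OF J K] by blast
      then show ?thesis using K(2) J(1) unfolding subset_chain_def P_def by blast
    qed
    then show "\<Union>K \<in> Collect P" using K unfolding subset_chain_def P_def by blast
  qed
  then obtain U where U: "P U" and max: "\<And>Z. P Z \<Longrightarrow> U \<subseteq> Z \<Longrightarrow> Z = U" by blast
  have UJ: "A \<inter> \<Inter>J \<noteq> {}" if "finite J" "J \<subseteq> U" for J using U that unfolding P_def by blast
  have "\<exists>v. {x. x a = v} \<in> U" if a: "a \<in> I" for a
  proof (rule ccontr)
    assume *: "\<nexists>v. {x. x a = v} \<in> U"
    have "\<exists>J. finite J \<and> J \<subseteq> U \<and> A \<inter> \<Inter>J \<inter> {x. x a = v} = {}" for v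
    proof -
      have "\<not> P (insert {x. x a = v} U)" using max[of "insert {x. x a = v} U"] * by blast
      then obtain J where J: "finite J" "J \<subseteq> insert {x. x a = v} U" "A \<inter> \<Inter>J = {}"
        using U unfolding P_def by blast
      then have "finite (J - {{x. x a = v}})" "J - {{x. x a = v}} \<subseteq> U"
        "A \<inter> \<Inter>(J - {{x. x a = v}}) \<inter> {x. x a = v} = {}" by blast+
      then show ?thesis by blast
    qed
    then obtain J where J: "\<And>v. finite (J v)" "\<And>v. J v \<subseteq> U" "\<And>v. A \<inter> \<Inter>(J v) \<inter> {x. x a = v} = {}" by metis
    let ?J = "\<Union>(J ` (\<lambda>x. x a) ` A)"
    have "finite ?J" using fin[OF a] J(1) by blast
    moreover have "?J \<subseteq> U" using J(2) by blast
    ultimately obtain x where "x \<in> A" "x \<in> \<Inter>?J" using UJ by blast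
    then show False using J(3)[of "x a"] by blast
  qed
  then obtain y where y: "\<And>a. a \<in> I \<Longrightarrow> {x. x a = y a} \<in> U" by metis
  show ?thesis
  proof (rule that)
    fix E J assume EJ: "finite E" "E \<subseteq> I" "finite J" "J \<subseteq> C"
    let ?J = "J \<union> (\<lambda>a. {x. x a = y a}) ` E"
    have "C \<subseteq> U" using U unfolding P_def by blast
    then have "?J \<subseteq> U" using EJ(2,4) y by auto
    then have "A \<inter> \<Inter>?J \<noteq> {}" using EJ(1,3) by (intro UJ) auto
    then obtain x where x: "x \<in> A" "x \<in> \<Inter>?J" by auto
    from x(2) have "x \<in> \<Inter>J" "\<forall>a \<in> E. x a = y a" by auto
    with x(1) show "\<exists>x \<in> A \<inter> \<Inter>J. \<forall>a \<in> E. x a = y a" by (intro bexI[of _ x] IntI)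
  qed
qed

context field_pair
begin

lemma Irr_image:
  assumes k: "subfield k F" and h: "h \<in> ring_hom (F\<lparr>carrier := k\<rparr>) S" and x: "x \<in> carrier F" "(F.algebraic over k) x"
  shows "set (F.Irr k x) \<subseteq> k" "map h (F.Irr k x) \<in> carrier (poly_ring S)" "length (F.Irr k x) \<ge> 2"
    "finite {z \<in> carrier S. S.eval (map h (F.Irr k x)) z = \<zero>\<^bsub>S\<^esub>}"
proof -
  note I = F.IrrE[OF k x] and hm = ring_hom_memE[OF h, simplified]
  show Ik: "set (F.Irr k x) \<subseteq> k" using I(1) F.polynomial_incl by (simp add: univ_poly_carrier[symmetric])
  show m: "map h (F.Irr k x) \<in> carrier (poly_ring S)" unfolding univ_poly_carrier[symmetric] polynomial_def
    using Ik I(3) hm(1,4) by (cases "F.Irr k x") auto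
  show l: "length (F.Irr k x) \<ge> 2" using F.pirreducible_degree[OF k I(1,2)] by simp
  then have "F.Irr k x \<noteq> []" by auto
  then show "finite {z \<in> carrier S. S.eval (map h (F.Irr k x)) z = \<zero>\<^bsub>S\<^esub>}"
    using S.finite_number_of_roots[OF m] by (simp add: S.is_root_def)
qed

lemma hom_root:
  assumes k: "subfield k F" and A: "subring A F" "k \<subseteq> A" "x \<in> A" and x: "(F.algebraic over k) x"
    and g: "g \<in> ring_hom (F\<lparr>carrier := A\<rparr>) S" "\<And>a. a \<in> k \<Longrightarrow> g a = h a"
  shows "g x \<in> carrier S" "S.eval (map h (F.Irr k x)) (g x) = \<zero>\<^bsub>S\<^esub>"
proof -
  have xc: "x \<in> carrier F" using A(3) subringE(1)[OF A(1)] by blast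
  show "g x \<in> carrier S" using ring_hom_memE(1)[OF g(1)] A(3) by simp
  have I: "set (F.Irr k x) \<subseteq> k" using F.IrrE(1)[OF k xc x] F.polynomial_incl by (simp add: univ_poly_carrier[symmetric])
  have e: "map h (F.Irr k x) = map g (F.Irr k x)" using I g(2) by auto
  show "S.eval (map h (F.Irr k x)) (g x) = \<zero>\<^bsub>S\<^esub>" unfolding e
    using F.subring_hom_eval[OF A(1) S.ring_axioms g(1) order_trans[OF I A(2)] A(3)] F.IrrE(4)[OF k xc x]
      F.subring_hom_zero[OF A(1) S.ring_axioms g(1)] by simp
qed

text \<open>A homomorphism extending \<open>h\<close> has finitely many possible values at an
  algebraic element, namely the roots of a fixed polynomial. The laws of a homomorphism and each
  condition \<open>r i\<close> involve finitely many arguments at a time, so they pass to the limit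
  function.\<close>

lemma hom_compactness:
  assumes k: "subfield k F" and h: "h \<in> ring_hom (F\<lparr>carrier := k\<rparr>) S"
    and A: "subring A F" "k \<subseteq> A" "\<And>x. x \<in> A \<Longrightarrow> (F.algebraic over k) x"
    and pq: "\<And>i. i \<in> I \<Longrightarrow> p i \<in> A" "\<And>i. i \<in> I \<Longrightarrow> q i \<in> A"
    and sat: "\<And>J. finite J \<Longrightarrow> J \<subseteq> I \<Longrightarrow> \<exists>g. g \<in> ring_hom (F\<lparr>carrier := A\<rparr>) S \<and> (\<forall>a \<in> k. g a = h a) \<and> (\<forall>i \<in> J. r i (g (p i)) (g (q i)))"
  obtains g where "g \<in> ring_hom (F\<lparr>carrier := A\<rparr>) S" "\<And>a. a \<in> k \<Longrightarrow> g a = h a" "\<And>i. i \<in> I \<Longrightarrow> r i (g (p i)) (g (q i))"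
proof -
  define H where "H = {g \<in> ring_hom (F\<lparr>carrier := A\<rparr>) S. \<forall>a \<in> k. g a = h a}"
  define D where "D i = {g. r i (g (p i)) (g (q i))}" for i
  have "finite ((\<lambda>g. g x) ` H)" if x: "x \<in> A" for x
  proof (rule finite_subset)
    have xc: "x \<in> carrier F" using x subringE(1)[OF A(1)] by blast
    show "finite {z \<in> carrier S. S.eval (map h (F.Irr k x)) z = \<zero>\<^bsub>S\<^esub>}" by (rule Irr_image(4)[OF k h xc A(3)[OF x]])
    show "(\<lambda>g. g x) ` H \<subseteq> {z \<in> carrier S. S.eval (map h (F.Irr k x)) z = \<zero>\<^bsub>S\<^esub>}"
      using hom_root[OF k A(1,2) x A(3)[OF x]] unfolding H_def by auto
  qed
  moreover have "H \<inter> \<Inter>J \<noteq> {}" if J: "finite J" "J \<subseteq> D ` I" for J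
  proof -
    obtain J' where "J' \<subseteq> I" "finite J'" "J = D ` J'" using finite_subset_image[OF J] by blast
    then show ?thesis using sat[of J'] unfolding H_def D_def by blast
  qed
  ultimately obtain g where g: "\<And>E J. finite E \<Longrightarrow> E \<subseteq> A \<Longrightarrow> finite J \<Longrightarrow> J \<subseteq> D ` I \<Longrightarrow> \<exists>x \<in> H \<inter> \<Inter>J. \<forall>a \<in> E. x a = g a"
    using function_compactness[of A H "D ` I"] by metis
  have gE: "\<exists>x. x \<in> ring_hom (F\<lparr>carrier := A\<rparr>) S \<and> (\<forall>a \<in> k. x a = h a) \<and> (\<forall>a \<in> E. x a = g a)" if "finite E" "E \<subseteq> A" for E
    using g[OF that, of "{}"] unfolding H_def by auto
  note sr = subringE[OF A(1)]
  show ?thesis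
  proof (rule that)
    show "g \<in> ring_hom (F\<lparr>carrier := A\<rparr>) S"
    proof (rule ring_hom_memI)
      fix a b assume "a \<in> carrier (F\<lparr>carrier := A\<rparr>)" "b \<in> carrier (F\<lparr>carrier := A\<rparr>)"
      then have ab: "a \<in> A" "b \<in> A" by simp_all
      obtain x where x: "x \<in> ring_hom (F\<lparr>carrier := A\<rparr>) S" "\<forall>c \<in> {a, b, a \<otimes>\<^bsub>F\<^esub> b, a \<oplus>\<^bsub>F\<^esub> b}. x c = g c"
        using gE[of "{a, b, a \<otimes>\<^bsub>F\<^esub> b, a \<oplus>\<^bsub>F\<^esub> b}"] ab sr(6,7) by auto
      show "g a \<in> carrier S" "g (a \<otimes>\<^bsub>F\<lparr>carrier := A\<rparr>\<^esub> b) = g a \<otimes>\<^bsub>S\<^esub> g b" "g (a \<oplus>\<^bsub>F\<lparr>carrier := A\<rparr>\<^esub> b) = g a \<oplus>\<^bsub>S\<^esub> g b"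
        using ring_hom_memE[OF x(1), simplified] ab x(2) by (metis insert_iff, simp_all, (metis insert_iff)+)
    next
      obtain x where x: "x \<in> ring_hom (F\<lparr>carrier := A\<rparr>) S" "\<forall>c \<in> {\<one>\<^bsub>F\<^esub>}. x c = g c"
        using gE[of "{\<one>\<^bsub>F\<^esub>}"] sr(3) by auto
      then show "g \<one>\<^bsub>F\<lparr>carrier := A\<rparr>\<^esub> = \<one>\<^bsub>S\<^esub>" using ring_hom_memE(4)[OF x(1)] by simp
    qed
    show "g a = h a" if "a \<in> k" for a using gE[of "{a}"] that A(2) by force
    show "r i (g (p i)) (g (q i))" if i: "i \<in> I" for i
    proof -
      obtain x where "x \<in> D i" "x (p i) = g (p i)" "x (q i) = g (q i)"
        using g[of "{p i, q i}" "{D i}"] pq[OF i] i by auto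
      then show ?thesis unfolding D_def by simp
    qed
  qed
qed

end

section \<open>Iterates of an endomorphism on an algebraic element\<close>

context field
begin

lemma dimension_eq:
  assumes k: "subfield k R" and d: "dimension n k V" "dimension m k W" "V \<subseteq> W"
  shows "n \<le> m" "m \<le> n \<Longrightarrow> V = W"
proof -
  obtain Us where Us: "set Us \<subseteq> carrier R" "independent k Us" "length Us = n" "Span k Us = V"
    using exists_base[OF k d(1)] by blast
  have UW: "set Us \<subseteq> W" using Span_base_incl[OF k Us(1)] Us(4) d(3) by blast
  show le: "n \<le> m" using independent_length_le_dimension[OF k d(2) Us(2) UW] Us(3) by simp
  show "V = W" if "m \<le> n"
    using independent_length_eq_dimension[OF k d(2) Us(2) UW] le that Us(3,4) by simp
qed

lemma hom_preimage_subring: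
  assumes "\<theta> \<in> ring_hom R R" "subring V R" shows "subring {x \<in> carrier R. \<theta> x \<in> V} R"
proof -
  interpret ring_hom_ring R R \<theta> by (rule ring_hom_ringI2[OF ring_axioms ring_axioms assms(1)])
  show ?thesis by (rule subringI) (use subringE[OF assms(2)] in \<open>auto simp: hom_a_inv\<close>)
qed

lemma hom_simple_extension:
  assumes \<theta>: "\<theta> \<in> ring_hom R R" "\<theta> ` k \<subseteq> k'" and k: "subring k R" "subring k' R"
    and y: "y \<in> carrier R" "x \<in> simple_extension k y"
  shows "\<theta> x \<in> simple_extension k' (\<theta> y)"
proof -
  have ty: "\<theta> y \<in> carrier R" using ring_hom_memE(1)[OF \<theta>(1) y(1)] .
  have "simple_extension k y \<subseteq> {x \<in> carrier R. \<theta> x \<in> simple_extension k' (\<theta> y)}"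
    by (rule simple_extension_subring_incl[OF hom_preimage_subring[OF \<theta>(1) simple_extension_subring[OF k(2) ty]]])
      (use simple_extension_incl[OF subringE(1)[OF k(2)] ty] simple_extension_mem[OF k(2) ty] \<theta>(2) y(1) subringE(1)[OF k(1)] in auto)
  then show ?thesis using y(2) by blast
qed

text \<open>The image of the minimal polynomial of \<open>x\<close> annihilates
  \<open>\<theta> x\<close>.\<close>

lemma deg_over_hom:
  assumes G: "subfield G R" and H: "subfield H R" and \<theta>: "\<theta> \<in> ring_hom R R" "\<theta> ` G \<subseteq> H"
    and x: "x \<in> carrier R" "(algebraic over G) x"
  shows "(algebraic over H) (\<theta> x)" "deg_over H (\<theta> x) \<le> deg_over G x"
proof -
  have "(algebraic over \<theta> ` G) (\<theta> x)" by (rule algebraic_hom[OF \<theta>(1) field_axioms field_axioms G x])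
  then show a: "(algebraic over H) (\<theta> x)" using algebraic_mono[OF \<theta>(2)] by simp
  note I = IrrE[OF G x]
  have tx: "\<theta> x \<in> carrier R" using ring_hom_memE(1)[OF \<theta>(1) x(1)] .
  interpret t: ring_hom_ring R R \<theta> by (rule ring_hom_ringI2[OF ring_axioms ring_axioms \<theta>(1)])
  let ?p = "map \<theta> (Irr G x)"
  have I1: "set (Irr G x) \<subseteq> G" using I(1) polynomial_incl by (simp add: univ_poly_carrier[symmetric])
  have ne: "Irr G x \<noteq> []" using pirreducible_degree[OF G I(1,2)] by auto
  have p: "?p \<in> carrier (H[X])" unfolding univ_poly_carrier[symmetric] polynomial_def
    using I1 \<theta>(2) ne I(3) by (cases "Irr G x") auto
  have "eval ?p (\<theta> x) = \<zero>" using t.eval_hom'[OF x(1), of "Irr G x"] I1 subfieldE(3)[OF G] I(4) by auto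
  then have "Irr H (\<theta> x) pdivides ?p" by (rule Irr_minimal[OF H tx a p])
  then show "deg_over H (\<theta> x) \<le> deg_over G x"
    using pdivides_imp_degree_le[OF subfieldE(1)[OF H] IrrE(1)[OF H tx a] p] ne by simp
qed

lemma deg_over_mono:
  assumes "subfield G R" "subfield H R" "G \<subseteq> H" "x \<in> carrier R" "(algebraic over G) x"
  shows "deg_over H x \<le> deg_over G x"
  using deg_over_hom(2)[OF assms(1,2), of id x] assms(3-5) by (simp add: ring_hom_def)

lemma deg_over_pos:
  assumes "subfield G R" "x \<in> carrier R" "(algebraic over G) x" shows "deg_over G x \<ge> 1"
  using pirreducible_degree[OF assms(1) IrrE(1,2)[OF assms]] .

end

lemma ring_hom_funpow: "\<tau> \<in> ring_hom R R \<Longrightarrow> \<tau> ^^ n \<in> ring_hom R R"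
proof (induction n)
  case 0 show ?case by (simp add: ring_hom_def)
next
  case (Suc n) then show ?case using ring_hom_trans[of "\<tau> ^^ n" R R \<tau>] by (simp add: comp_def)
qed

locale field_endo = F: field F for F :: "'f ring" +
  fixes k \<tau>
  assumes k: "subfield k F" and \<tau>: "\<tau> \<in> ring_hom F F" and \<tau>k: "\<tau> ` k \<subseteq> k"
begin

definition good :: "'f \<Rightarrow> bool"
  where "good x \<longleftrightarrow> x \<in> carrier F \<and> (F.algebraic over k) x \<and> \<tau> x \<in> F.simple_extension k x \<and>
    x \<in> F.simple_extension k (\<tau> x) \<and> (\<forall>n. frob_exp F n \<longrightarrow> x \<in> F.simple_extension k (x [^]\<^bsub>F\<^esub> n))"

lemmas kr = subfieldE(1)[OF k] and kC = subfieldE(3)[OF k]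

lemma \<tau>n: "\<tau> ^^ n \<in> ring_hom F F" by (rule ring_hom_funpow[OF \<tau>])

lemma \<tau>n_closed: "x \<in> carrier F \<Longrightarrow> (\<tau> ^^ n) x \<in> carrier F"
  using ring_hom_memE(1)[OF \<tau>n] .

lemma \<tau>nk: "(\<tau> ^^ n) ` k \<subseteq> k"
  by (induction n) (use \<tau>k in auto)

lemma algebraic_\<tau>n: "x \<in> carrier F \<Longrightarrow> (F.algebraic over k) x \<Longrightarrow> (F.algebraic over k) ((\<tau> ^^ n) x)"
  using F.deg_over_hom(1)[OF k k \<tau>n \<tau>nk] by blast

text \<open>The element is one of least degree among the images of \<open>c\<close> under powers of
  \<tau> followed by \<open>q\<close>-th powers, so its further powers generate the same field.
  Applying the same map to the hypothesis on \<open>\<tau> c\<close> puts an \<open>n\<close>-th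
  power of the next image into the field generated by the present one, and minimality recovers the
  image itself from this power.\<close>

lemma good_from_finite:
  assumes c: "c \<in> carrier F" "(F.algebraic over k) c" and n: "frob_exp F n" "(\<tau> c) [^]\<^bsub>F\<^esub> n \<in> F.simple_extension k c"
  obtains r m where "frob_exp F m" "good (((\<tau> ^^ r) c) [^]\<^bsub>F\<^esub> m)"
proof -
  define g where "g r m = ((\<tau> ^^ r) c) [^]\<^bsub>F\<^esub> m" for r and m :: nat
  have gc: "g r m \<in> carrier F" "(F.algebraic over k) (g r m)" for r m
    unfolding g_def using F.algebraic_pow(2,3)[OF k \<tau>n_closed[OF c(1)] algebraic_\<tau>n[OF c]] by blast+
  obtain rm where rm: "frob_exp F (snd rm)" "\<And>r m. frob_exp F m \<Longrightarrow> F.deg_over k (g (fst rm) (snd rm)) \<le> F.deg_over k (g r m)"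
    using ex_has_least_nat[of "\<lambda>rm. frob_exp F (snd rm)" "(0, 1)" "\<lambda>rm. F.deg_over k (g (fst rm) (snd rm))"] frob_exp_1[of F]
    by (metis fst_conv snd_conv)
  define r m where "r = fst rm" and "m = snd rm"
  have m: "frob_exp F m" and min: "\<And>r' m'. frob_exp F m' \<Longrightarrow> F.deg_over k (g r m) \<le> F.deg_over k (g r' m')"
    using rm by (simp_all add: r_def m_def)
  let ?x = "g r m"
  have gp: "g r' m' [^]\<^bsub>F\<^esub> i = g r' (m' * i)" for r' m' and i :: nat
    unfolding g_def using F.nat_pow_pow[OF \<tau>n_closed[OF c(1)]] by simp
  interpret t: ring_hom_ring F F \<tau> by (rule ring_hom_ringI2[OF F.ring_axioms F.ring_axioms \<tau>])
  have gt: "\<tau> (g r' m') = g (Suc r') m'" for r' m'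
    unfolding g_def using t.hom_nat_pow[OF \<tau>n_closed[OF c(1)]] by simp
  have sp: "?x \<in> F.simple_extension k (?x [^]\<^bsub>F\<^esub> i)" if i: "frob_exp F i" for i
    using F.deg_over_le(2)[OF k gc F.algebraic_pow(1)[OF k gc]] min[OF frob_exp_mult[OF m i]] by (simp add: gp)
  let ?t = "\<lambda>x. ((\<tau> ^^ r) x) [^]\<^bsub>F\<^esub> m"
  have th: "?t \<in> ring_hom F F"
    using ring_hom_trans[OF \<tau>n F.frob_hom[OF m], of r] by (simp add: comp_def)
  have tk: "?t ` k \<subseteq> k"
  proof -
    have "y [^]\<^bsub>F\<^esub> i \<in> k" if "y \<in> k" for y and i :: nat
      by (induction i) (use that subringE(3,6)[OF kr] in auto)
    then show ?thesis using \<tau>nk[of r] by blast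
  qed
  have "?t ((\<tau> c) [^]\<^bsub>F\<^esub> n) \<in> F.simple_extension k (?t c)"
    by (rule F.hom_simple_extension[OF th tk kr kr c(1) n(2)])
  moreover have "?t ((\<tau> c) [^]\<^bsub>F\<^esub> n) = g (Suc r) m [^]\<^bsub>F\<^esub> n"
  proof -
    interpret tr: ring_hom_ring F F "\<tau> ^^ r" by (rule ring_hom_ringI2[OF F.ring_axioms F.ring_axioms \<tau>n])
    have "\<tau> c \<in> carrier F" using c(1) by simp
    then show ?thesis unfolding g_def using F.nat_pow_pow \<tau>n_closed
      by (simp add: tr.hom_nat_pow funpow_swap1 mult.commute)
  qed
  ultimately have e: "g (Suc r) m [^]\<^bsub>F\<^esub> n \<in> F.simple_extension k ?x" by (simp add: g_def)
  \<comment> \<open>Since \<tau> does not raise degrees and \<open>?x\<close> has the least one,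
    \<open>\<tau> ?x\<close> and its \<open>n\<close>-th power have the same degree and generate the
    same field.\<close>
  have "F.deg_over k (g (Suc r) m) \<le> F.deg_over k ?x"
    using F.deg_over_hom(2)[OF k k \<tau> \<tau>k gc, of r m] by (simp add: gt)
  also have "\<dots> \<le> F.deg_over k (g (Suc r) m [^]\<^bsub>F\<^esub> n)" unfolding gp by (rule min[OF frob_exp_mult[OF m n(1)]])
  finally have "g (Suc r) m \<in> F.simple_extension k (g (Suc r) m [^]\<^bsub>F\<^esub> n)"
    by (rule F.deg_over_le(2)[OF k gc F.algebraic_pow(1)[OF k gc]])
  then have tx: "\<tau> ?x \<in> F.simple_extension k ?x"
    unfolding gt using F.simple_extension_trans[OF k gc(1) e] by blast
  moreover have "?x \<in> F.simple_extension k (\<tau> ?x)"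
    by (rule F.deg_over_le(2)[OF k gc tx]) (simp only: gt, rule min[OF m])
  ultimately have "good ?x" unfolding good_def using gc sp by blast
  with m show ?thesis unfolding g_def by (rule that)
qed

end

context field
begin

lemma Span_in_subring:
  assumes k: "subfield k R" and V: "subring V R" "k \<subseteq> V" and Us: "set Us \<subseteq> V"
  shows "Span k Us \<subseteq> V"
proof (rule subalgebra_Span_incl[OF k _ Us])
  show "subalgebra k V R"
    using V subringE(6)[OF V(1)] by (intro subalgebra.intro subalgebra_axioms.intro) (auto simp: subring_def)
qed

end

section \<open>Fields generated by the tails of an orbit\<close>

context field_endo
begin

text \<open>The field generated over \<open>G\<close> by \<open>j\<close> successive iterates,
  starting with \<open>\<tau>\<^sup>t b\<close>. It is built one generator at a time, so that its
  degree over \<open>G\<close> is a product of numbers \<open>dg\<close>. The base is variable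
  because \<open>limit_bounded\<close> compares towers over \<open>k\<close> with towers over an
  intermediate field.\<close>

primrec tower :: "'f \<Rightarrow> 'f set \<Rightarrow> nat \<Rightarrow> nat \<Rightarrow> 'f set"
  where "tower b G t 0 = G"
  | "tower b G t (Suc j) = F.simple_extension (tower b G t j) ((\<tau> ^^ (t + j)) b)"

definition tail :: "'f \<Rightarrow> nat \<Rightarrow> 'f set"
  where "tail b n = (\<Union>j. tower b k n j)"

definition limit :: "'f \<Rightarrow> 'f set"
  where "limit b = (\<Inter>n. tail b n)"

context
  fixes b
  assumes b: "b \<in> carrier F" "(F.algebraic over k) b"
begin

lemma orbit: "(\<tau> ^^ i) b \<in> carrier F" "k \<subseteq> G \<Longrightarrow> (F.algebraic over G) ((\<tau> ^^ i) b)"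
  using \<tau>n_closed[OF b(1)] F.algebraic_mono algebraic_\<tau>n[OF b] by blast+

lemma tower_subfield:
  assumes "subfield G F" "k \<subseteq> G"
  shows "subfield (tower b G t j) F" "G \<subseteq> tower b G t j"
proof (induction j)
  case (Suc j)
  case 1 show ?case using F.simple_extension_is_subfield[OF Suc(1) orbit(1)] orbit(2) Suc(2) assms(2) by simp
  case 2 show ?case using F.simple_extension_incl[OF subfieldE(3)[OF Suc(1)] orbit(1)] Suc(2) by auto
qed (use assms in simp_all)

lemma tower_mono_length:
  assumes "subfield G F" "k \<subseteq> G" "i \<le> j" shows "tower b G t i \<subseteq> tower b G t j"
  using assms(3)
proof (induction j)
  case (Suc j)
  have "tower b G t j \<subseteq> tower b G t (Suc j)"
    using F.simple_extension_incl[OF subfieldE(3)[OF tower_subfield(1)[OF assms(1,2)]] orbit(1)] by simp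
  then show ?case using Suc by (cases "i = Suc j") auto
qed simp

lemma tower_mem:
  assumes "subfield G F" "k \<subseteq> G" "i < j" shows "(\<tau> ^^ (t + i)) b \<in> tower b G t j"
proof -
  have "(\<tau> ^^ (t + i)) b \<in> tower b G t (Suc i)"
    using F.simple_extension_mem[OF subfieldE(1)[OF tower_subfield(1)[OF assms(1,2)]] orbit(1)] by simp
  then show ?thesis using tower_mono_length[OF assms(1,2), of "Suc i" j] assms(3) by auto
qed

lemma tower_least:
  assumes "subring V F" "G \<subseteq> V" "\<And>i. i < j \<Longrightarrow> (\<tau> ^^ (t + i)) b \<in> V"
  shows "tower b G t j \<subseteq> V"
  using assms(3)
proof (induction j)
  case (Suc j)
  then show ?case using F.simple_extension_subring_incl[OF assms(1), of "tower b G t j"] by simp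
qed (use assms(2) in simp)

lemma tower_add: "tower b (tower b G t a) (t + a) j = tower b G t (a + j)"
  by (induction j) (simp_all add: add.assoc)

lemmas kk = k subset_refl[of k]

lemma tower_hom: "(\<tau> ^^ n) ` tower b k t j \<subseteq> tower b k (n + t) j"
proof (induction j)
  case (Suc j)
  show ?case
  proof
    fix y assume "y \<in> (\<tau> ^^ n) ` tower b k t (Suc j)"
    then obtain x where x: "y = (\<tau> ^^ n) x" "x \<in> F.simple_extension (tower b k t j) ((\<tau> ^^ (t + j)) b)" by auto
    note sr = subfieldE(1)[OF tower_subfield(1)[OF kk]]
    have "(\<tau> ^^ n) x \<in> F.simple_extension (tower b k (n + t) j) ((\<tau> ^^ n) ((\<tau> ^^ (t + j)) b))"
      by (rule F.hom_simple_extension[OF \<tau>n Suc sr sr orbit(1) x(2)])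
    then show "y \<in> tower b k (n + t) (Suc j)" using x(1) by (simp add: funpow_add add.assoc)
  qed
qed (use \<tau>nk in simp)

lemma tower_shift: "tower b k (Suc t) j \<subseteq> tower b k t (Suc j)"
proof (rule tower_least[OF subfieldE(1)[OF tower_subfield(1)[OF kk]] tower_subfield(2)[OF kk]])
  show "(\<tau> ^^ (Suc t + i)) b \<in> tower b k t (Suc j)" if "i < j" for i
    using tower_mem[OF kk, of "Suc i" "Suc j" t] that by simp
qed

definition dg :: "'f set \<Rightarrow> nat \<Rightarrow> nat \<Rightarrow> nat"
  where "dg G t i = F.deg_over (tower b G t i) ((\<tau> ^^ (t + i)) b)"

lemma tower_dim:
  assumes "subfield G F" "k \<subseteq> G"
  shows "F.dimension (\<Prod>i<j. dg G t i) G (tower b G t j)"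
proof (induction j)
  case 0 show ?case using F.dimension_one[OF assms(1)] by simp
next
  case (Suc j)
  note T = tower_subfield[OF assms, of t j]
  have "k \<subseteq> tower b G t j" using T(2) assms(2) by blast
  then have "F.dimension (dg G t j) (tower b G t j) (tower b G t (Suc j))"
    using F.dimension_simple_extension[OF T(1) orbit(1) orbit(2)] by (simp add: dg_def)
  from F.telescopic_base[OF assms(1) T(1) Suc this] show ?case by simp
qed

lemma dg_pos: "subfield G F \<Longrightarrow> k \<subseteq> G \<Longrightarrow> dg G t i \<ge> 1"
  unfolding dg_def using tower_subfield[of G t i] by (intro F.deg_over_pos orbit) auto

text \<open>The map \<tau> carries the minimal polynomial of an iterate to an annihilating
  polynomial of the next iterate, whose coefficients lie in the next stage of the tower.\<close>

lemma dg_anti: "dg k 0 (Suc i) \<le> dg k 0 i"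
proof -
  have "\<tau> ` tower b k 0 i \<subseteq> tower b k 0 (Suc i)"
    using tower_hom[of 1 0 i] tower_shift[of 0 i] by simp
  from F.deg_over_hom(2)[OF tower_subfield(1)[OF kk] tower_subfield(1)[OF kk] \<tau> this orbit(1) orbit(2)[OF tower_subfield(2)[OF kk]], of i]
  show ?thesis by (simp add: dg_def)
qed

lemma dg_shift: "dg k t i \<le> dg k 0 i"
proof -
  have "(\<tau> ^^ t) ` tower b k 0 i \<subseteq> tower b k t i" using tower_hom[of t 0 i] by simp
  from F.deg_over_hom(2)[OF tower_subfield(1)[OF kk] tower_subfield(1)[OF kk] \<tau>n this orbit(1) orbit(2)[OF tower_subfield(2)[OF kk]], of i]
  show ?thesis by (simp add: dg_def funpow_add)
qed

text \<open>Over the past \<open>tower b k 0 m\<close>, which contains \<open>G\<close>, the later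
  iterates have at most the degree that they have over \<open>G\<close>. This is the lower bound in
  \<open>limit_bounded\<close>.\<close>

lemma dg_base:
  assumes "subfield G F" "k \<subseteq> G" "G \<subseteq> tower b k 0 m"
  shows "dg k 0 (m + i) \<le> dg G m i"
proof -
  note T = tower_subfield[OF kk, of 0 m]
  have e: "tower b (tower b k 0 m) m i = tower b k 0 (m + i)" using tower_add[of k 0 m i] by simp
  have "tower b G m i \<subseteq> tower b (tower b k 0 m) m i"
  proof (rule tower_least)
    show "subring (tower b (tower b k 0 m) m i) F" by (rule subfieldE(1)[OF tower_subfield(1)[OF T]])
    show "G \<subseteq> tower b (tower b k 0 m) m i" using assms(3) tower_subfield(2)[OF T] by blast
    show "(\<tau> ^^ (m + l)) b \<in> tower b (tower b k 0 m) m i" if "l < i" for l by (rule tower_mem[OF T that])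
  qed
  then have "F.deg_over (tower b k 0 (m + i)) ((\<tau> ^^ (m + i)) b) \<le> F.deg_over (tower b G m i) ((\<tau> ^^ (m + i)) b)"
    unfolding e using tower_subfield[OF assms(1,2), of m i] assms(2)
    by (intro F.deg_over_mono tower_subfield(1)[OF kk] orbit) auto
  then show ?thesis by (simp add: dg_def)
qed

lemma tail_subfield: "subfield (tail b n) F" "k \<subseteq> tail b n"
proof -
  note T = tower_subfield[OF kk, of n]
  have two: "\<exists>j. x \<in> tower b k n j \<and> y \<in> tower b k n j" if xy: "x \<in> tail b n" "y \<in> tail b n" for x y
  proof -
    obtain i j where ij: "x \<in> tower b k n i" "y \<in> tower b k n j" using xy unfolding tail_def by auto
    then show ?thesis
      using tower_mono_length[OF kk, of i "max i j" n] tower_mono_length[OF kk, of j "max i j" n] by (intro exI[of _ "max i j"]) auto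
  qed
  show k: "k \<subseteq> tail b n" unfolding tail_def using T(2) by blast
  note R = subringE[OF subfieldE(1)[OF T(1)]]
  show "subfield (tail b n) F"
  proof (rule F.subfieldI'[OF F.subringI])
    show "tail b n \<subseteq> carrier F" unfolding tail_def using R(1) by blast
    show "\<one>\<^bsub>F\<^esub> \<in> tail b n" using k subringE(3)[OF kr] by blast
    show "\<ominus>\<^bsub>F\<^esub> x \<in> tail b n" if "x \<in> tail b n" for x using that R(5) unfolding tail_def by blast
    show "x \<otimes>\<^bsub>F\<^esub> y \<in> tail b n" if "x \<in> tail b n" "y \<in> tail b n" for x y
      using two[OF that] R(6) unfolding tail_def by blast
    show "x \<oplus>\<^bsub>F\<^esub> y \<in> tail b n" if "x \<in> tail b n" "y \<in> tail b n" for x y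
      using two[OF that] R(7) unfolding tail_def by blast
    show "inv\<^bsub>F\<^esub> x \<in> tail b n" if "x \<in> tail b n - {\<zero>\<^bsub>F\<^esub>}" for x
      using that F.subfield_m_inv(1)[OF T(1)] unfolding tail_def by blast
  qed
qed

lemma tail_anti: "tail b (Suc n) \<subseteq> tail b n"
  unfolding tail_def using tower_shift by blast

lemma tail_hom: "\<tau> ` tail b n \<subseteq> tail b (Suc n)"
  unfolding tail_def using tower_hom[of 1 n] by auto

lemma tail_algebraic: "x \<in> tail b n \<Longrightarrow> (F.algebraic over k) x"
proof -
  assume "x \<in> tail b n"
  then obtain j where "x \<in> tower b k n j" unfolding tail_def by blast
  then show ?thesis
    using F.finite_dimension_imp_algebraic[OF k subfieldE(1)[OF tower_subfield(1)[OF kk]] F.finite_dimensionI[OF tower_dim[OF kk]]]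
    by blast
qed

lemma limit_subfield: "subfield (limit b) F" "k \<subseteq> limit b"
proof -
  show k: "k \<subseteq> limit b" unfolding limit_def using tail_subfield(2) by blast
  have "subring (limit b) F" unfolding limit_def
    by (rule F.subring_Inter) (use subfieldE(1)[OF tail_subfield(1)] in auto)
  then show "subfield (limit b) F"
    by (rule F.subfieldI') (use F.subfield_m_inv(1)[OF tail_subfield(1)] in \<open>auto simp: limit_def\<close>)
qed

lemma limit_hom: "\<tau> ` limit b \<subseteq> limit b"
proof -
  have "\<tau> ` limit b \<subseteq> tail b n" for n
  proof -
    have "limit b \<subseteq> tail b n" unfolding limit_def by blast
    then show ?thesis using tail_hom[of n] tail_anti[of n] by blast
  qed
  then show ?thesis unfolding limit_def by blast
qed

lemma in_tower:
  assumes "finite E" "E \<subseteq> tail b n" shows "\<exists>j0. \<forall>j\<ge>j0. E \<subseteq> tower b k n j"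
  using assms
proof (induction rule: finite_induct)
  case (insert x E)
  then obtain j0 where j0: "\<forall>j\<ge>j0. E \<subseteq> tower b k n j" by auto
  obtain i where "x \<in> tower b k n i" using insert.prems unfolding tail_def by auto
  then have "\<forall>j\<ge>max i j0. insert x E \<subseteq> tower b k n j"
    using tower_mono_length[OF kk, of i _ n] j0 by auto
  then show ?case by blast
qed simp

text \<open>
  Since the degrees \<open>dg k 0 i\<close> are eventually constant, the past \<open>tower b k 0 m\<close> and the future
  \<open>tail b m\<close> are so independent that their intersection has bounded degree.
\<close>

lemma limit_bounded:
  obtains c where "\<And>G g. subfield G F \<Longrightarrow> k \<subseteq> G \<Longrightarrow> G \<subseteq> limit b \<Longrightarrow> F.dimension g k G \<Longrightarrow> g \<le> c"
proof -
  have anti: "dg k 0 j \<le> dg k 0 i" if "i \<le> j" for i j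
    by (rule lift_Suc_antimono_le[of "dg k 0", OF dg_anti that])
  obtain i0 where i0: "\<And>i. dg k 0 i0 \<le> dg k 0 i" using ex_has_least_nat[of "\<lambda>_. True" 0 "dg k 0"] by blast
  define d where "d = dg k 0 i0"
  have d: "dg k 0 i = d" if "i \<ge> i0" for i using anti[OF that] i0[of i] unfolding d_def by simp
  have d1: "d \<ge> 1" unfolding d_def by (rule dg_pos[OF kk])
  \<comment> \<open>The degree of the tower up to the point from which all steps have degree
    \<open>d\<close>.\<close>
  define c where "c = (\<Prod>i<i0. dg k 0 i)"
  have "g \<le> c" if G: "subfield G F" "k \<subseteq> G" "G \<subseteq> limit b" and g: "F.dimension g k G" for G g
  proof -
    obtain Us where Us: "set Us \<subseteq> carrier F" "F.Span k Us = G" using F.exists_base[OF k g] by blast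
    have UG: "set Us \<subseteq> G" using F.Span_base_incl[OF k Us(1)] Us(2) by simp
    have inT: "G \<subseteq> tower b k n j" if "set Us \<subseteq> tower b k n j" for n j
      using F.Span_in_subring[OF k subfieldE(1)[OF tower_subfield(1)[OF kk]] tower_subfield(2)[OF kk] that] Us(2) by simp
    have UT: "set Us \<subseteq> tail b n" for n using UG G(3) unfolding limit_def by blast
    obtain m0 where m0: "\<forall>j\<ge>m0. set Us \<subseteq> tower b k 0 j" using in_tower[OF finite_set UT] by blast
    \<comment> \<open>Large enough for the past to contain \<open>G\<close>, and at least
      \<open>i0\<close>, so that all later steps have degree \<open>d\<close>.\<close>
    define m where "m = max i0 m0"
    have Gm: "G \<subseteq> tower b k 0 m" using m0 by (intro inT) (simp add: m_def)
    obtain j0 where j0: "\<forall>j\<ge>j0. set Us \<subseteq> tower b k m j" using in_tower[OF finite_set UT] by blast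
    define j where "j = max i0 j0"
    let ?Y = "tower b k m j"
    have GY: "G \<subseteq> ?Y" using j0 by (intro inT) (simp add: j_def)
    \<comment> \<open>As \<open>G\<close> lies in the future as well, starting the tower at
      \<open>G\<close> instead of \<open>k\<close> does not enlarge it.\<close>
    have "tower b G m j = ?Y"
    proof
      show "tower b G m j \<subseteq> ?Y"
        by (rule tower_least[OF subfieldE(1)[OF tower_subfield(1)[OF kk]] GY tower_mem[OF kk]])
      show "?Y \<subseteq> tower b G m j"
        using tower_subfield[OF G(1,2), of m j] G(2)
        by (intro tower_least tower_mem[OF G(1,2)] subfieldE(1)) auto
    qed
    then have e: "F.dimension (\<Prod>i<j. dg G m i) G ?Y" using tower_dim[OF G(1,2), of m j] by simp
    have "d ^ j \<le> (\<Prod>i<j. dg G m i)"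
    proof -
      have "(\<Prod>i<j. d) \<le> (\<Prod>i<j. dg G m i)"
        by (rule prod_mono) (use dg_base[OF G(1,2) Gm] d in \<open>auto simp: m_def le_max_iff_disj trans_le_add1\<close>)
      then show ?thesis by simp
    qed
    \<comment> \<open>The degree of \<open>?Y\<close> over \<open>k\<close>, computed through
      \<open>G\<close> and directly. Every factor above \<open>G\<close> is at least
      \<open>d\<close>; in the direct product the first \<open>i0\<close> factors are absorbed in
      \<open>c\<close> and the others are at most \<open>d\<close>. Cancelling \<open>d ^ j\<close>
      leaves the bound.\<close>
    then have "g * d ^ j \<le> g * (\<Prod>i<j. dg G m i)" by simp
    also have "\<dots> = (\<Prod>i<j. dg k m i)"
      by (rule F.dimension_is_inj[OF k F.telescopic_base[OF k G(1) g e] tower_dim[OF kk]])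
    also have "\<dots> \<le> (\<Prod>i<j. dg k 0 i)" by (rule prod_mono) (use dg_shift in auto)
    also have "\<dots> = c * (\<Prod>i=i0..<j. dg k 0 i)"
      unfolding c_def by (simp add: lessThan_atLeast0 prod.atLeastLessThan_concat j_def)
    also have "(\<Prod>i=i0..<j. dg k 0 i) = (\<Prod>i=i0..<j. d)" by (rule prod.cong) (use d in auto)
    also have "\<dots> = d ^ (j - i0)" by simp
    also have "c * d ^ (j - i0) \<le> c * d ^ j" using d1 by (intro mult_left_mono power_increasing) auto
    finally show "g \<le> c" using d1 by simp
  qed
  then show ?thesis by (rule that)
qed

text \<open>The degrees of finitely generated subextensions are bounded, so one of largest degree
  exists, and adjoining a further element of the limit field cannot enlarge it.\<close>

lemma limit_finite:
  obtains xs where "set xs \<subseteq> limit b" "limit b = F.finite_extension k xs"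
proof -
  obtain c where c: "\<And>G g. subfield G F \<Longrightarrow> k \<subseteq> G \<Longrightarrow> G \<subseteq> limit b \<Longrightarrow> F.dimension g k G \<Longrightarrow> g \<le> c"
    by (rule limit_bounded; rule that)
  note L = limit_subfield
  have alg: "(F.algebraic over k) x" if "x \<in> limit b" for x
    using tail_algebraic[of x 0] that unfolding limit_def by blast
  have LC: "limit b \<subseteq> carrier F" by (rule subfieldE(3)[OF L(1)])
  define E where "E xs = F.finite_extension k xs" for xs
  have E: "subfield (E xs) F" "k \<subseteq> E xs" "E xs \<subseteq> limit b" "\<exists>n. F.dimension n k (E xs)" "set xs \<subseteq> E xs"
    if xs: "set xs \<subseteq> limit b" for xs
  proof -
    have xc: "set xs \<subseteq> carrier F" using xs LC by blast
    have xa: "\<And>x. x \<in> set xs \<Longrightarrow> (F.algebraic over k) x" using alg xs by blast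
    show "subfield (E xs) F" unfolding E_def by (rule F.finite_extension_is_subfield[OF k xc xa])
    show "k \<subseteq> E xs" unfolding E_def by (rule F.finite_extension_incl[OF kC xc])
    show "E xs \<subseteq> limit b" unfolding E_def by (rule F.finite_extension_subring_incl[OF subfieldE(1)[OF L(1)] L(2) xs])
    show "\<exists>n. F.dimension n k (E xs)" using F.finite_extension_finite_dimension(1)[OF k xc xa] unfolding E_def F.finite_dimension_def .
    show "set xs \<subseteq> E xs" unfolding E_def by (rule F.finite_extension_mem[OF kr xc])
  qed
  let ?P = "\<lambda>n. \<exists>xs. set xs \<subseteq> limit b \<and> F.dimension n k (E xs)"
  have "\<exists>n. F.dimension n k (E [])" by (rule E(4)) simp
  then obtain n0 where "F.dimension n0 k (E [])" ..
  then have n0: "?P n0" by (intro exI[of _ "[]"] conjI) simp_all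
  have bd: "m \<le> c" if m: "?P m" for m
  proof -
    obtain xs where xs: "set xs \<subseteq> limit b" "F.dimension m k (E xs)" using m by (elim exE conjE)
    show ?thesis by (rule c[OF E(1)[OF xs(1)] E(2)[OF xs(1)] E(3)[OF xs(1)] xs(2)])
  qed
  have bd': "\<forall>m. ?P m \<longrightarrow> m \<le> c" by (intro allI impI bd)
  obtain n where n: "?P n" "\<forall>m. ?P m \<longrightarrow> m \<le> n"
    by (rule exE[OF Nat.ex_has_greatest_nat[of ?P, OF n0 bd']]) (elim conjE, rule that)
  obtain xs where xs: "set xs \<subseteq> limit b" "F.dimension n k (E xs)" using n(1) by (elim exE conjE)
  have "limit b \<subseteq> E xs"
  proof
    fix x assume x: "x \<in> limit b"
    then have xx: "set (x # xs) \<subseteq> limit b" using xs(1) by simp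
    obtain m where m: "F.dimension m k (E (x # xs))" using E(4)[OF xx] by blast
    have "E xs \<subseteq> E (x # xs)" unfolding E_def
      by (rule F.finite_extension_incl_aux[OF kC]) (use x xs(1) LC in auto)
    moreover have "m \<le> n" by (rule n(2)[rule_format]) (intro exI conjI, rule xx, rule m)
    ultimately have "E xs = E (x # xs)" by (rule F.dimension_eq(2)[OF k xs(2) m])
    then show "x \<in> E xs" using E(5)[OF xx] by simp
  qed
  then show ?thesis using that[OF xs(1)] E(3)[OF xs(1)] unfolding E_def by blast
qed

end

end

locale endo_pair = field_pair F S + field_endo F k \<tau> for F :: "'f ring" and S :: "'s ring" and k \<tau> +
  fixes h \<rho>
  assumes h: "h \<in> ring_hom (F\<lparr>carrier := k\<rparr>) S" and \<rho>: "\<rho> \<in> ring_hom S S"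
    and equiv: "a \<in> k \<Longrightarrow> \<rho> (h a) = h (\<tau> a)"
begin

text \<open>The primitive element \<open>c\<close> generates the limit field up to
  \<open>n\<close>-th powers. The limit field is stable under \<tau>, so the \<open>n\<close>-th
  power of \<open>\<tau> c\<close> lies in \<open>k(c)\<close>, which is the hypothesis of
  \<open>good_from_finite\<close>.\<close>

lemma limit_good:
  assumes b: "b \<in> carrier F" "(F.algebraic over k) b"
  obtains x r n where "good x" "frob_exp F n" "\<And>e. e \<in> limit b \<Longrightarrow> ((\<tau> ^^ r) e) [^]\<^bsub>F\<^esub> n \<in> F.simple_extension k x"
proof -
  obtain xs where xs: "set xs \<subseteq> limit b" "limit b = F.finite_extension k xs"
    by (rule limit_finite[OF b]; rule that)
  note L = limit_subfield[OF b]
  have LC: "limit b \<subseteq> carrier F" by (rule subfieldE(3)[OF L(1)])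
  have alg: "(F.algebraic over k) x" if "x \<in> limit b" for x
    using tail_algebraic[OF b, of x 0] that unfolding limit_def by blast
  obtain c n where c: "c \<in> F.finite_extension k xs" "c \<in> carrier F" "(F.algebraic over k) c" "frob_exp F n"
    "\<And>x. x \<in> set xs \<Longrightarrow> x [^]\<^bsub>F\<^esub> n \<in> F.simple_extension k c"
    by (rule primitive_element[OF k h, of xs]) (use xs LC alg in blast)+
  note C = F.simple_extension_subring[OF kr c(2)]
  have Lc: "e [^]\<^bsub>F\<^esub> n \<in> F.simple_extension k c" if "e \<in> limit b" for e
  proof -
    have "limit b \<subseteq> {x \<in> carrier F. x [^]\<^bsub>F\<^esub> n \<in> F.simple_extension k c}"
      unfolding xs(2)
    proof (rule F.finite_extension_subring_incl[OF F.hom_preimage_subring[OF F.frob_hom[OF c(4)] C]])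
      have "a [^]\<^bsub>F\<^esub> i \<in> k" if "a \<in> k" for a and i :: nat
        by (induction i) (use that subringE(3,6)[OF kr] in auto)
      then show "k \<subseteq> {x \<in> carrier F. x [^]\<^bsub>F\<^esub> n \<in> F.simple_extension k c}"
        using F.simple_extension_incl[OF kC c(2)] kC by blast
      show "set xs \<subseteq> {x \<in> carrier F. x [^]\<^bsub>F\<^esub> n \<in> F.simple_extension k c}" using c(5) xs(1) LC by blast
    qed
    then show ?thesis using that by blast
  qed
  have "c \<in> limit b" using c(1) xs(2) by simp
  then have tc: "(\<tau> c) [^]\<^bsub>F\<^esub> n \<in> F.simple_extension k c" using limit_hom[OF b] Lc by blast
  obtain r m where rm: "frob_exp F m" "good (((\<tau> ^^ r) c) [^]\<^bsub>F\<^esub> m)"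
    by (rule good_from_finite[OF c(2,3,4) tc]; rule that)
  let ?t = "\<lambda>x. ((\<tau> ^^ r) x) [^]\<^bsub>F\<^esub> m"
  have th: "?t \<in> ring_hom F F"
    using ring_hom_trans[OF \<tau>n F.frob_hom[OF rm(1)], of r] by (simp add: comp_def)
  have tk: "?t ` k \<subseteq> k"
  proof -
    have "y [^]\<^bsub>F\<^esub> i \<in> k" if "y \<in> k" for y and i :: nat
      by (induction i) (use that subringE(3,6)[OF kr] in auto)
    then show ?thesis using \<tau>nk[of r] by blast
  qed
  interpret tr: ring_hom_ring F F "\<tau> ^^ r" by (rule ring_hom_ringI2[OF F.ring_axioms F.ring_axioms \<tau>n])
  have "((\<tau> ^^ r) e) [^]\<^bsub>F\<^esub> (n * m) \<in> F.simple_extension k (((\<tau> ^^ r) c) [^]\<^bsub>F\<^esub> m)" if e: "e \<in> limit b" for e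
  proof -
    have ec: "e \<in> carrier F" using e LC by blast
    have "?t (e [^]\<^bsub>F\<^esub> n) \<in> F.simple_extension k (?t c)"
      by (rule F.hom_simple_extension[OF th tk kr kr c(2) Lc[OF e]])
    then show ?thesis using ec \<tau>n_closed[OF ec] by (simp add: tr.hom_nat_pow F.nat_pow_pow)
  qed
  then show ?thesis by (rule that[OF rm(2) frob_exp_mult[OF c(4) rm(1)]])
qed

end

section \<open>Equivariant homomorphisms on algebraic elements\<close>

context algebraically_closed
begin

lemma monic_linear_factor:
  assumes q: "set q \<subseteq> carrier L" "length q > 1" "hd q = \<one>"
  obtains \<xi> q' where "\<xi> \<in> carrier L" "set q' \<subseteq> carrier L" "q' \<noteq> []" "hd q' = \<one>" "length q = Suc (length q')"
    "q = poly_mult [\<one>, \<ominus> \<xi>] q'"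
proof -
  have qp: "polynomial (carrier L) q" unfolding polynomial_def using q by auto
  then have qc: "q \<in> carrier (poly_ring L)" by (simp only: univ_poly_carrier)
  obtain \<xi> where \<xi>: "\<xi> \<in> carrier L" "eval q \<xi> = \<zero>" by (rule root_exists[OF qc q(2)])
  have Xp: "polynomial (carrier L) [\<one>, \<ominus> \<xi>]" unfolding polynomial_def using \<xi>(1) by simp
  have ne: "q \<noteq> []" using q(2) by auto
  then have "is_root q \<xi>" unfolding is_root_def using \<xi> by simp
  then have "[\<one>, \<ominus> \<xi>] pdivides q" by (rule is_root_imp_pdivides[OF qc])
  then obtain q' where q': "q' \<in> carrier (poly_ring L)" "q = poly_mult [\<one>, \<ominus> \<xi>] q'"
    unfolding pdivides_def factor_def by (elim bexE) (simp only: univ_poly_mult)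
  have pp: "polynomial (carrier L) q'" using q'(1) by (simp only: univ_poly_carrier)
  have ne': "q' \<noteq> []" using ne q'(2) poly_mult_zero(2)[of "[\<one>, \<ominus> \<xi>]"] \<xi>(1) by auto
  have d: "length q - 1 = 1 + (length q' - 1)"
    using poly_mult_degree_eq[OF carrier_is_subring Xp pp] q'(2) ne' by simp
  then have len: "length q = Suc (length q')" using ne' q(2) by (cases q') auto
  have lead: "hd q = \<one> \<otimes> hd q'" using poly_mult_lead_coeff[OF carrier_is_subring Xp pp _ ne'] q'(2) by simp
  have c: "set q' \<subseteq> carrier L" by (rule polynomial_incl[OF pp])
  then have "hd q' \<in> carrier L" using ne' by (meson hd_in_set subsetD)
  then have "hd q' = \<one>" using lead q(3) by simp
  from that[OF \<xi>(1) c ne' this len q'(2)] show ?thesis .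
qed

text \<open>The polynomial splits over the algebraically closed \<open>L\<close>, so its image
  splits over the image of \<rho>. This allows an endomorphism that is not surjective to be inverted
  at roots.\<close>

lemma image_of_roots:
  assumes T: "field T" and \<rho>: "\<rho> \<in> ring_hom L T" and y: "y \<in> carrier T"
  shows "set q \<subseteq> carrier L \<Longrightarrow> q \<noteq> [] \<Longrightarrow> hd q = \<one> \<Longrightarrow> ring.eval T (map \<rho> q) y = \<zero>\<^bsub>T\<^esub> \<Longrightarrow> y \<in> \<rho> ` carrier L"
proof (induction "length q" arbitrary: q)
  case (Suc n)
  interpret T: field T by fact
  have cr: "ring_hom_ring L T \<rho>" by (rule ring_hom_ringI2[OF ring_axioms T.ring_axioms \<rho>])
  note rm = ring_hom_memE[OF \<rho>]
  show ?case
  proof (cases "length q > 1")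
    case False
    then obtain a where "q = [a]" using Suc(4) by (cases q) auto
    then show ?thesis using Suc(5,6) y rm(4) by simp
  next
    case True
    obtain \<xi> q' where q': "\<xi> \<in> carrier L" "set q' \<subseteq> carrier L" "q' \<noteq> []" "hd q' = \<one>" "length q = Suc (length q')"
      "q = poly_mult [\<one>, \<ominus> \<xi>] q'"
      by (rule monic_linear_factor[OF Suc(3) True Suc(5)]; rule that)
    let ?X = "[\<one>, \<ominus> \<xi>]"
    have X: "set ?X \<subseteq> carrier L" using q'(1) by simp
    have rc: "set (map \<rho> l) \<subseteq> carrier T" if "set l \<subseteq> carrier L" for l using that rm(1) by auto
    have "T.eval (map \<rho> q) y = T.eval (T.normalize (map \<rho> q)) y" using T.eval_normalize[OF rc[OF Suc(3)] y] by simp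
    also have "T.normalize (map \<rho> q) = T.poly_mult (map \<rho> ?X) (map \<rho> q')"
      unfolding q'(6) by (rule ring_hom_ring.poly_mult_hom'[OF cr X q'(2)])
    also have "T.eval \<dots> y = T.eval (map \<rho> ?X) y \<otimes>\<^bsub>T\<^esub> T.eval (map \<rho> q') y"
      by (rule T.eval_poly_mult[OF rc[OF X] rc[OF q'(2)] y])
    finally have p: "T.eval (map \<rho> ?X) y \<otimes>\<^bsub>T\<^esub> T.eval (map \<rho> q') y = \<zero>\<^bsub>T\<^esub>" using Suc(6) by simp
    have e: "T.eval (map \<rho> ?X) y = y \<ominus>\<^bsub>T\<^esub> \<rho> \<xi>"
      using y q'(1) rm(1,4) by (simp add: a_minus_def ring_hom_cring.hom_a_inv[OF ring_hom_cringI[OF is_cring T.is_cring \<rho>]])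
    consider "y \<ominus>\<^bsub>T\<^esub> \<rho> \<xi> = \<zero>\<^bsub>T\<^esub>" | "T.eval (map \<rho> q') y = \<zero>\<^bsub>T\<^esub>"
      using T.integral[OF p[unfolded e]] y rm(1)[OF q'(1)] T.eval_in_carrier[OF rc[OF q'(2)] y] by auto
    then show ?thesis
    proof cases
      case 1
      then have "y = \<rho> \<xi>" using y rm(1)[OF q'(1)] T.r_right_minus_eq by blast
      then show ?thesis using q'(1) by blast
    next
      case 2
      show ?thesis using Suc(1)[OF _ q'(2,3,4) 2] Suc(2) q'(5) by simp
    qed
  qed
qed simp

end

context ring
begin

lemma hom_agree_simple_extension:
  assumes V: "subring V R" "k \<subseteq> V" "x \<in> V" and S: "ring S"
    and z: "z \<in> ring_hom (R\<lparr>carrier := V\<rparr>) S" "z' \<in> ring_hom (R\<lparr>carrier := V\<rparr>) S"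
    and eq: "\<And>a. a \<in> k \<Longrightarrow> z a = z' a" "z x = z' x" and s: "s \<in> simple_extension k x"
  shows "z s = z' s"
proof -
  note VC = subringE(1)[OF V(1)]
  obtain p where p: "set p \<subseteq> k" "s = eval p x"
    using s mem_simple_extension_iff[of k x s] V(2,3) VC by blast
  have pV: "set p \<subseteq> V" using p(1) V(2) by blast
  have e: "map z p = map z' p" using eq(1) p(1) by auto
  show ?thesis unfolding p(2) subring_hom_eval[OF V(1) S z(1) pV V(3)] subring_hom_eval[OF V(1) S z(2) pV V(3)] e eq(2) ..
qed

lemma subring_hom_nat_pow:
  assumes V: "subring V R" "s \<in> V" and S: "ring S" and z: "z \<in> ring_hom (R\<lparr>carrier := V\<rparr>) S"
  shows "z (s [^] (n::nat)) = z s [^]\<^bsub>S\<^esub> n"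
proof -
  have cr: "ring_hom_ring (R\<lparr>carrier := V\<rparr>) S z" by (rule subring_hom_ring[OF V(1) S z])
  show ?thesis using ring_hom_ring.hom_nat_pow[OF cr, of s n] V(2) nat_pow_consistent[of s n V] by simp
qed

text \<open>Undoes the powers in \<open>primitive_element\<close>: taking \<open>n\<close>-th powers
  is injective on \<open>S\<close>.\<close>

lemma hom_agree_frob:
  assumes V: "subring V R" "s \<in> V" and S: "field S"
    and z: "z \<in> ring_hom (R\<lparr>carrier := V\<rparr>) S" "z' \<in> ring_hom (R\<lparr>carrier := V\<rparr>) S"
    and n: "frob_exp S n" and eq: "z (s [^] n) = z' (s [^] n)"
  shows "z s = z' s"
proof -
  interpret S: field S by fact
  show ?thesis
    using S.frob_inj[OF n] eq subring_hom_nat_pow[OF V S.ring_axioms z(1)] subring_hom_nat_pow[OF V S.ring_axioms z(2)]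
      ring_hom_memE(1)[OF z(1)] ring_hom_memE(1)[OF z(2)] V(2) by simp
qed

end


context domain
begin

text \<open>The difference of two monic annihilating polynomials of the minimal degree has smaller
  degree, hence vanishes.\<close>

lemma Irr_unique:
  assumes E: "subfield E R" and x: "x \<in> carrier R" "(algebraic over E) x"
    and p: "set p \<subseteq> E" "hd p = \<one>" "length p = length (Irr E x)" "eval p x = \<zero>"
  shows "p = Irr E x"
proof -
  let ?q = "Irr E x"
  note I = IrrE[OF E x] and Er = subfieldE(1)[OF E] and EC = subfieldE(3)[OF E]
  have qE: "set ?q \<subseteq> E" using I(1) polynomial_incl by (simp add: univ_poly_carrier[symmetric])
  have l: "length ?q \<ge> 2" using pirreducible_degree[OF E I(1,2)] by simp
  define d where "d = map2 (\<lambda>a b. a \<ominus> \<one> \<otimes> b) p ?q"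
  have pC: "set p \<subseteq> carrier R" "set ?q \<subseteq> carrier R" using p(1) qE EC by blast+
  have len: "length d = length ?q" using p(3) by (simp add: d_def)
  have dE: "set d \<subseteq> E"
  proof -
    have "a \<ominus> \<one> \<otimes> b \<in> E" if "a \<in> E" "b \<in> E" for a b
      using that subringE(3,5,6,7)[OF Er] by (simp add: a_minus_def)
    moreover have "a \<in> E" "b \<in> E" if "(a, b) \<in> set (zip p ?q)" for a b
      using set_zip_leftD[OF that] set_zip_rightD[OF that] p(1) qE by blast+
    ultimately show ?thesis unfolding d_def by auto
  qed
  have "eval d x = \<zero>" unfolding d_def eval_map2_minus[OF p(3) pC one_closed x(1)] using p(4) I(4) by simp
  then have ev: "eval (normalize d) x = \<zero>" using eval_normalize[of d x] dE EC x(1) by auto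
  have nE: "normalize d \<in> carrier (E[X])"
    using normalize_gives_polynomial[OF dE] by (simp only: univ_poly_carrier)
  have "hd d = \<zero>"
  proof -
    obtain p' q' where pq: "p = \<one> # p'" "?q = \<one> # q'" using p(2,3) I(3) l by (cases p; cases ?q) auto
    show ?thesis unfolding d_def pq by (simp add: a_minus_def r_neg)
  qed
  then have lt: "length (normalize d) < length ?q" using normalize_length_lt[of d] len l by fastforce
  have "normalize d = []"
  proof (rule ccontr)
    assume ne: "normalize d \<noteq> []"
    have "?q pdivides normalize d" by (rule Irr_minimal[OF E x nE ev])
    then have "length ?q - 1 \<le> length (normalize d) - 1" by (rule pdivides_imp_degree_le[OF Er I(1) nE ne])
    then show False using lt l ne by (cases "normalize d") auto
  qed
  then have "d = replicate (length d) \<zero>" using normalize_def'(1)[of d] by simp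
  then have z: "d ! i = \<zero>" if "i < length d" for i using that List.nth_replicate[of i "length d" \<zero>] by simp
  show ?thesis
  proof (rule nth_equalityI[OF p(3)])
    fix i assume i: "i < length p"
    then have c: "p ! i \<in> carrier R" "?q ! i \<in> carrier R" using pC p(3) by (auto simp: subset_iff)
    have "p ! i \<ominus> \<one> \<otimes> ?q ! i = \<zero>" using z[of i] i p(3) by (simp add: d_def)
    then show "p ! i = ?q ! i" using c by simp
  qed
qed

end

section \<open>Shifting homomorphisms back along \<tau>\<close>

context endo_pair
begin

definition algs where "algs = {x \<in> carrier F. (F.algebraic over k) x}"

lemma algs: "subfield algs F" "k \<subseteq> algs" "\<tau> ` algs \<subseteq> algs" "x \<in> algs \<Longrightarrow> x \<in> carrier F" "x \<in> algs \<Longrightarrow> (F.algebraic over k) x"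
proof -
  show "subfield algs F" unfolding algs_def by (rule F.subfield_of_algebraics[OF k])
  show "k \<subseteq> algs" unfolding algs_def using F.algebraic_self[OF kr] kC by blast
  show "\<tau> ` algs \<subseteq> algs" unfolding algs_def using algebraic_\<tau>n[of _ 1] ring_hom_memE(1)[OF \<tau>] by auto
qed (auto simp: algs_def)

lemmas algs_ring = subfieldE(1)[OF algs(1)]

lemma algs_\<tau>: "x \<in> algs \<Longrightarrow> \<tau> x \<in> algs" using algs(3) by blast

lemma simple_extension_algs: "x \<in> algs \<Longrightarrow> F.simple_extension k x \<subseteq> algs"
  by (rule F.simple_extension_subring_incl[OF algs_ring algs(2)])

definition ext :: "('f \<Rightarrow> 's) \<Rightarrow> bool"
  where "ext z \<longleftrightarrow> z \<in> ring_hom (F\<lparr>carrier := algs\<rparr>) S \<and> (\<forall>a \<in> k. z a = h a)"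

text \<open>
  \<open>shift z\<close> is \<open>\<rho>\<close>-inverse after \<open>z\<close> after \<open>\<tau>\<close>; thus \<open>z\<close> is equivariant iff it is fixed by \<open>shift\<close>.
\<close>

definition shift :: "('f \<Rightarrow> 's) \<Rightarrow> 'f \<Rightarrow> 's"
  where "shift z a = inv_into (carrier S) \<rho> (z (\<tau> a))"

lemma extD: "ext z \<Longrightarrow> z \<in> ring_hom (F\<lparr>carrier := algs\<rparr>) S" "ext z \<Longrightarrow> a \<in> k \<Longrightarrow> z a = h a"
  by (simp_all add: ext_def)

lemma ext_closed: "ext z \<Longrightarrow> a \<in> algs \<Longrightarrow> z a \<in> carrier S"
  using ring_hom_memE(1)[OF extD(1)] by simp

lemma \<rho>_inj: "inj_on \<rho> (carrier S)"
  by (rule non_trivial_field_hom_is_inj[OF \<rho> S.field_axioms S.field_axioms])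

lemma \<tau>_algs: "\<tau> \<in> ring_hom (F\<lparr>carrier := algs\<rparr>) (F\<lparr>carrier := algs\<rparr>)"
  using ring_hom_memE[OF \<tau>] algs(4) algs_\<tau> by (intro ring_hom_memI) auto

lemma ext_\<tau>: "ext z \<Longrightarrow> (\<lambda>a. z (\<tau> a)) \<in> ring_hom (F\<lparr>carrier := algs\<rparr>) S"
  using ring_hom_trans[OF \<tau>_algs extD(1), of z] by (simp add: comp_def)

lemma \<rho>_ext: "ext z \<Longrightarrow> (\<lambda>a. \<rho> (z a)) \<in> ring_hom (F\<lparr>carrier := algs\<rparr>) S"
  using ring_hom_trans[OF extD(1) \<rho>, of z] by (simp add: comp_def)

text \<open>On \<open>k\<close> the map \<open>z \<circ> \<tau>\<close> equals
  \<open>\<rho> \<circ> h\<close>, so \<open>z (\<tau> a)\<close> is a root of the \<rho>-image of a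
  polynomial over \<open>S\<close>, and \<open>image_of_roots\<close> provides the preimage.\<close>

lemma shift:
  assumes z: "ext z" and a: "a \<in> algs"
  shows "shift z a \<in> carrier S" "\<rho> (shift z a) = z (\<tau> a)"
proof -
  note I = F.IrrE[OF k algs(4)[OF a] algs(5)[OF a]] and Im = Irr_image[OF k h algs(4)[OF a] algs(5)[OF a]]
  have eq: "z (\<tau> b) = \<rho> (h b)" if "b \<in> k" for b
    using that extD(2)[OF z] \<tau>k equiv by (simp add: image_subset_iff)
  note r = hom_root[OF k algs_ring algs(2) a algs(5)[OF a] ext_\<tau>[OF z] eq]
  have "z (\<tau> a) \<in> \<rho> ` carrier S"
  proof (rule S.image_of_roots[OF S.field_axioms \<rho> r(1)])
    show "set (map h (F.Irr k a)) \<subseteq> carrier S" using S.polynomial_incl Im(2) by (simp only: univ_poly_carrier)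
    show "map h (F.Irr k a) \<noteq> []" using Im(3) by auto
    show "hd (map h (F.Irr k a)) = \<one>\<^bsub>S\<^esub>" using Im(3) I(3) ring_hom_memE(4)[OF h] by (cases "F.Irr k a") auto
    show "S.eval (map \<rho> (map h (F.Irr k a))) (z (\<tau> a)) = \<zero>\<^bsub>S\<^esub>" using r(2) by (simp add: comp_def)
  qed
  then show "shift z a \<in> carrier S" "\<rho> (shift z a) = z (\<tau> a)"
    unfolding shift_def by (auto simp: inv_into_into f_inv_into_f)
qed

lemma shift_unique: "ext z \<Longrightarrow> a \<in> algs \<Longrightarrow> w \<in> carrier S \<Longrightarrow> \<rho> w = z (\<tau> a) \<Longrightarrow> shift z a = w"
  using shift[of z a] inj_onD[OF \<rho>_inj] by simp

lemma shift_ext: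
  assumes z: "ext z" shows "ext (shift z)"
proof -
  note zt = ring_hom_memE[OF ext_\<tau>[OF z], simplified] and rm = ring_hom_memE[OF \<rho>] and sr = subringE[OF algs_ring]
  have "shift z \<in> ring_hom (F\<lparr>carrier := algs\<rparr>) S"
    using shift[OF z] zt rm sr(3,6,7) by (intro ring_hom_memI) (auto intro!: shift_unique[OF z])
  moreover have "shift z a = h a" if "a \<in> k" for a
    using that algs(2) ring_hom_memE(1)[OF h] extD(2)[OF z] \<tau>k equiv by (intro shift_unique[OF z]) (auto simp: image_subset_iff)
  ultimately show ?thesis by (simp add: ext_def)
qed

lemma shift_pow_ext: "ext z \<Longrightarrow> ext ((shift ^^ j) z)"
  by (induction j) (simp_all add: shift_ext)

text \<open>The value of the \<open>j\<close>-fold shift at \<open>a\<close> depends only on the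
  value of \<open>z\<close> at the \<open>j\<close>-th iterate of \<open>a\<close>. An equality
  known after \<open>j\<close> steps of \<tau> is thereby moved back to \<open>a\<close>.\<close>

lemma shift_pow_agree:
  "z ((\<tau> ^^ j) a) = z' ((\<tau> ^^ j) a) \<Longrightarrow> (shift ^^ j) z a = (shift ^^ j) z' a"
proof (induction j arbitrary: a)
  case (Suc j)
  have "(shift ^^ j) z (\<tau> a) = (shift ^^ j) z' (\<tau> a)"
    by (rule Suc(1)) (use Suc(2) in \<open>simp add: funpow_swap1\<close>)
  then show ?case by (simp only: funpow.simps comp_apply shift_def[of "(shift ^^ j) z"] shift_def[of "(shift ^^ j) z'"])
qed simp

lemma frob_S: "frob_exp F n \<Longrightarrow> frob_exp S n"
  using field.frob_exp_hom[OF F.subfield_iff(2)[OF k] S.field_axioms h, of n] by (simp add: frob_exp_subring)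

lemma tail_algs: "b \<in> algs \<Longrightarrow> tail b n \<subseteq> algs"
  using tail_algebraic[of b] subfieldE(3)[OF tail_subfield(1)[of b]] algs(4,5)[of b] unfolding algs_def by blast


context
  assumes good_hom: "\<And>x. good x \<Longrightarrow> \<exists>\<delta> \<in> ring_hom (F\<lparr>carrier := F.simple_extension k x\<rparr>) S.
    (\<forall>a \<in> k. \<delta> a = h a) \<and> \<rho> (\<delta> x) = \<delta> (\<tau> x)"
begin

text \<open>For the good element \<open>c\<close>, \<open>good_hom\<close> provides a homomorphism
  on \<open>k(c)\<close> that commutes with the endomorphisms, and a place extends it to all
  algebraic elements. It is fixed by \<open>shift\<close> at the \<open>r\<close>-th iterate of
  \<open>e\<close>, since the \<open>n\<close>-th power of this iterate lies in \<open>k(c)\<close>;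
  shifting \<open>r\<close> times moves this to \<open>e\<close>.\<close>

lemma fixed_on_limit:
  assumes b: "b \<in> algs"
  obtains z where "ext z" "\<And>e. e \<in> limit b \<Longrightarrow> shift z e = z e"
proof -
  note b' = algs(4)[OF b] algs(5)[OF b]
  obtain c r n where c: "good c" "frob_exp F n" "\<And>e. e \<in> limit b \<Longrightarrow> ((\<tau> ^^ r) e) [^]\<^bsub>F\<^esub> n \<in> F.simple_extension k c"
    by (rule limit_good[OF b']; rule that)
  have cc: "c \<in> carrier F" "c \<in> algs" "\<tau> c \<in> F.simple_extension k c"
    using c(1) unfolding good_def algs_def by blast+
  let ?E = "F.simple_extension k c"
  note Er = F.simple_extension_subring[OF kr cc(1)] and Ei = F.simple_extension_incl[OF kC cc(1)]
    and Em = F.simple_extension_mem[OF kr cc(1)]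
  obtain \<delta> where \<delta>: "\<delta> \<in> ring_hom (F\<lparr>carrier := ?E\<rparr>) S" "\<And>a. a \<in> k \<Longrightarrow> \<delta> a = h a" "\<rho> (\<delta> c) = \<delta> (\<tau> c)"
    using good_hom[OF c(1)] by (elim bexE conjE) (rule that, simp_all)
  obtain V \<phi> where V: "place F S V \<phi>" "?E \<subseteq> V" "\<And>a. a \<in> ?E \<Longrightarrow> \<phi> a = \<delta> a"
    by (rule place_extends[OF Er \<delta>(1)]; rule that)
  have kV: "k \<subseteq> V" using Ei V(2) by blast
  have AV: "algs \<subseteq> V" using algebraic_in_place[OF V(1) k kV] unfolding algs_def by blast
  have \<phi>: "ext \<phi>" unfolding ext_def
  proof (intro conjI ballI)
    show "\<phi> \<in> ring_hom (F\<lparr>carrier := algs\<rparr>) S" by (rule ring_hom_subring_mono[OF placeD(2)[OF V(1)] AV])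
    show "\<phi> a = h a" if "a \<in> k" for a using V(3)[OF subsetD[OF Ei that]] \<delta>(2)[OF that] by simp
  qed
  have E\<tau>: "shift \<phi> v = \<phi> v" if v: "v \<in> ?E" for v
  proof -
    have va: "v \<in> algs" using v simple_extension_algs[OF cc(2)] by blast
    have "\<rho> (\<phi> v) = \<phi> (\<tau> v)"
    proof (rule F.hom_agree_simple_extension[OF algs_ring algs(2) cc(2) S.ring_axioms \<rho>_ext[OF \<phi>] ext_\<tau>[OF \<phi>] _ _ v])
      show "\<rho> (\<phi> a) = \<phi> (\<tau> a)" if "a \<in> k" for a
        using that extD(2)[OF \<phi>] \<tau>k equiv by (simp add: image_subset_iff)
      show "\<rho> (\<phi> c) = \<phi> (\<tau> c)" using V(3)[OF Em] V(3)[OF cc(3)] \<delta>(3) by simp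
    qed
    then show ?thesis by (rule shift_unique[OF \<phi> va ext_closed[OF \<phi> va]])
  qed
  have eq: "shift \<phi> ((\<tau> ^^ r) e) = \<phi> ((\<tau> ^^ r) e)" if e: "e \<in> limit b" for e
  proof -
    have ea: "e \<in> algs" using e tail_algs[OF b, of 0] unfolding limit_def by blast
    have ta: "(\<tau> ^^ r) e \<in> algs" by (induction r) (use ea algs_\<tau> in auto)
    show ?thesis
      by (rule F.hom_agree_frob[OF algs_ring ta S.field_axioms extD(1)[OF shift_ext[OF \<phi>]] extD(1)[OF \<phi>] frob_S[OF c(2)] E\<tau>[OF c(3)[OF e]]])
  qed
  show ?thesis
  proof (rule that)
    show "ext ((shift ^^ r) \<phi>)" by (rule shift_pow_ext[OF \<phi>])
    show "shift ((shift ^^ r) \<phi>) e = (shift ^^ r) \<phi> e" if "e \<in> limit b" for e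
      using shift_pow_agree[of "shift \<phi>" r e \<phi>] eq[OF that] by (simp add: funpow_swap1)
  qed
qed

end

end

lemma (in field) subring_hom_image:
  assumes V: "subfield V R" and S: "field S" and z: "z \<in> ring_hom (R\<lparr>carrier := V\<rparr>) S"
  shows "subfield (z ` V) S" "inv_into V z \<in> ring_hom (S\<lparr>carrier := z ` V\<rparr>) (R\<lparr>carrier := V\<rparr>)"
proof -
  interpret S: field S by fact
  note Vr = subfieldE(1)[OF V]
  have cr: "ring_hom_ring (R\<lparr>carrier := V\<rparr>) S z" by (rule subring_hom_ring[OF Vr S.ring_axioms z])
  have o: "\<one>\<^bsub>S\<^esub> \<noteq> \<zero>\<^bsub>S\<^esub>" by simp
  have "subfield (z ` carrier (R\<lparr>carrier := V\<rparr>)) S"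
    by (rule ring_hom_ring.img_is_subfield(2)[OF cr field.carrier_is_subfield[OF subfield_iff(2)[OF V]] o])
  then show "subfield (z ` V) S" by simp
  have inj: "inj_on z V" by (rule subfield_hom_inj[OF V S z])
  note zm = ring_hom_memE[OF z, simplified] and sr = subringE[OF Vr]
  show "inv_into V z \<in> ring_hom (S\<lparr>carrier := z ` V\<rparr>) (R\<lparr>carrier := V\<rparr>)"
  proof (rule ring_hom_memI)
    show "inv_into V z x \<in> carrier (R\<lparr>carrier := V\<rparr>)" if "x \<in> carrier (S\<lparr>carrier := z ` V\<rparr>)" for x
      using that inv_into_into[of x z V] by simp
    show "inv_into V z (x \<otimes>\<^bsub>S\<lparr>carrier := z ` V\<rparr>\<^esub> y) = inv_into V z x \<otimes>\<^bsub>R\<lparr>carrier := V\<rparr>\<^esub> inv_into V z y"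
      if "x \<in> carrier (S\<lparr>carrier := z ` V\<rparr>)" "y \<in> carrier (S\<lparr>carrier := z ` V\<rparr>)" for x y
    proof -
      from that have "x \<in> z ` V" "y \<in> z ` V" by simp_all
      then obtain a b where ab: "a \<in> V" "b \<in> V" "x = z a" "y = z b" by blast
      show ?thesis unfolding ab(3,4) using ab(1,2) sr(6) zm(2) inv_into_f_f[OF inj, of a] inv_into_f_f[OF inj, of b]
          inv_into_f_f[OF inj, of "a \<otimes> b"] by simp
    qed
    show "inv_into V z (x \<oplus>\<^bsub>S\<lparr>carrier := z ` V\<rparr>\<^esub> y) = inv_into V z x \<oplus>\<^bsub>R\<lparr>carrier := V\<rparr>\<^esub> inv_into V z y"
      if "x \<in> carrier (S\<lparr>carrier := z ` V\<rparr>)" "y \<in> carrier (S\<lparr>carrier := z ` V\<rparr>)" for x y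
    proof -
      from that have "x \<in> z ` V" "y \<in> z ` V" by simp_all
      then obtain a b where ab: "a \<in> V" "b \<in> V" "x = z a" "y = z b" by blast
      show ?thesis unfolding ab(3,4) using ab(1,2) sr(7) zm(3) inv_into_f_f[OF inj, of a] inv_into_f_f[OF inj, of b]
          inv_into_f_f[OF inj, of "a \<oplus> b"] by simp
    qed
    show "inv_into V z \<one>\<^bsub>S\<lparr>carrier := z ` V\<rparr>\<^esub> = \<one>\<^bsub>R\<lparr>carrier := V\<rparr>\<^esub>"
      using inv_into_f_f[OF inj, of \<one>] zm(4) sr(3) by simp
  qed
qed

context field_pair
begin

lemma hom_algebraic:
  assumes k: "subfield k F" and h: "h \<in> ring_hom (F\<lparr>carrier := k\<rparr>) S"
    and A: "subring A F" "k \<subseteq> A" "x \<in> A" and x: "(F.algebraic over k) x"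
    and g: "g \<in> ring_hom (F\<lparr>carrier := A\<rparr>) S" "\<And>a. a \<in> k \<Longrightarrow> g a = h a"
  shows "(S.algebraic over (h ` k)) (g x)"
proof (rule S.algebraicI)
  have xc: "x \<in> carrier F" using A(3) subringE(1)[OF A(1)] by blast
  note I = Irr_image[OF k h xc x]
  show "map h (F.Irr k x) \<noteq> []" using I(3) by auto
  show "S.eval (map h (F.Irr k x)) (g x) = \<zero>\<^bsub>S\<^esub>" by (rule hom_root(2)[OF k A x g])
  have "polynomial\<^bsub>S\<^esub> (carrier S) (map h (F.Irr k x))" using I(2) by (simp only: univ_poly_carrier)
  then have "polynomial\<^bsub>S\<^esub> (h ` k) (map h (F.Irr k x))" unfolding polynomial_def using I(1) by auto
  then show "map h (F.Irr k x) \<in> carrier ((h ` k)[X]\<^bsub>S\<^esub>)" by (simp only: univ_poly_carrier)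
qed

end

context endo_pair
begin

text \<open>
  Let \<open>\<gamma>\<close> generate the normal closure of \<open>b\<close> in \<open>S\<close>. The minimal polynomial of \<open>\<gamma>\<close> over the image of
  \<open>tail b n\<close> stabilises, hence has coefficients in the image of \<open>limit b\<close>, where \<open>z\<close> is already
  equivariant. So the failure of equivariance of \<open>z\<close> on \<open>tail b n\<close> is corrected by a partial
  automorphism \<open>u\<close> of \<open>S\<close> with \<open>u \<gamma> = \<gamma>\<close>, and applying \<open>u \<circ> shift\<close> \<open>n\<close> times to \<open>z\<close> moves the
  correction from \<open>tail b n\<close> back to \<open>b\<close>.
\<close>

lemma equivariant_at:
  assumes b: "b \<in> algs" and z: "ext z" "\<And>e. e \<in> limit b \<Longrightarrow> shift z e = z e"
  obtains y where "ext y" "\<rho> (y b) = y (\<tau> b)"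
proof -
  note b' = algs(4)[OF b] algs(5)[OF b]
  interpret SS: field_pair S S by unfold_locales
  define g where "g = shift z"
  have g: "ext g" unfolding g_def by (rule shift_ext[OF z(1)])
  note T = tail_subfield[OF b'] and TA = tail_algs[OF b]
  have gT: "g \<in> ring_hom (F\<lparr>carrier := tail b n\<rparr>) S" for n by (rule ring_hom_subring_mono[OF extD(1)[OF g] TA])
  define E where "E n = g ` tail b n" for n
  have E: "subfield (E n) S" for n unfolding E_def by (rule F.subring_hom_image(1)[OF T(1) S.field_axioms gT])
  have Ean: "E (Suc n) \<subseteq> E n" for n unfolding E_def using tail_anti[OF b', of n] by blast
  have Ean': "E m \<subseteq> E n" if "n \<le> m" for n m by (rule lift_Suc_antimono_le[of E, OF Ean that])
  let ?hk = "h ` k"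
  have hk: "subfield ?hk S" by (rule F.subring_hom_image(1)[OF k S.field_axioms h])
  have hkE: "?hk \<subseteq> E n" for n unfolding E_def using T(2)[of n] extD(2)[OF g] by (auto simp: image_iff) (metis subsetD)
  define B where "B = {s \<in> carrier S. S.eval (map h (F.Irr k b)) s = \<zero>\<^bsub>S\<^esub>}"
  note I = Irr_image[OF k h b']
  have algB: "(S.algebraic over ?hk) s" if "s \<in> B" for s
  proof (rule S.algebraicI)
    show "map h (F.Irr k b) \<noteq> []" using I(3) by auto
    show "S.eval (map h (F.Irr k b)) s = \<zero>\<^bsub>S\<^esub>" using that unfolding B_def by blast
    have "polynomial\<^bsub>S\<^esub> (carrier S) (map h (F.Irr k b))" using I(2) by (simp only: univ_poly_carrier)
    then have "polynomial\<^bsub>S\<^esub> (h ` k) (map h (F.Irr k b))" unfolding polynomial_def using I(1) by auto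
    then show "map h (F.Irr k b) \<in> carrier ((h ` k)[X]\<^bsub>S\<^esub>)" by (simp only: univ_poly_carrier)
  qed
  have "finite B" unfolding B_def by (rule I(4))
  then obtain bs where bs: "set bs = B" using finite_list by blast
  have idh: "id \<in> ring_hom (S\<lparr>carrier := ?hk\<rparr>) S" using subfieldE(3)[OF hk] by (intro ring_hom_memI) auto
  have idh': "id \<in> ring_hom (S\<lparr>carrier := E n\<rparr>) S" for n using subfieldE(3)[OF E] by (intro ring_hom_memI) auto
  have bsC: "set bs \<subseteq> carrier S" unfolding bs B_def by blast
  obtain \<gamma> n' where \<gamma>: "\<gamma> \<in> S.finite_extension ?hk bs" "\<gamma> \<in> carrier S" "(S.algebraic over ?hk) \<gamma>" "frob_exp S n'"
    "\<And>s. s \<in> set bs \<Longrightarrow> s [^]\<^bsub>S\<^esub> n' \<in> S.simple_extension ?hk \<gamma>"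
    by (rule SS.primitive_element[OF hk idh bsC algB]; (simp only: bs)?; rule that)
  have \<gamma>E: "(S.algebraic over E n) \<gamma>" for n by (rule S.algebraic_mono[OF hkE \<gamma>(3)])
  \<comment> \<open>The fields \<open>E m\<close> decrease, so the degrees of \<gamma> over them
    grow; they are bounded by its degree over \<open>?hk\<close>, and the largest one is
    attained.\<close>
  obtain n0 where n0: "\<And>m. S.deg_over (E m) \<gamma> \<le> S.deg_over (E n0) \<gamma>"
  proof -
    have bd: "\<forall>m. True \<longrightarrow> S.deg_over (E m) \<gamma> \<le> S.deg_over ?hk \<gamma>"
      using S.deg_over_mono[OF hk E hkE \<gamma>(2,3)] by blast
    have "\<forall>m. True \<longrightarrow> S.deg_over (E m) \<gamma> < Suc (S.deg_over ?hk \<gamma>)" using bd by (simp add: less_Suc_eq_le)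
    from ex_has_greatest_nat[of "\<lambda>_. True" 0 "\<lambda>m. S.deg_over (E m) \<gamma>", OF TrueI this]
    obtain n0 where n0: "\<forall>y. True \<longrightarrow> S.deg_over (E y) \<gamma> \<le> S.deg_over (E n0) \<gamma>" by (elim exE conjE) (rule that)
    show ?thesis by (rule that[of n0]) (use n0 in simp)
  qed
  let ?q = "S.Irr (E n0) \<gamma>"
  note Im = SS.Irr_image[OF E idh' \<gamma>(2) \<gamma>E]
  \<comment> \<open>For \<open>m\<close> beyond \<open>n0\<close> the minimal polynomial over the
    smaller field has the same degree, hence is the same polynomial.\<close>
  have q: "set ?q \<subseteq> E m" for m
  proof (cases "m \<le> n0")
    case True
    then show ?thesis using Im(1)[of n0] Ean'[OF True] by blast
  next
    case False
    then have mn: "E m \<subseteq> E n0" using Ean'[of n0 m] by simp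
    have "S.deg_over (E n0) \<gamma> \<le> S.deg_over (E m) \<gamma>" by (rule S.deg_over_mono[OF E E mn \<gamma>(2) \<gamma>E])
    then have l: "length (S.Irr (E m) \<gamma>) = length ?q" using n0[of m] Im(3)[of m] Im(3)[of n0] by simp
    note I' = S.IrrE[OF E[of m] \<gamma>(2) \<gamma>E]
    have "S.Irr (E m) \<gamma> = ?q"
      by (rule S.Irr_unique[OF E \<gamma>(2) \<gamma>E order_trans[OF Im(1) mn] I'(3) l I'(4)])
    then show ?thesis using Im(1)[of m] by simp
  qed
  have ginj: "inj_on g algs" by (rule F.subfield_hom_inj[OF algs(1) S.field_axioms extD(1)[OF g]])
  \<comment> \<open>The discrepancy between \<open>shift z\<close> and \<open>z\<close> on the tail,
    as a homomorphism on the image of the tail under \<open>shift z\<close>.\<close>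
  define v where "v c = z (inv_into (tail b n0) g c)" for c
  have vg: "v (g a) = z a" if "a \<in> tail b n0" for a
    unfolding v_def using inv_into_f_f[OF inj_on_subset[OF ginj TA] that] by simp
  \<comment> \<open>By injectivity of \<open>g\<close> a coefficient of \<open>?q\<close> has one
    preimage that lies in every tail, thus in the limit field, where \<open>z\<close> and
    \<open>shift z\<close> agree.\<close>
  have vq: "v c = c" if c: "c \<in> set ?q" for c
  proof -
    obtain a where a: "a \<in> tail b n0" "c = g a" using c q[of n0] unfolding E_def by blast
    have "a \<in> tail b m" for m
    proof -
      obtain a' where a': "a' \<in> tail b m" "c = g a'" using c q[of m] unfolding E_def by blast
      have "a = a'" using inj_onD[OF ginj, of a a'] a a' TA by auto
      then show ?thesis using a'(1) by simp
    qed
    then have "a \<in> limit b" unfolding limit_def by blast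
    then show ?thesis using z(2)[of a] vg[OF a(1)] a(2) unfolding g_def by simp
  qed
  have vh: "v \<in> ring_hom (S\<lparr>carrier := E n0\<rparr>) S"
    using ring_hom_trans[OF F.subring_hom_image(2)[OF T(1) S.field_axioms gT] ring_hom_subring_mono[OF extD(1)[OF z(1)] TA]]
    unfolding E_def v_def comp_def .
  have "map v ?q = ?q" using vq by (intro map_idI)
  then have "S.eval (map v ?q) \<gamma> = \<zero>\<^bsub>S\<^esub>" using S.IrrE(4)[OF E \<gamma>(2) \<gamma>E, of n0] by simp
  \<comment> \<open>Since \<open>v\<close> fixes the coefficients of the minimal polynomial of
    \<gamma>, the element \<gamma> is an admissible value at \<gamma>.\<close>
  then obtain V u where V: "place S S V u" "E n0 \<subseteq> V" "\<And>a. a \<in> E n0 \<Longrightarrow> u a = v a" "\<gamma> \<in> V" "u \<gamma> = \<gamma>"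
    using SS.root_place[OF E vh \<gamma>(2) \<gamma>E \<gamma>(2)] that by metis
  have hkV: "?hk \<subseteq> V" using hkE[of n0] V(2) by blast
  have algV: "s \<in> V" if "s \<in> carrier S" "(S.algebraic over ?hk) s" for s
    by (rule SS.algebraic_in_place[OF V(1) hk hkV that])
  have uk: "u c = c" if c: "c \<in> ?hk" for c
  proof -
    obtain a where a: "a \<in> k" "c = h a" using c by blast
    then have "c = g a" using extD(2)[OF g] by simp
    then show ?thesis using V(3)[of c] vg[of a] T(2)[of n0] hkE[of n0] c a extD(2)[OF z(1)] by (auto simp: subset_iff)
  qed
  \<comment> \<open>The \<open>n'\<close>-th power of a conjugate of \<open>b\<close> lies in the
    field generated by \<gamma>, which \<open>u\<close> fixes, and the power determines the
    conjugate.\<close>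
  have uB: "u s = s" if s: "s \<in> B" for s
  proof -
    have sV: "s \<in> V" using algV algB[OF s] s unfolding B_def by blast
    have Vid: "id \<in> ring_hom (S\<lparr>carrier := V\<rparr>) S" using subringE(1)[OF placeD(1)[OF V(1)]] by (intro ring_hom_memI) auto
    have "u (s [^]\<^bsub>S\<^esub> n') = id (s [^]\<^bsub>S\<^esub> n')"
      by (rule S.hom_agree_simple_extension[OF placeD(1)[OF V(1)] hkV V(4) S.ring_axioms placeD(2)[OF V(1)] Vid _ _ \<gamma>(5)])
        (use uk V(5) s bs in auto)
    then show ?thesis
      using S.hom_agree_frob[OF placeD(1)[OF V(1)] sV S.field_axioms placeD(2)[OF V(1)] Vid \<gamma>(4)] by simp
  qed
  have zV: "w a \<in> V" if w: "ext w" and a: "a \<in> algs" for w a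
    by (rule algV[OF ext_closed[OF w a] hom_algebraic[OF k h algs_ring algs(2) a algs(5)[OF a] extD[OF w]]])
  define t where "t w a = u (shift w a)" for w a
  have t: "ext (t w)" if w: "ext w" for w
  proof -
    note sw = shift_ext[OF w]
    have "shift w \<in> ring_hom (F\<lparr>carrier := algs\<rparr>) (S\<lparr>carrier := V\<rparr>)"
      using ring_hom_memE[OF extD(1)[OF sw]] zV[OF sw] by (intro ring_hom_memI) auto
    from ring_hom_trans[OF this placeD(2)[OF V(1)]] show ?thesis
      unfolding ext_def t_def comp_def using extD(2)[OF sw] uk by auto
  qed
  have agree: "w ((\<tau> ^^ j) a) = w' ((\<tau> ^^ j) a) \<Longrightarrow> (t ^^ j) w a = (t ^^ j) w' a" for j a w w'
  proof (induction j arbitrary: a)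
    case (Suc j)
    have "(t ^^ j) w (\<tau> a) = (t ^^ j) w' (\<tau> a)" by (rule Suc(1)) (use Suc(2) in \<open>simp add: funpow_swap1\<close>)
    then show ?case unfolding funpow.simps comp_apply t_def[of "(t ^^ j) w"] t_def[of "(t ^^ j) w'"]
        shift_def[of "(t ^^ j) w"] shift_def[of "(t ^^ j) w'"] by simp
  qed simp
  define y where "y = (t ^^ n0) z"
  have y: "ext y"
  proof -
    have "ext ((t ^^ j) z)" for j by (induction j) (simp_all add: t z(1))
    then show ?thesis by (simp add: y_def)
  qed
  have bt: "(\<tau> ^^ n) b \<in> tail b n" for n
  proof -
    have "(\<tau> ^^ (n + 0)) b \<in> tower b k n 1" by (rule tower_mem[OF b' kk[OF b']]) simp
    then show ?thesis unfolding tail_def by (intro UN_I[of 1]) (simp_all only: UNIV_I add_0_right)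
  qed
  \<comment> \<open>On \<open>tail b n0\<close> the map \<open>u\<close> takes
    \<open>shift z\<close> to \<open>z\<close>, and this tail contains the \<open>n0\<close>-th
    iterate of \<open>b\<close>.\<close>
  have "t z ((\<tau> ^^ n0) b) = z ((\<tau> ^^ n0) b)"
    using V(3)[of "g ((\<tau> ^^ n0) b)"] vg[OF bt] bt[of n0] unfolding t_def g_def[symmetric] E_def by simp
  then have "(t ^^ n0) (t z) b = (t ^^ n0) z b" by (rule agree)
  then have ty: "t y b = y b" unfolding y_def by (simp add: funpow_swap1)
  \<comment> \<open>The value \<open>shift y b\<close> is a conjugate of \<open>b\<close> and so
    fixed by \<open>u\<close>; the correction disappears at \<open>b\<close>.\<close>
  have "shift y b \<in> B" unfolding B_def
    using hom_root[OF k algs_ring algs(2) b b'(2) extD[OF shift_ext[OF y]]] by blast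
  then have "shift y b = y b" using uB ty unfolding t_def by simp
  then have "\<rho> (y b) = y (\<tau> b)" using shift(2)[OF y b] by simp
  then show ?thesis by (rule that[OF y])
qed


text \<open>By compactness only finitely many elements have to be treated at once. Up to
  \<open>n\<close>-th powers they lie in \<open>k(b)\<close> for a single \<open>b\<close>, so
  equivariance at \<open>b\<close> suffices.\<close>

theorem equivariant_extension:
  assumes good_hom: "\<And>x. good x \<Longrightarrow> \<exists>\<delta> \<in> ring_hom (F\<lparr>carrier := F.simple_extension k x\<rparr>) S.
    (\<forall>a \<in> k. \<delta> a = h a) \<and> \<rho> (\<delta> x) = \<delta> (\<tau> x)"
  obtains g where "ext g" "\<And>a. a \<in> algs \<Longrightarrow> \<rho> (g a) = g (\<tau> a)"
proof -
  obtain g where g: "g \<in> ring_hom (F\<lparr>carrier := algs\<rparr>) S" "\<And>a. a \<in> k \<Longrightarrow> g a = h a"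
    "\<And>a. a \<in> algs \<Longrightarrow> \<rho> (g a) = g (\<tau> a)"
  proof (rule hom_compactness[OF k h algs_ring algs(2,5), where I = algs and p = "\<lambda>a. a" and q = \<tau> and r = "\<lambda>_ v w. \<rho> v = w"])
    show "\<exists>z. z \<in> ring_hom (F\<lparr>carrier := algs\<rparr>) S \<and> (\<forall>a\<in>k. z a = h a) \<and> (\<forall>s\<in>J. \<rho> (z s) = z (\<tau> s))"
      if J: "finite J" "J \<subseteq> algs" for J
    proof -
      obtain xs where xs: "set xs = J" using finite_list[OF J(1)] by blast
      have xsC: "set xs \<subseteq> carrier F" unfolding xs using J(2) algs(4) by blast
      have xsa: "(F.algebraic over k) x" if "x \<in> set xs" for x using that J(2) algs(5) unfolding xs by blast
      obtain b n where b: "b \<in> F.finite_extension k xs" "b \<in> carrier F" "(F.algebraic over k) b" "frob_exp F n"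
        "\<And>s. s \<in> set xs \<Longrightarrow> s [^]\<^bsub>F\<^esub> n \<in> F.simple_extension k b"
        by (rule primitive_element[OF k h xsC xsa]; (assumption)?; rule that)
      have ba: "b \<in> algs" unfolding algs_def using b(2,3) by blast
      obtain z0 where z0: "ext z0" "\<And>e. e \<in> limit b \<Longrightarrow> shift z0 e = z0 e"
        by (rule fixed_on_limit[OF good_hom ba]; (assumption)?; rule that)
      obtain y where y: "ext y" "\<rho> (y b) = y (\<tau> b)" by (rule equivariant_at[where b = b and z = z0, OF ba z0]; (assumption)?; rule that)
      have "\<rho> (y s) = y (\<tau> s)" if s: "s \<in> J" for s
      proof -
        have yk: "\<rho> (y a) = y (\<tau> a)" if "a \<in> k" for a
          using that extD(2)[OF y(1)] \<tau>k equiv by (simp add: image_subset_iff)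
        have sx: "s \<in> set xs" "s \<in> algs" using s J(2) unfolding xs by blast+
        have "\<rho> (y (s [^]\<^bsub>F\<^esub> n)) = y (\<tau> (s [^]\<^bsub>F\<^esub> n))"
          by (rule F.hom_agree_simple_extension[OF algs_ring algs(2) ba S.ring_axioms \<rho>_ext[OF y(1)] ext_\<tau>[OF y(1)] yk y(2) b(5)[OF sx(1)]])
        then show ?thesis
          by (rule F.hom_agree_frob[OF algs_ring sx(2) S.field_axioms \<rho>_ext[OF y(1)] ext_\<tau>[OF y(1)] frob_S[OF b(4)]])
      qed
      then show ?thesis using extD[OF y(1)] by (intro exI[of _ y]) simp
    qed
  next
    show "\<tau> i \<in> algs" if "i \<in> algs" for i by (rule algs_\<tau>[OF that])
  qed (assumption | rule that)+
  show ?thesis by (rule that[of g]) (simp_all add: ext_def g)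
qed

end

section \<open>Lifting an endomorphism to an algebraic closure\<close>

lemma (in field) algebraic_over_algebraics:
  assumes k: "subfield k R" and q: "set q \<subseteq> carrier R" "q \<noteq> []" "hd q \<noteq> \<zero>" "\<And>c. c \<in> set q \<Longrightarrow> (algebraic over k) c"
    and x: "x \<in> carrier R" "eval q x = \<zero>"
  shows "(algebraic over k) x"
proof -
  let ?K = "finite_extension k q"
  have K: "subfield ?K R" by (rule finite_extension_is_subfield[OF k q(1,4)])
  have "set q \<subseteq> ?K" by (rule finite_extension_mem[OF subfieldE(1)[OF k] q(1)])
  then have "polynomial ?K q" unfolding polynomial_def using q(2,3) by simp
  then have "q \<in> carrier (?K[X])" by (simp only: univ_poly_carrier)
  then have xa: "(algebraic over ?K) x" by (rule algebraicI) (rule q(2), rule x(2))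
  obtain n where n: "dimension n k ?K" using finite_extension_finite_dimension(1)[OF k q(1,4)] by blast
  have "finite_dimension k (simple_extension ?K x)"
    by (rule finite_dimensionI[OF telescopic_base[OF k K n dimension_simple_extension[OF K x(1) xa]]])
  then show ?thesis
    by (rule finite_dimension_imp_algebraic[OF k simple_extension_subring[OF subfieldE(1)[OF K] x(1)] _ simple_extension_mem[OF subfieldE(1)[OF K] x(1)]])
qed

context algebraically_closed
begin

lemma algebraics_algebraically_closed:
  assumes k: "subfield k L"
  shows "algebraically_closed (L\<lparr>carrier := {x \<in> carrier L. (algebraic over k) x}\<rparr>)"
proof -
  let ?E = "{x \<in> carrier L. (algebraic over k) x}"
  have E: "subfield ?E L" by (rule subfield_of_algebraics[OF k])
  note Er = subfieldE(1)[OF E]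
  show ?thesis
  proof (rule field.algebraically_closedI[OF subfield_iff(2)[OF E]])
    fix p assume p: "p \<in> carrier (poly_ring (L\<lparr>carrier := ?E\<rparr>))" "length p - 1 > 1"
    then have "p \<in> carrier (univ_poly L ?E)" by (simp add: univ_poly_consistent[OF Er])
    then have pp: "polynomial ?E p" by (simp only: univ_poly_carrier)
    then have pE: "set p \<subseteq> ?E" "p \<noteq> []" "hd p \<noteq> \<zero>" using p(2) unfolding polynomial_def by auto
    then have "polynomial (carrier L) p" unfolding polynomial_def by auto
    then have "p \<in> carrier (poly_ring L)" by (simp only: univ_poly_carrier)
    then obtain \<xi> where \<xi>: "\<xi> \<in> carrier L" "eval p \<xi> = \<zero>" by (rule root_exists) (use p(2) in auto)
    have "(algebraic over k) \<xi>" by (rule algebraic_over_algebraics[OF k _ pE(2,3) _ \<xi>]) (use pE(1) in auto)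
    then show "\<exists>x \<in> carrier (L\<lparr>carrier := ?E\<rparr>). ring.eval (L\<lparr>carrier := ?E\<rparr>) p x = \<zero>\<^bsub>L\<lparr>carrier := ?E\<rparr>\<^esub>"
      using \<xi> eval_consistent[OF Er] by auto
  qed
qed

text \<open>The polynomial is a product of monic linear factors whose roots lie in \<open>E\<close>.
  In \<open>endo_lift\<close> it is a minimal polynomial over \<open>L\<close> with roots algebraic
  over \<open>k\<close>.\<close>

lemma coefficients_of_roots:
  assumes E: "subring E L"
  shows "set q \<subseteq> carrier L \<Longrightarrow> q \<noteq> [] \<Longrightarrow> hd q = \<one> \<Longrightarrow> (\<And>\<xi>. \<xi> \<in> carrier L \<Longrightarrow> eval q \<xi> = \<zero> \<Longrightarrow> \<xi> \<in> E) \<Longrightarrow> set q \<subseteq> E"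
proof (induction "length q" arbitrary: q)
  case (Suc n)
  note sr = subringE[OF E]
  show ?case
  proof (cases "length q > 1")
    case False
    then obtain a where "q = [a]" using Suc(4) by (cases q) auto
    then show ?thesis using Suc(5) sr(3) by simp
  next
    case True
    obtain \<xi> q' where q': "\<xi> \<in> carrier L" "set q' \<subseteq> carrier L" "q' \<noteq> []" "hd q' = \<one>" "length q = Suc (length q')"
      "q = poly_mult [\<one>, \<ominus> \<xi>] q'"
      by (rule monic_linear_factor[OF Suc(3) True Suc(5)]; rule that)
    let ?X = "[\<one>, \<ominus> \<xi>]"
    have X: "set ?X \<subseteq> carrier L" using q'(1) by simp
    have ev: "eval q x = (x \<ominus> \<xi>) \<otimes> eval q' x" if x: "x \<in> carrier L" for x
    proof -
      have "eval ?X x = x \<ominus> \<xi>" using x q'(1) by (simp add: a_minus_def)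
      then show ?thesis unfolding q'(6) by (simp add: eval_poly_mult[OF X q'(2) x] del: poly_mult.simps eval.simps)
    qed
    have c: "eval q' x \<in> carrier L" if "x \<in> carrier L" for x using eval_in_carrier[OF q'(2) that] .
    have "eval q \<xi> = \<zero>" using ev[OF q'(1)] c[OF q'(1)] q'(1) by (simp add: a_minus_def r_neg)
    then have \<xi>E: "\<xi> \<in> E" by (rule Suc(6)[OF q'(1)])
    have "x \<in> E" if x: "x \<in> carrier L" "eval q' x = \<zero>" for x
      using Suc(6)[OF x(1)] ev[OF x(1)] x q'(1) by simp
    then have "set q' \<subseteq> E" using Suc(1)[OF _ q'(2,3,4)] Suc(2) q'(5) by simp
    moreover have "set ?X \<subseteq> E" using \<xi>E sr(3,5) by simp
    ultimately show ?thesis unfolding q'(6)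
      using poly_mult_is_polynomial[OF E] polynomial_incl by blast
  qed
qed simp

end

locale endo_extension = \<Lambda>: algebraically_closed \<Lambda> + \<Omega>: algebraically_closed \<Omega>
  for \<Lambda> :: "'f ring" and \<Omega> :: "'s ring" +
  fixes L k \<theta> \<rho> g
  assumes L: "subfield L \<Lambda>" "\<And>x. x \<in> carrier \<Lambda> \<Longrightarrow> (\<Lambda>.algebraic over L) x" and k: "subfield k \<Lambda>" "k \<subseteq> L"
    and \<theta>: "\<theta> \<in> ring_hom (\<Lambda>\<lparr>carrier := L\<rparr>) (\<Lambda>\<lparr>carrier := L\<rparr>)" "\<theta> ` k \<subseteq> k"
    and \<rho>: "\<rho> \<in> ring_hom \<Omega> \<Omega>"
    and g: "g \<in> ring_hom (\<Lambda>\<lparr>carrier := {x \<in> L. (\<Lambda>.algebraic over k) x}\<rparr>) \<Omega>"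
      "\<And>x. x \<in> L \<Longrightarrow> (\<Lambda>.algebraic over k) x \<Longrightarrow> \<rho> (g x) = g (\<theta> x)"
begin

sublocale field_pair \<Lambda> \<Omega> by unfold_locales

definition E where "E = {x \<in> carrier \<Lambda>. (\<Lambda>.algebraic over k) x}"
definition A where "A = {x \<in> L. (\<Lambda>.algebraic over k) x}"

lemma LC: "L \<subseteq> carrier \<Lambda>" by (rule subfieldE(3)[OF L(1)])

lemma E: "subfield E \<Lambda>" "k \<subseteq> E" "A \<subseteq> E" "A = E \<inter> L"
proof -
  show "subfield E \<Lambda>" unfolding E_def by (rule \<Lambda>.subfield_of_algebraics[OF k(1)])
  show "k \<subseteq> E" unfolding E_def using \<Lambda>.algebraic_self[OF subfieldE(1)[OF k(1)]] subfieldE(3)[OF k(1)] by blast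
  show "A \<subseteq> E" "A = E \<inter> L" unfolding A_def E_def using LC by blast+
qed

lemma A: "subring A \<Lambda>" "k \<subseteq> A"
  unfolding E(4) using \<Lambda>.subring_Inter[of "{E, L}"] subfieldE(1)[OF E(1)] subfieldE(1)[OF L(1)] E(2) k(2) by auto


lemmas Er = subfieldE(1)[OF E(1)] and kr = subfieldE(1)[OF k(1)] and Lr = subfieldE(1)[OF L(1)]

lemma EI: "x \<in> carrier \<Lambda> \<Longrightarrow> (\<Lambda>.algebraic over k) x \<Longrightarrow> x \<in> E"
  and ED: "x \<in> E \<Longrightarrow> x \<in> carrier \<Lambda>" "x \<in> E \<Longrightarrow> (\<Lambda>.algebraic over k) x"
  by (simp_all add: E_def)

lemma \<theta>k: "a \<in> k \<Longrightarrow> \<theta> a \<in> k" using \<theta>(2) by blast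

lemma \<theta>L: "\<theta> \<in> ring_hom (\<Lambda>\<lparr>carrier := L\<rparr>) \<Lambda>"
  using ring_hom_memE[OF \<theta>(1)] LC by (intro ring_hom_memI) auto

lemma \<theta>A: "a \<in> A \<Longrightarrow> \<theta> a \<in> A"
proof -
  assume a: "a \<in> A"
  then have aL: "a \<in> L" "a \<in> carrier \<Lambda>" "(\<Lambda>.algebraic over k) a" unfolding A_def using LC by auto
  interpret \<Lambda>\<Lambda>: field_pair \<Lambda> \<Lambda> by unfold_locales
  have "(\<Lambda>.algebraic over (\<theta> ` k)) (\<theta> a)"
    by (rule \<Lambda>\<Lambda>.hom_algebraic[OF k(1) ring_hom_subring_mono[OF \<theta>L k(2)] Lr k(2) aL(1,3) \<theta>L]) simp
  then have "(\<Lambda>.algebraic over k) (\<theta> a)" by (rule \<Lambda>.algebraic_mono[OF \<theta>(2)])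
  then show ?thesis unfolding A_def using ring_hom_memE(1)[OF \<theta>(1), of a] aL(1) by simp
qed

text \<open>A place extends \<open>g\<close> to \<open>x\<close> on \<open>E\<close>. Because
  \<open>E\<close> is algebraically closed, a root in \<Omega> of a monic polynomial over the image
  of \<open>x\<close> lies in that image. So \<rho> maps the image into itself, and \<open>w\<close>
  is \<rho> read through the injection \<open>x\<close>; injectivity also yields agreement with
  \<theta> on \<open>A\<close>.\<close>

lemma algebraics_lift:
  obtains x w where "x \<in> ring_hom (\<Lambda>\<lparr>carrier := E\<rparr>) \<Omega>" "w \<in> ring_hom (\<Lambda>\<lparr>carrier := E\<rparr>) (\<Lambda>\<lparr>carrier := E\<rparr>)"
    "\<And>a. a \<in> A \<Longrightarrow> x a = g a" "\<And>a. a \<in> A \<Longrightarrow> w a = \<theta> a" "\<And>e. e \<in> E \<Longrightarrow> x (w e) = \<rho> (x e)"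
proof -
  have gA: "g \<in> ring_hom (\<Lambda>\<lparr>carrier := A\<rparr>) \<Omega>" using g(1) unfolding A_def .
  have g\<rho>: "\<rho> (g a) = g (\<theta> a)" if "a \<in> A" for a using g(2) that unfolding A_def by blast
  obtain V x where V: "place \<Lambda> \<Omega> V x" "A \<subseteq> V" "\<And>a. a \<in> A \<Longrightarrow> x a = g a"
    by (rule place_extends[OF A(1) gA]; rule that)
  have kV: "k \<subseteq> V" using A(2) V(2) by blast
  have EV: "E \<subseteq> V" using algebraic_in_place[OF V(1) k(1) kV] unfolding E_def by blast
  have x: "x \<in> ring_hom (\<Lambda>\<lparr>carrier := E\<rparr>) \<Omega>" by (rule ring_hom_subring_mono[OF placeD(2)[OF V(1)] EV])
  have xk: "\<rho> (x a) = x (\<theta> a)" if "a \<in> A" for a using g\<rho>[OF that] V(3)[OF that] V(3)[OF \<theta>A[OF that]] by simp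
  note EE = \<Lambda>.subfield_iff(2)[OF E(1)]
  have rx: "(\<lambda>a. \<rho> (x a)) \<in> ring_hom (\<Lambda>\<lparr>carrier := E\<rparr>) \<Omega>" using ring_hom_trans[OF x \<rho>] by (simp add: comp_def)
  have im: "\<rho> (x e) \<in> x ` E" if e: "e \<in> E" for e
  proof -
    \<comment> \<open>On \<open>k\<close> the maps \<open>\<rho> \<circ> x\<close> and
      \<open>x \<circ> \<theta>\<close> coincide, so \<open>\<rho> (x e)\<close> is a root of the
      \<open>x\<close>-image of this polynomial.\<close>
    let ?q = "map \<theta> (\<Lambda>.Irr k e)"
    note I = \<Lambda>.IrrE[OF k(1) ED[OF e]] and Im = Irr_image[OF k(1) ring_hom_subring_mono[OF x E(2)] ED[OF e]]
    have qk: "set ?q \<subseteq> k" using Im(1) \<theta>k by auto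
    have "\<rho> (x e) \<in> x ` carrier (\<Lambda>\<lparr>carrier := E\<rparr>)"
    proof (rule algebraically_closed.image_of_roots[OF _ \<Omega>.field_axioms x, where q = ?q])
      show "algebraically_closed (\<Lambda>\<lparr>carrier := E\<rparr>)" unfolding E_def by (rule \<Lambda>.algebraics_algebraically_closed[OF k(1)])
      show "\<rho> (x e) \<in> carrier \<Omega>" using ring_hom_memE(1)[OF rx] e by simp
      show "set ?q \<subseteq> carrier (\<Lambda>\<lparr>carrier := E\<rparr>)" using qk E(2) by simp
      show "?q \<noteq> []" using Im(3) by auto
      show "hd ?q = \<one>\<^bsub>\<Lambda>\<lparr>carrier := E\<rparr>\<^esub>" using Im(3) I(3) ring_hom_memE(4)[OF \<theta>L] by (cases "\<Lambda>.Irr k e") auto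
      have e': "map x ?q = map (\<lambda>a. \<rho> (x a)) (\<Lambda>.Irr k e)" using xk A(2) Im(1) by (auto simp: subset_iff)
      show "\<Omega>.eval (map x ?q) (\<rho> (x e)) = \<zero>\<^bsub>\<Omega>\<^esub>"
        unfolding e' by (rule hom_root(2)[OF k(1) Er E(2) e ED(2)[OF e] rx refl])
    qed
    then show ?thesis by simp
  qed
  define w where "w e = inv_into E x (\<rho> (x e))" for e
  have wE: "w e \<in> E" "x (w e) = \<rho> (x e)" if "e \<in> E" for e
    using im[OF that] unfolding w_def by (simp_all add: inv_into_into f_inv_into_f)
  have xinj: "inj_on x E" by (rule \<Lambda>.subfield_hom_inj[OF E(1) \<Omega>.field_axioms x])
  have wI: "w e = y" if "e \<in> E" "y \<in> E" "x y = \<rho> (x e)" for e y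
    using inj_onD[OF xinj, of "w e" y] wE[OF that(1)] that by simp
  note xm = ring_hom_memE[OF x, simplified] and rm = ring_hom_memE[OF \<rho>] and sr = subringE[OF Er]
  have "w \<in> ring_hom (\<Lambda>\<lparr>carrier := E\<rparr>) (\<Lambda>\<lparr>carrier := E\<rparr>)"
    using wE xm rm sr(3,6,7) by (intro ring_hom_memI) (auto intro!: wI)
  moreover have "w a = \<theta> a" if a: "a \<in> A" for a
    by (rule wI) (use a \<theta>A[OF a] E(3) xk[OF a] in auto)
  ultimately show ?thesis using that[OF x _ V(3)] wE(2) by blast
qed

text \<open>The maps to be joined agree on \<open>A\<close>, the intersection of \<open>E\<close>
  and \<open>L\<close>. For \<open>c\<close> in \<open>E\<close> all roots of the minimal polynomial
  over \<open>L\<close> are algebraic over \<open>k\<close>, so its coefficients lie in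
  \<open>A\<close>; hence \<open>v c\<close> is a root of its \<theta>-image, and \<theta> extends
  with value \<open>v c\<close> at \<open>c\<close>. Primitive elements and compactness then cover
  all of \<open>E\<close>.\<close>

theorem endo_lift:
  obtains x w where "x \<in> ring_hom (\<Lambda>\<lparr>carrier := E\<rparr>) \<Omega>" "w \<in> ring_hom \<Lambda> \<Lambda>" "w ` E \<subseteq> E"
    "\<And>a. a \<in> A \<Longrightarrow> x a = g a" "\<And>a. a \<in> L \<Longrightarrow> w a = \<theta> a" "\<And>e. e \<in> E \<Longrightarrow> x (w e) = \<rho> (x e)"
proof -
  obtain x v where x: "x \<in> ring_hom (\<Lambda>\<lparr>carrier := E\<rparr>) \<Omega>" and v: "v \<in> ring_hom (\<Lambda>\<lparr>carrier := E\<rparr>) (\<Lambda>\<lparr>carrier := E\<rparr>)"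
    and xg: "\<And>a. a \<in> A \<Longrightarrow> x a = g a" and v\<theta>: "\<And>a. a \<in> A \<Longrightarrow> v a = \<theta> a" and xv: "\<And>e. e \<in> E \<Longrightarrow> x (v e) = \<rho> (x e)"
    by (rule algebraics_lift; rule that)
  interpret \<Lambda>\<Lambda>: field_pair \<Lambda> \<Lambda> by unfold_locales
  have v': "v \<in> ring_hom (\<Lambda>\<lparr>carrier := E\<rparr>) \<Lambda>" using ring_hom_memE[OF v] E_def by (intro ring_hom_memI) auto
  have vE: "v e \<in> E" if "e \<in> E" for e using ring_hom_memE(1)[OF v] that by simp
  have idk: "id \<in> ring_hom (\<Lambda>\<lparr>carrier := k\<rparr>) \<Lambda>" using subfieldE(3)[OF k(1)] by (intro ring_hom_memI) auto
  note LCr = \<Lambda>.carrier_is_subring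
  obtain w where w: "w \<in> ring_hom (\<Lambda>\<lparr>carrier := carrier \<Lambda>\<rparr>) \<Lambda>" "\<And>a. a \<in> L \<Longrightarrow> w a = \<theta> a" "\<And>e. e \<in> E \<Longrightarrow> w e = v e"
  proof (rule \<Lambda>\<Lambda>.hom_compactness[OF L(1) \<theta>L LCr LC L(2), where I = E and p = "\<lambda>a. a" and q = "\<lambda>a. a" and r = "\<lambda>e u _. u = v e"])
    show "\<exists>z. z \<in> ring_hom (\<Lambda>\<lparr>carrier := carrier \<Lambda>\<rparr>) \<Lambda> \<and> (\<forall>a\<in>L. z a = \<theta> a) \<and> (\<forall>s\<in>J. z s = v s)"
      if J: "finite J" "J \<subseteq> E" for J
    proof -
      obtain xs where xs: "set xs = J" using finite_list[OF J(1)] by blast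
      have xsC: "set xs \<subseteq> carrier \<Lambda>" unfolding xs using J(2) ED(1) by blast
      have xsa: "(\<Lambda>.algebraic over k) y" if "y \<in> set xs" for y using that J(2) ED(2) unfolding xs by blast
      obtain c n where c: "c \<in> \<Lambda>.finite_extension k xs" "c \<in> carrier \<Lambda>" "(\<Lambda>.algebraic over k) c" "frob_exp \<Lambda> n"
        "\<And>s. s \<in> set xs \<Longrightarrow> s [^]\<^bsub>\<Lambda>\<^esub> n \<in> \<Lambda>.simple_extension k c"
        by (rule \<Lambda>\<Lambda>.primitive_element[OF k(1) idk xsC xsa]; (assumption)?; rule that)
      have cE: "c \<in> E" by (rule EI[OF c(2,3)])
      note cL = L(2)[OF c(2)]
      let ?q = "\<Lambda>.Irr L c"
      note I = \<Lambda>.IrrE[OF L(1) c(2) cL] and Im = \<Lambda>\<Lambda>.Irr_image[OF L(1) \<theta>L c(2) cL]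
      have qE: "set ?q \<subseteq> E"
      proof (rule \<Lambda>.coefficients_of_roots[OF Er])
        show "set ?q \<subseteq> carrier \<Lambda>" using Im(1) LC by blast
        show "?q \<noteq> []" using Im(3) by auto
        show "hd ?q = \<one>\<^bsub>\<Lambda>\<^esub>" by (rule I(3))
        show "\<xi> \<in> E" if \<xi>: "\<xi> \<in> carrier \<Lambda>" "\<Lambda>.eval ?q \<xi> = \<zero>\<^bsub>\<Lambda>\<^esub>" for \<xi>
        proof (rule EI[OF \<xi>(1)], rule \<Lambda>.algebraicI)
          note I' = \<Lambda>.IrrE[OF k(1) c(2,3)] and Im' = \<Lambda>\<Lambda>.Irr_image[OF k(1) idk c(2,3)]
          have idL: "(\<lambda>a. a) \<in> ring_hom (\<Lambda>\<lparr>carrier := L\<rparr>) \<Lambda>" using LC by (intro ring_hom_memI) auto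
          show "\<Lambda>.Irr k c \<in> carrier (k[X]\<^bsub>\<Lambda>\<^esub>)" by (rule I'(1))
          show "\<Lambda>.Irr k c \<noteq> []" using Im'(3) by auto
          have "\<Lambda>.eval (map (\<lambda>a. a) (\<Lambda>.Irr k c)) \<xi> = \<zero>\<^bsub>\<Lambda>\<^esub>"
            by (rule \<Lambda>.root_transfer[OF L(1) c(2) cL \<Lambda>.is_cring idL \<xi>(1) _ order_trans[OF Im'(1) k(2)] I'(4)]) (use \<xi>(2) in simp)
          then show "\<Lambda>.eval (\<Lambda>.Irr k c) \<xi> = \<zero>\<^bsub>\<Lambda>\<^esub>" by simp
        qed
      qed
      have e': "map \<theta> ?q = map v ?q" using qE Im(1) v\<theta>[symmetric] unfolding E(4) by (intro map_cong refl) blast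
      have root: "\<Lambda>.eval (map \<theta> ?q) (v c) = \<zero>\<^bsub>\<Lambda>\<^esub>"
        unfolding e' using \<Lambda>.subring_hom_eval[OF Er \<Lambda>.ring_axioms v' qE cE] I(4) \<Lambda>.subring_hom_zero[OF Er \<Lambda>.ring_axioms v'] by simp
      obtain V u where V: "place \<Lambda> \<Lambda> V u" "L \<subseteq> V" "\<And>a. a \<in> L \<Longrightarrow> u a = \<theta> a" "c \<in> V" "u c = v c"
        by (rule \<Lambda>\<Lambda>.root_place[OF L(1) \<theta>L c(2) cL ED(1)[OF vE[OF cE]] root]; rule that)
      have "carrier \<Lambda> \<subseteq> V" using \<Lambda>\<Lambda>.algebraic_in_place[OF V(1) L(1) V(2)] L(2) by blast
      then have u: "u \<in> ring_hom (\<Lambda>\<lparr>carrier := carrier \<Lambda>\<rparr>) \<Lambda>" by (rule ring_hom_subring_mono[OF placeD(2)[OF V(1)]])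
      have uE: "u \<in> ring_hom (\<Lambda>\<lparr>carrier := E\<rparr>) \<Lambda>" by (rule ring_hom_subring_mono[OF u]) (use ED(1) in blast)
      have uk: "u a = v a" if "a \<in> k" for a using V(3)[of a] v\<theta>[of a] A(2) k(2) that by (auto simp: subset_iff)
      have "u s = v s" if s: "s \<in> J" for s
      proof -
        have sx: "s \<in> set xs" "s \<in> E" using s J(2) unfolding xs by blast+
        have "u (s [^]\<^bsub>\<Lambda>\<^esub> n) = v (s [^]\<^bsub>\<Lambda>\<^esub> n)"
          by (rule \<Lambda>.hom_agree_simple_extension[OF Er E(2) cE \<Lambda>.ring_axioms uE v' uk V(5) c(5)[OF sx(1)]])
        then show ?thesis by (rule \<Lambda>.hom_agree_frob[OF Er sx(2) \<Lambda>.field_axioms uE v' c(4)])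
      qed
      then show ?thesis using u V(3) by (intro exI[of _ u]) simp
    qed
  qed (assumption | rule ED(1) | rule that)+
  have "w \<in> ring_hom \<Lambda> \<Lambda>" using w(1) by (simp add: ring_hom_def)
  moreover have "w ` E \<subseteq> E" using w(3) vE by auto
  moreover have "x (w e) = \<rho> (x e)" if "e \<in> E" for e using w(3)[OF that] xv[OF that] by simp
  ultimately show ?thesis using that[OF x _ _ xg w(2)] by simp
qed

end

section \<open>Tensor products over a field\<close>

definition additive_ext :: "('a \<times> 'b) set \<Rightarrow> 'c ring \<Rightarrow> ('a \<times> 'b \<Rightarrow> 'c) \<Rightarrow> ('a \<times> 'b \<Rightarrow>\<^sub>0 int) \<Rightarrow> 'c"
  where "additive_ext D T f = (SOME h. h \<in> hom (free_Abelian_group D) (add_monoid T) \<and> (\<forall>x \<in> D. h (frag_of x) = f x))"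

lemma additive_ext:
  fixes T :: "'c ring"
  assumes "ring T" and f: "f ` D \<subseteq> carrier T"
  shows "Poly_Mapping.keys z \<subseteq> D \<Longrightarrow> additive_ext D T f z \<in> carrier T"
    "p \<in> D \<Longrightarrow> additive_ext D T f (frag_of p) = f p"
    "additive_ext D T f 0 = \<zero>\<^bsub>T\<^esub>"
    "Poly_Mapping.keys z \<subseteq> D \<Longrightarrow> Poly_Mapping.keys z' \<subseteq> D \<Longrightarrow>
      additive_ext D T f (z + z') = additive_ext D T f z \<oplus>\<^bsub>T\<^esub> additive_ext D T f z'"
    "Poly_Mapping.keys z \<subseteq> D \<Longrightarrow> Poly_Mapping.keys z' \<subseteq> D \<Longrightarrow>
      additive_ext D T f (z - z') = additive_ext D T f z \<ominus>\<^bsub>T\<^esub> additive_ext D T f z'"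
proof -
  interpret T: ring T by fact
  let ?h = "additive_ext D T f"
  have "\<exists>h. h \<in> hom (free_Abelian_group D) (add_monoid T) \<and> (\<forall>x \<in> D. h (frag_of x) = f x)"
    by (rule comm_group.free_Abelian_group_universal[OF T.a_comm_group, of f D]) (use f in auto)
  then have h: "?h \<in> hom (free_Abelian_group D) (add_monoid T)" "\<forall>x \<in> D. ?h (frag_of x) = f x"
    unfolding additive_ext_def by (rule someI2_ex; blast)+
  have c: "?h z \<in> carrier T" if "Poly_Mapping.keys z \<subseteq> D" for z
    using h(1) that unfolding hom_def by (auto simp: free_Abelian_group_def)
  have a: "?h (z + z') = ?h z \<oplus>\<^bsub>T\<^esub> ?h z'" if "Poly_Mapping.keys z \<subseteq> D" "Poly_Mapping.keys z' \<subseteq> D" for z z'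
    using h(1) that unfolding hom_def by (auto simp: free_Abelian_group_def)
  show "Poly_Mapping.keys z \<subseteq> D \<Longrightarrow> ?h z \<in> carrier T" "p \<in> D \<Longrightarrow> ?h (frag_of p) = f p"
    "Poly_Mapping.keys z \<subseteq> D \<Longrightarrow> Poly_Mapping.keys z' \<subseteq> D \<Longrightarrow> ?h (z + z') = ?h z \<oplus>\<^bsub>T\<^esub> ?h z'"
    using c a h(2) by blast+
  have "?h 0 \<oplus>\<^bsub>T\<^esub> ?h 0 = ?h 0" using a[of 0 0] by simp
  then show "?h 0 = \<zero>\<^bsub>T\<^esub>" using c[of 0] by simp
  assume z: "Poly_Mapping.keys z \<subseteq> D" "Poly_Mapping.keys z' \<subseteq> D"
  then have "?h (z - z') \<oplus>\<^bsub>T\<^esub> ?h z' = ?h z" using a[OF keys_diff_subset[OF z] z(2)] by simp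
  then show "?h (z - z') = ?h z \<ominus>\<^bsub>T\<^esub> ?h z'"
    using c[OF z(1)] c[OF z(2)] c[OF keys_diff_subset[OF z]] T.add.inv_solve_right unfolding a_minus_def by metis
qed

lemma pair_eval_hom:
  fixes T :: "'c ring"
  assumes R: "cring R" and S: "cring S" and T: "cring T" and \<alpha>: "\<alpha> \<in> ring_hom R T" and \<beta>: "\<beta> \<in> ring_hom S T"
  shows "additive_ext (carrier R \<times> carrier S) T (\<lambda>(r, s). \<alpha> r \<otimes>\<^bsub>T\<^esub> \<beta> s) \<in> ring_hom (pair_ring R S) T"
    (is "?h \<in> _")
proof -
  interpret R: cring R by fact
  interpret S: cring S by fact
  interpret T: cring T by fact
  note P = pair_ring_cring[OF R S]
  interpret P: cring "pair_ring R S" by (rule P)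
  note am = ring_hom_memE[OF \<alpha>] and bm = ring_hom_memE[OF \<beta>]
  have im: "(\<lambda>(r, s). \<alpha> r \<otimes>\<^bsub>T\<^esub> \<beta> s) ` (carrier R \<times> carrier S) \<subseteq> carrier T" using am(1) bm(1) by auto
  note h = additive_ext[OF T.ring_axioms im, folded pair_ring_carrier]
  have closed: "a \<otimes>\<^bsub>pair_ring R S\<^esub> b \<in> carrier (pair_ring R S)" if "a \<in> carrier (pair_ring R S)" "b \<in> carrier (pair_ring R S)" for a b
    using that by (rule P.m_closed)
  have d: "a - b \<in> carrier (pair_ring R S)" if "a \<in> carrier (pair_ring R S)" "b \<in> carrier (pair_ring R S)" for a b
    using that keys_diff_subset unfolding pair_ring_carrier by blast
  have mult: "?h (a \<otimes>\<^bsub>pair_ring R S\<^esub> b) = ?h a \<otimes>\<^bsub>T\<^esub> ?h b" if a: "a \<in> carrier (pair_ring R S)" and b: "b \<in> carrier (pair_ring R S)" for a b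
  proof -
    have "a \<in> carrier (pair_ring R S) \<and> ?h (a \<otimes>\<^bsub>pair_ring R S\<^esub> b) = ?h a \<otimes>\<^bsub>T\<^esub> ?h b"
      using a[unfolded pair_ring_carrier]
    proof (induction a rule: frag_induction)
      case zero
      show ?case using h(1)[OF b] by (simp add: pair_mult_0 h(3) pair_ring_carrier)
    next
      case (one p)
      then obtain r s where p: "p = (r, s)" "r \<in> carrier R" "s \<in> carrier S" by auto
      have pc: "frag_of p \<in> carrier (pair_ring R S)" using one by (simp add: pair_ring_carrier)
      have "b \<in> carrier (pair_ring R S) \<and> ?h (frag_of p \<otimes>\<^bsub>pair_ring R S\<^esub> b) = ?h (frag_of p) \<otimes>\<^bsub>T\<^esub> ?h b"
        using b[unfolded pair_ring_carrier]
      proof (induction b rule: frag_induction)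
        case zero
        show ?case using h(1)[OF pc] by (simp add: pair_mult_0 h(3) pair_ring_carrier)
      next
        case (one q)
        then obtain r' s' where q: "q = (r', s')" "r' \<in> carrier R" "s' \<in> carrier S" by auto
        have c: "\<alpha> r \<in> carrier T" "\<beta> s \<in> carrier T" "\<alpha> r' \<in> carrier T" "\<beta> s' \<in> carrier T" using p q am(1) bm(1) by auto
        show ?case unfolding p(1) q(1) using p q c
          by (simp add: pair_mult_of h(2) am(2) bm(2) pair_ring_carrier T.m_ac)
      next
        case (diff x y)
        note dd = closed[OF pc] h(1)
        have c: "?h (frag_of p) \<in> carrier T" "?h x \<in> carrier T" "?h y \<in> carrier T" using h(1) pc diff by auto
        show ?case using diff d[of x y] h(5)[OF closed[OF pc] closed[OF pc], of x y] h(5)[of x y] c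
          by (simp add: pair_mult_diff a_minus_def T.r_distr T.r_minus)
      qed
      then show ?case using pc by blast
    next
      case (diff x y)
      have c: "?h b \<in> carrier T" "?h x \<in> carrier T" "?h y \<in> carrier T" using h(1) b diff by auto
      show ?case using diff d[of x y] h(5)[OF closed[OF _ b] closed[OF _ b], of x y] h(5)[of x y] c
        by (simp add: pair_mult_diff a_minus_def T.l_distr T.l_minus)
    qed
    then show ?thesis ..
  qed
  show ?thesis
  proof (rule ring_hom_memI)
    show "?h \<one>\<^bsub>pair_ring R S\<^esub> = \<one>\<^bsub>T\<^esub>" using am(4) bm(4) by (simp add: pair_ring_simps h(2))
  qed (use h(1,4) mult in \<open>auto simp: pair_ring_simps\<close>)
qed

text \<open>Tensors are handled through representatives in the pair ring \<open>P\<close> and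
  congruences modulo \<open>I\<close>. This avoids arithmetic with cosets, and maps such as
  \<open>pair_map\<close> act on representatives.\<close>

locale tensor_pair = R: cring R + S: cring S for K :: "'k ring" and R :: "'r ring" and S :: "'s ring" +
  fixes \<phi> \<psi>
  assumes \<phi>: "\<phi> \<in> ring_hom K R" and \<psi>: "\<psi> \<in> ring_hom K S"
begin

abbreviation P where "P \<equiv> pair_ring R S"
abbreviation I where "I \<equiv> tensor_ideal K R \<phi> S \<psi>"

sublocale P: cring P by (rule pair_ring_cring[OF R.is_cring S.is_cring])

sublocale I: ideal I P by (rule tensor_ideal(1)[OF R.is_cring S.is_cring \<phi> \<psi>])

lemmas \<phi>_hom = ring_hom_memE[OF \<phi>] and \<psi>_hom = ring_hom_memE[OF \<psi>]

lemma P_minus: "a \<in> carrier P \<Longrightarrow> \<ominus>\<^bsub>P\<^esub> a = - a"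
  using P.l_neg[of a] by (simp add: pair_ring_simps add_eq_0_iff2)

lemma P_diff: "a \<in> carrier P \<Longrightarrow> b \<in> carrier P \<Longrightarrow> a - b \<in> carrier P"
  and P_add: "a \<in> carrier P \<Longrightarrow> b \<in> carrier P \<Longrightarrow> a + b \<in> carrier P"
  using P.minus_closed[of a b] P.a_closed[of a b] P_minus[of b] by (simp_all add: a_minus_def pair_ring_simps)

lemma P_of: "frag_of (r, s) \<in> carrier P \<longleftrightarrow> r \<in> carrier R \<and> s \<in> carrier S"
  by (simp add: pair_ring_carrier)

lemma I_zero: "0 \<in> I" and I_add: "a \<in> I \<Longrightarrow> b \<in> I \<Longrightarrow> a + b \<in> I"
  using I.zero_closed I.a_closed[of a b] by (simp_all add: pair_ring_simps)

lemma I_carrier: "a \<in> I \<Longrightarrow> a \<in> carrier P" by (rule I.Icarr)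

lemma I_minus: "a \<in> I \<Longrightarrow> - a \<in> I"
  using I.a_inv_closed[of a] P_minus[OF I_carrier] by simp

lemma I_diff: "a \<in> I \<Longrightarrow> b \<in> I \<Longrightarrow> a - b \<in> I"
  using I_add[OF _ I_minus, of a b] by simp

lemma I_mem_cong: "a - b \<in> I \<Longrightarrow> a \<in> I \<longleftrightarrow> b \<in> I"
  using I_diff[of a "a - b"] I_add[of b "a - b"] by auto

lemma I_relations:
  "r \<in> carrier R \<Longrightarrow> r' \<in> carrier R \<Longrightarrow> s \<in> carrier S \<Longrightarrow> frag_of (r \<oplus>\<^bsub>R\<^esub> r', s) - (frag_of (r, s) + frag_of (r', s)) \<in> I"
  "r \<in> carrier R \<Longrightarrow> s \<in> carrier S \<Longrightarrow> s' \<in> carrier S \<Longrightarrow> frag_of (r, s \<oplus>\<^bsub>S\<^esub> s') - (frag_of (r, s) + frag_of (r, s')) \<in> I"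
  "a \<in> carrier K \<Longrightarrow> r \<in> carrier R \<Longrightarrow> s \<in> carrier S \<Longrightarrow> frag_of (\<phi> a \<otimes>\<^bsub>R\<^esub> r, s) - frag_of (r, \<psi> a \<otimes>\<^bsub>S\<^esub> s) \<in> I"
  using tensor_ideal(2)[OF R.is_cring S.is_cring \<phi> \<psi>] unfolding diff_diff_eq[symmetric] tensor_relations_def by blast+

lemma I_zero_of: "s \<in> carrier S \<Longrightarrow> frag_of (\<zero>\<^bsub>R\<^esub>, s) \<in> I" "r \<in> carrier R \<Longrightarrow> frag_of (r, \<zero>\<^bsub>S\<^esub>) \<in> I"
  using I_minus[OF I_relations(1)[of "\<zero>\<^bsub>R\<^esub>" "\<zero>\<^bsub>R\<^esub>" s]] I_minus[OF I_relations(2)[of r "\<zero>\<^bsub>S\<^esub>" "\<zero>\<^bsub>S\<^esub>"]] by simp_all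

abbreviation pure_sum :: "'r list \<Rightarrow> 's list \<Rightarrow> ('r \<times> 's \<Rightarrow>\<^sub>0 int)"
  where "pure_sum ds os \<equiv> sum_list (map frag_of (zip ds os))"

lemma pure_sum_carrier: "set ds \<subseteq> carrier R \<Longrightarrow> set os \<subseteq> carrier S \<Longrightarrow> pure_sum ds os \<in> carrier P"
proof (induction ds os rule: list_induct2')
  case (4 d ds x os)
  then show ?case using P_add[of "frag_of (d, x)" "pure_sum ds os"] P_of by simp
qed (use P.zero_closed in \<open>simp_all add: pair_ring_simps\<close>)

lemma pure_sum_zero: "set ds \<subseteq> carrier R \<Longrightarrow> set os \<subseteq> {\<zero>\<^bsub>S\<^esub>} \<Longrightarrow> pure_sum ds os \<in> I"
proof (induction ds os rule: list_induct2')
  case (4 d ds x os)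
  then show ?case using I_add[OF I_zero_of(2), of d "pure_sum ds os"] by simp
qed (simp_all add: I_zero)

lemma pure_sum_minus:
  assumes "length os = length ds" "length os' = length ds" "set ds \<subseteq> carrier R" "set os \<subseteq> carrier S" "set os' \<subseteq> carrier S"
  shows "(pure_sum ds os - pure_sum ds os') - pure_sum ds (map2 (\<lambda>a b. a \<ominus>\<^bsub>S\<^esub> b) os os') \<in> I"
  using assms
proof (induction ds arbitrary: os os')
  case (Cons d ds)
  obtain a as where os: "os = a # as" using Cons(2) by (cases os) auto
  obtain b bs where os': "os' = b # bs" using Cons(3) by (cases os') auto
  have c: "d \<in> carrier R" "a \<in> carrier S" "b \<in> carrier S" using Cons(4-6) os os' by auto
  have ab: "a \<ominus>\<^bsub>S\<^esub> b \<oplus>\<^bsub>S\<^esub> b = a" using c by (simp add: a_minus_def S.a_assoc S.l_neg)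
  have "frag_of (d, a) - (frag_of (d, a \<ominus>\<^bsub>S\<^esub> b) + frag_of (d, b)) \<in> I"
    using I_relations(2)[of d "a \<ominus>\<^bsub>S\<^esub> b" b] c ab by simp
  moreover have "(pure_sum ds as - pure_sum ds bs) - pure_sum ds (map2 (\<lambda>a b. a \<ominus>\<^bsub>S\<^esub> b) as bs) \<in> I"
    using Cons os os' by simp
  ultimately show ?case unfolding os os' using I_add by (fastforce simp: algebra_simps)
qed (simp add: I_zero)

lemma pure_of_combine:
  assumes "length as = length ds" "set as \<subseteq> carrier K" "set ds \<subseteq> carrier R" "s \<in> carrier S"
  shows "frag_of (R.combine (map \<phi> as) ds, s) - pure_sum ds (map (\<lambda>a. \<psi> a \<otimes>\<^bsub>S\<^esub> s) as) \<in> I"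
  using assms(1-3)
proof (induction as ds rule: list_induct2)
  case (Cons a as d ds)
  have c: "d \<in> carrier R" "a \<in> carrier K" "\<phi> a \<in> carrier R" "R.combine (map \<phi> as) ds \<in> carrier R"
    using Cons(3,4) \<phi>_hom(1) by (auto intro!: R.combine_in_carrier simp: subset_iff image_iff)
  have "frag_of (R.combine (map \<phi> as) ds, s) - pure_sum ds (map (\<lambda>a. \<psi> a \<otimes>\<^bsub>S\<^esub> s) as) \<in> I" using Cons by simp
  from I_add[OF I_add[OF I_relations(1)[of "\<phi> a \<otimes>\<^bsub>R\<^esub> d" "R.combine (map \<phi> as) ds" s] I_relations(3)[of a d s]] this]
  show ?case using c assms(4) by (simp add: algebra_simps)
qed (simp add: I_zero_of assms(4))

text \<open>Bilinearity rewrites each term over a list that spans its first component, and the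
  coefficients are collected in the second factor.\<close>

lemma pure_sum_exists:
  assumes ds: "set ds \<subseteq> carrier R"
    and z: "Poly_Mapping.keys z \<subseteq> {R.combine (map \<phi> as) ds | as. length as = length ds \<and> set as \<subseteq> carrier K} \<times> carrier S"
  obtains os where "length os = length ds" "set os \<subseteq> carrier S" "z - pure_sum ds os \<in> I"
proof -
  have "\<exists>os. length os = length ds \<and> set os \<subseteq> carrier S \<and> z - pure_sum ds os \<in> I"
    using z
  proof (induction z rule: frag_induction)
    case zero
    have "- pure_sum ds (replicate (length ds) \<zero>\<^bsub>S\<^esub>) \<in> I" by (intro I_minus pure_sum_zero ds) auto
    then show ?case by (intro exI[of _ "replicate (length ds) \<zero>\<^bsub>S\<^esub>"]) auto
  next
    case (one p)
    then obtain as s where p: "p = (R.combine (map \<phi> as) ds, s)" "length as = length ds" "set as \<subseteq> carrier K" "s \<in> carrier S" by auto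
    show ?case unfolding p(1)
      by (intro exI[of _ "map (\<lambda>a. \<psi> a \<otimes>\<^bsub>S\<^esub> s) as"] conjI pure_of_combine p ds) (use p \<psi>_hom(1) in auto)
  next
    case (diff x y)
    then obtain os os' where os: "length os = length ds" "set os \<subseteq> carrier S" "x - pure_sum ds os \<in> I"
      and os': "length os' = length ds" "set os' \<subseteq> carrier S" "y - pure_sum ds os' \<in> I" by (elim exE conjE)
    let ?d = "map2 (\<lambda>a b. a \<ominus>\<^bsub>S\<^esub> b) os os'"
    have "(x - y) - pure_sum ds ?d \<in> I"
      using I_add[OF I_diff[OF os(3) os'(3)] pure_sum_minus[OF os(1) os'(1) ds os(2) os'(2)]] by (simp add: algebra_simps)
    moreover have "set ?d \<subseteq> carrier S"
    proof -
      have "a \<in> carrier S \<and> b \<in> carrier S" if "(a, b) \<in> set (zip os os')" for a b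
        using set_zip_leftD[OF that] set_zip_rightD[OF that] os(2) os'(2) by blast
      then show ?thesis by auto
    qed
    ultimately show ?case using os(1) os'(1) by (intro exI[of _ ?d]) simp
  qed
  then show ?thesis using that by blast
qed

definition linear :: "('r \<Rightarrow> 'k) \<Rightarrow> bool"
  where "linear f \<longleftrightarrow> (\<forall>r \<in> carrier R. f r \<in> carrier K) \<and>
    (\<forall>r \<in> carrier R. \<forall>r' \<in> carrier R. f (r \<oplus>\<^bsub>R\<^esub> r') = f r \<oplus>\<^bsub>K\<^esub> f r') \<and>
    (\<forall>a \<in> carrier K. \<forall>r \<in> carrier R. f (\<phi> a \<otimes>\<^bsub>R\<^esub> r) = a \<otimes>\<^bsub>K\<^esub> f r)"

definition contract :: "('r \<Rightarrow> 'k) \<Rightarrow> ('r \<times> 's \<Rightarrow>\<^sub>0 int) \<Rightarrow> 's"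
  where "contract f = additive_ext (carrier R \<times> carrier S) S (\<lambda>(r, s). \<psi> (f r) \<otimes>\<^bsub>S\<^esub> s)"

lemma contract:
  assumes f: "linear f"
  shows "z \<in> carrier P \<Longrightarrow> contract f z \<in> carrier S"
    "r \<in> carrier R \<Longrightarrow> s \<in> carrier S \<Longrightarrow> contract f (frag_of (r, s)) = \<psi> (f r) \<otimes>\<^bsub>S\<^esub> s"
    "contract f 0 = \<zero>\<^bsub>S\<^esub>"
    "z \<in> carrier P \<Longrightarrow> z' \<in> carrier P \<Longrightarrow> contract f (z + z') = contract f z \<oplus>\<^bsub>S\<^esub> contract f z'"
    "z \<in> carrier P \<Longrightarrow> z' \<in> carrier P \<Longrightarrow> contract f (z - z') = contract f z \<ominus>\<^bsub>S\<^esub> contract f z'"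
proof -
  have "(\<lambda>(r, s). \<psi> (f r) \<otimes>\<^bsub>S\<^esub> s) ` (carrier R \<times> carrier S) \<subseteq> carrier S"
    using f \<psi>_hom(1) unfolding linear_def by auto
  note h = additive_ext[OF S.ring_axioms this, folded pair_ring_carrier contract_def]
  show "z \<in> carrier P \<Longrightarrow> contract f z \<in> carrier S" "contract f 0 = \<zero>\<^bsub>S\<^esub>"
    "r \<in> carrier R \<Longrightarrow> s \<in> carrier S \<Longrightarrow> contract f (frag_of (r, s)) = \<psi> (f r) \<otimes>\<^bsub>S\<^esub> s"
    "z \<in> carrier P \<Longrightarrow> z' \<in> carrier P \<Longrightarrow> contract f (z + z') = contract f z \<oplus>\<^bsub>S\<^esub> contract f z'"
    "z \<in> carrier P \<Longrightarrow> z' \<in> carrier P \<Longrightarrow> contract f (z - z') = contract f z \<ominus>\<^bsub>S\<^esub> contract f z'"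
    using h by simp_all
qed

lemma linear_translate:
  assumes f: "linear f" and r: "r \<in> carrier R"
  shows "linear (\<lambda>x. f (r \<otimes>\<^bsub>R\<^esub> x))"
  unfolding linear_def
proof (intro conjI ballI)
  fix a x assume a: "a \<in> carrier K" "x \<in> carrier R"
  have "r \<otimes>\<^bsub>R\<^esub> (\<phi> a \<otimes>\<^bsub>R\<^esub> x) = \<phi> a \<otimes>\<^bsub>R\<^esub> (r \<otimes>\<^bsub>R\<^esub> x)" using a r \<phi>_hom(1) by (simp add: R.m_lcomm)
  then show "f (r \<otimes>\<^bsub>R\<^esub> (\<phi> a \<otimes>\<^bsub>R\<^esub> x)) = a \<otimes>\<^bsub>K\<^esub> f (r \<otimes>\<^bsub>R\<^esub> x)"
    using f a r unfolding linear_def by simp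
qed (use f r in \<open>auto simp: linear_def R.r_distr\<close>)

lemma contract_mult:
  assumes f: "linear f" and rs: "r \<in> carrier R" "s \<in> carrier S" and z: "z \<in> carrier P"
  shows "contract f (frag_of (r, s) \<otimes>\<^bsub>P\<^esub> z) = s \<otimes>\<^bsub>S\<^esub> contract (\<lambda>x. f (r \<otimes>\<^bsub>R\<^esub> x)) z"
proof -
  let ?g = "\<lambda>x. f (r \<otimes>\<^bsub>R\<^esub> x)"
  note g = linear_translate[OF f rs(1)]
  have p: "frag_of (r, s) \<in> carrier P" using rs P_of by simp
  have "z \<in> carrier P \<and> contract f (frag_of (r, s) \<otimes>\<^bsub>P\<^esub> z) = s \<otimes>\<^bsub>S\<^esub> contract ?g z"
    using z[unfolded pair_ring_carrier]
  proof (induction z rule: frag_induction)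
    case zero
    show ?case using rs by (simp add: pair_mult_0 contract(3)[OF f] contract(3)[OF g] pair_ring_carrier)
  next
    case (one q)
    then obtain r' s' where q: "q = (r', s')" "r' \<in> carrier R" "s' \<in> carrier S" by auto
    have "\<psi> (f (r \<otimes>\<^bsub>R\<^esub> r')) \<in> carrier S" using f rs(1) q(2) \<psi>_hom(1) unfolding linear_def by simp
    then show ?case unfolding q(1) using rs q(2,3)
      by (simp add: pair_mult_of contract(2)[OF f] contract(2)[OF g] P_of S.m_lcomm)
  next
    case (diff x y)
    have c: "contract ?g x \<in> carrier S" "contract ?g y \<in> carrier S" using contract(1)[OF g] diff by auto
    show ?case using diff P_diff[of x y] P.m_closed[OF p] rs c
      by (simp add: pair_mult_diff contract(5)[OF f] contract(5)[OF g] a_minus_def S.r_distr S.r_minus)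
  qed
  then show ?thesis ..
qed

text \<open>The elements killed by all contractions form an ideal: multiplication by the pair
  \<open>(r, s)\<close> turns the contraction with \<open>f\<close> into \<open>s\<close> times the
  contraction with \<open>x \<mapsto> f (r x)\<close>. This is why all functionals are treated
  together.\<close>

lemma contract_ideal:
  assumes z: "z \<in> I" and f: "linear f"
  shows "contract f z = \<zero>\<^bsub>S\<^esub>"
proof -
  define J where "J = {z \<in> carrier P. \<forall>f. linear f \<longrightarrow> contract f z = \<zero>\<^bsub>S\<^esub>}"
  have JI: "x \<in> J" if "x \<in> carrier P" "\<And>f. linear f \<Longrightarrow> contract f x = \<zero>\<^bsub>S\<^esub>" for x
    using that unfolding J_def by blast
  have JD: "x \<in> carrier P" "linear f \<Longrightarrow> contract f x = \<zero>\<^bsub>S\<^esub>" if "x \<in> J" for x f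
    using that unfolding J_def by blast+
  have J0: "0 \<in> J" by (rule JI) (use contract(3) P.zero_closed in \<open>simp_all add: pair_ring_simps\<close>)
  have Jd: "x - y \<in> J" if "x \<in> J" "y \<in> J" for x y
    by (rule JI) (use JD[OF that(1)] JD[OF that(2)] contract(5) P_diff in \<open>simp_all add: a_minus_def\<close>)
  have Jl: "x \<otimes>\<^bsub>P\<^esub> a \<in> J" if a: "a \<in> J" and x: "x \<in> carrier P" for x a
    using x[unfolded pair_ring_carrier]
  proof (induction x rule: frag_induction)
    case zero show ?case using J0 by (simp add: pair_mult_0)
  next
    case (one q)
    then obtain r s where q: "q = (r, s)" "r \<in> carrier R" "s \<in> carrier S" by auto
    have "frag_of (r, s) \<in> carrier P" using q P_of by simp
    then show ?case unfolding q(1)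
      by (intro JI) (use JD[OF a] q contract_mult linear_translate in \<open>simp_all\<close>)
  next
    case (diff x y) then show ?case using Jd by (simp add: pair_mult_diff)
  qed
  have "ideal J P"
  proof (rule idealI[OF P.ring_axioms])
    show "subgroup J (add_monoid P)"
    proof (rule group.subgroupI[OF P.a_group])
      show "J \<subseteq> carrier (add_monoid P)" "J \<noteq> {}" using JD(1) J0 by auto
      show "inv\<^bsub>add_monoid P\<^esub> a \<in> J" if "a \<in> J" for a
        using Jd[OF J0 that] P_minus[OF JD(1)[OF that]] by (simp add: a_inv_def)
      show "a \<otimes>\<^bsub>add_monoid P\<^esub> b \<in> J" if "a \<in> J" "b \<in> J" for a b
        using Jd[OF that(1) Jd[OF J0 that(2)]] by (simp add: pair_ring_simps)
    qed
    show "x \<otimes>\<^bsub>P\<^esub> a \<in> J" if "a \<in> J" "x \<in> carrier P" for a x by (rule Jl[OF that])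
    show "a \<otimes>\<^bsub>P\<^esub> x \<in> J" if "a \<in> J" "x \<in> carrier P" for a x
      using Jl[OF that] P.m_comm[OF that(2) JD(1)[OF that(1)]] by simp
  qed
  moreover have "tensor_relations K R \<phi> S \<psi> \<subseteq> J"
  proof
    fix g assume g: "g \<in> tensor_relations K R \<phi> S \<psi>"
    have gc: "g \<in> carrier P" using tensor_relations_carrier[OF R.is_cring S.is_cring \<phi> \<psi>] g by blast
    show "g \<in> J"
    proof (rule JI[OF gc])
      fix f assume f: "linear f"
      note fD = f[unfolded linear_def]
      have fc: "\<psi> (f r) \<in> carrier S" if "r \<in> carrier R" for r using fD \<psi>_hom(1) that by blast
      from g consider
        (l) r r' s where "g = frag_of (r \<oplus>\<^bsub>R\<^esub> r', s) - frag_of (r, s) - frag_of (r', s)"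
          "r \<in> carrier R" "r' \<in> carrier R" "s \<in> carrier S" |
        (r) r s s' where "g = frag_of (r, s \<oplus>\<^bsub>S\<^esub> s') - frag_of (r, s) - frag_of (r, s')"
          "r \<in> carrier R" "s \<in> carrier S" "s' \<in> carrier S" |
        (m) a r s where "g = frag_of (\<phi> a \<otimes>\<^bsub>R\<^esub> r, s) - frag_of (r, \<psi> a \<otimes>\<^bsub>S\<^esub> s)"
          "a \<in> carrier K" "r \<in> carrier R" "s \<in> carrier S"
        unfolding tensor_relations_def by blast
      then show "contract f g = \<zero>\<^bsub>S\<^esub>"
      proof cases
        case l
        have "\<psi> (f (r \<oplus>\<^bsub>R\<^esub> r')) = \<psi> (f r) \<oplus>\<^bsub>S\<^esub> \<psi> (f r')" using fD l \<psi>_hom(3) by simp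
        then show ?thesis unfolding l(1) using l(2-) fc[of r] fc[of r']
          by (simp add: contract(5)[OF f] contract(2)[OF f] P_of P_diff S.l_distr) algebra
      next
        case r
        show ?thesis unfolding r(1) using r(2-) fc[of r]
          by (simp add: contract(5)[OF f] contract(2)[OF f] P_of P_diff S.r_distr) algebra
      next
        case m
        have "\<psi> (f (\<phi> a \<otimes>\<^bsub>R\<^esub> r)) = \<psi> a \<otimes>\<^bsub>S\<^esub> \<psi> (f r)" using fD m \<psi>_hom(2) by simp
        then show ?thesis unfolding m(1) using m(2-) fc[of r] \<phi>_hom(1) \<psi>_hom(1)
          by (simp add: contract(5)[OF f] contract(2)[OF f] P_of S.m_ac)
      qed
    qed
  qed
  ultimately have "I \<subseteq> J" unfolding tensor_ideal_def by (intro P.genideal_minimal)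
  then show ?thesis using JD(2)[OF _ f] z by blast
qed

end

section \<open>Linear functionals and fractions\<close>

definition (in ring) subspace :: "'a set \<Rightarrow> 'a set \<Rightarrow> bool"
  where "subspace E W \<longleftrightarrow> W \<subseteq> carrier R \<and> \<zero> \<in> W \<and> (\<forall>x \<in> W. \<forall>y \<in> W. x \<oplus> y \<in> W) \<and> (\<forall>e \<in> E. \<forall>x \<in> W. e \<otimes> x \<in> W)"

context field
begin

lemma subspaceD:
  assumes "subspace E W"
  shows "W \<subseteq> carrier R" "\<zero> \<in> W" "x \<in> W \<Longrightarrow> y \<in> W \<Longrightarrow> x \<oplus> y \<in> W" "e \<in> E \<Longrightarrow> x \<in> W \<Longrightarrow> e \<otimes> x \<in> W"
  using assms unfolding subspace_def by blast+

lemma subspace_minus: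
  assumes E: "subfield E R" and W: "subspace E W" and x: "x \<in> W" "y \<in> W"
  shows "\<ominus> x \<in> W" "x \<ominus> y \<in> W"
proof -
  note sr = subringE[OF subfieldE(1)[OF E]]
  have m: "\<ominus> x \<in> W" if "x \<in> W" for x
    using subspaceD(4)[OF W sr(5)[OF sr(3)] that] subspaceD(1)[OF W] that by (auto simp: l_minus)
  show "\<ominus> x \<in> W" "x \<ominus> y \<in> W" using m subspaceD(3)[OF W] x by (auto simp: a_minus_def)
qed

text \<open>A subspace maximal among those that contain \<open>W0\<close> and avoid \<open>d\<close>
  is a hyperplane: adjoining another vector \<open>v\<close> captures \<open>d\<close>, and solving
  this relation expresses \<open>v\<close> through \<open>d\<close> modulo \<open>M\<close>.\<close>

lemma complement_exists:
  assumes E: "subfield E R" and W0: "subspace E W0" and d: "d \<in> carrier R" "d \<notin> W0"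
  obtains M where "subspace E M" "W0 \<subseteq> M" "d \<notin> M" "\<And>v. v \<in> carrier R \<Longrightarrow> \<exists>c \<in> E. v \<ominus> c \<otimes> d \<in> M"
proof -
  note sr = subringE[OF subfieldE(1)[OF E]]
  define Q where "Q = {W. subspace E W \<and> W0 \<subseteq> W \<and> d \<notin> W}"
  have "W0 \<in> Q" using W0 d unfolding Q_def by blast
  moreover have "\<Union>C \<in> Q" if C: "C \<noteq> {}" "subset.chain Q C" for C
  proof -
    have CQ: "W \<in> Q" if "W \<in> C" for W using that C(2) unfolding subset_chain_def by blast
    have two: "\<exists>W \<in> C. x \<in> W \<and> y \<in> W" if "x \<in> \<Union>C" "y \<in> \<Union>C" for x y
      using that C(2) unfolding subset_chain_def by blast
    obtain W1 where W1: "W1 \<in> C" using C(1) by blast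
    have s: "subspace E W" if "W \<in> C" for W using CQ[OF that] unfolding Q_def by blast
    have "subspace E (\<Union>C)" unfolding subspace_def
    proof (intro conjI ballI)
      show "\<Union>C \<subseteq> carrier R" using subspaceD(1)[OF s] by blast
      show "\<zero> \<in> \<Union>C" using subspaceD(2)[OF s[OF W1]] W1 by blast
      show "x \<oplus> y \<in> \<Union>C" if "x \<in> \<Union>C" "y \<in> \<Union>C" for x y using two[OF that] subspaceD(3)[OF s] by blast
      show "e \<otimes> x \<in> \<Union>C" if "e \<in> E" "x \<in> \<Union>C" for e x using that subspaceD(4)[OF s] by blast
    qed
    then show ?thesis using CQ W1 unfolding Q_def by blast
  qed
  ultimately obtain M where M: "M \<in> Q" "\<forall>W\<in>Q. M \<subseteq> W \<longrightarrow> W = M"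
    using subset_Zorn_nonempty[of Q] by blast
  have Ms: "subspace E M" "W0 \<subseteq> M" "d \<notin> M" using M(1) unfolding Q_def by blast+
  note MD = subspaceD[OF Ms(1)]
  have "\<exists>c \<in> E. v \<ominus> c \<otimes> d \<in> M" if v: "v \<in> carrier R" for v
  proof (cases "v \<in> M")
    case True
    then show ?thesis using sr(2) v d(1) by (intro bexI[of _ \<zero>]) (simp_all add: a_minus_def)
  next
    case False
    define M' where "M' = {m \<oplus> e \<otimes> v | m e. m \<in> M \<and> e \<in> E}"
    have Mc: "m \<in> carrier R" if "m \<in> M" for m using that MD(1) by blast
    have Ec: "e \<in> carrier R" if "e \<in> E" for e using that sr(1) by blast
    have "subspace E M'" unfolding subspace_def
    proof (intro conjI ballI)
      show "M' \<subseteq> carrier R" using Mc Ec v unfolding M'_def by auto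
      have "\<zero> = \<zero> \<oplus> \<zero> \<otimes> v" using v by simp
      then show "\<zero> \<in> M'" unfolding M'_def using MD(2) sr(2) by blast
      show "x \<oplus> y \<in> M'" if xy': "x \<in> M'" "y \<in> M'" for x y
      proof -
        obtain m e m' e' where xy: "x = m \<oplus> e \<otimes> v" "y = m' \<oplus> e' \<otimes> v" "m \<in> M" "m' \<in> M" "e \<in> E" "e' \<in> E"
          using xy' unfolding M'_def by blast
        have "x \<oplus> y = (m \<oplus> m') \<oplus> (e \<oplus> e') \<otimes> v" unfolding xy(1,2) using Mc[OF xy(3)] Mc[OF xy(4)] Ec[OF xy(5)] Ec[OF xy(6)] v by algebra
        then show ?thesis unfolding M'_def using MD(3)[OF xy(3,4)] sr(7)[OF xy(5,6)] by blast
      qed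
      show "c \<otimes> x \<in> M'" if c: "c \<in> E" and "x \<in> M'" for c x
      proof -
        obtain m e where x: "x = m \<oplus> e \<otimes> v" "m \<in> M" "e \<in> E" using \<open>x \<in> M'\<close> unfolding M'_def by blast
        have "c \<otimes> x = (c \<otimes> m) \<oplus> (c \<otimes> e) \<otimes> v" unfolding x(1) using Mc[OF x(2)] Ec[OF x(3)] Ec[OF c] v by algebra
        then show ?thesis unfolding M'_def using MD(4)[OF c x(2)] sr(6)[OF c x(3)] by blast
      qed
    qed
    moreover have MM': "M \<subseteq> M'"
    proof
      fix m assume m: "m \<in> M"
      then have "m = m \<oplus> \<zero> \<otimes> v" using Mc v by simp
      then show "m \<in> M'" unfolding M'_def using m sr(2) by blast
    qed
    moreover have "v \<in> M'"
    proof -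
      have "v = \<zero> \<oplus> \<one> \<otimes> v" using v by simp
      then show ?thesis unfolding M'_def using MD(2) sr(3) by blast
    qed
    ultimately have "d \<in> M'" using M(2) Ms(2) False unfolding Q_def by blast
    then obtain m e where de: "d = m \<oplus> e \<otimes> v" "m \<in> M" "e \<in> E" unfolding M'_def by blast
    have "e \<noteq> \<zero>" using de Mc v Ms(3) by auto
    then have ie: "inv e \<in> E" "inv e \<in> carrier R" "inv e \<otimes> e = \<one>"
      using subfield_m_inv[OF E, of e] de(3) Ec by auto
    have "v \<ominus> inv e \<otimes> d = (inv e \<otimes> e) \<otimes> v \<ominus> inv e \<otimes> d" using ie(3) v by simp
    also have "\<dots> = \<ominus> (inv e \<otimes> m)" unfolding de(1) using ie(2) Mc[OF de(2)] Ec[OF de(3)] v by algebra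
    finally have "v \<ominus> inv e \<otimes> d \<in> M" using subspace_minus(1)[OF E Ms(1) MD(4)[OF ie(1) de(2)] MD(4)[OF ie(1) de(2)]] by simp
    then show ?thesis using ie(1) by blast
  qed
  from that[OF Ms this] show ?thesis .
qed

text \<open>The value \<open>f v\<close> is the coefficient of \<open>d\<close> in \<open>v\<close>
  modulo such a hyperplane.\<close>

lemma functional_exists:
  assumes E: "subfield E R" and W0: "subspace E W0" and d: "d \<in> carrier R" "d \<notin> W0"
  obtains f where "\<And>v. v \<in> carrier R \<Longrightarrow> f v \<in> E" "f d = \<one>" "\<And>v. v \<in> W0 \<Longrightarrow> f v = \<zero>"
    "\<And>v v'. v \<in> carrier R \<Longrightarrow> v' \<in> carrier R \<Longrightarrow> f (v \<oplus> v') = f v \<oplus> f v'"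
    "\<And>e v. e \<in> E \<Longrightarrow> v \<in> carrier R \<Longrightarrow> f (e \<otimes> v) = e \<otimes> f v"
proof -
  note sr = subringE[OF subfieldE(1)[OF E]]
  obtain M where M: "subspace E M" "W0 \<subseteq> M" "d \<notin> M" "\<And>v. v \<in> carrier R \<Longrightarrow> \<exists>c \<in> E. v \<ominus> c \<otimes> d \<in> M"
    by (rule complement_exists[OF assms]; rule that)
  note MD = subspaceD[OF M(1)]
  have Ec: "e \<in> carrier R" if "e \<in> E" for e using that sr(1) by blast
  have uniq: "c = c'" if c: "c \<in> E" "c' \<in> E" "v \<ominus> c \<otimes> d \<in> M" "v \<ominus> c' \<otimes> d \<in> M" and v: "v \<in> carrier R" for c c' v
  proof (rule ccontr)
    assume "c \<noteq> c'"
    then have ne: "c \<ominus> c' \<noteq> \<zero>" using Ec c(1,2) by simp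
    have cE: "c \<ominus> c' \<in> E" using sr(5,7) c(1,2) by (simp add: a_minus_def)
    then have i: "inv (c \<ominus> c') \<in> E" "inv (c \<ominus> c') \<otimes> (c \<ominus> c') = \<one>" using subfield_m_inv[OF E, of "c \<ominus> c'"] ne by auto
    have "(v \<ominus> c' \<otimes> d) \<ominus> (v \<ominus> c \<otimes> d) = (c \<ominus> c') \<otimes> d" using v Ec[OF c(1)] Ec[OF c(2)] d(1) by algebra
    then have "inv (c \<ominus> c') \<otimes> ((c \<ominus> c') \<otimes> d) \<in> M" using MD(4)[OF i(1)] subspace_minus(2)[OF E M(1) c(4,3)] by simp
    moreover have "inv (c \<ominus> c') \<otimes> ((c \<ominus> c') \<otimes> d) = d" using m_assoc[OF Ec[OF i(1)] Ec[OF cE] d(1)] i(2) d(1) by simp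
    ultimately show False using M(3) by simp
  qed
  define f where "f v = (THE c. c \<in> E \<and> v \<ominus> c \<otimes> d \<in> M)" for v
  have fI: "f v = c" if "v \<in> carrier R" "c \<in> E" "v \<ominus> c \<otimes> d \<in> M" for v c
    unfolding f_def by (rule the_equality) (use that uniq in blast)+
  have f: "f v \<in> E" "v \<ominus> f v \<otimes> d \<in> M" if "v \<in> carrier R" for v
    using M(4)[OF that] fI[OF that] by auto
  show ?thesis
  proof (rule that[of f])
    show "f v \<in> E" if "v \<in> carrier R" for v using f(1)[OF that] .
    show "f d = \<one>" by (rule fI[OF d(1) sr(3)]) (use d(1) MD(2) in \<open>simp add: a_minus_def r_neg\<close>)
    show "f v = \<zero>" if "v \<in> W0" for v
    proof (rule fI[OF _ sr(2)])
      show vc: "v \<in> carrier R" using that M(2) MD(1) by blast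
      show "v \<ominus> \<zero> \<otimes> d \<in> M" using that M(2) vc d(1) by (auto simp: a_minus_def)
    qed
    show "f (v \<oplus> v') = f v \<oplus> f v'" if v: "v \<in> carrier R" "v' \<in> carrier R" for v v'
    proof (rule fI)
      have "(v \<oplus> v') \<ominus> (f v \<oplus> f v') \<otimes> d = (v \<ominus> f v \<otimes> d) \<oplus> (v' \<ominus> f v' \<otimes> d)"
        using v Ec[OF f(1)[OF v(1)]] Ec[OF f(1)[OF v(2)]] d(1) by algebra
      then show "(v \<oplus> v') \<ominus> (f v \<oplus> f v') \<otimes> d \<in> M" using MD(3) f(2) v by simp
    qed (use v f(1) sr(7) in auto)
    show "f (e \<otimes> v) = e \<otimes> f v" if v: "e \<in> E" "v \<in> carrier R" for e v
    proof (rule fI)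
      have "(e \<otimes> v) \<ominus> (e \<otimes> f v) \<otimes> d = e \<otimes> (v \<ominus> f v \<otimes> d)" using v Ec[OF v(1)] Ec[OF f(1)[OF v(2)]] d(1) by algebra
      then show "(e \<otimes> v) \<ominus> (e \<otimes> f v) \<otimes> d \<in> M" using MD(4)[OF v(1) f(2)[OF v(2)]] by simp
    qed (use v f(1) sr(6) Ec in auto)
  qed
qed

end

text \<open>The fraction field of \<open>P / Q\<close>, formed directly from pairs in
  \<open>P\<close> without passing to cosets first. An equation between fractions is a membership in
  \<open>Q\<close>.\<close>

locale fractions = cring P + primeideal Q P for P (structure) and Q
begin

definition dom where "dom = carrier P \<times> (carrier P - Q)"

definition eqv :: "'a \<times> 'a \<Rightarrow> 'a \<times> 'a \<Rightarrow> bool"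
  where "eqv p q \<longleftrightarrow> fst p \<otimes> snd q \<ominus> fst q \<otimes> snd p \<in> Q"

definition cls :: "'a \<times> 'a \<Rightarrow> ('a \<times> 'a) set"
  where "cls p = {q \<in> dom. eqv p q}"

definition rep :: "('a \<times> 'a) set \<Rightarrow> 'a \<times> 'a"
  where "rep U = (SOME p. p \<in> U)"

definition frac :: "('a \<times> 'a) set ring"
  where "frac = \<lparr>carrier = cls ` dom,
    monoid.mult = (\<lambda>U V. cls (fst (rep U) \<otimes> fst (rep V), snd (rep U) \<otimes> snd (rep V))),
    one = cls (\<one>, \<one>), ring.zero = cls (\<zero>, \<one>),
    ring.add = (\<lambda>U V. cls (fst (rep U) \<otimes> snd (rep V) \<oplus> fst (rep V) \<otimes> snd (rep U), snd (rep U) \<otimes> snd (rep V)))\<rparr>"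

lemma Q_cancel: "a \<in> carrier P \<Longrightarrow> d \<in> carrier P - Q \<Longrightarrow> a \<otimes> d \<in> Q \<Longrightarrow> a \<in> Q"
  using I_prime by blast

lemma prod_notin: "a \<in> carrier P - Q \<Longrightarrow> b \<in> carrier P - Q \<Longrightarrow> a \<otimes> b \<in> carrier P - Q"
  using I_prime by blast

lemma one_notin: "\<one> \<in> carrier P - Q"
  using I_notcarr one_imp_carrier by blast

lemma domI: "a \<in> carrier P \<Longrightarrow> b \<in> carrier P - Q \<Longrightarrow> (a, b) \<in> dom"
  by (simp add: dom_def)

lemma domE:
  assumes "p \<in> dom" obtains a b where "p = (a, b)" "a \<in> carrier P" "b \<in> carrier P" "b \<in> carrier P - Q"
  using assms unfolding dom_def by auto

lemma eqv_refl: "p \<in> dom \<Longrightarrow> eqv p p"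
  by (elim domE) (simp add: eqv_def a_minus_def r_neg additive_subgroup.zero_closed[OF additive_subgroup_axioms])

lemma eqv_sym:
  assumes "p \<in> dom" "q \<in> dom" "eqv p q" shows "eqv q p"
proof -
  obtain a b where p: "p = (a, b)" "a \<in> carrier P" "b \<in> carrier P" "b \<in> carrier P - Q" by (rule domE[OF assms(1)])
  obtain c d where q: "q = (c, d)" "c \<in> carrier P" "d \<in> carrier P" "d \<in> carrier P - Q" by (rule domE[OF assms(2)])
  have "c \<otimes> b \<ominus> a \<otimes> d = \<ominus> (a \<otimes> d \<ominus> c \<otimes> b)" using p(2,3) q(2,3) by algebra
  then show ?thesis using assms(3) a_inv_closed unfolding eqv_def p q by simp
qed

lemma eqv_trans:
  assumes "p \<in> dom" "q \<in> dom" "r \<in> dom" "eqv p q" "eqv q r" shows "eqv p r"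
proof -
  obtain a b where p: "p = (a, b)" "a \<in> carrier P" "b \<in> carrier P" "b \<in> carrier P - Q" by (rule domE[OF assms(1)])
  obtain c d where q: "q = (c, d)" "c \<in> carrier P" "d \<in> carrier P" "d \<in> carrier P - Q" by (rule domE[OF assms(2)])
  obtain e f where r: "r = (e, f)" "e \<in> carrier P" "f \<in> carrier P" "f \<in> carrier P - Q" by (rule domE[OF assms(3)])
  have 1: "a \<otimes> d \<ominus> c \<otimes> b \<in> Q" "c \<otimes> f \<ominus> e \<otimes> d \<in> Q" using assms(4,5) unfolding eqv_def p q r by simp_all
  have "(a \<otimes> f \<ominus> e \<otimes> b) \<otimes> d = f \<otimes> (a \<otimes> d \<ominus> c \<otimes> b) \<oplus> b \<otimes> (c \<otimes> f \<ominus> e \<otimes> d)"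
    using p(2,3) q(2,3) r(2,3) by algebra
  then have "(a \<otimes> f \<ominus> e \<otimes> b) \<otimes> d \<in> Q" using I_l_closed[OF 1(1) r(3)] I_l_closed[OF 1(2) p(3)] a_closed by simp
  from Q_cancel[OF _ q(4) this] have "a \<otimes> f \<ominus> e \<otimes> b \<in> Q" using p(2,3) r(2,3) by simp
  then show ?thesis unfolding eqv_def p r by simp
qed

lemma cls_eq: "p \<in> dom \<Longrightarrow> q \<in> dom \<Longrightarrow> cls p = cls q \<longleftrightarrow> eqv p q"
proof
  assume p: "p \<in> dom" and q: "q \<in> dom"
  show "eqv p q" if "cls p = cls q"
    using that eqv_refl[OF q] q unfolding cls_def by auto
  show "cls p = cls q" if pq: "eqv p q"
    unfolding cls_def using eqv_trans[OF p q _ pq] eqv_trans[OF q p _ eqv_sym[OF p q pq]] by auto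
qed

lemma rep_cls: assumes "p \<in> dom" shows "rep (cls p) \<in> dom" "eqv p (rep (cls p))"
proof -
  have "p \<in> cls p" using assms eqv_refl by (simp add: cls_def)
  then have "rep (cls p) \<in> cls p" unfolding rep_def by (rule someI)
  then show "rep (cls p) \<in> dom" "eqv p (rep (cls p))" by (simp_all add: cls_def)
qed

lemma frac_mult:
  assumes p: "a \<in> carrier P" "b \<in> carrier P - Q" and q: "c \<in> carrier P" "d \<in> carrier P - Q"
  shows "cls (a, b) \<otimes>\<^bsub>frac\<^esub> cls (c, d) = cls (a \<otimes> c, b \<otimes> d)"
proof -
  obtain a' b' where p': "rep (cls (a, b)) = (a', b')" "a' \<in> carrier P" "b' \<in> carrier P" "b' \<in> carrier P - Q"
    by (rule domE[OF rep_cls(1)[OF domI[OF p]]])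
  obtain c' d' where q': "rep (cls (c, d)) = (c', d')" "c' \<in> carrier P" "d' \<in> carrier P" "d' \<in> carrier P - Q"
    by (rule domE[OF rep_cls(1)[OF domI[OF q]]])
  have 1: "a \<otimes> b' \<ominus> a' \<otimes> b \<in> Q" "c \<otimes> d' \<ominus> c' \<otimes> d \<in> Q"
    using rep_cls(2)[OF domI[OF p]] rep_cls(2)[OF domI[OF q]] unfolding p' q' eqv_def by simp_all
  have bd: "b \<in> carrier P" "d \<in> carrier P" using p q by auto
  have "(a' \<otimes> c') \<otimes> (b \<otimes> d) \<ominus> (a \<otimes> c) \<otimes> (b' \<otimes> d') =
    \<ominus> ((c \<otimes> d') \<otimes> (a \<otimes> b' \<ominus> a' \<otimes> b) \<oplus> (a' \<otimes> b) \<otimes> (c \<otimes> d' \<ominus> c' \<otimes> d))"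
    using p(1) q(1) bd p'(2,3) q'(2,3) by algebra
  moreover have "(c \<otimes> d') \<otimes> (a \<otimes> b' \<ominus> a' \<otimes> b) \<oplus> (a' \<otimes> b) \<otimes> (c \<otimes> d' \<ominus> c' \<otimes> d) \<in> Q"
    using I_l_closed[OF 1(1)] I_l_closed[OF 1(2)] a_closed p(1) q(1) bd p'(2,3) q'(2,3) by simp
  ultimately have "eqv (a' \<otimes> c', b' \<otimes> d') (a \<otimes> c, b \<otimes> d)" using a_inv_closed by (simp add: eqv_def)
  then have "cls (a' \<otimes> c', b' \<otimes> d') = cls (a \<otimes> c, b \<otimes> d)"
    using cls_eq domI prod_notin p q p' q' by simp
  then show ?thesis by (simp add: frac_def p' q')
qed

lemma frac_add:
  assumes p: "a \<in> carrier P" "b \<in> carrier P - Q" and q: "c \<in> carrier P" "d \<in> carrier P - Q"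
  shows "cls (a, b) \<oplus>\<^bsub>frac\<^esub> cls (c, d) = cls (a \<otimes> d \<oplus> c \<otimes> b, b \<otimes> d)"
proof -
  obtain a' b' where p': "rep (cls (a, b)) = (a', b')" "a' \<in> carrier P" "b' \<in> carrier P" "b' \<in> carrier P - Q"
    by (rule domE[OF rep_cls(1)[OF domI[OF p]]])
  obtain c' d' where q': "rep (cls (c, d)) = (c', d')" "c' \<in> carrier P" "d' \<in> carrier P" "d' \<in> carrier P - Q"
    by (rule domE[OF rep_cls(1)[OF domI[OF q]]])
  have 1: "a \<otimes> b' \<ominus> a' \<otimes> b \<in> Q" "c \<otimes> d' \<ominus> c' \<otimes> d \<in> Q"
    using rep_cls(2)[OF domI[OF p]] rep_cls(2)[OF domI[OF q]] unfolding p' q' eqv_def by simp_all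
  have bd: "b \<in> carrier P" "d \<in> carrier P" using p q by auto
  have "(a' \<otimes> d' \<oplus> c' \<otimes> b') \<otimes> (b \<otimes> d) \<ominus> (a \<otimes> d \<oplus> c \<otimes> b) \<otimes> (b' \<otimes> d') =
    \<ominus> ((d \<otimes> d') \<otimes> (a \<otimes> b' \<ominus> a' \<otimes> b) \<oplus> (b \<otimes> b') \<otimes> (c \<otimes> d' \<ominus> c' \<otimes> d))"
    using p(1) q(1) bd p'(2,3) q'(2,3) by algebra
  moreover have "(d \<otimes> d') \<otimes> (a \<otimes> b' \<ominus> a' \<otimes> b) \<oplus> (b \<otimes> b') \<otimes> (c \<otimes> d' \<ominus> c' \<otimes> d) \<in> Q"
    using I_l_closed[OF 1(1)] I_l_closed[OF 1(2)] a_closed p(1) q(1) bd p'(2,3) q'(2,3) by simp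
  ultimately have "eqv (a' \<otimes> d' \<oplus> c' \<otimes> b', b' \<otimes> d') (a \<otimes> d \<oplus> c \<otimes> b, b \<otimes> d)" using a_inv_closed by (simp add: eqv_def)
  moreover have "(a' \<otimes> d' \<oplus> c' \<otimes> b', b' \<otimes> d') \<in> dom" "(a \<otimes> d \<oplus> c \<otimes> b, b \<otimes> d) \<in> dom"
    using domI prod_notin p q bd p' q' by simp_all
  ultimately have "cls (a' \<otimes> d' \<oplus> c' \<otimes> b', b' \<otimes> d') = cls (a \<otimes> d \<oplus> c \<otimes> b, b \<otimes> d)"
    using cls_eq by blast
  then show ?thesis by (simp add: frac_def p' q')
qed

lemma fracE:
  assumes "U \<in> carrier frac"
  obtains a b where "U = cls (a, b)" "a \<in> carrier P" "b \<in> carrier P" "b \<in> carrier P - Q"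
  using assms unfolding frac_def by (auto elim!: domE)

lemma frac_closed: "a \<in> carrier P \<Longrightarrow> b \<in> carrier P - Q \<Longrightarrow> cls (a, b) \<in> carrier frac"
  unfolding frac_def using domI by simp

lemma frac_consts: "\<one>\<^bsub>frac\<^esub> = cls (\<one>, \<one>)" "\<zero>\<^bsub>frac\<^esub> = cls (\<zero>, \<one>)"
  by (simp_all add: frac_def)

lemma cls_eqI:
  assumes "a \<in> carrier P" "b \<in> carrier P - Q" "c \<in> carrier P" "d \<in> carrier P - Q" "a \<otimes> d = c \<otimes> b"
  shows "cls (a, b) = cls (c, d)"
proof -
  have "a \<otimes> d \<ominus> c \<otimes> b \<in> Q" using assms by (simp add: a_minus_def r_neg additive_subgroup.zero_closed[OF additive_subgroup_axioms])
  then show ?thesis using cls_eq[OF domI domI] assms(1-4) by (simp add: eqv_def)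
qed

lemma zero_carrier: "\<zero> \<in> carrier P"
  by (rule add.one_closed)

lemma cls_zero_iff:
  assumes "a \<in> carrier P" "b \<in> carrier P - Q" shows "cls (a, b) = \<zero>\<^bsub>frac\<^esub> \<longleftrightarrow> a \<in> Q"
  unfolding frac_consts cls_eq[OF domI[OF assms] domI[OF zero_carrier one_notin]] eqv_def
  using assms by (simp add: a_minus_def)

lemma frac_cring: "cring frac"
proof (rule cringI)
  show "abelian_group frac"
  proof (rule abelian_groupI)
    fix U V assume "U \<in> carrier frac" "V \<in> carrier frac"
    then obtain a b c d where u: "U = cls (a, b)" "a \<in> carrier P" "b \<in> carrier P" "b \<in> carrier P - Q"
      and v: "V = cls (c, d)" "c \<in> carrier P" "d \<in> carrier P" "d \<in> carrier P - Q" by (elim fracE)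
    note bd = prod_notin[OF u(4) v(4)] and db = prod_notin[OF v(4) u(4)]
    show "U \<oplus>\<^bsub>frac\<^esub> V \<in> carrier frac" "U \<oplus>\<^bsub>frac\<^esub> V = V \<oplus>\<^bsub>frac\<^esub> U"
      unfolding u(1) v(1) frac_add[OF u(2,4) v(2,4)] frac_add[OF v(2,4) u(2,4)]
      using bd db u v by (simp_all add: frac_closed a_comm m_comm)
  next
    fix U V W assume "U \<in> carrier frac" "V \<in> carrier frac" "W \<in> carrier frac"
    then obtain a b c d e f where u: "U = cls (a, b)" "a \<in> carrier P" "b \<in> carrier P" "b \<in> carrier P - Q"
      and v: "V = cls (c, d)" "c \<in> carrier P" "d \<in> carrier P" "d \<in> carrier P - Q"
      and w: "W = cls (e, f)" "e \<in> carrier P" "f \<in> carrier P" "f \<in> carrier P - Q" by (elim fracE)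
    note bd = prod_notin[OF u(4) v(4)] and df = prod_notin[OF v(4) w(4)]
    have 1: "a \<otimes> d \<oplus> c \<otimes> b \<in> carrier P" "c \<otimes> f \<oplus> e \<otimes> d \<in> carrier P" using u v w by simp_all
    have "(a \<otimes> d \<oplus> c \<otimes> b) \<otimes> f \<oplus> e \<otimes> (b \<otimes> d) = a \<otimes> (d \<otimes> f) \<oplus> (c \<otimes> f \<oplus> e \<otimes> d) \<otimes> b"
      using u(2,3) v(2,3) w(2,3) by algebra
    then show "U \<oplus>\<^bsub>frac\<^esub> V \<oplus>\<^bsub>frac\<^esub> W = U \<oplus>\<^bsub>frac\<^esub> (V \<oplus>\<^bsub>frac\<^esub> W)"
      unfolding u(1) v(1) w(1) frac_add[OF u(2,4) v(2,4)] frac_add[OF v(2,4) w(2,4)]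
        frac_add[OF 1(1) bd w(2,4)] frac_add[OF u(2,4) 1(2) df]
      using u v w by (simp add: m_assoc)
  next
    show "\<zero>\<^bsub>frac\<^esub> \<in> carrier frac" unfolding frac_consts by (rule frac_closed[OF zero_carrier one_notin])
  next
    fix U assume "U \<in> carrier frac"
    then obtain a b where u: "U = cls (a, b)" "a \<in> carrier P" "b \<in> carrier P" "b \<in> carrier P - Q" by (elim fracE)
    show "\<zero>\<^bsub>frac\<^esub> \<oplus>\<^bsub>frac\<^esub> U = U"
      unfolding u(1) frac_consts frac_add[OF zero_carrier one_notin u(2,4)] using u by simp
    have ma: "\<ominus> a \<in> carrier P" using u(2) by simp
    have "cls (\<ominus> a, b) \<oplus>\<^bsub>frac\<^esub> U = \<zero>\<^bsub>frac\<^esub>"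
      unfolding u(1) frac_add[OF ma u(4) u(2,4)] frac_consts
      by (rule cls_eqI) (use u prod_notin[OF u(4) u(4)] one_notin in \<open>simp_all add: l_minus l_neg\<close>)
    then show "\<exists>V \<in> carrier frac. V \<oplus>\<^bsub>frac\<^esub> U = \<zero>\<^bsub>frac\<^esub>"
      using frac_closed[of "\<ominus> a" b] u by (intro bexI[of _ "cls (\<ominus> a, b)"]) simp_all
  qed
  show "comm_monoid frac"
  proof (rule comm_monoidI)
    fix U V assume "U \<in> carrier frac" "V \<in> carrier frac"
    then obtain a b c d where u: "U = cls (a, b)" "a \<in> carrier P" "b \<in> carrier P" "b \<in> carrier P - Q"
      and v: "V = cls (c, d)" "c \<in> carrier P" "d \<in> carrier P" "d \<in> carrier P - Q" by (elim fracE)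
    note bd = prod_notin[OF u(4) v(4)] and db = prod_notin[OF v(4) u(4)]
    show "U \<otimes>\<^bsub>frac\<^esub> V \<in> carrier frac" "U \<otimes>\<^bsub>frac\<^esub> V = V \<otimes>\<^bsub>frac\<^esub> U"
      unfolding u(1) v(1) frac_mult[OF u(2,4) v(2,4)] frac_mult[OF v(2,4) u(2,4)]
      using bd db u v by (simp_all add: frac_closed m_comm)
  next
    fix U V W assume "U \<in> carrier frac" "V \<in> carrier frac" "W \<in> carrier frac"
    then obtain a b c d e f where u: "U = cls (a, b)" "a \<in> carrier P" "b \<in> carrier P" "b \<in> carrier P - Q"
      and v: "V = cls (c, d)" "c \<in> carrier P" "d \<in> carrier P" "d \<in> carrier P - Q"
      and w: "W = cls (e, f)" "e \<in> carrier P" "f \<in> carrier P" "f \<in> carrier P - Q" by (elim fracE)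
    note bd = prod_notin[OF u(4) v(4)] and df = prod_notin[OF v(4) w(4)]
    show "U \<otimes>\<^bsub>frac\<^esub> V \<otimes>\<^bsub>frac\<^esub> W = U \<otimes>\<^bsub>frac\<^esub> (V \<otimes>\<^bsub>frac\<^esub> W)"
      unfolding u(1) v(1) w(1) frac_mult[OF u(2,4) v(2,4)] frac_mult[OF v(2,4) w(2,4)]
        frac_mult[OF m_closed[OF u(2) v(2)] bd w(2,4)] frac_mult[OF u(2,4) m_closed[OF v(2) w(2)] df]
      using u v w by (simp add: m_assoc)
  next
    show "\<one>\<^bsub>frac\<^esub> \<in> carrier frac" unfolding frac_consts by (rule frac_closed[OF one_closed one_notin])
  next
    fix U assume "U \<in> carrier frac"
    then obtain a b where u: "U = cls (a, b)" "a \<in> carrier P" "b \<in> carrier P" "b \<in> carrier P - Q" by (elim fracE)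
    show "\<one>\<^bsub>frac\<^esub> \<otimes>\<^bsub>frac\<^esub> U = U"
      unfolding u(1) frac_consts frac_mult[OF one_closed one_notin u(2,4)] using u by simp
  qed
  fix U V W assume "U \<in> carrier frac" "V \<in> carrier frac" "W \<in> carrier frac"
  then obtain a b c d e f where u: "U = cls (a, b)" "a \<in> carrier P" "b \<in> carrier P" "b \<in> carrier P - Q"
    and v: "V = cls (c, d)" "c \<in> carrier P" "d \<in> carrier P" "d \<in> carrier P - Q"
    and w: "W = cls (e, f)" "e \<in> carrier P" "f \<in> carrier P" "f \<in> carrier P - Q" by (elim fracE)
  note bd = prod_notin[OF u(4) v(4)] and bf = prod_notin[OF u(4) w(4)] and df = prod_notin[OF v(4) w(4)]
  have 1: "a \<otimes> d \<oplus> c \<otimes> b \<in> carrier P" using u v by simp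
  show "(U \<oplus>\<^bsub>frac\<^esub> V) \<otimes>\<^bsub>frac\<^esub> W = U \<otimes>\<^bsub>frac\<^esub> W \<oplus>\<^bsub>frac\<^esub> V \<otimes>\<^bsub>frac\<^esub> W"
    unfolding u(1) v(1) w(1) frac_add[OF u(2,4) v(2,4)] frac_mult[OF u(2,4) w(2,4)] frac_mult[OF v(2,4) w(2,4)]
      frac_mult[OF 1 bd w(2,4)] frac_add[OF m_closed[OF u(2) w(2)] bf m_closed[OF v(2) w(2)] df]
  proof (rule cls_eqI)
    show "(a \<otimes> d \<oplus> c \<otimes> b) \<otimes> e \<otimes> (b \<otimes> f \<otimes> (d \<otimes> f)) = (a \<otimes> e \<otimes> (d \<otimes> f) \<oplus> c \<otimes> e \<otimes> (b \<otimes> f)) \<otimes> (b \<otimes> d \<otimes> f)"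
      using u(2,3) v(2,3) w(2,3) by algebra
  qed (use u v w prod_notin[OF bd w(4)] prod_notin[OF bf df] in simp_all)
qed

lemma frac_field: "field frac"
proof (rule cring.cring_fieldI2[OF frac_cring])
  show "\<zero>\<^bsub>frac\<^esub> \<noteq> \<one>\<^bsub>frac\<^esub>"
    using cls_zero_iff[OF one_closed one_notin] one_notin unfolding frac_consts(1) by auto
  fix U assume U: "U \<in> carrier frac" "U \<noteq> \<zero>\<^bsub>frac\<^esub>"
  then obtain a b where u: "U = cls (a, b)" "a \<in> carrier P" "b \<in> carrier P" "b \<in> carrier P - Q" by (elim fracE)
  then have a: "a \<in> carrier P - Q" using U(2) cls_zero_iff by blast
  have "U \<otimes>\<^bsub>frac\<^esub> cls (b, a) = \<one>\<^bsub>frac\<^esub>"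
    unfolding u(1) frac_mult[OF u(2,4) u(3) a] frac_consts
    by (rule cls_eqI) (use u a prod_notin[OF u(4) a] one_notin in \<open>simp_all add: m_comm\<close>)
  then show "\<exists>V\<in>carrier frac. U \<otimes>\<^bsub>frac\<^esub> V = \<one>\<^bsub>frac\<^esub>" using frac_closed[OF u(3) a] by blast
qed

lemma frac_hom: "(\<lambda>a. cls (a, \<one>)) \<in> ring_hom P frac"
  by (rule ring_hom_memI) (use one_notin in \<open>simp_all add: frac_closed frac_mult frac_add frac_consts\<close>)

text \<open>The equivalence \<open>sQ\<close> is used in both directions: one keeps denominators
  outside \<open>Q\<close>, the other keeps equal fractions equal.\<close>

lemma frac_endo:
  assumes s: "s \<in> ring_hom P P" and sQ: "\<And>z. z \<in> carrier P \<Longrightarrow> s z \<in> Q \<longleftrightarrow> z \<in> Q"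
  obtains \<mu> where "\<mu> \<in> ring_hom frac frac" "\<And>a. a \<in> carrier P \<Longrightarrow> \<mu> (cls (a, \<one>)) = cls (s a, \<one>)"
proof -
  note sm = ring_hom_memE[OF s]
  define \<mu> where "\<mu> U = cls (s (fst (rep U)), s (snd (rep U)))" for U
  interpret s: ring_hom_ring P P s by (rule ring_hom_ringI2[OF ring_axioms ring_axioms s])
  have sn: "s b \<in> carrier P - Q" if "b \<in> carrier P - Q" for b using sQ sm(1) that by blast
  have \<mu>: "\<mu> (cls (a, b)) = cls (s a, s b)" if p: "a \<in> carrier P" "b \<in> carrier P - Q" for a b
  proof -
    obtain a' b' where p': "rep (cls (a, b)) = (a', b')" "a' \<in> carrier P" "b' \<in> carrier P" "b' \<in> carrier P - Q"
      by (rule domE[OF rep_cls(1)[OF domI[OF p]]])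
    have b: "b \<in> carrier P" using p by blast
    have 1: "a \<otimes> b' \<ominus> a' \<otimes> b \<in> Q" using rep_cls(2)[OF domI[OF p]] unfolding p' eqv_def by simp
    have "s (a \<otimes> b' \<ominus> a' \<otimes> b) = s a \<otimes> s b' \<ominus> s a' \<otimes> s b"
      using p(1) b p'(2,3) by (simp add: a_minus_def)
    moreover have "s (a \<otimes> b' \<ominus> a' \<otimes> b) \<in> Q" using sQ 1 p(1) b p'(2,3) by simp
    ultimately have "eqv (s a, s b) (s a', s b')" by (simp add: eqv_def)
    then have "cls (s a, s b) = cls (s a', s b')"
      using cls_eq[OF domI[OF sm(1)[OF p(1)] sn[OF p(2)]] domI[OF sm(1)[OF p'(2)] sn[OF p'(4)]]] by blast
    then show ?thesis by (simp add: \<mu>_def p')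
  qed
  have "\<mu> \<in> ring_hom frac frac"
  proof (rule ring_hom_memI)
    fix U V assume "U \<in> carrier frac" "V \<in> carrier frac"
    then obtain a b c d where u: "U = cls (a, b)" "a \<in> carrier P" "b \<in> carrier P" "b \<in> carrier P - Q"
      and v: "V = cls (c, d)" "c \<in> carrier P" "d \<in> carrier P" "d \<in> carrier P - Q" by (elim fracE)
    have 1: "a \<otimes> d \<oplus> c \<otimes> b \<in> carrier P" using u v by simp
    note bd = prod_notin[OF u(4) v(4)]
    show "\<mu> (U \<otimes>\<^bsub>frac\<^esub> V) = \<mu> U \<otimes>\<^bsub>frac\<^esub> \<mu> V"
      unfolding u(1) v(1) frac_mult[OF u(2,4) v(2,4)] \<mu>[OF u(2,4)] \<mu>[OF v(2,4)] \<mu>[OF m_closed[OF u(2) v(2)] bd]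
        frac_mult[OF sm(1)[OF u(2)] sn[OF u(4)] sm(1)[OF v(2)] sn[OF v(4)]] using u v by simp
    show "\<mu> (U \<oplus>\<^bsub>frac\<^esub> V) = \<mu> U \<oplus>\<^bsub>frac\<^esub> \<mu> V"
      unfolding u(1) v(1) frac_add[OF u(2,4) v(2,4)] \<mu>[OF u(2,4)] \<mu>[OF v(2,4)] \<mu>[OF 1 bd]
        frac_add[OF sm(1)[OF u(2)] sn[OF u(4)] sm(1)[OF v(2)] sn[OF v(4)]] using u v by simp
  next
    fix U assume "U \<in> carrier frac"
    then obtain a b where u: "U = cls (a, b)" "a \<in> carrier P" "b \<in> carrier P" "b \<in> carrier P - Q" by (elim fracE)
    show "\<mu> U \<in> carrier frac" unfolding u(1) \<mu>[OF u(2,4)] by (rule frac_closed[OF sm(1)[OF u(2)] sn[OF u(4)]])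
  next
    show "\<mu> \<one>\<^bsub>frac\<^esub> = \<one>\<^bsub>frac\<^esub>" unfolding frac_consts \<mu>[OF one_closed one_notin] by simp
  qed
  then show ?thesis by (rule that) (use \<mu> one_notin in simp)
qed

end

section \<open>Tensor products over algebraically closed fields\<close>

locale closed_base = \<Lambda>: field \<Lambda> + \<Omega>: field \<Omega> for \<Lambda> :: "'f ring" and \<Omega> :: "'s ring" +
  fixes E x
  assumes E: "subfield E \<Lambda>" "algebraically_closed (\<Lambda>\<lparr>carrier := E\<rparr>)" and x: "x \<in> ring_hom (\<Lambda>\<lparr>carrier := E\<rparr>) \<Omega>"
begin

lemmas Er = subfieldE(1)[OF E(1)] and EC = subfieldE(3)[OF E(1)]

lemma E_hom: "(\<lambda>a. a) \<in> ring_hom (\<Lambda>\<lparr>carrier := E\<rparr>) \<Lambda>"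
  using EC by (intro ring_hom_memI) auto

sublocale tensor_pair "\<Lambda>\<lparr>carrier := E\<rparr>" \<Lambda> \<Omega> "\<lambda>a. a" x
  by (intro tensor_pair.intro tensor_pair_axioms.intro \<Lambda>.is_cring \<Omega>.is_cring E_hom x)

sublocale PE: field_pair \<Omega> "\<Lambda>\<lparr>carrier := E\<rparr>"
  by (intro field_pair.intro \<Omega>.field_axioms E(2))

text \<open>The place extends the inverse of \<open>x\<close> on the image of \<open>E\<close>. Its
  values lie in \<open>E\<close>, because \<open>E\<close> is itself algebraically closed and can
  serve as the target.\<close>

lemma place_over_base:
  obtains V \<pi> where "place \<Omega> (\<Lambda>\<lparr>carrier := E\<rparr>) V \<pi>" "\<And>e. e \<in> E \<Longrightarrow> x e \<in> V" "\<And>e. e \<in> E \<Longrightarrow> \<pi> (x e) = e"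
proof -
  note im = \<Lambda>.subring_hom_image[OF E(1) \<Omega>.field_axioms x]
  have inj: "inj_on x E" by (rule \<Lambda>.subfield_hom_inj[OF E(1) \<Omega>.field_axioms x])
  obtain V \<pi> where V: "place \<Omega> (\<Lambda>\<lparr>carrier := E\<rparr>) V \<pi>" "x ` E \<subseteq> V" "\<And>a. a \<in> x ` E \<Longrightarrow> \<pi> a = inv_into E x a"
    by (rule PE.place_extends[OF subfieldE(1)[OF im(1)] im(2)]; rule that)
  show ?thesis by (rule that[OF V(1)]) (use V(2,3) inj in auto)
qed

context
  fixes V \<pi>
  assumes V: "place \<Omega> (\<Lambda>\<lparr>carrier := E\<rparr>) V \<pi>" and xV: "\<And>e. e \<in> E \<Longrightarrow> x e \<in> V" and \<pi>x: "\<And>e. e \<in> E \<Longrightarrow> \<pi> (x e) = e"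
begin

abbreviation PV where "PV \<equiv> pair_ring \<Lambda> (\<Omega>\<lparr>carrier := V\<rparr>)"

text \<open>The reduction \<open>\<Lambda> \<otimes> V \<rightarrow> \<Lambda>\<close> modulo the
  place, on representatives.\<close>

definition ev where "ev = additive_ext (carrier \<Lambda> \<times> V) \<Lambda> (\<lambda>(l, v). l \<otimes>\<^bsub>\<Lambda>\<^esub> \<pi> v)"

lemmas Vr = placeD(1)[OF V] and VC = subringE(1)[OF placeD(1)[OF V]] and \<pi>_hom = ring_hom_memE[OF placeD(2)[OF V], simplified]

lemma \<pi>_closed: "v \<in> V \<Longrightarrow> \<pi> v \<in> E" "v \<in> V \<Longrightarrow> \<pi> v \<in> carrier \<Lambda>"
  using \<pi>_hom(1) EC by blast+

lemma PV_carrier: "z \<in> carrier PV \<longleftrightarrow> Poly_Mapping.keys z \<subseteq> carrier \<Lambda> \<times> V" "carrier PV \<subseteq> carrier P"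
proof -
  show "z \<in> carrier PV \<longleftrightarrow> Poly_Mapping.keys z \<subseteq> carrier \<Lambda> \<times> V" by (simp add: pair_ring_carrier)
  have VV: "carrier \<Lambda> \<times> V \<subseteq> carrier \<Lambda> \<times> carrier \<Omega>" using VC by blast
  show "carrier PV \<subseteq> carrier P"
  proof
    fix z assume "z \<in> carrier PV"
    then have "Poly_Mapping.keys z \<subseteq> carrier \<Lambda> \<times> V" by (simp add: pair_ring_carrier)
    then show "z \<in> carrier P" using VV unfolding pair_ring_carrier by (rule order_trans)
  qed
qed

lemma PV_mult: "a \<otimes>\<^bsub>PV\<^esub> b = a \<otimes>\<^bsub>P\<^esub> b"
  by (simp add: pair_ring_def)

lemma ev_hom: "ev \<in> ring_hom PV \<Lambda>"
proof -
  have p: "\<pi> \<in> ring_hom (\<Omega>\<lparr>carrier := V\<rparr>) \<Lambda>" using \<pi>_hom EC by (intro ring_hom_memI) auto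
  have cr: "cring (\<Omega>\<lparr>carrier := V\<rparr>)" using \<Omega>.subcring_iff[OF VC] \<Omega>.subcringI'[OF Vr] by simp
  from pair_eval_hom[OF \<Lambda>.is_cring cr \<Lambda>.is_cring _ p, of "\<lambda>a. a"]
  show ?thesis unfolding ev_def by (simp add: ring_hom_def)
qed

lemma ev:
  "z \<in> carrier PV \<Longrightarrow> ev z \<in> carrier \<Lambda>" "l \<in> carrier \<Lambda> \<Longrightarrow> v \<in> V \<Longrightarrow> ev (frag_of (l, v)) = l \<otimes>\<^bsub>\<Lambda>\<^esub> \<pi> v" "ev 0 = \<zero>\<^bsub>\<Lambda>\<^esub>"
  "z \<in> carrier PV \<Longrightarrow> z' \<in> carrier PV \<Longrightarrow> ev (z + z') = ev z \<oplus>\<^bsub>\<Lambda>\<^esub> ev z'"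
  "z \<in> carrier PV \<Longrightarrow> z' \<in> carrier PV \<Longrightarrow> ev (z - z') = ev z \<ominus>\<^bsub>\<Lambda>\<^esub> ev z'"
proof -
  have im: "(\<lambda>(l, v). l \<otimes>\<^bsub>\<Lambda>\<^esub> \<pi> v) ` (carrier \<Lambda> \<times> V) \<subseteq> carrier \<Lambda>" using \<pi>_closed(2) by auto
  note a = additive_ext[OF \<Lambda>.ring_axioms im, folded ev_def PV_carrier(1)]
  show "z \<in> carrier PV \<Longrightarrow> ev z \<in> carrier \<Lambda>" "ev 0 = \<zero>\<^bsub>\<Lambda>\<^esub>"
    "l \<in> carrier \<Lambda> \<Longrightarrow> v \<in> V \<Longrightarrow> ev (frag_of (l, v)) = l \<otimes>\<^bsub>\<Lambda>\<^esub> \<pi> v"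
    "z \<in> carrier PV \<Longrightarrow> z' \<in> carrier PV \<Longrightarrow> ev (z + z') = ev z \<oplus>\<^bsub>\<Lambda>\<^esub> ev z'"
    "z \<in> carrier PV \<Longrightarrow> z' \<in> carrier PV \<Longrightarrow> ev (z - z') = ev z \<ominus>\<^bsub>\<Lambda>\<^esub> ev z'"
    using a by simp_all
qed

lemma ev_contract:
  assumes f: "linear f" and z: "z \<in> carrier PV"
  shows "contract f z \<in> V" "\<pi> (contract f z) = f (ev z)"
proof -
  note fD = f[unfolded linear_def, simplified]
  have f0: "f \<zero>\<^bsub>\<Lambda>\<^esub> = \<zero>\<^bsub>\<Lambda>\<^esub>" using fD subringE(2)[OF Er] EC by (metis \<Lambda>.l_null \<Lambda>.zero_closed subsetD)
  have fm: "f (a \<ominus>\<^bsub>\<Lambda>\<^esub> b) = f a \<ominus>\<^bsub>\<Lambda>\<^esub> f b" if "a \<in> carrier \<Lambda>" "b \<in> carrier \<Lambda>" for a b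
  proof -
    have "f (a \<ominus>\<^bsub>\<Lambda>\<^esub> b) \<oplus>\<^bsub>\<Lambda>\<^esub> f b = f a"
      using fD that by (metis \<Lambda>.minus_closed \<Lambda>.add.inv_solve_right a_minus_def)
    then show ?thesis using fD EC that by (metis \<Lambda>.minus_closed \<Lambda>.add.inv_solve_right a_minus_def subsetD)
  qed
  have piz: "\<pi> \<zero>\<^bsub>\<Omega>\<^esub> = \<zero>\<^bsub>\<Lambda>\<^esub>"
    using \<Omega>.subring_hom_zero[OF Vr _ placeD(2)[OF V]] PE.S.ring_axioms by simp
  interpret p: ring_hom_ring "\<Omega>\<lparr>carrier := V\<rparr>" "\<Lambda>\<lparr>carrier := E\<rparr>" \<pi>
    by (rule \<Omega>.subring_hom_ring[OF Vr PE.S.ring_axioms placeD(2)[OF V]])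
  have pim: "\<pi> (a \<ominus>\<^bsub>\<Omega>\<^esub> b) = \<pi> a \<ominus>\<^bsub>\<Lambda>\<^esub> \<pi> b" if "a \<in> V" "b \<in> V" for a b
  proof -
    have d: "a \<ominus>\<^bsub>\<Omega>\<^esub> b \<in> V" using subringE(5,7)[OF Vr] that by (simp add: a_minus_def)
    have "a \<ominus>\<^bsub>\<Omega>\<^esub> b \<oplus>\<^bsub>\<Omega>\<^esub> b = a" using that VC by (simp add: a_minus_def \<Omega>.a_assoc \<Omega>.l_neg subset_iff)
    then have "\<pi> (a \<ominus>\<^bsub>\<Omega>\<^esub> b) \<oplus>\<^bsub>\<Lambda>\<^esub> \<pi> b = \<pi> a" using \<pi>_hom(3)[OF d that(2)] by simp
    then show ?thesis using \<pi>_closed(2) d that by (metis \<Lambda>.add.inv_solve_right a_minus_def)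
  qed
  have "z \<in> carrier PV \<and> contract f z \<in> V \<and> \<pi> (contract f z) = f (ev z)"
    using z[unfolded PV_carrier(1)]
  proof (induction z rule: frag_induction)
    case zero show ?case using contract(3)[OF f] ev(3) f0 piz subringE(2)[OF Vr] by (simp add: PV_carrier(1))
  next
    case (one q)
    then obtain l v where q: "q = (l, v)" "l \<in> carrier \<Lambda>" "v \<in> V" by auto
    have c: "f l \<in> E" "\<pi> v \<in> E" using fD q(2) \<pi>_closed(1)[OF q(3)] by simp_all
    have "f (l \<otimes>\<^bsub>\<Lambda>\<^esub> \<pi> v) = \<pi> v \<otimes>\<^bsub>\<Lambda>\<^esub> f l" using fD c q(2) EC \<Lambda>.m_comm[of l "\<pi> v"] by (simp add: subset_iff)
    also have "\<dots> = f l \<otimes>\<^bsub>\<Lambda>\<^esub> \<pi> v" using c EC by (intro \<Lambda>.m_comm) blast+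
    finally have e: "f (l \<otimes>\<^bsub>\<Lambda>\<^esub> \<pi> v) = f l \<otimes>\<^bsub>\<Lambda>\<^esub> \<pi> v" .
    have vc: "v \<in> carrier \<Omega>" using q(3) VC by blast
    show ?case unfolding q(1) contract(2)[OF f q(2) vc] ev(2)[OF q(2,3)] e
      using \<pi>_hom(2)[OF xV[OF c(1)] q(3)] \<pi>x[OF c(1)] subringE(6)[OF Vr xV[OF c(1)] q(3)] q(2,3)
      by (simp add: PV_carrier(1))
  next
    case (diff a b)
    then have ab: "a \<in> carrier P" "b \<in> carrier P" using PV_carrier(2) by blast+
    have "a - b \<in> carrier PV" using diff keys_diff_subset unfolding PV_carrier(1) by blast
    moreover have "contract f a \<ominus>\<^bsub>\<Omega>\<^esub> contract f b \<in> V" using subringE(5,7)[OF Vr] diff by (simp add: a_minus_def)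
    ultimately show ?case using diff by (simp add: contract(5)[OF f ab] ev(5) pim fm ev(1))
  qed
  then show "contract f z \<in> V" "\<pi> (contract f z) = f (ev z)" by blast+
qed

text \<open>
  Contracting with a functional \<open>f\<close> and then applying the place gives \<open>f (ev z)\<close>.
\<close>

lemma ev_ideal:
  assumes z: "z \<in> carrier PV" "z \<in> I" shows "ev z = \<zero>\<^bsub>\<Lambda>\<^esub>"
proof (rule ccontr)
  assume ne: "ev z \<noteq> \<zero>\<^bsub>\<Lambda>\<^esub>"
  have zs: "\<Lambda>.subspace E {\<zero>\<^bsub>\<Lambda>\<^esub>}" using EC by (auto simp: \<Lambda>.subspace_def)
  obtain f where f: "\<And>v. v \<in> carrier \<Lambda> \<Longrightarrow> f v \<in> E" "f (ev z) = \<one>\<^bsub>\<Lambda>\<^esub>" "\<And>v. v \<in> {\<zero>\<^bsub>\<Lambda>\<^esub>} \<Longrightarrow> f v = \<zero>\<^bsub>\<Lambda>\<^esub>"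
    "\<And>v v'. v \<in> carrier \<Lambda> \<Longrightarrow> v' \<in> carrier \<Lambda> \<Longrightarrow> f (v \<oplus>\<^bsub>\<Lambda>\<^esub> v') = f v \<oplus>\<^bsub>\<Lambda>\<^esub> f v'"
    "\<And>e v. e \<in> E \<Longrightarrow> v \<in> carrier \<Lambda> \<Longrightarrow> f (e \<otimes>\<^bsub>\<Lambda>\<^esub> v) = e \<otimes>\<^bsub>\<Lambda>\<^esub> f v"
    by (rule \<Lambda>.functional_exists[OF E(1) zs ev(1)[OF z(1)]]) (use ne that in auto)
  have lin: "linear f" unfolding linear_def using f by simp
  have "\<pi> \<zero>\<^bsub>\<Omega>\<^esub> = \<one>\<^bsub>\<Lambda>\<^esub>" using ev_contract(2)[OF lin z(1)] contract_ideal[OF z(2) lin] f(2) by simp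
  then show False using \<Omega>.subring_hom_zero[OF Vr _ placeD(2)[OF V]] PE.S.ring_axioms by simp
qed

lemma ev_pure_sum:
  assumes "set ds \<subseteq> carrier \<Lambda>" "set os \<subseteq> V"
  shows "pure_sum ds os \<in> carrier PV \<and> ev (pure_sum ds os) = \<Lambda>.combine (map \<pi> os) ds"
  using assms
proof (induction ds os rule: list_induct2')
  case (4 d ds v os)
  then have c: "pure_sum ds os \<in> carrier PV" "frag_of (d, v) \<in> carrier PV" "d \<in> carrier \<Lambda>" "v \<in> V" by (auto simp: PV_carrier(1))
  have "frag_of (d, v) + pure_sum ds os \<in> carrier PV"
    using c(1,2) order_trans[OF keys_add Un_least] unfolding PV_carrier(1) by blast
  then show ?case using 4 c \<pi>_closed(2)[OF c(4)] by (simp add: ev(4)[OF c(2,1)] ev(2) \<Lambda>.m_comm)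
qed (simp_all add: PV_carrier(1) ev(3))

text \<open>The divisor is an entry of least valuation. A new entry \<open>u\<close> is compared
  with the previous choice \<open>c\<close> through \<open>u / c\<close>: if this lies outside
  \<open>V\<close>, its inverse lies in \<open>V\<close> and \<open>u\<close> becomes the
  divisor.\<close>

lemma scale_into_place:
  assumes "set os \<subseteq> carrier \<Omega>" "\<not> set os \<subseteq> {\<zero>\<^bsub>\<Omega>\<^esub>}"
  shows "\<exists>c \<in> set os. c \<noteq> \<zero>\<^bsub>\<Omega>\<^esub> \<and> (\<forall>v \<in> set os. inv\<^bsub>\<Omega>\<^esub> c \<otimes>\<^bsub>\<Omega>\<^esub> v \<in> V)"
  using assms
proof (induction os)
  case (Cons u os)
  note sr = subringE[OF Vr]
  have uc: "u \<in> carrier \<Omega>" using Cons(2) by simp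
  have iu: "inv\<^bsub>\<Omega>\<^esub> u \<in> carrier \<Omega>" "inv\<^bsub>\<Omega>\<^esub> u \<otimes>\<^bsub>\<Omega>\<^esub> u = \<one>\<^bsub>\<Omega>\<^esub>" "u \<otimes>\<^bsub>\<Omega>\<^esub> inv\<^bsub>\<Omega>\<^esub> u = \<one>\<^bsub>\<Omega>\<^esub>"
    if "u \<in> carrier \<Omega>" "u \<noteq> \<zero>\<^bsub>\<Omega>\<^esub>" for u
    using \<Omega>.subfield_m_inv[OF \<Omega>.carrier_is_subfield, of u] that by auto
  show ?case
  proof (cases "set os \<subseteq> {\<zero>\<^bsub>\<Omega>\<^esub>}")
    case True
    then have u: "u \<noteq> \<zero>\<^bsub>\<Omega>\<^esub>" using Cons(3) by auto
    have "inv\<^bsub>\<Omega>\<^esub> u \<otimes>\<^bsub>\<Omega>\<^esub> v \<in> V" if "v \<in> set (u # os)" for v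
      using that iu[OF uc u] True sr(2,3) by auto
    then show ?thesis using u by (intro bexI[of _ u]) simp_all
  next
    case False
    then obtain c where c: "c \<in> set os" "c \<noteq> \<zero>\<^bsub>\<Omega>\<^esub>" "\<And>v. v \<in> set os \<Longrightarrow> inv\<^bsub>\<Omega>\<^esub> c \<otimes>\<^bsub>\<Omega>\<^esub> v \<in> V"
      using Cons by auto
    have cc: "c \<in> carrier \<Omega>" using c(1) Cons(2) by auto
    let ?t = "inv\<^bsub>\<Omega>\<^esub> c \<otimes>\<^bsub>\<Omega>\<^esub> u"
    have tc: "?t \<in> carrier \<Omega>" using iu(1)[OF cc c(2)] uc by simp
    show ?thesis
    proof (cases "?t \<in> V")
      case True
      then show ?thesis using c by (intro bexI[of _ c]) auto
    next
      case False
      have t: "?t \<noteq> \<zero>\<^bsub>\<Omega>\<^esub>" "inv\<^bsub>\<Omega>\<^esub> ?t \<in> V" using placeD(3)[OF V tc False] by blast+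
      then have u: "u \<noteq> \<zero>\<^bsub>\<Omega>\<^esub>" using iu(1)[OF cc c(2)] by auto
      have "inv\<^bsub>\<Omega>\<^esub> u \<otimes>\<^bsub>\<Omega>\<^esub> v \<in> V" if v: "v \<in> set os" for v
      proof -
        have vc: "v \<in> carrier \<Omega>" using v Cons(2) by auto
        note iuc = iu(1)[OF uc u] and icc = iu(1)[OF cc c(2)]
        have "?t \<otimes>\<^bsub>\<Omega>\<^esub> (inv\<^bsub>\<Omega>\<^esub> u \<otimes>\<^bsub>\<Omega>\<^esub> v) = inv\<^bsub>\<Omega>\<^esub> c \<otimes>\<^bsub>\<Omega>\<^esub> (u \<otimes>\<^bsub>\<Omega>\<^esub> inv\<^bsub>\<Omega>\<^esub> u) \<otimes>\<^bsub>\<Omega>\<^esub> v"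
          using iuc icc uc vc by (simp add: \<Omega>.m_assoc)
        also have "\<dots> = inv\<^bsub>\<Omega>\<^esub> c \<otimes>\<^bsub>\<Omega>\<^esub> v" using iu(3)[OF uc u] icc by simp
        finally have e: "?t \<otimes>\<^bsub>\<Omega>\<^esub> (inv\<^bsub>\<Omega>\<^esub> u \<otimes>\<^bsub>\<Omega>\<^esub> v) = inv\<^bsub>\<Omega>\<^esub> c \<otimes>\<^bsub>\<Omega>\<^esub> v" .
        have "inv\<^bsub>\<Omega>\<^esub> u \<otimes>\<^bsub>\<Omega>\<^esub> v = (inv\<^bsub>\<Omega>\<^esub> ?t \<otimes>\<^bsub>\<Omega>\<^esub> ?t) \<otimes>\<^bsub>\<Omega>\<^esub> (inv\<^bsub>\<Omega>\<^esub> u \<otimes>\<^bsub>\<Omega>\<^esub> v)"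
          using iu(2)[OF tc t(1)] iuc vc by simp
        also have "\<dots> = inv\<^bsub>\<Omega>\<^esub> ?t \<otimes>\<^bsub>\<Omega>\<^esub> (inv\<^bsub>\<Omega>\<^esub> c \<otimes>\<^bsub>\<Omega>\<^esub> v)"
          unfolding e[symmetric] using iu(1)[OF tc t(1)] tc iuc vc by (intro \<Omega>.m_assoc) simp_all
        finally show ?thesis using sr(6)[OF t(2) c(3)[OF v]] by simp
      qed
      moreover have "inv\<^bsub>\<Omega>\<^esub> u \<otimes>\<^bsub>\<Omega>\<^esub> u \<in> V" using iu(2)[OF uc u] sr(3) by simp
      ultimately show ?thesis using u by (intro bexI[of _ u]) auto
    qed
  qed
qed simp

lemma scale_pure_sum:
  assumes "set ds \<subseteq> carrier \<Lambda>" "c \<in> carrier \<Omega>"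
  shows "frag_of (\<one>\<^bsub>\<Lambda>\<^esub>, c) \<otimes>\<^bsub>P\<^esub> pure_sum ds os = pure_sum ds (map (\<lambda>v. c \<otimes>\<^bsub>\<Omega>\<^esub> v) os)"
  using assms(1) by (induction ds os rule: list_induct2') (simp_all add: pair_mult_0 pair_mult_add pair_mult_of)

text \<open>The tensor is written over a basis of the span of its first components, and its
  coefficients are divided by one of least valuation. One coefficient becomes \<open>\<one>\<close>,
  so the reduction is a nontrivial combination of independent vectors.\<close>

lemma scale_nonzero:
  assumes z: "z \<in> carrier P" "z \<notin> I"
  obtains c y where "c \<in> carrier \<Omega>" "y \<in> carrier PV" "ev y \<noteq> \<zero>\<^bsub>\<Lambda>\<^esub>" "frag_of (\<one>\<^bsub>\<Lambda>\<^esub>, c) \<otimes>\<^bsub>P\<^esub> z - y \<in> I"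
proof -
  obtain ls where ls: "set ls = fst ` Poly_Mapping.keys z" using finite_list[of "fst ` Poly_Mapping.keys z"] by auto
  have lsC: "set ls \<subseteq> carrier \<Lambda>" unfolding ls using z(1) unfolding pair_ring_carrier by auto
  obtain n where n: "\<Lambda>.dimension n E (\<Lambda>.Span E ls)" using \<Lambda>.Span_finite_dimension[OF E(1) lsC] by blast
  obtain ds where ds: "set ds \<subseteq> carrier \<Lambda>" "\<Lambda>.independent E ds" "\<Lambda>.Span E ds = \<Lambda>.Span E ls"
    using \<Lambda>.exists_base[OF E(1) n] by blast
  have "set ls \<subseteq> \<Lambda>.Span E ds" unfolding ds(3) by (rule \<Lambda>.Span_base_incl[OF E(1) lsC])
  then have zk: "Poly_Mapping.keys z \<subseteq> {\<Lambda>.combine (map (\<lambda>a. a) as) ds | as. length as = length ds \<and> set as \<subseteq> carrier (\<Lambda>\<lparr>carrier := E\<rparr>)} \<times> carrier \<Omega>"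
    using z(1) unfolding pair_ring_carrier ls \<Lambda>.Span_eq_combine_set_length_version[OF E(1) ds(1)] by force
  obtain os where os: "length os = length ds" "set os \<subseteq> carrier \<Omega>" "z - pure_sum ds os \<in> I"
    by (rule pure_sum_exists[OF ds(1) zk]; rule that)
  have "\<not> set os \<subseteq> {\<zero>\<^bsub>\<Omega>\<^esub>}" using pure_sum_zero[OF ds(1), of os] I_mem_cong[OF os(3)] z(2) by blast
  from scale_into_place[OF os(2) this] obtain c where c: "c \<in> set os" "c \<noteq> \<zero>\<^bsub>\<Omega>\<^esub>" "\<forall>v \<in> set os. inv\<^bsub>\<Omega>\<^esub> c \<otimes>\<^bsub>\<Omega>\<^esub> v \<in> V" by blast
  have cc: "c \<in> carrier \<Omega>" using c(1) os(2) by blast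
  have ic: "inv\<^bsub>\<Omega>\<^esub> c \<in> carrier \<Omega>" "inv\<^bsub>\<Omega>\<^esub> c \<otimes>\<^bsub>\<Omega>\<^esub> c = \<one>\<^bsub>\<Omega>\<^esub>"
    using \<Omega>.subfield_m_inv[OF \<Omega>.carrier_is_subfield, of c] cc c(2) by auto
  let ?os = "map (\<lambda>v. inv\<^bsub>\<Omega>\<^esub> c \<otimes>\<^bsub>\<Omega>\<^esub> v) os"
  have osV: "set ?os \<subseteq> V" using c(3) by auto
  note y = ev_pure_sum[OF ds(1) osV]
  have "ev (pure_sum ds ?os) \<noteq> \<zero>\<^bsub>\<Lambda>\<^esub>"
  proof
    assume "ev (pure_sum ds ?os) = \<zero>\<^bsub>\<Lambda>\<^esub>"
    then have 0: "\<Lambda>.combine (map \<pi> ?os) ds = \<zero>\<^bsub>\<Lambda>\<^esub>" using y by simp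
    have "set (map \<pi> ?os) \<subseteq> E" using osV \<pi>_closed(1) by auto
    from \<Lambda>.independent_imp_trivial_combine[OF E(1) ds(2) this 0] have "set (map \<pi> ?os) \<subseteq> {\<zero>\<^bsub>\<Lambda>\<^esub>}" using os(1) by simp
    then have "\<pi> (inv\<^bsub>\<Omega>\<^esub> c \<otimes>\<^bsub>\<Omega>\<^esub> c) = \<zero>\<^bsub>\<Lambda>\<^esub>" using c(1) by auto
    then show False using ic(2) \<pi>_hom(4) by simp
  qed
  moreover have "frag_of (\<one>\<^bsub>\<Lambda>\<^esub>, inv\<^bsub>\<Omega>\<^esub> c) \<otimes>\<^bsub>P\<^esub> z - pure_sum ds ?os \<in> I"
    using I.I_l_closed[OF os(3), of "frag_of (\<one>\<^bsub>\<Lambda>\<^esub>, inv\<^bsub>\<Omega>\<^esub> c)"] ic(1) P_of scale_pure_sum[OF ds(1) ic(1), of os]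
    by (simp add: pair_mult_diff)
  ultimately show ?thesis using that[OF ic(1)] y by blast
qed

text \<open>Tensors outside \<open>I\<close> can be scaled to have nonzero reduction. The product of
  two such reductions is nonzero in the field \<Lambda>, whereas elements of \<open>I\<close> reduce
  to zero.\<close>

lemma tensor_ideal_prime_aux: "primeideal I P"
proof (rule primeidealI[OF I.ideal_axioms P.is_cring])
  have "ev \<one>\<^bsub>PV\<^esub> = \<one>\<^bsub>\<Lambda>\<^esub>" using ring_hom_memE(4)[OF ev_hom] .
  moreover have "\<one>\<^bsub>PV\<^esub> = \<one>\<^bsub>P\<^esub>" "\<one>\<^bsub>PV\<^esub> \<in> carrier PV" using subringE(3)[OF Vr] by (simp_all add: pair_ring_simps PV_carrier(1))
  ultimately show "carrier P \<noteq> I" using ev_ideal[of "\<one>\<^bsub>PV\<^esub>"] P.one_closed by auto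
  fix a b assume ab: "a \<in> carrier P" "b \<in> carrier P" "a \<otimes>\<^bsub>P\<^esub> b \<in> I"
  show "a \<in> I \<or> b \<in> I"
  proof (rule ccontr)
    assume "\<not> (a \<in> I \<or> b \<in> I)"
    then have n: "a \<notin> I" "b \<notin> I" by blast+
    obtain c u where u: "c \<in> carrier \<Omega>" "u \<in> carrier PV" "ev u \<noteq> \<zero>\<^bsub>\<Lambda>\<^esub>" "frag_of (\<one>\<^bsub>\<Lambda>\<^esub>, c) \<otimes>\<^bsub>P\<^esub> a - u \<in> I"
      by (rule scale_nonzero[OF ab(1) n(1)]; rule that)
    obtain d v where v: "d \<in> carrier \<Omega>" "v \<in> carrier PV" "ev v \<noteq> \<zero>\<^bsub>\<Lambda>\<^esub>" "frag_of (\<one>\<^bsub>\<Lambda>\<^esub>, d) \<otimes>\<^bsub>P\<^esub> b - v \<in> I"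
      by (rule scale_nonzero[OF ab(2) n(2)]; rule that)
    let ?c = "frag_of (\<one>\<^bsub>\<Lambda>\<^esub>, c)" and ?d = "frag_of (\<one>\<^bsub>\<Lambda>\<^esub>, d)"
    have cd: "?c \<in> carrier P" "?d \<in> carrier P" using u(1) v(1) P_of by simp_all
    have uv: "u \<in> carrier P" "v \<in> carrier P" using u(2) v(2) PV_carrier(2) by blast+
    have "(?c \<otimes>\<^bsub>P\<^esub> a) \<otimes>\<^bsub>P\<^esub> (?d \<otimes>\<^bsub>P\<^esub> b) = (?c \<otimes>\<^bsub>P\<^esub> ?d) \<otimes>\<^bsub>P\<^esub> (a \<otimes>\<^bsub>P\<^esub> b)" using cd ab by (simp add: P.m_ac)
    then have 1: "(?c \<otimes>\<^bsub>P\<^esub> a) \<otimes>\<^bsub>P\<^esub> (?d \<otimes>\<^bsub>P\<^esub> b) \<in> I" using I.I_l_closed[OF ab(3)] cd by simp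
    have 2: "(?c \<otimes>\<^bsub>P\<^esub> a) \<otimes>\<^bsub>P\<^esub> (?d \<otimes>\<^bsub>P\<^esub> b) - u \<otimes>\<^bsub>P\<^esub> (?d \<otimes>\<^bsub>P\<^esub> b) \<in> I"
      using I.I_r_closed[OF u(4), of "?d \<otimes>\<^bsub>P\<^esub> b"] cd ab by (simp add: pair_mult_diff)
    have 3: "u \<otimes>\<^bsub>P\<^esub> (?d \<otimes>\<^bsub>P\<^esub> b) - u \<otimes>\<^bsub>P\<^esub> v \<in> I"
      using I.I_l_closed[OF v(4) uv(1)] by (simp add: pair_mult_diff)
    have "u \<otimes>\<^bsub>P\<^esub> v \<in> I" using 1 I_mem_cong[OF 2] I_mem_cong[OF 3] by simp
    moreover have "u \<otimes>\<^bsub>PV\<^esub> v \<in> carrier PV"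
    proof -
      have "cring (\<Omega>\<lparr>carrier := V\<rparr>)" using \<Omega>.subcring_iff[OF VC] \<Omega>.subcringI'[OF Vr] by simp
      then interpret PV: cring PV by (rule pair_ring_cring[OF \<Lambda>.is_cring])
      show ?thesis using u(2) v(2) by (rule PV.m_closed)
    qed
    ultimately have "ev (u \<otimes>\<^bsub>PV\<^esub> v) = \<zero>\<^bsub>\<Lambda>\<^esub>" using ev_ideal PV_mult by simp
    then have "ev u \<otimes>\<^bsub>\<Lambda>\<^esub> ev v = \<zero>\<^bsub>\<Lambda>\<^esub>" using ring_hom_memE(2)[OF ev_hom u(2) v(2)] by simp
    then show False using \<Lambda>.integral[OF _ ev(1)[OF u(2)] ev(1)[OF v(2)]] u(3) v(3) by blast
  qed
qed

end

theorem tensor_ideal_prime: "primeideal I P"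
proof -
  obtain V \<pi> where "place \<Omega> (\<Lambda>\<lparr>carrier := E\<rparr>) V \<pi>" "\<And>e. e \<in> E \<Longrightarrow> x e \<in> V" "\<And>e. e \<in> E \<Longrightarrow> \<pi> (x e) = e"
    by (rule place_over_base; rule that)
  then show ?thesis by (rule tensor_ideal_prime_aux)
qed

end

section \<open>Amalgamation of fields with an endomorphism\<close>

context closed_base
begin

theorem amalgamation:
  assumes w: "w \<in> ring_hom \<Lambda> \<Lambda>" "w ` E \<subseteq> E" and \<rho>: "\<rho> \<in> ring_hom \<Omega> \<Omega>" and xw: "\<And>e. e \<in> E \<Longrightarrow> x (w e) = \<rho> (x e)"
  obtains M :: "(('f \<times> 's \<Rightarrow>\<^sub>0 int) \<times> ('f \<times> 's \<Rightarrow>\<^sub>0 int)) set ring" and \<mu> \<alpha> \<beta>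
  where "field M" "\<mu> \<in> ring_hom M M" "\<alpha> \<in> ring_hom \<Lambda> M" "\<beta> \<in> ring_hom \<Omega> M"
    "\<And>e. e \<in> E \<Longrightarrow> \<alpha> e = \<beta> (x e)" "\<And>l. l \<in> carrier \<Lambda> \<Longrightarrow> \<mu> (\<alpha> l) = \<alpha> (w l)" "\<And>v. v \<in> carrier \<Omega> \<Longrightarrow> \<mu> (\<beta> v) = \<beta> (\<rho> v)"
proof -
  define s where "s = pair_map w \<rho>"
  have s: "s \<in> ring_hom P P" unfolding s_def by (rule pair_map_hom[OF w(1) \<rho>])
  have sI: "s z \<in> I" if "z \<in> I" for z
    unfolding s_def
    by (rule pair_map_ideal[OF \<Lambda>.is_cring \<Omega>.is_cring E_hom x \<Lambda>.is_cring \<Omega>.is_cring E_hom x w(1) \<rho> _ _ _ that, where \<kappa> = w])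
      (use w(2) xw in auto)
  have sn: "s ^^ n \<in> ring_hom P P" for n by (rule ring_hom_funpow[OF s])
  note snm = ring_hom_memE[OF sn]
  have snI: "(s ^^ m) z \<in> I" if "(s ^^ n) z \<in> I" "n \<le> m" for n m z
    using that(2)
  proof (induction m)
    case (Suc m)
    then show ?case using that(1) sI by (cases "n = Suc m") auto
  qed (use that(1) in simp)
  \<comment> \<open>An increasing union of preimages of the prime ideal \<open>I\<close>, hence
    prime as long as it is proper; it is, because \<open>s\<close> fixes the unit.\<close>
  define Q where "Q = {z \<in> carrier P. \<exists>n. (s ^^ n) z \<in> I}"
  have QI: "z \<in> Q" if "z \<in> carrier P" "(s ^^ n) z \<in> I" for z n using that unfolding Q_def by blast
  have IQ: "I \<subseteq> Q" using I_carrier unfolding Q_def by (auto intro!: exI[of _ "0::nat"])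
  have two: "\<exists>n. (s ^^ n) a \<in> I \<and> (s ^^ n) b \<in> I" if ab: "a \<in> Q" "b \<in> Q" for a b
  proof -
    obtain n m where "(s ^^ n) a \<in> I" "(s ^^ m) b \<in> I" using ab unfolding Q_def by blast
    then show ?thesis using snI[of n a "max n m"] snI[of m b "max n m"] by auto
  qed
  have QC: "Q \<subseteq> carrier P" unfolding Q_def by blast
  interpret Ip: primeideal I P by (rule tensor_ideal_prime)
  have l: "y \<otimes>\<^bsub>P\<^esub> a \<in> Q" if a: "a \<in> Q" and y: "y \<in> carrier P" for a y
  proof -
    obtain n where n: "(s ^^ n) a \<in> I" using a unfolding Q_def by blast
    have "(s ^^ n) (y \<otimes>\<^bsub>P\<^esub> a) \<in> I" using snm(2)[OF y subsetD[OF QC a]] I.I_l_closed[OF n snm(1)[OF y]] by simp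
    then show ?thesis by (rule QI[OF P.m_closed[OF y subsetD[OF QC a]]])
  qed
  have diff: "a - b \<in> Q" if ab: "a \<in> Q" "b \<in> Q" for a b
  proof -
    obtain n where n: "(s ^^ n) a \<in> I" "(s ^^ n) b \<in> I" using two[OF ab] by blast
    have c: "a \<in> carrier P" "b \<in> carrier P" using ab QC by blast+
    have "(s ^^ n) (a - b) = (s ^^ n) a - (s ^^ n) b"
      by (induction n) (simp_all add: s_def)
    then have "(s ^^ n) (a - b) \<in> I" using I_diff[OF n] by simp
    then show ?thesis by (rule QI[OF P_diff[OF c]])
  qed
  have Q0: "0 \<in> Q" using IQ I_zero by blast
  have "primeideal Q P"
  proof (rule primeidealI[OF idealI[OF P.ring_axioms] P.is_cring])
    show "subgroup Q (add_monoid P)"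
    proof (rule group.subgroupI[OF P.a_group])
      show "Q \<subseteq> carrier (add_monoid P)" "Q \<noteq> {}" using QC Q0 by auto
      show "inv\<^bsub>add_monoid P\<^esub> a \<in> Q" if "a \<in> Q" for a
        using diff[OF Q0 that] P_minus[of a] QC that by (auto simp: a_inv_def)
      show "a \<otimes>\<^bsub>add_monoid P\<^esub> b \<in> Q" if "a \<in> Q" "b \<in> Q" for a b
        using diff[OF that(1) diff[OF Q0 that(2)]] by (simp add: pair_ring_simps)
    qed
    show "y \<otimes>\<^bsub>P\<^esub> a \<in> Q" "a \<otimes>\<^bsub>P\<^esub> y \<in> Q" if "a \<in> Q" "y \<in> carrier P" for a y
      using l[OF that] P.m_comm[OF that(2) subsetD[OF QC that(1)]] by simp_all
    have "\<one>\<^bsub>P\<^esub> \<notin> Q"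
    proof
      assume "\<one>\<^bsub>P\<^esub> \<in> Q"
      then obtain n where "(s ^^ n) \<one>\<^bsub>P\<^esub> \<in> I" unfolding Q_def by blast
      then have "\<one>\<^bsub>P\<^esub> \<in> I" using snm(4) by simp
      then show False using I.one_imp_carrier Ip.I_notcarr by simp
    qed
    then show "carrier P \<noteq> Q" using P.one_closed by blast
    show "a \<in> Q \<or> b \<in> Q" if ab: "a \<in> carrier P" "b \<in> carrier P" "a \<otimes>\<^bsub>P\<^esub> b \<in> Q" for a b
    proof -
      obtain n where "(s ^^ n) (a \<otimes>\<^bsub>P\<^esub> b) \<in> I" using ab(3) unfolding Q_def by blast
      then have "(s ^^ n) a \<otimes>\<^bsub>P\<^esub> (s ^^ n) b \<in> I" using snm(2)[OF ab(1,2)] by simp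
      from Ip.I_prime[OF snm(1)[OF ab(1)] snm(1)[OF ab(2)] this] show ?thesis
        by (elim disjE) (blast intro: QI[OF ab(1)] QI[OF ab(2)])+
    qed
  qed
  then interpret Fr: fractions P Q by (intro fractions.intro P.is_cring)
  \<comment> \<open>Taking the union over all powers makes \<open>Q\<close> its own preimage under
    \<open>s\<close>, which \<open>I\<close> alone need not be.\<close>
  have sQ: "s z \<in> Q \<longleftrightarrow> z \<in> Q" if z: "z \<in> carrier P" for z
  proof
    assume "s z \<in> Q"
    then obtain n where "(s ^^ Suc n) z \<in> I" unfolding Q_def by (auto simp: funpow_swap1)
    then show "z \<in> Q" by (rule QI[OF z])
  next
    assume "z \<in> Q"
    then obtain n where "(s ^^ n) z \<in> I" unfolding Q_def by blast
    then have "(s ^^ n) (s z) \<in> I" using sI by (simp add: funpow_swap1[symmetric])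
    then show "s z \<in> Q" by (rule QI[OF ring_hom_memE(1)[OF s z]])
  qed
  obtain \<mu> where \<mu>: "\<mu> \<in> ring_hom Fr.frac Fr.frac" "\<And>a. a \<in> carrier P \<Longrightarrow> \<mu> (Fr.cls (a, \<one>\<^bsub>P\<^esub>)) = Fr.cls (s a, \<one>\<^bsub>P\<^esub>)"
    by (rule Fr.frac_endo[OF s sQ]; (assumption)?; rule that)
  define c where "c a = Fr.cls (a, \<one>\<^bsub>P\<^esub>)" for a
  note ch = ring_hom_memE[OF Fr.frac_hom, folded c_def]
  have ceq: "c a = c b" if "a \<in> carrier P" "b \<in> carrier P" "a - b \<in> I" for a b
    unfolding c_def Fr.cls_eq[OF Fr.domI[OF that(1) Fr.one_notin] Fr.domI[OF that(2) Fr.one_notin]] Fr.eqv_def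
    using that IQ P_minus[OF that(2)] by (auto simp: a_minus_def pair_ring_simps(3))
  have o: "\<one>\<^bsub>\<Lambda>\<^esub> \<in> carrier \<Lambda>" "\<one>\<^bsub>\<Omega>\<^esub> \<in> carrier \<Omega>" by simp_all
  define \<alpha> where "\<alpha> l = c (frag_of (l, \<one>\<^bsub>\<Omega>\<^esub>))" for l
  define \<beta> where "\<beta> v = c (frag_of (\<one>\<^bsub>\<Lambda>\<^esub>, v))" for v
  have \<alpha>: "\<alpha> \<in> ring_hom \<Lambda> Fr.frac"
  proof (rule ring_hom_memI)
    show "\<alpha> l \<in> carrier Fr.frac" if "l \<in> carrier \<Lambda>" for l unfolding \<alpha>_def by (rule ch(1)) (simp add: P_of that)
    show "\<alpha> (l \<otimes>\<^bsub>\<Lambda>\<^esub> m) = \<alpha> l \<otimes>\<^bsub>Fr.frac\<^esub> \<alpha> m" if "l \<in> carrier \<Lambda>" "m \<in> carrier \<Lambda>" for l m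
      unfolding \<alpha>_def using ch(2)[of "frag_of (l, \<one>\<^bsub>\<Omega>\<^esub>)" "frag_of (m, \<one>\<^bsub>\<Omega>\<^esub>)"] that by (simp add: P_of pair_mult_of)
    show "\<alpha> (l \<oplus>\<^bsub>\<Lambda>\<^esub> m) = \<alpha> l \<oplus>\<^bsub>Fr.frac\<^esub> \<alpha> m" if lm: "l \<in> carrier \<Lambda>" "m \<in> carrier \<Lambda>" for l m
    proof -
      have "c (frag_of (l \<oplus>\<^bsub>\<Lambda>\<^esub> m, \<one>\<^bsub>\<Omega>\<^esub>)) = c (frag_of (l, \<one>\<^bsub>\<Omega>\<^esub>) + frag_of (m, \<one>\<^bsub>\<Omega>\<^esub>))"
        by (rule ceq[OF _ _ I_relations(1)[OF lm o(2)]]) (use lm P_add P_of in simp_all)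
      then show ?thesis unfolding \<alpha>_def using ch(3)[of "frag_of (l, \<one>\<^bsub>\<Omega>\<^esub>)" "frag_of (m, \<one>\<^bsub>\<Omega>\<^esub>)"] lm by (simp add: P_of pair_ring_simps(3))
    qed
    show "\<alpha> \<one>\<^bsub>\<Lambda>\<^esub> = \<one>\<^bsub>Fr.frac\<^esub>" unfolding \<alpha>_def using ch(4) by (simp add: pair_ring_simps(1))
  qed
  have \<beta>: "\<beta> \<in> ring_hom \<Omega> Fr.frac"
  proof (rule ring_hom_memI)
    show "\<beta> l \<in> carrier Fr.frac" if "l \<in> carrier \<Omega>" for l unfolding \<beta>_def by (rule ch(1)) (simp add: P_of that)
    show "\<beta> (l \<otimes>\<^bsub>\<Omega>\<^esub> m) = \<beta> l \<otimes>\<^bsub>Fr.frac\<^esub> \<beta> m" if "l \<in> carrier \<Omega>" "m \<in> carrier \<Omega>" for l m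
      unfolding \<beta>_def using ch(2)[of "frag_of (\<one>\<^bsub>\<Lambda>\<^esub>, l)" "frag_of (\<one>\<^bsub>\<Lambda>\<^esub>, m)"] that by (simp add: P_of pair_mult_of)
    show "\<beta> (l \<oplus>\<^bsub>\<Omega>\<^esub> m) = \<beta> l \<oplus>\<^bsub>Fr.frac\<^esub> \<beta> m" if lm: "l \<in> carrier \<Omega>" "m \<in> carrier \<Omega>" for l m
    proof -
      have "c (frag_of (\<one>\<^bsub>\<Lambda>\<^esub>, l \<oplus>\<^bsub>\<Omega>\<^esub> m)) = c (frag_of (\<one>\<^bsub>\<Lambda>\<^esub>, l) + frag_of (\<one>\<^bsub>\<Lambda>\<^esub>, m))"
        by (rule ceq[OF _ _ I_relations(2)[OF o(1) lm]]) (use lm P_add P_of in simp_all)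
      then show ?thesis unfolding \<beta>_def using ch(3)[of "frag_of (\<one>\<^bsub>\<Lambda>\<^esub>, l)" "frag_of (\<one>\<^bsub>\<Lambda>\<^esub>, m)"] lm by (simp add: P_of pair_ring_simps(3))
    qed
    show "\<beta> \<one>\<^bsub>\<Omega>\<^esub> = \<one>\<^bsub>Fr.frac\<^esub>" unfolding \<beta>_def using ch(4) by (simp add: pair_ring_simps(1))
  qed
  show ?thesis
  proof (rule that[OF Fr.frac_field \<mu>(1) \<alpha> \<beta>])
    show "\<alpha> e = \<beta> (x e)" if e: "e \<in> E" for e
    proof -
      have ec: "e \<in> carrier \<Lambda>" "x e \<in> carrier \<Omega>" using e EC \<psi>_hom(1)[of e] by auto
      have "frag_of (e, \<one>\<^bsub>\<Omega>\<^esub>) - frag_of (\<one>\<^bsub>\<Lambda>\<^esub>, x e) \<in> I" using I_relations(3)[of e "\<one>\<^bsub>\<Lambda>\<^esub>" "\<one>\<^bsub>\<Omega>\<^esub>"] e ec by simp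
      then show ?thesis unfolding \<alpha>_def \<beta>_def using ec by (intro ceq) (simp_all add: P_of)
    qed
    show "\<mu> (\<alpha> l) = \<alpha> (w l)" if "l \<in> carrier \<Lambda>" for l
      using \<mu>(2)[of "frag_of (l, \<one>\<^bsub>\<Omega>\<^esub>)"] that ring_hom_memE(4)[OF \<rho>] by (simp add: \<alpha>_def c_def P_of s_def)
    show "\<mu> (\<beta> v) = \<beta> (\<rho> v)" if "v \<in> carrier \<Omega>" for v
      using \<mu>(2)[of "frag_of (\<one>\<^bsub>\<Lambda>\<^esub>, v)"] that ring_hom_memE(4)[OF w(1)] by (simp add: \<beta>_def c_def P_of s_def)
  qed
qed

end

section \<open>Algebraic closures with an endomorphism\<close>

lemma (in field) algebraic_of_image:
  assumes S: "field S" and \<iota>: "\<iota> \<in> ring_hom R S" and k: "subfield k R" and a: "a \<in> carrier R" "(ring.algebraic S over (\<iota> ` k)) (\<iota> a)"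
  shows "(algebraic over k) a"
proof -
  interpret S: field S by fact
  note inj = non_trivial_field_hom_is_inj[OF \<iota> field_axioms S] and kC = subfieldE(3)[OF k]
  have cr: "ring_hom_ring R S \<iota>" by (rule ring_hom_ringI2[OF ring_axioms S.ring_axioms \<iota>])
  note im = ring_hom_memE[OF \<iota>]
  have sk: "subring (\<iota> ` k) S" by (rule ring_hom_ring.img_is_subring[OF cr subfieldE(1)[OF k]])
  obtain p where p: "p \<in> carrier ((\<iota> ` k)[X]\<^bsub>S\<^esub>)" "p \<noteq> []" "S.eval p (\<iota> a) = \<zero>\<^bsub>S\<^esub>"
    by (rule S.algebraicE[OF sk im(1)[OF a(1)] a(2)])
  have pp: "set p \<subseteq> \<iota> ` k" "hd p \<noteq> \<zero>\<^bsub>S\<^esub>" using p(1,2) unfolding univ_poly_carrier[symmetric] polynomial_def by auto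
  then have "p \<in> lists (\<iota> ` k)" by (auto simp: in_lists_conv_set)
  then obtain q where q: "set q \<subseteq> k" "map \<iota> q = p" unfolding lists_image by (auto simp: in_lists_conv_set)
  have z: "\<iota> \<zero> = \<zero>\<^bsub>S\<^esub>" by (rule ring_hom_zero[OF \<iota> ring_axioms S.ring_axioms])
  have qC: "set q \<subseteq> carrier R" using q(1) kC by blast
  have "\<iota> (eval q a) = \<iota> \<zero>" using ring_hom_ring.eval_hom'[OF cr a(1) qC] q(2) p(3) z by simp
  then have e: "eval q a = \<zero>" using inj_onD[OF inj] eval_in_carrier[OF qC a(1)] by simp
  have ne: "q \<noteq> []" using q(2) p(2) by auto
  have "hd q \<noteq> \<zero>" using pp(2) q(2) ne z by (cases q) auto
  then have "polynomial k q" unfolding polynomial_def using q(1) by simp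
  then have "q \<in> carrier (k[X])" by (simp only: univ_poly_carrier)
  then show ?thesis by (rule algebraicI) (rule ne, rule e)
qed

text \<open>An algebraic closure contains its base field only up to the embedding \<iota>, so
  homomorphisms have to be carried to the image.\<close>

lemma (in field) hom_transport:
  assumes S: "field S" and \<iota>: "\<iota> \<in> ring_hom R S" and V: "subring V R" and T: "ring T" and f: "f \<in> ring_hom (R\<lparr>carrier := V\<rparr>) T"
  obtains f' where "f' \<in> ring_hom (S\<lparr>carrier := \<iota> ` V\<rparr>) T" "\<And>a. a \<in> V \<Longrightarrow> f' (\<iota> a) = f a"
proof -
  interpret S: field S by fact
  note im = ring_hom_memE[OF \<iota>] and fm = ring_hom_memE[OF f, simplified] and sr = subringE[OF V]
  have inj: "inj_on \<iota> V" by (rule inj_on_subset[OF non_trivial_field_hom_is_inj[OF \<iota> field_axioms S] sr(1)])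
  define f' where "f' y = f (inv_into V \<iota> y)" for y
  have f': "f' (\<iota> a) = f a" if "a \<in> V" for a unfolding f'_def using inv_into_f_f[OF inj that] by simp
  have c: "a \<in> carrier R" if "a \<in> V" for a using that sr(1) by blast
  have "f' \<in> ring_hom (S\<lparr>carrier := \<iota> ` V\<rparr>) T"
  proof (rule ring_hom_memI)
    fix y z assume "y \<in> carrier (S\<lparr>carrier := \<iota> ` V\<rparr>)" "z \<in> carrier (S\<lparr>carrier := \<iota> ` V\<rparr>)"
    then obtain a b where ab: "a \<in> V" "b \<in> V" "y = \<iota> a" "z = \<iota> b" by auto
    show "f' (y \<otimes>\<^bsub>S\<lparr>carrier := \<iota> ` V\<rparr>\<^esub> z) = f' y \<otimes>\<^bsub>T\<^esub> f' z"
      using f'[of "a \<otimes> b"] f'[of a] f'[of b] ab sr(6) fm(2) im(2)[OF c c] by simp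
    show "f' (y \<oplus>\<^bsub>S\<lparr>carrier := \<iota> ` V\<rparr>\<^esub> z) = f' y \<oplus>\<^bsub>T\<^esub> f' z"
      using f'[of "a \<oplus> b"] f'[of a] f'[of b] ab sr(7) fm(3) im(3)[OF c c] by simp
  next
    fix y assume "y \<in> carrier (S\<lparr>carrier := \<iota> ` V\<rparr>)"
    then show "f' y \<in> carrier T" using f' fm(1) by auto
  next
    show "f' \<one>\<^bsub>S\<lparr>carrier := \<iota> ` V\<rparr>\<^esub> = \<one>\<^bsub>T\<^esub>" using f'[OF sr(3)] fm(4) im(4) by simp
  qed
  then show ?thesis by (rule that[OF _ f'])
qed

text \<open>A place of the closure with values in the closure is defined everywhere, since all
  elements are algebraic over the base field.\<close>

lemma (in field) alg_closure_endo:
  assumes \<nu>: "\<nu> \<in> ring_hom R R"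
  obtains \<rho> where "\<rho> \<in> ring_hom alg_closure alg_closure" "\<And>a. a \<in> carrier R \<Longrightarrow> \<rho> (indexed_const a) = indexed_const (\<nu> a)"
proof -
  interpret C: algebraic_closure alg_closure "indexed_const ` carrier R" by (rule alg_closureE(1))
  interpret CC: field_pair alg_closure alg_closure by unfold_locales
  have f: "(\<lambda>a. indexed_const (\<nu> a)) \<in> ring_hom (R\<lparr>carrier := carrier R\<rparr>) alg_closure"
    using ring_hom_trans[OF \<nu> alg_closureE(2)] by (simp add: comp_def)
  obtain f' where f': "f' \<in> ring_hom (alg_closure\<lparr>carrier := indexed_const ` carrier R\<rparr>) alg_closure"
    "\<And>a. a \<in> carrier R \<Longrightarrow> f' (indexed_const a) = indexed_const (\<nu> a)"
    by (rule hom_transport[OF C.field_axioms alg_closureE(2) carrier_is_subring C.ring_axioms f]; (assumption)?; rule that)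
  note sf = C.subfield_axioms
  obtain V \<rho> where V: "place alg_closure alg_closure V \<rho>" "indexed_const ` carrier R \<subseteq> V" "\<And>a. a \<in> indexed_const ` carrier R \<Longrightarrow> \<rho> a = f' a"
    by (rule CC.place_extends[OF subfieldE(1)[OF sf] f'(1)]; (assumption)?; rule that)
  have "carrier alg_closure \<subseteq> V" using CC.algebraic_in_place[OF V(1) sf V(2) _ C.algebraic_extension] by blast
  then have "\<rho> \<in> ring_hom (alg_closure\<lparr>carrier := carrier alg_closure\<rparr>) alg_closure"
    by (rule ring_hom_subring_mono[OF placeD(2)[OF V(1)]])
  then have "\<rho> \<in> ring_hom alg_closure alg_closure" by (simp add: ring_hom_def)
  then show ?thesis by (rule that) (use V(3) f'(2) in simp)
qed

lemma sigma_extension_field_endo: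
  assumes "sigma_extension K \<sigma> L \<tau> \<phi>" shows "field_endo L (\<phi> ` carrier K) \<tau>"
proof -
  interpret sigma_extension K \<sigma> L \<tau> \<phi> by fact
  have "\<phi> \<in> ring_hom (K\<lparr>carrier := carrier K\<rparr>) L" using structure_map by (simp add: ring_hom_def)
  then have "subfield (\<phi> ` carrier K) L" by (rule K.subring_hom_image(1)[OF K.carrier_is_subfield L.field_axioms])
  moreover have "\<tau> ` \<phi> ` carrier K \<subseteq> \<phi> ` carrier K"
    using equivariant[symmetric] ring_hom_memE(1)[OF K.endo] by auto
  ultimately show ?thesis
    by (intro field_endo.intro field_endo_axioms.intro L.field_axioms L.endo)
qed

text \<open>The element types of \<open>alg_closure\<close> and of the amalgam. They are spelled out
  because the amalgamation is applied twice, the second time to a field of the first amalgam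
  type.\<close>

type_synonym 'l closure = "('l list \<times> nat) multiset \<Rightarrow> 'l"

type_synonym ('l, 'n) amalgam = "(('l closure \<times> 'n closure \<Rightarrow>\<^sub>0 int) \<times> ('l closure \<times> 'n closure \<Rightarrow>\<^sub>0 int)) set"

text \<open>The hypothesis on good elements is the only link between \<open>N\<close> and the strong
  core of \<open>L\<close>. The constructions take place between the closures of \<open>L\<close>
  and \<open>N\<close>, to which all maps are carried along \<open>indexed_const\<close>, and the
  amalgam of the closures contains both fields.\<close>

theorem sigma_amalgamation:
  fixes K :: "'k ring" and L :: "'l ring" and N :: "'n ring"
  assumes L: "sigma_extension K \<sigma> L \<tau> \<phi>" and N: "sigma_extension K \<sigma> N \<nu> \<psi>"
    and good_hom: "\<And>x. field_endo.good L (\<phi> ` carrier K) \<tau> x \<Longrightarrow>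
      \<exists>\<delta> \<in> ring_hom (L\<lparr>carrier := ring.simple_extension L (\<phi> ` carrier K) x\<rparr>) N.
        (\<forall>a \<in> carrier K. \<delta> (\<phi> a) = \<psi> a) \<and> \<nu> (\<delta> x) = \<delta> (\<tau> x)"
  shows "\<exists>(M :: ('l, 'n) amalgam ring) \<mu> \<epsilon> \<epsilon>'.
    sigma_extension K \<sigma> M \<mu> (\<epsilon> \<circ> \<phi>) \<and> sigma_embedding K L \<tau> \<phi> M \<mu> (\<epsilon> \<circ> \<phi>) \<epsilon> \<and>
    sigma_embedding K N \<nu> \<psi> M \<mu> (\<epsilon> \<circ> \<phi>) \<epsilon>'"
proof -
  interpret L: sigma_extension K \<sigma> L \<tau> \<phi> by fact
  interpret N: sigma_extension K \<sigma> N \<nu> \<psi> by fact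
  let ?k = "\<phi> ` carrier K" and ?\<Omega> = "N.L.alg_closure" and ?\<Lambda> = "L.L.alg_closure"
  let ?\<iota> = "L.L.indexed_const" and ?\<eta> = "N.L.indexed_const"
  interpret fe: field_endo L ?k \<tau> by (rule sigma_extension_field_endo[OF L])
  note \<iota> = L.L.alg_closureE(2) and \<eta> = N.L.alg_closureE(2)
  interpret \<Omega>: algebraic_closure ?\<Omega> "?\<eta> ` carrier N" by (rule N.L.alg_closureE(1))
  interpret \<Lambda>: algebraic_closure ?\<Lambda> "?\<iota> ` carrier L" by (rule L.L.alg_closureE(1))
  obtain \<rho> where \<rho>: "\<rho> \<in> ring_hom ?\<Omega> ?\<Omega>" "\<And>a. a \<in> carrier N \<Longrightarrow> \<rho> (?\<eta> a) = ?\<eta> (\<nu> a)"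
    by (rule N.L.alg_closure_endo[OF N.L.endo]; rule that)
  have hf: "(\<lambda>a. ?\<eta> (\<psi> a)) \<in> ring_hom (K\<lparr>carrier := carrier K\<rparr>) ?\<Omega>"
    using ring_hom_trans[OF N.structure_map \<eta>] by (simp add: comp_def ring_hom_def)
  obtain h where h: "h \<in> ring_hom (L\<lparr>carrier := ?k\<rparr>) ?\<Omega>" "\<And>a. a \<in> carrier K \<Longrightarrow> h (\<phi> a) = ?\<eta> (\<psi> a)"
    by (rule L.K.hom_transport[OF L.L.field_axioms L.structure_map L.K.carrier_is_subring \<Omega>.ring_axioms hf]; (assumption)?; rule that)
  have equiv: "\<rho> (h a) = h (\<tau> a)" if a: "a \<in> ?k" for a
  proof -
    obtain b where b: "b \<in> carrier K" "a = \<phi> b" using a by blast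
    have "\<rho> (h a) = ?\<eta> (\<psi> (\<sigma> b))"
      unfolding b(2) h(2)[OF b(1)] using \<rho>(2) ring_hom_memE(1)[OF N.structure_map b(1)] N.equivariant[OF b(1)] by simp
    also have "\<dots> = h (\<tau> a)" unfolding b(2) L.equivariant[OF b(1), symmetric]
      using h(2) ring_hom_memE(1)[OF L.K.endo b(1)] by simp
    finally show ?thesis .
  qed
  interpret ep: endo_pair L ?\<Omega> ?k \<tau> h \<rho>
    by (intro endo_pair.intro endo_pair_axioms.intro field_pair.intro L.L.field_axioms \<Omega>.algebraically_closed_axioms
        fe.field_endo_axioms h(1) \<rho>(1) equiv)
  have gh: "\<exists>\<delta> \<in> ring_hom (L\<lparr>carrier := L.L.simple_extension ?k x\<rparr>) ?\<Omega>. (\<forall>a \<in> ?k. \<delta> a = h a) \<and> \<rho> (\<delta> x) = \<delta> (\<tau> x)"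
    if x: "fe.good x" for x
  proof -
    obtain \<delta> where \<delta>: "\<delta> \<in> ring_hom (L\<lparr>carrier := L.L.simple_extension ?k x\<rparr>) N"
      "\<And>a. a \<in> carrier K \<Longrightarrow> \<delta> (\<phi> a) = \<psi> a" "\<nu> (\<delta> x) = \<delta> (\<tau> x)"
      using good_hom[OF x] by (elim bexE conjE) (rule that, simp_all)
    have "x \<in> L.L.simple_extension ?k x" using L.L.simple_extension_mem[OF fe.kr] x unfolding fe.good_def by blast
    then have "\<delta> x \<in> carrier N" using ring_hom_memE(1)[OF \<delta>(1)] by simp
    then have "\<rho> (?\<eta> (\<delta> x)) = ?\<eta> (\<delta> (\<tau> x))" using \<rho>(2) \<delta>(3) by simp
    moreover have "(\<lambda>a. ?\<eta> (\<delta> a)) \<in> ring_hom (L\<lparr>carrier := L.L.simple_extension ?k x\<rparr>) ?\<Omega>"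
      using ring_hom_trans[OF \<delta>(1) \<eta>] by (simp add: comp_def)
    moreover have "\<forall>a \<in> ?k. ?\<eta> (\<delta> a) = h a" using \<delta>(2) h(2) by simp
    ultimately show ?thesis by (intro bexI[of _ "\<lambda>a. ?\<eta> (\<delta> a)"] conjI)
  qed
  obtain g where g: "ep.ext g" "\<And>a. a \<in> ep.algs \<Longrightarrow> \<rho> (g a) = g (\<tau> a)"
    by (rule ep.equivariant_extension[OF gh]; (assumption)?; rule that)
  let ?L = "?\<iota> ` carrier L" and ?k' = "?\<iota> ` ?k"
  have \<iota>L: "?\<iota> \<in> ring_hom (L\<lparr>carrier := carrier L\<rparr>) ?\<Lambda>" using \<iota> by (simp add: ring_hom_def)
  have k': "subfield ?k' ?\<Lambda>"
    by (rule L.L.subring_hom_image(1)[OF fe.k \<Lambda>.field_axioms ring_hom_subring_mono[OF \<iota>L fe.kC]])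
  \<comment> \<open>Passing to the closure does not change which elements of \<open>L\<close> are
    algebraic over \<open>K\<close>, so the transported \<open>g\<close> has the domain that
    \<open>endo_extension\<close> asks for.\<close>
  have sub: "{y \<in> ?L. (\<Lambda>.algebraic over ?k') y} = ?\<iota> ` ep.algs"
  proof
    show "?\<iota> ` ep.algs \<subseteq> {y \<in> ?L. (\<Lambda>.algebraic over ?k') y}"
      using algebraic_hom[OF \<iota> L.L.field_axioms \<Lambda>.field_axioms fe.k] ep.algs(4,5) by blast
    show "{y \<in> ?L. (\<Lambda>.algebraic over ?k') y} \<subseteq> ?\<iota> ` ep.algs"
      using L.L.algebraic_of_image[OF \<Lambda>.field_axioms \<iota> fe.k] unfolding ep.algs_def by blast
  qed
  obtain g' where g': "g' \<in> ring_hom (?\<Lambda>\<lparr>carrier := ?\<iota> ` ep.algs\<rparr>) ?\<Omega>" "\<And>a. a \<in> ep.algs \<Longrightarrow> g' (?\<iota> a) = g a"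
    by (rule L.L.hom_transport[OF \<Lambda>.field_axioms \<iota> ep.algs_ring \<Omega>.ring_axioms ep.extD(1)[OF g(1)]]; (assumption)?; rule that)
  have tf: "(\<lambda>a. ?\<iota> (\<tau> a)) \<in> ring_hom (L\<lparr>carrier := carrier L\<rparr>) (?\<Lambda>\<lparr>carrier := ?L\<rparr>)"
    using ring_hom_memE[OF \<iota>] ring_hom_memE[OF L.L.endo] by (intro ring_hom_memI) auto
  obtain \<theta> where \<theta>: "\<theta> \<in> ring_hom (?\<Lambda>\<lparr>carrier := ?L\<rparr>) (?\<Lambda>\<lparr>carrier := ?L\<rparr>)" "\<And>a. a \<in> carrier L \<Longrightarrow> \<theta> (?\<iota> a) = ?\<iota> (\<tau> a)"
    by (rule L.L.hom_transport[OF \<Lambda>.field_axioms \<iota> L.L.carrier_is_subring \<Lambda>.subring_is_ring[OF subfieldE(1)[OF \<Lambda>.subfield_axioms]] tf];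
        (assumption)?; rule that)
  interpret ee: endo_extension ?\<Lambda> ?\<Omega> ?L ?k' \<theta> \<rho> g'
  proof (intro endo_extension.intro endo_extension_axioms.intro \<Lambda>.algebraically_closed_axioms \<Omega>.algebraically_closed_axioms
      \<Lambda>.subfield_axioms \<Lambda>.algebraic_extension k' \<theta>(1) \<rho>(1))
    show "?k' \<subseteq> ?L" using fe.kC by blast
    show "\<theta> ` ?k' \<subseteq> ?k'" using \<theta>(2) fe.\<tau>k fe.kC by (auto simp: image_subset_iff subset_iff)
    show "g' \<in> ring_hom (?\<Lambda>\<lparr>carrier := {y \<in> ?L. (\<Lambda>.algebraic over ?k') y}\<rparr>) ?\<Omega>" unfolding sub by (rule g'(1))
    show "\<rho> (g' y) = g' (\<theta> y)" if y: "y \<in> ?L" "(\<Lambda>.algebraic over ?k') y" for y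
    proof -
      have "y \<in> ?\<iota> ` ep.algs" unfolding sub[symmetric] using y by simp
      then obtain a where a: "a \<in> ep.algs" "y = ?\<iota> a" by blast
      show ?thesis unfolding a(2) \<theta>(2)[OF ep.algs(4)[OF a(1)]] g'(2)[OF a(1)] g'(2)[OF ep.algs_\<tau>[OF a(1)]] by (rule g(2)[OF a(1)])
    qed
  qed
  obtain x w where x: "x \<in> ring_hom (?\<Lambda>\<lparr>carrier := ee.E\<rparr>) ?\<Omega>" and w: "w \<in> ring_hom ?\<Lambda> ?\<Lambda>" "w ` ee.E \<subseteq> ee.E"
    and xg: "\<And>a. a \<in> ee.A \<Longrightarrow> x a = g' a" and w\<theta>: "\<And>a. a \<in> ?L \<Longrightarrow> w a = \<theta> a" and xw: "\<And>e. e \<in> ee.E \<Longrightarrow> x (w e) = \<rho> (x e)"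
    by (rule ee.endo_lift; rule that)
  interpret cb: closed_base ?\<Lambda> ?\<Omega> ee.E x
  proof (intro closed_base.intro closed_base_axioms.intro \<Lambda>.field_axioms \<Omega>.field_axioms ee.E(1) x)
    show "algebraically_closed (?\<Lambda>\<lparr>carrier := ee.E\<rparr>)" unfolding ee.E_def by (rule \<Lambda>.algebraics_algebraically_closed[OF k'])
  qed
  obtain M :: "('l, 'n) amalgam ring" and \<mu> \<alpha> \<beta>
    where M: "field M" "\<mu> \<in> ring_hom M M" "\<alpha> \<in> ring_hom ?\<Lambda> M" "\<beta> \<in> ring_hom ?\<Omega> M"
    "\<And>e. e \<in> ee.E \<Longrightarrow> \<alpha> e = \<beta> (x e)" "\<And>l. l \<in> carrier ?\<Lambda> \<Longrightarrow> \<mu> (\<alpha> l) = \<alpha> (w l)" "\<And>v. v \<in> carrier ?\<Omega> \<Longrightarrow> \<mu> (\<beta> v) = \<beta> (\<rho> v)"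
    by (rule cb.amalgamation[OF w \<rho>(1) xw]; (assumption)?; rule that)
  interpret M: field M by (rule M(1))
  let ?e = "\<lambda>l. \<alpha> (?\<iota> l)" and ?e' = "\<lambda>n. \<beta> (?\<eta> n)"
  have e: "?e \<in> ring_hom L M" "?e' \<in> ring_hom N M"
    using ring_hom_trans[OF \<iota> M(3)] ring_hom_trans[OF \<eta> M(4)] by (simp_all add: comp_def)
  have e\<tau>: "?e (\<tau> l) = \<mu> (?e l)" if "l \<in> carrier L" for l
    using M(6)[OF ring_hom_memE(1)[OF \<iota> that]] w\<theta>[OF imageI[OF that]] \<theta>(2)[OF that] by simp
  have e\<nu>: "?e' (\<nu> n) = \<mu> (?e' n)" if "n \<in> carrier N" for n
    using M(7)[OF ring_hom_memE(1)[OF \<eta> that]] \<rho>(2)[OF that] by simp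
  have eK: "?e' (\<psi> a) = ?e (\<phi> a)" if a: "a \<in> carrier K" for a
  proof -
    have pa: "\<phi> a \<in> ep.algs" "\<phi> a \<in> ?k" using a ep.algs(2) by blast+
    have "?\<iota> (\<phi> a) \<in> ee.A" unfolding ee.A_def sub using pa(1) by blast
    then have "x (?\<iota> (\<phi> a)) = ?\<eta> (\<psi> a)" using xg g'(2)[OF pa(1)] ep.extD(2)[OF g(1) pa(2)] h(2)[OF a] by simp
    moreover have "?\<iota> (\<phi> a) \<in> ee.E" using ee.E(2) pa(2) by blast
    ultimately show ?thesis using M(5) by simp
  qed
  have "sigma_extension K \<sigma> M \<mu> (?e \<circ> \<phi>)"
  proof (intro sigma_extension.intro sigma_extension_axioms.intro)
    show "sigma_field K \<sigma>" by (rule L.K.sigma_field_axioms)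
    show "sigma_field M \<mu>" by (intro sigma_field.intro sigma_field_axioms.intro M(1,2))
    show "?e \<circ> \<phi> \<in> ring_hom K M" by (rule ring_hom_trans[OF L.structure_map e(1)])
    show "(?e \<circ> \<phi>) (\<sigma> a) = \<mu> ((?e \<circ> \<phi>) a)" if a: "a \<in> carrier K" for a
      using e\<tau>[OF ring_hom_memE(1)[OF L.structure_map a]] L.equivariant[OF a] by simp
  qed
  moreover have "sigma_embedding K L \<tau> \<phi> M \<mu> (?e \<circ> \<phi>) ?e"
    unfolding sigma_embedding_def using e(1) e\<tau> non_trivial_field_hom_is_inj[OF e(1) L.L.field_axioms M(1)] by simp
  moreover have "sigma_embedding K N \<nu> \<psi> M \<mu> (?e \<circ> \<phi>) ?e'"
    unfolding sigma_embedding_def using e(2) e\<nu> eK non_trivial_field_hom_is_inj[OF e(2) N.L.field_axioms M(1)] by simp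
  ultimately show ?thesis by blast
qed

section \<open>Subfields of the strong core\<close>

lemma ring_hom_list:
  assumes "\<And>g. g \<in> set gs \<Longrightarrow> g \<in> ring_hom P R"
  shows "(\<lambda>z. map (\<lambda>g. g z) gs) \<in> ring_hom P (RDirProd_list (replicate (length gs) R))"
  using assms
proof (induction gs)
  case Nil
  show ?case by (intro ring_hom_memI) (auto simp: monoid.defs)
next
  case (Cons g gs)
  let ?T = "RDirProd_list (replicate (length gs) R)"
  note gm = ring_hom_memE[OF Cons(2)[of g, simplified]] and hm = ring_hom_memE[OF Cons(1)[OF Cons(2)], simplified]
  have "(\<lambda>z. (g z, map (\<lambda>g. g z) gs)) \<in> ring_hom P (RDirProd R ?T)"
    by (rule ring_hom_memI) (simp_all add: RDirProd_sel gm hm)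
  from ring_hom_trans[OF this RDirProd_list_hom1] show ?case by (simp add: comp_def)
qed

lemma (in field) eval_zero_of_many_roots:
  assumes os: "set os \<subseteq> carrier R" and Z: "finite Z" "Z \<subseteq> carrier R" "length os \<le> card Z" "\<And>z. z \<in> Z \<Longrightarrow> eval os z = \<zero>"
  shows "set os \<subseteq> {\<zero>}"
proof -
  let ?p = "normalize os"
  have pp: "polynomial (carrier R) ?p" by (rule normalize_gives_polynomial[OF os])
  then have p: "?p \<in> carrier (poly_ring R)" by (simp only: univ_poly_carrier)
  have "?p = []"
  proof (rule ccontr)
    assume ne: "?p \<noteq> []"
    have cs: "card (set_mset M) \<le> size M" for M :: "'a multiset" by (induction M) (auto simp: card_insert_if)
    have "Z \<subseteq> set_mset (roots ?p)"
    proof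
      fix z assume z: "z \<in> Z"
      then have "eval ?p z = \<zero>" using Z(2,4) eval_normalize[OF os] by auto
      then show "z \<in># roots ?p" using roots_mem_iff_is_root[OF p] z Z(2) ne by (auto simp: is_root_def)
    qed
    then have "card Z \<le> card (set_mset (roots ?p))" by (intro card_mono) simp_all
    also have "\<dots> \<le> size (roots ?p)" by (rule cs)
    also have "\<dots> \<le> length ?p - 1" by (rule size_roots_le_degree[OF p])
    also have "\<dots> < length os" using normalize_length_le[of os] ne by (cases ?p) auto
    finally show False using Z(3) by simp
  qed
  then have "os = replicate (length os) \<zero>" using normalize_def'(1)[of os] by simp
  then show ?thesis by (metis in_set_replicate subsetI singletonI)
qed

text \<open>Lagrange interpolation: \<open>t\<close> separates the homomorphisms, \<open>c\<close>
  supplies constants, and a product of factors \<open>t - c (h t)\<close> vanishes at the chosen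
  \<open>h\<close> but at no homomorphism with another value at \<open>t\<close>. The ring is kept
  general, since the lemma is applied to the pair ring before the quotient is taken.\<close>

lemma interpolation:
  assumes P: "cring P" and R: "field R" and t: "t \<in> carrier P"
    and c: "\<And>a. a \<in> carrier R \<Longrightarrow> c a \<in> carrier P" "\<And>a g. a \<in> carrier R \<Longrightarrow> g \<in> set gs \<Longrightarrow> g (c a) = a"
    and gs: "\<And>g. g \<in> set gs \<Longrightarrow> g \<in> ring_hom P R" and d: "distinct (map (\<lambda>g. g t) gs)"
    and vs: "length vs = length gs" "set vs \<subseteq> carrier R"
  shows "\<exists>z \<in> carrier P. map (\<lambda>g. g z) gs = vs"
proof -
  interpret P: cring P by fact
  interpret R: field R by fact
  have gm: "g z \<in> carrier R" "g (z \<otimes>\<^bsub>P\<^esub> z') = g z \<otimes>\<^bsub>R\<^esub> g z'" "g (z \<oplus>\<^bsub>P\<^esub> z') = g z \<oplus>\<^bsub>R\<^esub> g z'" "g \<one>\<^bsub>P\<^esub> = \<one>\<^bsub>R\<^esub>"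
    if "g \<in> set gs" "z \<in> carrier P" "z' \<in> carrier P" for g z z'
    using ring_hom_memE[OF gs[OF that(1)]] that(2,3) by auto
  have gminus: "g (z \<ominus>\<^bsub>P\<^esub> z') = g z \<ominus>\<^bsub>R\<^esub> g z'" if g: "g \<in> set gs" "z \<in> carrier P" "z' \<in> carrier P" for g z z'
  proof -
    interpret g: ring_hom_ring P R g by (rule ring_hom_ringI2[OF P.ring_axioms R.ring_axioms gs[OF g(1)]])
    show ?thesis using g by (simp add: a_minus_def)
  qed
  have vanish: "\<exists>y \<in> carrier P. (\<forall>g \<in> set hs. g y = \<zero>\<^bsub>R\<^esub>) \<and> (\<forall>g \<in> set gs. (\<forall>h \<in> set hs. g t \<noteq> h t) \<longrightarrow> g y \<noteq> \<zero>\<^bsub>R\<^esub>)"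
    if "set hs \<subseteq> set gs" for hs
    using that
  proof (induction hs)
    case Nil
    have "g \<one>\<^bsub>P\<^esub> \<noteq> \<zero>\<^bsub>R\<^esub>" if "g \<in> set gs" for g unfolding gm(4)[OF that t t] by (rule R.one_not_zero)
    then show ?case by (intro bexI[of _ "\<one>\<^bsub>P\<^esub>"]) simp_all
  next
    case (Cons h hs)
    then obtain y where y: "y \<in> carrier P" "\<forall>g \<in> set hs. g y = \<zero>\<^bsub>R\<^esub>" "\<forall>g \<in> set gs. (\<forall>h \<in> set hs. g t \<noteq> h t) \<longrightarrow> g y \<noteq> \<zero>\<^bsub>R\<^esub>" by auto
    have h: "h \<in> set gs" using Cons(2) by simp
    have ht: "h t \<in> carrier R" by (rule gm(1)[OF h t t])
    let ?u = "t \<ominus>\<^bsub>P\<^esub> c (h t)"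
    have u: "?u \<in> carrier P" using t c(1)[OF ht] by simp
    have gu: "g ?u = g t \<ominus>\<^bsub>R\<^esub> h t" if g: "g \<in> set gs" for g
      using gminus[OF g t c(1)[OF ht]] c(2)[OF ht g] by simp
    have gy: "g (y \<otimes>\<^bsub>P\<^esub> ?u) = g y \<otimes>\<^bsub>R\<^esub> (g t \<ominus>\<^bsub>R\<^esub> h t)" if g: "g \<in> set gs" for g
      using gm(2)[OF g y(1) u] gu[OF g] by simp
    have gt: "g y \<in> carrier R" "g t \<in> carrier R" if "g \<in> set gs" for g using gm(1)[OF that] y(1) t by auto
    show ?case
    proof (intro bexI[of _ "y \<otimes>\<^bsub>P\<^esub> ?u"] conjI ballI impI)
      show "y \<otimes>\<^bsub>P\<^esub> ?u \<in> carrier P" using y(1) u by simp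
      show "g (y \<otimes>\<^bsub>P\<^esub> ?u) = \<zero>\<^bsub>R\<^esub>" if "g \<in> set (h # hs)" for g
      proof -
        have g: "g \<in> set gs" using that Cons(2) by auto
        have "g y = \<zero>\<^bsub>R\<^esub> \<or> g = h" using that y(2) by auto
        then show ?thesis unfolding gy[OF g] using gt[OF g] ht by (auto simp: R.r_neg a_minus_def)
      qed
      show "g (y \<otimes>\<^bsub>P\<^esub> ?u) \<noteq> \<zero>\<^bsub>R\<^esub>" if g: "g \<in> set gs" "\<forall>h' \<in> set (h # hs). g t \<noteq> h' t" for g
      proof -
        have "g t \<ominus>\<^bsub>R\<^esub> h t \<noteq> \<zero>\<^bsub>R\<^esub>" using g(2) gt(2)[OF g(1)] ht by simp
        moreover have "g y \<noteq> \<zero>\<^bsub>R\<^esub>" using y(3) g by simp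
        ultimately show ?thesis using gy[OF g(1)] gt[OF g(1)] ht R.integral[of "g y" "g t \<ominus>\<^bsub>R\<^esub> h t"] by auto
      qed
    qed
  qed
  have "\<exists>z \<in> carrier P. map (\<lambda>g. g z) hs = ws"
    if "set hs \<subseteq> set gs" "distinct (map (\<lambda>g. g t) hs)" "length ws = length hs" "set ws \<subseteq> carrier R" for hs ws
    using that
  proof (induction hs arbitrary: ws)
    case Nil
    then show ?case using t by auto
  next
    case (Cons h hs)
    obtain v vs where ws: "ws = v # vs" using Cons(4) by (cases ws) auto
    obtain z where z: "z \<in> carrier P" "map (\<lambda>g. g z) hs = vs" using Cons(1)[of vs] Cons(2-5) ws by auto
    have hg: "set hs \<subseteq> set gs" "h \<in> set gs" using Cons(2) by simp_all
    from vanish[OF hg(1)] obtain y where y: "y \<in> carrier P" "\<forall>g \<in> set hs. g y = \<zero>\<^bsub>R\<^esub>"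
      "\<forall>g \<in> set gs. (\<forall>h \<in> set hs. g t \<noteq> h t) \<longrightarrow> g y \<noteq> \<zero>\<^bsub>R\<^esub>" by blast
    have "\<forall>h' \<in> set hs. h t \<noteq> h' t" using Cons(3) by (auto simp: image_iff)
    then have hy: "h y \<noteq> \<zero>\<^bsub>R\<^esub>" "h y \<in> carrier R" "h z \<in> carrier R" using y(3) hg(2) gm(1)[OF hg(2)] y(1) z(1) by auto
    have vc: "v \<in> carrier R" using Cons(5) ws by simp
    have iy: "inv\<^bsub>R\<^esub> (h y) \<in> carrier R" "h y \<otimes>\<^bsub>R\<^esub> inv\<^bsub>R\<^esub> (h y) = \<one>\<^bsub>R\<^esub>"
      using R.subfield_m_inv[OF R.carrier_is_subfield, of "h y"] hy by auto
    let ?a = "inv\<^bsub>R\<^esub> (h y) \<otimes>\<^bsub>R\<^esub> (v \<ominus>\<^bsub>R\<^esub> h z)"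
    let ?z = "z \<oplus>\<^bsub>P\<^esub> y \<otimes>\<^bsub>P\<^esub> c ?a"
    have ac: "?a \<in> carrier R" using iy(1) vc hy(3) by simp
    have gz: "g ?z = g z \<oplus>\<^bsub>R\<^esub> g y \<otimes>\<^bsub>R\<^esub> ?a" if g: "g \<in> set gs" for g
      using gm(3)[OF g z(1), of "y \<otimes>\<^bsub>P\<^esub> c ?a"] gm(2)[OF g y(1) c(1)[OF ac]] c(1)[OF ac] c(2)[OF ac g] y(1) by simp
    have "h y \<otimes>\<^bsub>R\<^esub> ?a = v \<ominus>\<^bsub>R\<^esub> h z"
      using R.m_assoc[OF hy(2) iy(1), of "v \<ominus>\<^bsub>R\<^esub> h z"] iy(2) vc hy(3) by simp
    then have "h ?z = h z \<oplus>\<^bsub>R\<^esub> (v \<ominus>\<^bsub>R\<^esub> h z)" using gz[OF hg(2)] by simp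
    also have "\<dots> = v" using vc hy(3) by algebra
    finally have hv: "h ?z = v" .
    have "g ?z = g z" if "g \<in> set hs" for g
    proof -
      have g: "g \<in> set gs" using that hg(1) by blast
      have "g y = \<zero>\<^bsub>R\<^esub>" using y(2) that by blast
      then show ?thesis unfolding gz[OF g] using gm(1)[OF g z(1) z(1)] ac by simp
    qed
    then have "map (\<lambda>g. g ?z) hs = vs" using z(2) by auto
    then show ?case using hv ws z(1) y(1) c(1)[OF ac] by (intro bexI[of _ ?z]) simp_all
  qed
  then show ?thesis using d vs by blast
qed

section \<open>The field generated by a good element is strongly etale\<close>

locale good_extension = sigma_extension K \<sigma> L \<tau> \<phi> for K :: "'k ring" (structure) and \<sigma> and L :: "'l ring" (structure) and \<tau> and \<phi> +
  fixes x
  assumes good: "field_endo.good L (\<phi> ` carrier K) \<tau> x"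
begin

abbreviation k where "k \<equiv> \<phi> ` carrier K"

sublocale fe: field_endo L k \<tau> by (rule sigma_extension_field_endo[OF sigma_extension_axioms])

lemma x: "x \<in> carrier L" "(L.algebraic over k) x" "\<tau> x \<in> L.simple_extension k x" "x \<in> L.simple_extension k (\<tau> x)"
  "frob_exp L n \<Longrightarrow> x \<in> L.simple_extension k (x [^]\<^bsub>L\<^esub> n)"
  using good unfolding fe.good_def by blast+

definition S where "S = L.simple_extension k x"

lemma S: "subfield S L" "k \<subseteq> S" "x \<in> S" "\<tau> ` S \<subseteq> S"
proof -
  show sf: "subfield S L" unfolding S_def using L.simple_extension_is_subfield[OF fe.k x(1)] x(2) by simp
  show kS: "k \<subseteq> S" unfolding S_def by (rule L.simple_extension_incl[OF fe.kC x(1)])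
  show "x \<in> S" unfolding S_def by (rule L.simple_extension_mem[OF fe.kr x(1)])
  show "\<tau> ` S \<subseteq> S"
  proof
    fix y assume "y \<in> \<tau> ` S"
    then obtain s where s: "s \<in> L.simple_extension k x" "y = \<tau> s" unfolding S_def by blast
    have "y \<in> L.simple_extension k (\<tau> x)" unfolding s(2) by (rule L.hom_simple_extension[OF fe.\<tau> fe.\<tau>k fe.kr fe.kr x(1) s(1)])
    then show "y \<in> S" unfolding S_def using L.simple_extension_trans[OF fe.k x(1,3)] by blast
  qed
qed

lemmas Sr = subfieldE(1)[OF S(1)] and SC = subfieldE(3)[OF S(1)]

lemma S_cring: "cring (L\<lparr>carrier := S\<rparr>)"
  using L.subcring_iff[OF SC] L.subcringI'[OF Sr] by simp

lemma \<phi>S: "\<phi> \<in> ring_hom K (L\<lparr>carrier := S\<rparr>)"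
  using ring_hom_memE[OF structure_map] S(2) by (intro ring_hom_memI) auto

lemma \<tau>S: "\<tau> \<in> ring_hom (L\<lparr>carrier := S\<rparr>) (L\<lparr>carrier := S\<rparr>)"
  using ring_hom_memE[OF fe.\<tau>] S(4) SC by (intro ring_hom_memI) (auto simp: subset_iff image_subset_iff)

lemma S_subalgebra: "sigma_subalgebra K S L \<tau> \<phi>"
  unfolding sigma_subalgebra_def using L.subcringI'[OF Sr] S(2,4) by blast

lemma S_algebra: "sigma_algebra K \<sigma> (L\<lparr>carrier := S\<rparr>) \<tau> \<phi>"
  by (intro sigma_algebra.intro sigma_algebra_axioms.intro K.sigma_field_axioms S_cring \<tau>S \<phi>S equivariant)

lemma tensor_pairI:
  "cring K' \<Longrightarrow> \<psi> \<in> ring_hom K K' \<Longrightarrow> tensor_pair K (L\<lparr>carrier := S\<rparr>) K' \<phi> \<psi>"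
  by (intro tensor_pair.intro tensor_pair_axioms.intro S_cring \<phi>S)

lemma S_combine: "ring.combine (L\<lparr>carrier := S\<rparr>) = L.combine"
proof (intro ext)
  note r = ring.combine.simps[OF L.subring_is_ring[OF Sr]]
  show "ring.combine (L\<lparr>carrier := S\<rparr>) Ks Us = L.combine Ks Us" for Ks Us
    by (induction Ks Us rule: L.combine.induct) (simp_all add: r)
qed

text \<open>Contraction with a functional that is \<open>\<one>\<close> at \<open>d\<close> and zero
  on the span of \<open>ds\<close> extracts the coefficient \<open>v\<close>, and elements of
  \<open>I\<close> contract to zero. The functional has values in \<open>k\<close>, so \<kappa>
  carries them back to \<open>K\<close>.\<close>

lemma independent_pure_sum:
  assumes K': "cring K'" "\<psi> \<in> ring_hom K K'"
  shows "L.independent k ds \<Longrightarrow> set ds \<subseteq> S \<Longrightarrow> length os = length ds \<Longrightarrow> set os \<subseteq> carrier K' \<Longrightarrow>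
    sum_list (map frag_of (zip ds os)) \<in> tensor_ideal K (L\<lparr>carrier := S\<rparr>) \<phi> K' \<psi> \<Longrightarrow> set os \<subseteq> {\<zero>\<^bsub>K'\<^esub>}"
proof (induction ds arbitrary: os)
  case (Cons d ds)
  interpret T: tensor_pair K "L\<lparr>carrier := S\<rparr>" K' \<phi> \<psi> by (rule tensor_pairI[OF K'])
  obtain v vs where os: "os = v # vs" using Cons(4) by (cases os) auto
  have c: "d \<in> S" "set ds \<subseteq> S" "v \<in> carrier K'" "set vs \<subseteq> carrier K'" using Cons(3,5) os by auto
  have dc: "d \<in> carrier L" "set ds \<subseteq> carrier L" using c SC by blast+
  have ind: "L.independent k ds" "d \<notin> L.Span k ds" using L.independent_backwards(1,2)[OF Cons(2)] by blast+
  have sp: "L.subspace k (L.Span k ds)" unfolding L.subspace_def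
    using L.Span_in_carrier[OF fe.kC dc(2)] L.Span_subgroup_props(2,3)[OF fe.k dc(2)] L.Span_smult_closed[OF fe.k dc(2)] by blast
  obtain f where f: "\<And>v. v \<in> carrier L \<Longrightarrow> f v \<in> k" "f d = \<one>\<^bsub>L\<^esub>" "\<And>v. v \<in> L.Span k ds \<Longrightarrow> f v = \<zero>\<^bsub>L\<^esub>"
    "\<And>v v'. v \<in> carrier L \<Longrightarrow> v' \<in> carrier L \<Longrightarrow> f (v \<oplus>\<^bsub>L\<^esub> v') = f v \<oplus>\<^bsub>L\<^esub> f v'"
    "\<And>e v. e \<in> k \<Longrightarrow> v \<in> carrier L \<Longrightarrow> f (e \<otimes>\<^bsub>L\<^esub> v) = e \<otimes>\<^bsub>L\<^esub> f v"
    by (rule L.functional_exists[OF fe.k sp dc(1) ind(2)]; rule that)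
  have \<phi>K: "\<phi> \<in> ring_hom (K\<lparr>carrier := carrier K\<rparr>) L" using structure_map by (simp add: ring_hom_def)
  define \<kappa> where "\<kappa> = inv_into (carrier K) \<phi>"
  have \<kappa>h: "\<kappa> \<in> ring_hom (L\<lparr>carrier := k\<rparr>) (K\<lparr>carrier := carrier K\<rparr>)"
    unfolding \<kappa>_def by (rule K.subring_hom_image(2)[OF K.carrier_is_subfield L.field_axioms \<phi>K])
  note \<kappa> = ring_hom_memE[OF \<kappa>h, simplified]
  have \<kappa>\<phi>: "\<kappa> (\<phi> a) = a" if "a \<in> carrier K" for a
    unfolding \<kappa>_def by (rule inv_into_f_f[OF non_trivial_field_hom_is_inj[OF structure_map K.field_axioms L.field_axioms] that])
  have \<kappa>0: "\<kappa> \<zero>\<^bsub>L\<^esub> = \<zero>\<^bsub>K\<^esub>" using \<kappa>\<phi>[of "\<zero>\<^bsub>K\<^esub>"] ring_hom_zero[OF structure_map K.ring_axioms L.ring_axioms] by simp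
  let ?f = "\<lambda>v. \<kappa> (f v)"
  have lin: "T.linear ?f" unfolding T.linear_def
  proof (intro conjI ballI; simp)
    show "\<kappa> (f r) \<in> carrier K" if "r \<in> S" for r using \<kappa>(1)[OF f(1)] that SC by blast
    show "\<kappa> (f (r \<oplus>\<^bsub>L\<^esub> r')) = \<kappa> (f r) \<oplus>\<^bsub>K\<^esub> \<kappa> (f r')" if "r \<in> S" "r' \<in> S" for r r'
    proof -
      have "r \<in> carrier L" "r' \<in> carrier L" using that SC by blast+
      then show ?thesis using f(4)[of r r'] \<kappa>(3)[OF f(1)[of r] f(1)[of r']] by simp
    qed
    show "\<kappa> (f (\<phi> a \<otimes>\<^bsub>L\<^esub> r)) = a \<otimes>\<^bsub>K\<^esub> \<kappa> (f r)" if "a \<in> carrier K" "r \<in> S" for a r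
    proof -
      have "r \<in> carrier L" "\<phi> a \<in> k" using that SC by blast+
      then show ?thesis using f(5)[of "\<phi> a" r] \<kappa>(2)[OF _ f(1)[of r], of "\<phi> a"] \<kappa>\<phi>[OF that(1)] by simp
    qed
  qed
  have f1: "?f d = \<one>\<^bsub>K\<^esub>" using f(2) \<kappa>(4) by simp
  have p0: "\<psi> \<zero>\<^bsub>K\<^esub> = \<zero>\<^bsub>K'\<^esub>" by (rule ring_hom_zero[OF K'(2) K.ring_axioms T.S.ring_axioms])
  have "set ds \<subseteq> L.Span k ds" by (rule L.Span_base_incl[OF fe.k dc(2)])
  then have ds0: "?f u = \<zero>\<^bsub>K\<^esub>" if "u \<in> set ds" for u using f(3)[of u] \<kappa>0 that by auto
  have P: "T.pure_sum us ws \<in> carrier T.P" if "set us \<subseteq> S" "set ws \<subseteq> carrier K'" for us ws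
    by (rule T.pure_sum_carrier) (use that in simp_all)
  have zero: "T.contract ?f (T.pure_sum us ws) = \<zero>\<^bsub>K'\<^esub>" if "set us \<subseteq> S" "set ws \<subseteq> carrier K'" "\<And>u. u \<in> set us \<Longrightarrow> ?f u = \<zero>\<^bsub>K\<^esub>" for us ws
    using that
  proof (induction us ws rule: list_induct2')
    case (4 u us w ws)
    then have "frag_of (u, w) \<in> carrier T.P" "T.pure_sum us ws \<in> carrier T.P" using T.P_of P by simp_all
    then show ?case using 4 p0 by (simp add: T.contract(4)[OF lin] T.contract(2)[OF lin])
  qed (simp_all add: T.contract(3)[OF lin])
  have dv: "frag_of (d, v) \<in> carrier T.P" using c T.P_of by simp
  have I: "frag_of (d, v) + T.pure_sum ds vs \<in> T.I" using Cons(6) os by simp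
  have "T.contract ?f (frag_of (d, v) + T.pure_sum ds vs) = v"
    using c T.contract(4)[OF lin dv P[OF c(2,4)]] T.contract(2)[OF lin, of d v] zero[OF c(2,4) ds0] f1 ring_hom_memE(4)[OF K'(2)] by simp
  then have v0: "v = \<zero>\<^bsub>K'\<^esub>" using T.contract_ideal[OF I lin] by simp
  have "T.pure_sum ds vs \<in> T.I" using T.I_diff[OF I T.I_zero_of(2)[of d]] c(1) v0 by simp
  then have "set vs \<subseteq> {\<zero>\<^bsub>K'\<^esub>}" by (intro Cons(1)[OF ind(1) c(2) _ c(4)]) (use Cons(4) os in simp_all)
  then show ?case using v0 os by simp
qed simp

abbreviation deg where "deg \<equiv> L.deg_over k x"

lemma deg_tau: "L.deg_over k (\<tau> x) = deg"
proof -
  have tx: "\<tau> x \<in> carrier L" "(L.algebraic over k) (\<tau> x)" using L.algebraic_simple_extension[OF fe.k x(1,2,3)] by blast+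
  show ?thesis using L.deg_over_le(1)[OF fe.k x(1,2,3)] L.deg_over_le(1)[OF fe.k tx x(4)] by simp
qed

lemma exp_base_S: "set (L.exp_base x deg) \<subseteq> S"
proof -
  have "set (L.exp_base x deg) \<subseteq> L.Span k (L.exp_base x deg)" by (rule L.Span_base_incl[OF fe.k L.exp_base_closed[OF x(1)]])
  then show ?thesis unfolding S_def L.Span_exp_base[OF fe.k x(1,2)] .
qed

lemma keys_span:
  assumes z: "z \<in> carrier (pair_ring (L\<lparr>carrier := S\<rparr>) K')"
  shows "Poly_Mapping.keys z \<subseteq> {ring.combine (L\<lparr>carrier := S\<rparr>) (map \<phi> as) (L.exp_base x deg) | as.
    length as = length (L.exp_base x deg) \<and> set as \<subseteq> carrier K} \<times> carrier K'"
proof -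
  have "S \<subseteq> {L.combine (map \<phi> as) (L.exp_base x deg) | as. length as = length (L.exp_base x deg) \<and> set as \<subseteq> carrier K}"
  proof
    fix s assume "s \<in> S"
    then have "s \<in> L.Span k (L.exp_base x deg)" unfolding S_def using L.Span_exp_base[OF fe.k x(1,2)] by simp
    then obtain Ks where Ks: "s = L.combine Ks (L.exp_base x deg)" "length Ks = length (L.exp_base x deg)" "set Ks \<subseteq> k"
      unfolding L.Span_eq_combine_set_length_version[OF fe.k L.exp_base_closed[OF x(1)]] by blast
    then have "Ks \<in> lists k" by (auto simp: in_lists_conv_set)
    then obtain as where as: "set as \<subseteq> carrier K" "map \<phi> as = Ks" unfolding lists_image by (auto simp: in_lists_conv_set)
    then show "s \<in> {L.combine (map \<phi> as) (L.exp_base x deg) | as. length as = length (L.exp_base x deg) \<and> set as \<subseteq> carrier K}"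
      using Ks(1,2) by auto
  qed
  note S_sub = this
  have "Poly_Mapping.keys z \<subseteq> S \<times> carrier K'" using z by (simp add: pair_ring_carrier)
  also have "S \<times> carrier K' \<subseteq> {L.combine (map \<phi> as) (L.exp_base x deg) | as. length as = length (L.exp_base x deg) \<and> set as \<subseteq> carrier K} \<times> carrier K'"
    by (rule Sigma_mono[OF S_sub order_refl])
  finally show ?thesis unfolding S_combine .
qed

text \<open>The powers of \<open>x\<close> are mapped to the powers of \<open>\<tau> x\<close>,
  which are again independent because \<open>\<tau> x\<close> has the same degree. So a tensor in
  the kernel has coefficients killed by \<open>\<sigma>'\<close>, which is injective on a
  field.\<close>

lemma separable: "sigma_separable K \<sigma> (L\<lparr>carrier := S\<rparr>) \<tau> \<phi>"
  unfolding sigma_separable_def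
proof (intro allI impI)
  fix K' :: "('k + nat) list ring" and \<sigma>' \<psi> assume K': "sigma_extension K \<sigma> K' \<sigma>' \<psi>"
  interpret K': sigma_extension K \<sigma> K' \<sigma>' \<psi> by (rule K')
  note KA = sigma_extension_imp_algebra[OF K']
  interpret T: tensor_pair K "L\<lparr>carrier := S\<rparr>" K' \<phi> \<psi> by (rule tensor_pairI[OF K'.L.is_cring K'.structure_map])
  let ?ds = "L.exp_base x deg" and ?es = "L.exp_base (\<tau> x) deg"
  have tx: "\<tau> x \<in> carrier L" "(L.algebraic over k) (\<tau> x)" using L.algebraic_simple_extension[OF fe.k x(1,2,3)] by blast+
  have dsC: "set ?ds \<subseteq> carrier L" by (rule L.exp_base_closed[OF x(1)])
  have dsS: "set ?ds \<subseteq> S" by (rule exp_base_S)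
  then have dsS': "set ?ds \<subseteq> carrier (L\<lparr>carrier := S\<rparr>)" by simp
  interpret t: ring_hom_ring L L \<tau> by (rule ring_hom_ringI2[OF L.ring_axioms L.ring_axioms fe.\<tau>])
  have es: "?es = map \<tau> ?ds" unfolding L.exp_base_def using x(1) by (simp add: t.hom_nat_pow)
  have ind: "L.independent k ?es" using L.exp_base_independent[OF fe.k tx] deg_tau by simp
  have esS: "set ?es \<subseteq> S" unfolding es using dsS S(4) by auto
  show "inj_on (tensor_endo K (L\<lparr>carrier := S\<rparr>) \<tau> \<phi> K' \<sigma>' \<psi>) (carrier (tensor K (L\<lparr>carrier := S\<rparr>) \<phi> K' \<psi>))"
    unfolding inj_on_tensor_endo_iff[OF S_algebra KA]
  proof (intro ballI impI)
    fix z assume z: "z \<in> carrier T.P" "pair_map \<tau> \<sigma>' z \<in> T.I"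
    have zk: "Poly_Mapping.keys z \<subseteq> {T.R.combine (map \<phi> as) ?ds | as. length as = length ?ds \<and> set as \<subseteq> carrier K} \<times> carrier K'"
      by (rule keys_span) (rule z(1))
    obtain os where os: "length os = length ?ds" "set os \<subseteq> carrier K'" "z - T.pure_sum ?ds os \<in> T.I"
      by (rule T.pure_sum_exists[OF dsS' zk]; rule that)
    have pm: "pair_map \<tau> \<sigma>' (T.pure_sum us ws) = T.pure_sum (map \<tau> us) (map \<sigma>' ws)" for us ws
      by (induction us ws rule: list_induct2') simp_all
    have "pair_map \<tau> \<sigma>' (z - T.pure_sum ?ds os) \<in> T.I"
      by (rule pair_map_ideal[OF S_cring K'.L.is_cring \<phi>S K'.structure_map S_cring K'.L.is_cring \<phi>S K'.structure_map \<tau>S K'.L.endo _ _ _ os(3), where \<kappa> = \<sigma>])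
        (use ring_hom_memE(1)[OF K.endo] equivariant K'.equivariant in simp_all)
    then have "T.pure_sum ?es (map \<sigma>' os) \<in> T.I"
      using T.I_mem_cong z(2) unfolding es pm[symmetric] by (simp add: pair_map_simps)
    then have "set (map \<sigma>' os) \<subseteq> {\<zero>\<^bsub>K'\<^esub>}"
      using os(1,2) ring_hom_memE(1)[OF K'.L.endo] es
      by (intro independent_pure_sum[OF K'.L.is_cring K'.structure_map ind esS]) auto
    moreover have "v = \<zero>\<^bsub>K'\<^esub>" if "v \<in> set os" "\<sigma>' v = \<zero>\<^bsub>K'\<^esub>" for v
      using that os(2) inj_onD[OF non_trivial_field_hom_is_inj[OF K'.L.endo K'.L.field_axioms K'.L.field_axioms], of v "\<zero>\<^bsub>K'\<^esub>"]
        ring_hom_zero[OF K'.L.endo K'.L.ring_axioms K'.L.ring_axioms] by auto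
    ultimately have "set os \<subseteq> {\<zero>\<^bsub>K'\<^esub>}" by auto
    then have "T.pure_sum ?ds os \<in> T.I" by (rule T.pure_sum_zero[OF dsS'])
    then show "z \<in> T.I" using T.I_mem_cong[OF os(3)] by simp
  qed
qed

text \<open>Separability of \<open>x\<close> gives \<open>deg\<close> homomorphisms from
  \<open>k(x)\<close> to the closure, hence a map from the tensor product to \<open>deg\<close>
  copies of the closure. A tensor in its kernel is a polynomial of degree below \<open>deg\<close>
  with \<open>deg\<close> roots, and surjectivity is interpolation at the distinct images of
  \<open>x\<close>.\<close>

lemma etale: "etale K (L\<lparr>carrier := S\<rparr>) \<phi>"
proof -
  let ?\<Omega> = "K.alg_closure" and ?\<iota> = "K.indexed_const" and ?ds = "L.exp_base x deg"
  note \<iota> = K.alg_closureE(2)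
  interpret \<Omega>: algebraic_closure ?\<Omega> "?\<iota> ` carrier K" by (rule K.alg_closureE(1))
  interpret FP: field_pair L ?\<Omega> by (intro field_pair.intro L.field_axioms \<Omega>.algebraically_closed_axioms)
  interpret T: tensor_pair K "L\<lparr>carrier := S\<rparr>" ?\<Omega> \<phi> ?\<iota> by (rule tensor_pairI[OF \<Omega>.is_cring \<iota>])
  have \<iota>K: "?\<iota> \<in> ring_hom (K\<lparr>carrier := carrier K\<rparr>) ?\<Omega>" using \<iota> by (simp add: ring_hom_def)
  obtain h where h: "h \<in> ring_hom (L\<lparr>carrier := k\<rparr>) ?\<Omega>" "\<And>a. a \<in> carrier K \<Longrightarrow> h (\<phi> a) = ?\<iota> a"
    by (rule K.hom_transport[OF L.field_axioms structure_map K.carrier_is_subring \<Omega>.ring_axioms \<iota>K]; (assumption)?; rule that)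
  define Z where "Z = {z \<in> carrier ?\<Omega>. \<Omega>.eval (map h (L.Irr k x)) z = \<zero>\<^bsub>?\<Omega>\<^esub>}"
  have Zc: "card Z = deg" unfolding Z_def by (rule FP.separable_roots[OF fe.k h(1) x(1,2,5)])
  have Zf: "finite Z" unfolding Z_def by (rule FP.Irr_image(4)[OF fe.k h(1) x(1,2)])
  obtain \<xi>s where \<xi>s: "set \<xi>s = Z" "distinct \<xi>s" using finite_distinct_list[OF Zf] by blast
  have len: "length \<xi>s = deg" using distinct_card[OF \<xi>s(2)] \<xi>s(1) Zc by simp
  have "\<exists>g. g \<in> ring_hom (L\<lparr>carrier := S\<rparr>) ?\<Omega> \<and> (\<forall>a \<in> carrier K. g (\<phi> a) = ?\<iota> a) \<and> g x = \<xi>" if \<xi>: "\<xi> \<in> Z" for \<xi>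
  proof -
    have z: "\<xi> \<in> carrier ?\<Omega>" "\<Omega>.eval (map h (L.Irr k x)) \<xi> = \<zero>\<^bsub>?\<Omega>\<^esub>" using \<xi> unfolding Z_def by auto
    obtain g where g: "g \<in> ring_hom (L\<lparr>carrier := L.simple_extension k x\<rparr>) ?\<Omega>" "\<And>a. a \<in> k \<Longrightarrow> g a = h a" "g x = \<xi>"
      by (rule simple_extension_hom[OF L.domain_axioms fe.k x(1,2) \<Omega>.is_cring h(1) z]; rule that)
    then show ?thesis using h(2) unfolding S_def by (intro exI[of _ g]) simp
  qed
  then obtain \<gamma> where \<gamma>: "\<And>\<xi>. \<xi> \<in> Z \<Longrightarrow> \<gamma> \<xi> \<in> ring_hom (L\<lparr>carrier := S\<rparr>) ?\<Omega>"
    "\<And>\<xi> a. \<xi> \<in> Z \<Longrightarrow> a \<in> carrier K \<Longrightarrow> \<gamma> \<xi> (\<phi> a) = ?\<iota> a" "\<And>\<xi>. \<xi> \<in> Z \<Longrightarrow> \<gamma> \<xi> x = \<xi>" by metis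
  note \<gamma>m = ring_hom_memE[OF \<gamma>(1), simplified]
  define G where "G \<xi> = additive_ext (S \<times> carrier ?\<Omega>) ?\<Omega> (\<lambda>(s, a). \<gamma> \<xi> s \<otimes>\<^bsub>?\<Omega>\<^esub> a)" for \<xi>
  have idh: "(\<lambda>a. a) \<in> ring_hom ?\<Omega> ?\<Omega>" by (simp add: ring_hom_def)
  have G: "G \<xi> \<in> ring_hom T.P ?\<Omega>" if "\<xi> \<in> Z" for \<xi>
    using pair_eval_hom[OF S_cring \<Omega>.is_cring \<Omega>.is_cring \<gamma>(1)[OF that] idh] unfolding G_def by simp
  have G_of: "G \<xi> (frag_of (s, a)) = \<gamma> \<xi> s \<otimes>\<^bsub>?\<Omega>\<^esub> a" and G0: "G \<xi> 0 = \<zero>\<^bsub>?\<Omega>\<^esub>"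
    and Gd: "z \<in> carrier T.P \<Longrightarrow> z' \<in> carrier T.P \<Longrightarrow> G \<xi> (z - z') = G \<xi> z \<ominus>\<^bsub>?\<Omega>\<^esub> G \<xi> z'"
    if "\<xi> \<in> Z" "s \<in> S" "a \<in> carrier ?\<Omega>" for \<xi> s a z z'
  proof -
    have im: "(\<lambda>(s, a). \<gamma> \<xi> s \<otimes>\<^bsub>?\<Omega>\<^esub> a) ` (S \<times> carrier ?\<Omega>) \<subseteq> carrier ?\<Omega>" using \<gamma>m(1)[OF that(1)] by auto
    note a = additive_ext[OF \<Omega>.ring_axioms im, folded G_def]
    show "G \<xi> (frag_of (s, a)) = \<gamma> \<xi> s \<otimes>\<^bsub>?\<Omega>\<^esub> a" using a(2)[of "(s, a)"] that by simp
    show "G \<xi> 0 = \<zero>\<^bsub>?\<Omega>\<^esub>" by (rule a(3))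
    show "G \<xi> (z - z') = G \<xi> z \<ominus>\<^bsub>?\<Omega>\<^esub> G \<xi> z'" if "z \<in> carrier T.P" "z' \<in> carrier T.P"
      using a(5) that by (simp add: pair_ring_carrier)
  qed
  note s1 = subringE(3)[OF Sr]
  have o1: "\<one>\<^bsub>?\<Omega>\<^esub> \<in> carrier ?\<Omega>" by simp
  note G0' = G0[OF _ s1 o1] and Gd' = Gd[OF _ s1 o1]
  have GI: "G \<xi> z = \<zero>\<^bsub>?\<Omega>\<^esub>" if \<xi>: "\<xi> \<in> Z" and z: "z \<in> T.I" for \<xi> z
  proof -
    have cr: "ring_hom_ring T.P ?\<Omega> (G \<xi>)" by (rule ring_hom_ringI2[OF T.P.ring_axioms \<Omega>.ring_axioms G[OF \<xi>]])
    let ?J = "a_kernel T.P ?\<Omega> (G \<xi>)"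
    have "tensor_relations K (L\<lparr>carrier := S\<rparr>) \<phi> ?\<Omega> ?\<iota> \<subseteq> ?J"
    proof
      fix g assume g: "g \<in> tensor_relations K (L\<lparr>carrier := S\<rparr>) \<phi> ?\<Omega> ?\<iota>"
      have gc: "g \<in> carrier T.P" using tensor_relations_carrier[OF S_cring \<Omega>.is_cring \<phi>S \<iota>] g by blast
      note sr = subringE(6,7)[OF Sr]
      from g consider
        (l) r r' s where "g = frag_of (r \<oplus>\<^bsub>L\<^esub> r', s) - frag_of (r, s) - frag_of (r', s)" "r \<in> S" "r' \<in> S" "s \<in> carrier ?\<Omega>" |
        (r) r s s' where "g = frag_of (r, s \<oplus>\<^bsub>?\<Omega>\<^esub> s') - frag_of (r, s) - frag_of (r, s')" "r \<in> S" "s \<in> carrier ?\<Omega>" "s' \<in> carrier ?\<Omega>" |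
        (m) a r s where "g = frag_of (\<phi> a \<otimes>\<^bsub>L\<^esub> r, s) - frag_of (r, ?\<iota> a \<otimes>\<^bsub>?\<Omega>\<^esub> s)" "a \<in> carrier K" "r \<in> S" "s \<in> carrier ?\<Omega>"
        unfolding tensor_relations_def by auto
      then have "G \<xi> g = \<zero>\<^bsub>?\<Omega>\<^esub>"
      proof cases
        case l
        then show ?thesis using \<xi> \<gamma>m(1,3)[OF \<xi>] sr
          by (simp add: Gd' G_of T.P_of T.P_diff \<Omega>.l_distr) algebra
      next
        case r
        then show ?thesis using \<xi> \<gamma>m(1)[OF \<xi>]
          by (simp add: Gd' G_of T.P_of T.P_diff \<Omega>.r_distr) algebra
      next
        case m
        have "\<phi> a \<in> S" "?\<iota> a \<in> carrier ?\<Omega>" using m(2) S(2) ring_hom_memE(1)[OF \<iota>] by blast+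
        then show ?thesis using m \<xi> \<gamma>m(1,2)[OF \<xi>] \<gamma>(2)[OF \<xi> m(2)] sr
          by (simp add: Gd' G_of T.P_of \<Omega>.m_ac)
      qed
      then show "g \<in> ?J" using gc by (simp add: a_kernel_def')
    qed
    then have "T.I \<subseteq> ?J" unfolding tensor_ideal_def by (intro T.P.genideal_minimal ring_hom_ring.kernel_is_ideal[OF cr])
    then show ?thesis using z by (auto simp: a_kernel_def')
  qed
  define gs where "gs = map G \<xi>s"
  define H where "H z = map (\<lambda>g. g z) gs" for z
  let ?RD = "RDirProd_list (replicate deg ?\<Omega>)"
  have gsI: "g \<in> ring_hom T.P ?\<Omega>" if "g \<in> set gs" for g using that G \<xi>s(1) unfolding gs_def by auto
  have lg: "length gs = deg" by (simp add: gs_def len)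
  have H: "H \<in> ring_hom T.P ?RD" unfolding H_def lg[symmetric] by (rule ring_hom_list) (rule gsI)
  have RDr: "ring ?RD" by (rule RDirProd_list_is_ring) (simp add: \<Omega>.ring_axioms)
  have cr: "ring_hom_ring T.P ?RD H" by (rule ring_hom_ringI2[OF T.P.ring_axioms RDr H])
  have ker: "a_kernel T.P ?RD H = T.I"
  proof
    have "\<zero>\<^bsub>?RD\<^esub> = H 0" using ring_hom_zero[OF H T.P.ring_axioms RDr] by (simp add: pair_ring_simps)
    then have H0: "H z = \<zero>\<^bsub>?RD\<^esub> \<longleftrightarrow> (\<forall>\<xi> \<in> Z. G \<xi> z = \<zero>\<^bsub>?\<Omega>\<^esub>)" for z
      unfolding H_def gs_def using G0' \<xi>s(1) by auto
    show "T.I \<subseteq> a_kernel T.P ?RD H" unfolding a_kernel_def' using H0 GI T.I_carrier by auto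
    show "a_kernel T.P ?RD H \<subseteq> T.I"
    proof
      fix z assume "z \<in> a_kernel T.P ?RD H"
      then have z: "z \<in> carrier T.P" "\<And>\<xi>. \<xi> \<in> Z \<Longrightarrow> G \<xi> z = \<zero>\<^bsub>?\<Omega>\<^esub>" unfolding a_kernel_def' using H0 by auto
      have dsS: "set ?ds \<subseteq> S" by (rule exp_base_S)
      then have dsS': "set ?ds \<subseteq> carrier (L\<lparr>carrier := S\<rparr>)" by simp
      obtain os where os: "length os = length ?ds" "set os \<subseteq> carrier ?\<Omega>" "z - T.pure_sum ?ds os \<in> T.I"
        by (rule T.pure_sum_exists[OF dsS' keys_span[OF z(1)]]; rule that)
      have P: "T.pure_sum us ws \<in> carrier T.P" if "set us \<subseteq> S" "set ws \<subseteq> carrier ?\<Omega>" for us ws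
        by (rule T.pure_sum_carrier) (use that in simp_all)
      have Gp: "G \<xi> (T.pure_sum us ws) = \<Omega>.combine ws (map (\<gamma> \<xi>) us)" if "\<xi> \<in> Z" "set us \<subseteq> S" "set ws \<subseteq> carrier ?\<Omega>" for \<xi> us ws
        using that
      proof (induction us ws rule: list_induct2')
        case (4 u us w ws)
        then have "frag_of (u, w) \<in> carrier T.P" "T.pure_sum us ws \<in> carrier T.P" using T.P_of P by simp_all
        from ring_hom_memE(3)[OF G[OF 4(2)] this] show ?case
          using 4 \<gamma>m(1)[OF 4(2), of u] by (simp add: G_of pair_ring_simps \<Omega>.m_comm)
      qed (simp_all add: G0')
      have "\<Omega>.eval os \<xi> = \<zero>\<^bsub>?\<Omega>\<^esub>" if \<xi>: "\<xi> \<in> Z" for \<xi>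
      proof -
        have \<xi>c: "\<xi> \<in> carrier ?\<Omega>" using \<xi> unfolding Z_def by blast
        \<comment> \<open>The list \<open>exp_base\<close> has the highest power first, as
          coefficient lists do, so the combination is an evaluation at \<open>\<xi>\<close>.\<close>
        have "map (\<gamma> \<xi>) ?ds = \<Omega>.exp_base \<xi> deg"
          unfolding L.exp_base_def \<Omega>.exp_base_def
          using L.subring_hom_nat_pow[OF Sr S(3) \<Omega>.ring_axioms \<gamma>(1)[OF \<xi>]] \<gamma>(3)[OF \<xi>] by simp
        moreover have "length os = deg" using os(1) by (simp add: L.exp_base_def)
        ultimately have "G \<xi> (T.pure_sum ?ds os) = \<Omega>.eval os \<xi>"
          using Gp[OF \<xi> dsS os(2)] \<Omega>.combine_eq_eval[of os \<xi>] by simp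
        moreover have "G \<xi> z \<ominus>\<^bsub>?\<Omega>\<^esub> G \<xi> (T.pure_sum ?ds os) = \<zero>\<^bsub>?\<Omega>\<^esub>"
          using GI[OF \<xi> os(3)] Gd'[OF \<xi> z(1) P[OF dsS os(2)]] by simp
        ultimately show ?thesis
          using z(2)[OF \<xi>] ring_hom_memE(1)[OF G[OF \<xi>] P[OF dsS os(2)]] by (simp add: a_minus_def)
      qed
      moreover have "Z \<subseteq> carrier ?\<Omega>" "length os \<le> card Z" unfolding Zc using os(1) by (auto simp: Z_def L.exp_base_def)
      ultimately have "set os \<subseteq> {\<zero>\<^bsub>?\<Omega>\<^esub>}" using \<Omega>.eval_zero_of_many_roots[OF os(2) Zf] by blast
      then have "T.pure_sum ?ds os \<in> T.I" by (rule T.pure_sum_zero[OF dsS'])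
      then show "z \<in> T.I" using T.I_mem_cong[OF os(3)] by simp
    qed
  qed
  have surj: "H ` carrier T.P = carrier ?RD"
  proof
    show "H ` carrier T.P \<subseteq> carrier ?RD" using ring_hom_memE(1)[OF H] by blast
    show "carrier ?RD \<subseteq> H ` carrier T.P"
    proof
      fix vs assume "vs \<in> carrier ?RD"
      note RDirProd_list_carrier_mem[OF this]
      then have vs: "length vs = length gs" "set vs \<subseteq> carrier ?\<Omega>" using lg by (auto simp: set_conv_nth)
      have "\<exists>z \<in> carrier T.P. map (\<lambda>g. g z) gs = vs"
      proof (rule interpolation[OF T.P.is_cring \<Omega>.field_axioms _ _ _ gsI _ vs, where t = "frag_of (x, \<one>\<^bsub>?\<Omega>\<^esub>)" and c = "\<lambda>a. frag_of (\<one>\<^bsub>L\<^esub>, a)"])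
        show "frag_of (x, \<one>\<^bsub>?\<Omega>\<^esub>) \<in> carrier T.P" using T.P_of S(3) by simp
        show "frag_of (\<one>\<^bsub>L\<^esub>, a) \<in> carrier T.P" if "a \<in> carrier ?\<Omega>" for a using T.P_of s1 that by simp
        show "g (frag_of (\<one>\<^bsub>L\<^esub>, a)) = a" if "a \<in> carrier ?\<Omega>" "g \<in> set gs" for a g
        proof -
          obtain \<xi> where "\<xi> \<in> Z" "g = G \<xi>" using \<open>g \<in> set gs\<close> \<xi>s(1) unfolding gs_def by auto
          then show ?thesis using G_of[of \<xi> "\<one>\<^bsub>L\<^esub>" a] s1 that(1) \<gamma>m(4) by simp
        qed
        have "map (\<lambda>g. g (frag_of (x, \<one>\<^bsub>?\<Omega>\<^esub>))) gs = map (\<lambda>\<xi>. \<xi>) \<xi>s"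
          unfolding gs_def map_map
        proof (rule map_cong[OF refl])
          fix \<xi> assume "\<xi> \<in> set \<xi>s"
          then have \<xi>: "\<xi> \<in> Z" using \<xi>s(1) by simp
          then have "\<xi> \<in> carrier ?\<Omega>" unfolding Z_def by blast
          then show "((\<lambda>g. g (frag_of (x, \<one>\<^bsub>?\<Omega>\<^esub>))) \<circ> G) \<xi> = \<xi>" using G_of[OF \<xi> S(3) o1] \<gamma>(3)[OF \<xi>] by simp
        qed
        then show "distinct (map (\<lambda>g. g (frag_of (x, \<one>\<^bsub>?\<Omega>\<^esub>))) gs)" using \<xi>s(2) by simp
      qed
      then show "vs \<in> H ` carrier T.P" unfolding H_def by blast
    qed
  qed
  let ?h = "\<lambda>U. the_elem (H ` U)"
  have iso: "?h \<in> ring_iso (tensor K (L\<lparr>carrier := S\<rparr>) \<phi> ?\<Omega> ?\<iota>) ?RD"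
    using ring_hom_ring.FactRing_iso_set[OF cr surj] unfolding ker tensor_def .
  have pt: "?h (pure_tensor K (L\<lparr>carrier := S\<rparr>) \<phi> ?\<Omega> ?\<iota> \<one>\<^bsub>L\<^esub> a) = replicate deg a" if a: "a \<in> carrier ?\<Omega>" for a
  proof -
    have "frag_of (\<one>\<^bsub>L\<^esub>, a) \<in> carrier T.P" using T.P_of s1 a by simp
    from ring_hom_ring.the_elem_simp[OF cr this]
    have "?h (pure_tensor K (L\<lparr>carrier := S\<rparr>) \<phi> ?\<Omega> ?\<iota> \<one>\<^bsub>L\<^esub> a) = H (frag_of (\<one>\<^bsub>L\<^esub>, a))"
      unfolding ker pure_tensor_def .
    also have "\<dots> = map (\<lambda>\<xi>. a) \<xi>s" unfolding H_def gs_def map_map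
    proof (rule map_cong[OF refl])
      fix \<xi> assume "\<xi> \<in> set \<xi>s"
      then have \<xi>: "\<xi> \<in> Z" using \<xi>s(1) by simp
      show "((\<lambda>g. g (frag_of (\<one>\<^bsub>L\<^esub>, a))) \<circ> G) \<xi> = a" using G_of[OF \<xi> s1 a] \<gamma>m(4)[OF \<xi>] a by simp
    qed
    also have "\<dots> = replicate deg a" using len by (simp add: map_replicate_const)
    finally show ?thesis .
  qed
  show ?thesis unfolding etale_def Let_def
    by (intro exI[of _ deg] bexI[OF _ iso] ballI) (simp add: pt)
qed

lemma strongly_etale: "strongly_etale K \<sigma> (L\<lparr>carrier := S\<rparr>) \<tau> \<phi>"
  unfolding strongly_etale_def using S_algebra separable etale by blast

end

section \<open>Compatibility\<close>

lemma sigma_embedding_trans: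
  assumes "sigma_embedding K L \<tau> \<phi> M \<rho> \<mu> \<epsilon>" "sigma_embedding K M \<rho> \<mu> N \<nu> \<psi> \<eta>"
  shows "sigma_embedding K L \<tau> \<phi> N \<nu> \<psi> (\<eta> \<circ> \<epsilon>)"
proof -
  note e = assms(1)[unfolded sigma_embedding_def] and n = assms(2)[unfolded sigma_embedding_def]
  have c: "\<epsilon> ` carrier L \<subseteq> carrier M" using ring_hom_memE(1)[of \<epsilon> L M] e by blast
  have "inj_on (\<eta> \<circ> \<epsilon>) (carrier L)" using e n by (intro comp_inj_on inj_on_subset[OF _ c]) blast+
  moreover have "\<eta> \<circ> \<epsilon> \<in> ring_hom L N" using e n ring_hom_trans by blast
  ultimately show ?thesis unfolding sigma_embedding_def using e n c by auto
qed

lemma sigma_embedding_restrict: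
  assumes "sigma_embedding K L \<tau> \<phi> M \<rho> \<mu> \<epsilon>" "S \<subseteq> carrier L"
  shows "sigma_embedding K (L\<lparr>carrier := S\<rparr>) \<tau> \<phi> M \<rho> \<mu> \<epsilon>"
  using assms inj_on_subset[of \<epsilon> "carrier L" S] unfolding sigma_embedding_def by (auto simp: ring_hom_def subset_iff)

lemma strong_core_carrier: "carrier (strong_core K \<sigma> L \<tau> \<phi>) \<subseteq> carrier L"
proof -
  have "S \<subseteq> carrier L" if "sigma_subalgebra K S L \<tau> \<phi>" for S
    using that subringE(1)[of S L] unfolding sigma_subalgebra_def subcring_def by blast
  then show ?thesis unfolding strong_core_def by auto
qed

lemma strong_core_eq: "strong_core K \<sigma> L \<tau> \<phi> = L\<lparr>carrier := carrier (strong_core K \<sigma> L \<tau> \<phi>)\<rparr>"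
  by (simp add: strong_core_def)

lemma sigma_embedding_core:
  assumes "sigma_embedding K L \<tau> \<phi> M \<rho> \<mu> \<epsilon>"
  shows "sigma_embedding K (strong_core K \<sigma> L \<tau> \<phi>) \<tau> \<phi> M \<rho> \<mu> \<epsilon>"
  using sigma_embedding_restrict[OF assms strong_core_carrier] strong_core_eq[of K \<sigma> L \<tau> \<phi>] by metis

text \<open>The field generated by a good element is one of the subalgebras that make up the core,
  so the embedding of the core can be restricted to it.\<close>

lemma good_hom_of_core:
  fixes K :: "'k ring" and L :: "'l ring"
  assumes L: "sigma_extension K \<sigma> L \<tau> \<phi>" and \<epsilon>: "sigma_embedding K (strong_core K \<sigma> L \<tau> \<phi>) \<tau> \<phi> N \<nu> \<psi> \<epsilon>"
    and good: "field_endo.good L (\<phi> ` carrier K) \<tau> x"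
  shows "\<exists>\<delta> \<in> ring_hom (L\<lparr>carrier := ring.simple_extension L (\<phi> ` carrier K) x\<rparr>) N.
    (\<forall>a \<in> carrier K. \<delta> (\<phi> a) = \<psi> a) \<and> \<nu> (\<delta> x) = \<delta> (\<tau> x)"
proof -
  interpret g: good_extension K \<sigma> L \<tau> \<phi> x
    by (intro good_extension.intro good_extension_axioms.intro L good)
  let ?C = "strong_core K \<sigma> L \<tau> \<phi>"
  have SC: "g.S \<subseteq> carrier ?C" using g.S_subalgebra g.strongly_etale unfolding strong_core_def by auto
  note e = \<epsilon>[unfolded sigma_embedding_def]
  have "\<epsilon> \<in> ring_hom (L\<lparr>carrier := carrier ?C\<rparr>) N" using e strong_core_eq[of K \<sigma> L \<tau> \<phi>] by simp
  then have "\<epsilon> \<in> ring_hom (L\<lparr>carrier := g.S\<rparr>) N" by (rule ring_hom_subring_mono[OF _ SC])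
  moreover have "\<nu> (\<epsilon> x) = \<epsilon> (\<tau> x)" using e SC g.S(3) by auto
  ultimately show ?thesis using e unfolding g.S_def by blast
qed

theorem theorem3p6:
  fixes K :: "'k ring" and L :: "'l ring" and L' :: "'l2 ring"
  assumes "sigma_extension K \<sigma> L \<tau> \<phi>"
    and "sigma_extension K \<sigma> L' \<tau>' \<phi>'"
  shows "compatible K \<sigma> L \<tau> \<phi> L' \<tau>' \<phi>' \<longleftrightarrow>
         compatible K \<sigma> (strong_core K \<sigma> L \<tau> \<phi>) \<tau> \<phi> (strong_core K \<sigma> L' \<tau>' \<phi>') \<tau>' \<phi>'"
proof
  let ?C = "strong_core K \<sigma> L \<tau> \<phi>" and ?C' = "strong_core K \<sigma> L' \<tau>' \<phi>'"
  show "compatible K \<sigma> ?C \<tau> \<phi> ?C' \<tau>' \<phi>'" if "compatible K \<sigma> L \<tau> \<phi> L' \<tau>' \<phi>'"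
    using that sigma_embedding_core unfolding compatible_def by meson
  assume "compatible K \<sigma> ?C \<tau> \<phi> ?C' \<tau>' \<phi>'"
  then obtain N :: "(('l + 'l2) + nat) list ring" and \<nu> \<psi> \<epsilon> \<epsilon>' where N: "sigma_extension K \<sigma> N \<nu> \<psi>"
    and \<epsilon>: "sigma_embedding K ?C \<tau> \<phi> N \<nu> \<psi> \<epsilon>" and \<epsilon>': "sigma_embedding K ?C' \<tau>' \<phi>' N \<nu> \<psi> \<epsilon>'"
    unfolding compatible_def by blast
  obtain M :: "('l, (('l + 'l2) + nat) list) amalgam ring" and \<mu> \<eta> \<eta>'
    where M: "sigma_extension K \<sigma> M \<mu> (\<eta> \<circ> \<phi>)" and \<eta>: "sigma_embedding K L \<tau> \<phi> M \<mu> (\<eta> \<circ> \<phi>) \<eta>"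
      and \<eta>': "sigma_embedding K N \<nu> \<psi> M \<mu> (\<eta> \<circ> \<phi>) \<eta>'"
    using sigma_amalgamation[OF assms(1) N] good_hom_of_core[OF assms(1) \<epsilon>] by blast
  \<comment> \<open>The core of \<open>L'\<close> embeds into \<open>M\<close> through
    \<open>N\<close>, so the amalgamation applies again with \<open>M\<close> in place of
    \<open>N\<close>.\<close>
  obtain M' :: "('l2, ('l, (('l + 'l2) + nat) list) amalgam) amalgam ring" and \<mu>' \<theta> \<theta>'
    where M': "sigma_extension K \<sigma> M' \<mu>' (\<theta> \<circ> \<phi>')" and \<theta>: "sigma_embedding K L' \<tau>' \<phi>' M' \<mu>' (\<theta> \<circ> \<phi>') \<theta>"
      and \<theta>': "sigma_embedding K M \<mu> (\<eta> \<circ> \<phi>) M' \<mu>' (\<theta> \<circ> \<phi>') \<theta>'"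
    using sigma_amalgamation[OF assms(2) M] good_hom_of_core[OF assms(2) sigma_embedding_trans[OF \<epsilon>' \<eta>']] by blast
  show "compatible K \<sigma> L \<tau> \<phi> L' \<tau>' \<phi>'"
    by (rule compatibleI[OF assms M' sigma_embedding_trans[OF \<eta> \<theta>'] \<theta>])
qed

end
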